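(* Let $\Gamma$ be a countable group with an infinite normal subgroup $\Gamma_0$ such that the inclusion $\Gamma_0\subset\Gamma$ has relative property (T) and $\Gamma/\Gamma_0$ is finitely generated. Let $\Gamma\curvearrowright^{\alpha}(X,\mu)$ be a free ergodic measure preserving profinite action on a standard probability space such that the restriction of $\alpha$ to $\Gamma_0$ is also ergodic, and let $\mathcal R_\Gamma$ be the equivalence relation induced by $\alpha$. Suppose that $\alpha$ is the limit of the actions $\Gamma\curvearrowright^{\alpha_n}X_n$, $n\ge1$, with $X_n$ finite. Then $$\mathcal S(\mathcal R_\Gamma)=\{m/|X_n| : m,n\geq 1\}\subset\mathbb Q_+^*.$$
   Context: A standard probability space is one isomorphic to the unit interval with Lebesgue measure. An action is free if $\mu(\{x:\gamma x=x\})=0$ for all $\gamma\neq e$. Relative property (T): an inclusion of countable groups $\Gamma_0\subset\Gamma$ has relative property (T) if every unitary representation of $\Gamma$ which weakly contains the trivial representation of $\Gamma$ contains the trivial representation of $\Gamma_0$ (i.e. has a non-zero $\Gamma_0$-invariant vector). Profinite actions: a measure preserving action $\Gamma\curvearrowright(X,\mu)$ is profinite if it is the inverse limit of a sequence of measure preserving actions $\Gamma\curvearrowright(X_n,\mu_n)$ on finite probability spaces, all of whose points have positive measure. Here one is given measure preserving, onto, $\Gamma$-equivariant maps $q_n:X_{n+1}\to X_n$; $X=\{(x_n)_n : x_n\in X_n,\ q_n(x_{n+1})=x_n\ \forall n\}$; $\mu$ is the unique probability measure making all coordinate maps $X\to X_n$ measure preserving; and $\gamma(x_n)_n=(\gamma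 x_n)_n$. $\mathcal R_\Gamma=\{(x,\gamma x):x\in X,\gamma\in\Gamma\}$. For an ergodic countable measure preserving equivalence relation $\mathcal R$ on a standard probability space $(X,\mu)$ and $t>0$, let $\widetilde{\mathcal R}$ be the equivalence relation on $X\times\mathbb N$ (with $\tilde\mu=\mu\times$ counting measure) given by $(x,i)\widetilde{\mathcal R}(y,j)\Leftrightarrow x\mathcal Ry$; the amplification $\mathcal R^t$ is the restriction of $\widetilde{\mathcal R}$ to a measurable set $Y\subset X\times\mathbb N$ of measure $t$, with probability measure $t^{-1}\tilde\mu|_Y$ (its isomorphism class depends only on $t$). $\mathcal S(\mathcal R)$ denotes the set of $t>0$ such that $\mathcal R^t$ is induced by (i.e. is isomorphic to the orbit equivalence relation of) a free ergodic measure preserving action of some countable group. *)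

theory Defs
  imports
    "HOL-Probability.Probability"
    "HOL-Algebra.Group_Action"
    "HOL-Algebra.Generated_Groups"
    "HOL-Algebra.Module"
    "HOL-Algebra.Algebraic_Closure_Type"
begin

section \<open>Unitary representations and relative property (T)\<close>

record 'v hilbert = "(complex, 'v) module" +
  hinner :: "'v \<Rightarrow> 'v \<Rightarrow> complex"

definition hnorm :: "('v, 'z) hilbert_scheme \<Rightarrow> 'v \<Rightarrow> real" where
  "hnorm H v = sqrt (Re (hinner H v v))"

text \<open>The inner product is linear in its first argument.  The ring fields that the
  module record carries besides addition and zero play no role.\<close>

locale hilbert_space = module "ring_of_type_algebra :: complex ring" H
  for H :: "('v, 'z) hilbert_scheme" (structure) +
  assumes hinner_add: "\<lbrakk>u \<in> carrier H; v \<in> carrier H; w \<in> carrier H\<rbrakk>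
      \<Longrightarrow> hinner H (u \<oplus> v) w = hinner H u w + hinner H v w"
    and hinner_smult: "\<lbrakk>u \<in> carrier H; v \<in> carrier H\<rbrakk>
      \<Longrightarrow> hinner H (c \<odot> u) v = c * hinner H u v"
    and hinner_commute: "\<lbrakk>u \<in> carrier H; v \<in> carrier H\<rbrakk>
      \<Longrightarrow> hinner H v u = cnj (hinner H u v)"
    and hinner_pos: "\<lbrakk>u \<in> carrier H; u \<noteq> \<zero>\<rbrakk> \<Longrightarrow> Re (hinner H u u) > 0"
    and complete: "\<lbrakk>range s \<subseteq> carrier H;
        \<forall>e>0. \<exists>N. \<forall>m\<ge>N. \<forall>n\<ge>N. hnorm H (s m \<ominus> s n) < e\<rbrakk>
      \<Longrightarrow> \<exists>l\<in>carrier H. (\<lambda>n. hnorm H (s n \<ominus> l)) \<longlonglongrightarrow> 0"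

definition unitary_rep ::
  "('g, 'a) monoid_scheme \<Rightarrow> ('v, 'z) hilbert_scheme \<Rightarrow> ('g \<Rightarrow> 'v \<Rightarrow> 'v) \<Rightarrow> bool" where
  "unitary_rep G H \<pi> \<longleftrightarrow>
     hilbert_space H \<and> group_action G (carrier H) \<pi> \<and>
     (\<forall>g\<in>carrier G. \<forall>u\<in>carrier H. \<forall>v\<in>carrier H.
        \<pi> g (u \<oplus>\<^bsub>H\<^esub> v) = \<pi> g u \<oplus>\<^bsub>H\<^esub> \<pi> g v \<and>
        (\<forall>c. \<pi> g (c \<odot>\<^bsub>H\<^esub> u) = c \<odot>\<^bsub>H\<^esub> \<pi> g u) \<and>
        hinner H (\<pi> g u) (\<pi> g v) = hinner H u v)"

text \<open>Fell's weak containment of \<open>(K, \<sigma>)\<close> in \<open>(H, \<pi>)\<close> for discrete groups: each function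
  of positive type associated with \<open>\<sigma>\<close> is approximated, uniformly on finite sets, by finite
  sums of functions of positive type associated with \<open>\<pi>\<close>.\<close>

definition weakly_contains ::
  "('g, 'a) monoid_scheme \<Rightarrow> ('v, 'z) hilbert_scheme \<Rightarrow> ('g \<Rightarrow> 'v \<Rightarrow> 'v) \<Rightarrow>
   ('w, 'y) hilbert_scheme \<Rightarrow> ('g \<Rightarrow> 'w \<Rightarrow> 'w) \<Rightarrow> bool" where
  "weakly_contains G H \<pi> K \<sigma> \<longleftrightarrow>
     (\<forall>v\<in>carrier K. \<forall>F e. finite F \<and> F \<subseteq> carrier G \<and> e > 0 \<longrightarrow>
        (\<exists>ws. set ws \<subseteq> carrier H \<and>
          (\<forall>g\<in>F. cmod (hinner K (\<sigma> g v) v - (\<Sum>w\<leftarrow>ws. hinner H (\<pi> g w) w)) < e)))"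

definition complex_line :: "complex hilbert" where
  "complex_line = \<lparr>carrier = UNIV, mult = (*), one = 1, zero = 0, add = (+),
     smult = (*), hinner = (\<lambda>z w. z * cnj w)\<rparr>"

definition trivial_rep :: "'g \<Rightarrow> complex \<Rightarrow> complex" where
  "trivial_rep g z = z"

text \<open>Hilbert spaces are quantified over those whose underlying set consists of complex
  sequences, which covers every separable Hilbert space up to isomorphism.  For countable
  \<open>G\<close> this is no restriction: a representation weakly containing the trivial one has a
  separable subrepresentation with the same property, spanned by the orbits of countably
  many vectors.\<close>

definition relative_property_T :: "('g, 'a) monoid_scheme \<Rightarrow> 'g set \<Rightarrow> bool" where
  "relative_property_T G G0 \<longleftrightarrow>
     (\<forall>(H :: (nat \<Rightarrow> complex) hilbert) \<pi>.
        unitary_rep G H \<pi> \<and> weakly_contains G H \<pi> complex_line trivial_rep \<longrightarrow>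
        (\<exists>v\<in>carrier H. v \<noteq> \<zero>\<^bsub>H\<^esub> \<and> (\<forall>g\<in>G0. \<pi> g v = v)))"

definition finitely_generated_group :: "('g, 'a) monoid_scheme \<Rightarrow> bool" where
  "finitely_generated_group G \<longleftrightarrow>
     (\<exists>S. finite S \<and> S \<subseteq> carrier G \<and> generate G S = carrier G)"


section \<open>Measure preserving actions\<close>

definition measure_preserving :: "'a measure \<Rightarrow> 'b measure \<Rightarrow> ('a \<Rightarrow> 'b) set" where
  "measure_preserving M N = {f \<in> M \<rightarrow>\<^sub>M N. distr M N f = N}"

text \<open>\<open>f\<close> is an isomorphism from the conull set \<open>A\<close> onto the conull set \<open>B\<close>.\<close>

definition iso_mod_null ::
  "'a measure \<Rightarrow> 'b measure \<Rightarrow> 'a set \<Rightarrow> 'b set \<Rightarrow> ('a \<Rightarrow> 'b) \<Rightarrow> bool" where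
  "iso_mod_null M N A B f \<longleftrightarrow>
     A \<in> sets M \<and> space M - A \<in> null_sets M \<and>
     B \<in> sets N \<and> space N - B \<in> null_sets N \<and>
     bij_betw f A B \<and>
     f \<in> measure_preserving (restrict_space M A) (restrict_space N B) \<and>
     inv_into A f \<in> measure_preserving (restrict_space N B) (restrict_space M A)"

definition standard_prob_space :: "'a measure \<Rightarrow> bool" where
  "standard_prob_space M \<longleftrightarrow>
     (\<exists>A B f. iso_mod_null M (restrict_space lborel {0..1::real}) A B f)"

definition mp_action ::
  "('g, 'b) monoid_scheme \<Rightarrow> 'a measure \<Rightarrow> ('g \<Rightarrow> 'a \<Rightarrow> 'a) \<Rightarrow> bool" where
  "mp_action G M a \<longleftrightarrow>
     prob_space M \<and> group_action G (space M) a \<and>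
     (\<forall>g\<in>carrier G. a g \<in> measure_preserving M M)"

definition free_action ::
  "('g, 'b) monoid_scheme \<Rightarrow> 'a measure \<Rightarrow> ('g \<Rightarrow> 'a \<Rightarrow> 'a) \<Rightarrow> bool" where
  "free_action G M a \<longleftrightarrow> (\<forall>g\<in>carrier G. g \<noteq> \<one>\<^bsub>G\<^esub> \<longrightarrow> (AE x in M. a g x \<noteq> x))"

definition ergodic_action ::
  "('g, 'b) monoid_scheme \<Rightarrow> 'a measure \<Rightarrow> ('g \<Rightarrow> 'a \<Rightarrow> 'a) \<Rightarrow> bool" where
  "ergodic_action G M a \<longleftrightarrow>
     (\<forall>A\<in>sets M. (\<forall>g\<in>carrier G. a g ` A = A) \<longrightarrow>
        emeasure M A = 0 \<or> emeasure M (space M - A) = 0)"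


section \<open>Profinite actions\<close>

definition finite_prob_space :: "'a measure \<Rightarrow> bool" where
  "finite_prob_space M \<longleftrightarrow>
     prob_space M \<and> finite (space M) \<and> sets M = Pow (space M) \<and>
     (\<forall>x\<in>space M. emeasure M {x} > 0)"

definition inverse_limit_set :: "(nat \<Rightarrow> 'x measure) \<Rightarrow> (nat \<Rightarrow> 'x \<Rightarrow> 'x) \<Rightarrow> (nat \<Rightarrow> 'x) set" where
  "inverse_limit_set Xs q =
     {x \<in> PiE {1..} (\<lambda>n. space (Xs n)). \<forall>n\<ge>1. q n (x (Suc n)) = x n}"

text \<open>The action \<open>a\<close> of \<open>G\<close> on \<open>M\<close> is the inverse limit of the actions \<open>\<alpha> n\<close> on \<open>Xs n\<close>,
  \<open>n \<ge> 1\<close>, along the maps \<open>q n\<close> from \<open>Xs (n + 1)\<close> to \<open>Xs n\<close>.  The conditions below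
  determine \<open>M\<close> uniquely.\<close>

definition is_inverse_limit ::
  "('g, 'b) monoid_scheme \<Rightarrow> (nat \<Rightarrow> 'x measure) \<Rightarrow> (nat \<Rightarrow> 'g \<Rightarrow> 'x \<Rightarrow> 'x) \<Rightarrow>
   (nat \<Rightarrow> 'x \<Rightarrow> 'x) \<Rightarrow> (nat \<Rightarrow> 'x) measure \<Rightarrow> ('g \<Rightarrow> (nat \<Rightarrow> 'x) \<Rightarrow> nat \<Rightarrow> 'x) \<Rightarrow> bool" where
  "is_inverse_limit G Xs \<alpha> q M a \<longleftrightarrow>
     (\<forall>n\<ge>1. finite_prob_space (Xs n) \<and> mp_action G (Xs n) (\<alpha> n)) \<and>
     (\<forall>n\<ge>1. q n \<in> measure_preserving (Xs (Suc n)) (Xs n) \<and>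
        q n ` space (Xs (Suc n)) = space (Xs n) \<and>
        (\<forall>g\<in>carrier G. \<forall>x\<in>space (Xs (Suc n)). q n (\<alpha> (Suc n) g x) = \<alpha> n g (q n x))) \<and>
     sets M = sets (restrict_space (PiM {1..} Xs) (inverse_limit_set Xs q)) \<and>
     (\<forall>n\<ge>1. (\<lambda>x. x n) \<in> measure_preserving M (Xs n)) \<and>
     mp_action G M a \<and>
     (\<forall>g\<in>carrier G. \<forall>x\<in>space M. \<forall>n\<ge>1. a g x n = \<alpha> n g (x n))"


section \<open>Orbit equivalence relations and amplifications\<close>

definition orbit_equiv_rel ::
  "('g, 'b) monoid_scheme \<Rightarrow> 'a measure \<Rightarrow> ('g \<Rightarrow> 'a \<Rightarrow> 'a) \<Rightarrow> ('a \<times> 'a) set" where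
  "orbit_equiv_rel G M a = {(x, a g x) | x g. x \<in> space M \<and> g \<in> carrier G}"

definition isomorphic_relations ::
  "'a measure \<Rightarrow> ('a \<times> 'a) set \<Rightarrow> 'b measure \<Rightarrow> ('b \<times> 'b) set \<Rightarrow> bool" where
  "isomorphic_relations M R N S \<longleftrightarrow>
     (\<exists>A B f. iso_mod_null M N A B f \<and>
        (\<forall>x\<in>A. \<forall>y\<in>A. (x, y) \<in> R \<longleftrightarrow> (f x, f y) \<in> S))"

definition stabilization :: "('a \<times> 'a) set \<Rightarrow> (('a \<times> nat) \<times> ('a \<times> nat)) set" where
  "stabilization R = {((x, i), (y, j)) | x i y j. (x, y) \<in> R}"

definition stabilized_measure :: "'a measure \<Rightarrow> ('a \<times> nat) measure" where
  "stabilized_measure M = M \<Otimes>\<^sub>M count_space UNIV"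

definition normalized_restriction :: "'a measure \<Rightarrow> real \<Rightarrow> 'a set \<Rightarrow> 'a measure" where
  "normalized_restriction N t Y = scale_measure (ennreal (1 / t)) (restrict_space N Y)"

text \<open>\<open>amplification_set M R\<close> is the set \<open>\<S>(\<R>)\<close> of all \<open>t > 0\<close> such that the amplification
  \<open>\<R>\<^sup>t\<close> is induced by a free ergodic measure preserving action of a countable group on a
  standard probability space.  The groups range over those with carrier a set of natural
  numbers and the spaces over those with a set of reals as underlying set; up to isomorphism
  these are all countable groups and, modulo null sets, all standard probability spaces.\<close>

definition amplification_set :: "'a measure \<Rightarrow> ('a \<times> 'a) set \<Rightarrow> real set" where
  "amplification_set M R = {t. t > 0 \<and>
     (\<exists>Y\<in>sets (stabilized_measure M). emeasure (stabilized_measure M) Y = ennreal t \<and>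
       (\<exists>(\<Lambda> :: nat monoid) (Z :: real measure) b.
          group \<Lambda> \<and> standard_prob_space Z \<and> mp_action \<Lambda> Z b \<and>
          free_action \<Lambda> Z b \<and> ergodic_action \<Lambda> Z b \<and>
          isomorphic_relations
            (normalized_restriction (stabilized_measure M) t Y)
            (stabilization R \<inter> Y \<times> Y)
            Z (orbit_equiv_rel \<Lambda> Z b)))}"

end

theory Submission
  imports Defs "HOL-Algebra.Zassenhaus" "HOL-Algebra.Elementary_Groups"
begin

text \<open>Suppose that \<open>\<R>\<^sub>\<Gamma>\<^sup>t\<close> is the orbit relation of a free ergodic action of \<open>\<Lambda>\<close> on \<open>Z\<close>.
  The isomorphism extends to an orbit preserving map \<open>\<theta>\<close> from \<open>X\<close> to \<open>Z\<close> with a cocycle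
  \<open>w\<close> from \<open>\<Gamma> \<times> X\<close> to \<open>\<Lambda>\<close>.  In the action \<open>g (x, y, l) = (g x, g y, w(g, x) l w(g, y)\<^sup>-\<^sup>1)\<close>
  on \<open>X \<times> X \<times> \<Lambda>\<close>, the normalized indicator functions of the sets \<open>x\<^sub>n = y\<^sub>n, l = 1\<close> are almost
  invariant, because every measurable set is nearly a union of cells \<open>x\<^sub>n = a\<close>.  Relative property
  (T) makes them close to \<open>\<Gamma>\<^sub>0\<close>-invariant functions, so that on some cell \<open>C\<close> the cocycle is nearly
  constant, uniformly over the stabilizer of \<open>C\<close> in \<open>\<Gamma>\<^sub>0\<close>; a second averaging argument and the
  ergodicity of \<open>\<Gamma>\<^sub>0\<close> show that \<open>w\<close> restricted to the stabilizer of \<open>C\<close> in \<open>\<Gamma>\<close> is cohomologous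
  to a homomorphism \<open>\<delta>\<close>.  Correcting \<open>\<theta>\<close> by the coboundary yields an equivariant map \<open>\<tau>\<close> on
  \<open>C\<close>, and the kernel of \<open>\<delta>\<close> is finite since \<open>\<tau>\<close> is countable-to-one and scales measure by
  \<open>1 / t\<close>.  On a smaller cell \<open>C'\<close> the map \<open>\<tau>\<close> is injective, and the translates of \<open>\<tau> C'\<close> by
  \<open>\<Lambda>\<close> partition \<open>Z\<close> into \<open>m\<close> pieces of measure \<open>\<mu> C' / t\<close>, whence \<open>t = m \<mu> C'\<close>.

  Conversely, the stabilizer of a cell times a cyclic group of order \<open>m\<close> acts on \<open>m\<close> copies of
  the cell and induces the amplification.\<close>

section \<open>Square integrable functions\<close>

text \<open>Relative property (T) yields closeness in norm, uniform over \<open>\<Gamma>0\<close>,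
  but neither exact identities nor control of the rest of \<open>\<Gamma>\<close>. Exactness comes
  from a minimal-norm argument in the skew product twisted by the nearly constant values: its
  invariant function singles out one fibre coordinate at almost every point of the cell. For the
  rest of \<open>\<Gamma>\<close>, finite generation of the quotient enters: finitely many
  representatives \<open>s\<close> are controlled on the same cell, transitivity of
  \<open>\<Gamma>0\<close> on the cells moves each into the stabilizer as
  \<open>h \<otimes> s\<close>, and normality makes the set where the corrected cocycle has a given
  value at such an element invariant under the stabilizer in \<open>\<Gamma>0\<close>, hence null or
  conull. The constants keep finitely many exceptional sets together smaller than the cell: with
  \<open>\<beta>\<close> one hundredth of its measure, the largest total met is
  \<open>34 * \<beta>\<close>. Transitivity also gives all cells of level n the measure
  \<open>1 / card_X n\<close>, the origin of the denominators in the theorem.\<close>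

definition l2 :: "'a measure \<Rightarrow> ('a \<Rightarrow> complex) set" where
  "l2 M = {f \<in> borel_measurable M. integrable M (\<lambda>x. (cmod (f x))\<^sup>2)}"

definition ip :: "'a measure \<Rightarrow> ('a \<Rightarrow> complex) \<Rightarrow> ('a \<Rightarrow> complex) \<Rightarrow> complex" where
  "ip M f g = (\<integral>x. f x * cnj (g x) \<partial>M)"

text \<open>No quotient by null functions is formed: two functions count as equal when
  \<open>nsq\<close> of their difference is 0, and \<open>ip_eqI\<close> says that inner products
  respect this. Keeping the norm squared turns the triangle inequality into
  \<open>nsq_diff_le\<close>, with a factor 2.\<close>

definition nsq :: "'a measure \<Rightarrow> ('a \<Rightarrow> complex) \<Rightarrow> real" where
  "nsq M f = (\<integral>x. (cmod (f x))\<^sup>2 \<partial>M)"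

lemma l2_measurable: "f \<in> l2 M \<Longrightarrow> f \<in> borel_measurable M"
  by (simp add: l2_def)

lemma l2_integrable: "f \<in> l2 M \<Longrightarrow> integrable M (\<lambda>x. (cmod (f x))\<^sup>2)"
  by (simp add: l2_def)

lemma cmod_add_sq_le: "(cmod (a + b))\<^sup>2 \<le> 2 * (cmod a)\<^sup>2 + 2 * (cmod b)\<^sup>2"
proof -
  have "(cmod (a + b))\<^sup>2 \<le> (cmod a + cmod b)\<^sup>2"
    by (intro power_mono norm_triangle_ineq) auto
  also have "\<dots> \<le> 2 * (cmod a)\<^sup>2 + 2 * (cmod b)\<^sup>2"
    using zero_le_power2[of "cmod a - cmod b"] by (simp add: power2_eq_square algebra_simps)
  finally show ?thesis .
qed

lemma l2_add:
  assumes "f \<in> l2 M" "g \<in> l2 M"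
  shows "(\<lambda>x. f x + g x) \<in> l2 M"
proof -
  note [measurable] = assms[THEN l2_measurable]
  have "integrable M (\<lambda>x. 2 * (cmod (f x))\<^sup>2 + 2 * (cmod (g x))\<^sup>2)"
    using assms[THEN l2_integrable] by auto
  then have "integrable M (\<lambda>x. (cmod (f x + g x))\<^sup>2)"
    by (rule Bochner_Integration.integrable_bound) (auto intro!: AE_I2 cmod_add_sq_le)
  then show ?thesis
    by (simp add: l2_def)
qed

lemma l2_scale:
  assumes "f \<in> l2 M"
  shows "(\<lambda>x. c * f x) \<in> l2 M"
  using assms by (auto simp: l2_def norm_mult power_mult_distrib)

lemma l2_zero: "(\<lambda>x. 0) \<in> l2 M"
  by (simp add: l2_def)

lemma l2_diff:
  assumes "f \<in> l2 M" "g \<in> l2 M"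
  shows "(\<lambda>x. f x - g x) \<in> l2 M"
  using l2_add[OF assms(1) l2_scale[OF assms(2), of "-1"]] by simp

lemma l2_bounded:
  assumes "f \<in> borel_measurable M" "g \<in> l2 M" "\<And>x. x \<in> space M \<Longrightarrow> cmod (f x) \<le> cmod (g x)"
  shows "f \<in> l2 M"
proof -
  have "integrable M (\<lambda>x. (cmod (f x))\<^sup>2)"
    by (rule Bochner_Integration.integrable_bound[OF l2_integrable[OF assms(2)]])
      (use assms(1,3) in \<open>auto intro!: AE_I2 power_mono\<close>)
  then show ?thesis using assms(1) by (simp add: l2_def)
qed

lemma borel_measurable_cnj [measurable]: "f \<in> borel_measurable M \<Longrightarrow> (\<lambda>x. cnj (f x)) \<in> borel_measurable M"
  by (rule measurable_compose[OF _ borel_measurable_continuous_onI]) (auto intro: continuous_intros)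

lemma integrable_ip:
  assumes "f \<in> l2 M" "g \<in> l2 M"
  shows "integrable M (\<lambda>x. f x * cnj (g x))"
proof -
  note [measurable] = assms[THEN l2_measurable]
  have "integrable M (\<lambda>x. (cmod (f x))\<^sup>2 + (cmod (g x))\<^sup>2)"
    using assms[THEN l2_integrable] by auto
  then show ?thesis
  proof (rule Bochner_Integration.integrable_bound)
    have "cmod a * cmod b \<le> (cmod a)\<^sup>2 + (cmod b)\<^sup>2" for a b :: complex
      using sum_squares_bound[of "cmod a" "cmod b"] mult_nonneg_nonneg[OF norm_ge_zero norm_ge_zero, of a b]
      by linarith
    then show "AE x in M. norm (f x * cnj (g x)) \<le> norm ((cmod (f x))\<^sup>2 + (cmod (g x))\<^sup>2)"
      by (auto simp: norm_mult)
  qed auto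
qed

lemma ip_add:
  assumes "f \<in> l2 M" "g \<in> l2 M" "h \<in> l2 M"
  shows "ip M (\<lambda>x. f x + g x) h = ip M f h + ip M g h"
  unfolding ip_def using assms by (simp add: distrib_right integrable_ip Bochner_Integration.integral_add)

lemma ip_diff:
  assumes "f \<in> l2 M" "g \<in> l2 M" "h \<in> l2 M"
  shows "ip M (\<lambda>x. f x - g x) h = ip M f h - ip M g h"
  unfolding ip_def using assms by (simp add: left_diff_distrib integrable_ip Bochner_Integration.integral_diff)

lemma ip_scale: "ip M (\<lambda>x. c * f x) h = c * ip M f h"
  unfolding ip_def by (simp add: mult.assoc)

lemma ip_commute: "ip M g f = cnj (ip M f g)"
  unfolding ip_def by (subst Bochner_Integration.integral_cnj[symmetric]) (simp add: mult.commute)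

lemma ip_self: "ip M f f = of_real (nsq M f)"
  unfolding ip_def nsq_def integral_complex_of_real[symmetric]
  by (intro Bochner_Integration.integral_cong refl) (simp only: complex_norm_square)

lemma nsq_nonneg [simp]: "nsq M f \<ge> 0"
  unfolding nsq_def by simp

lemma nsq_eq_0_iff:
  assumes "f \<in> l2 M"
  shows "nsq M f = 0 \<longleftrightarrow> (AE x in M. f x = 0)"
  unfolding nsq_def using integral_nonneg_eq_0_iff_AE[OF l2_integrable[OF assms]] by simp

lemma nsq_scale: "nsq M (\<lambda>x. c * f x) = (cmod c)\<^sup>2 * nsq M f"
  unfolding nsq_def by (simp add: norm_mult power_mult_distrib)

lemma nsq_minus_commute: "nsq M (\<lambda>x. f x - g x) = nsq M (\<lambda>x. g x - f x)"
  unfolding nsq_def by (simp add: norm_minus_commute)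

lemma nsq_add_le:
  assumes "f \<in> l2 M" "g \<in> l2 M"
  shows "nsq M (\<lambda>x. f x + g x) \<le> 2 * nsq M f + 2 * nsq M g"
proof -
  have "nsq M (\<lambda>x. f x + g x) \<le> (\<integral>x. 2 * (cmod (f x))\<^sup>2 + 2 * (cmod (g x))\<^sup>2 \<partial>M)"
    unfolding nsq_def
    using assms[THEN l2_integrable] l2_integrable[OF l2_add[OF assms]]
    by (intro integral_mono cmod_add_sq_le) auto
  also have "\<dots> = 2 * nsq M f + 2 * nsq M g"
    unfolding nsq_def using assms[THEN l2_integrable] by simp
  finally show ?thesis .
qed

lemma nsq_diff_le:
  assumes "f \<in> l2 M" "g \<in> l2 M" "h \<in> l2 M"
  shows "nsq M (\<lambda>x. f x - h x) \<le> 2 * nsq M (\<lambda>x. f x - g x) + 2 * nsq M (\<lambda>x. g x - h x)"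
  using nsq_add_le[OF l2_diff[OF assms(1,2)] l2_diff[OF assms(2,3)]] by simp

lemma nsq_parallelogram:
  assumes "f \<in> l2 M" "g \<in> l2 M"
  shows "nsq M (\<lambda>x. f x - g x) = 2 * nsq M f + 2 * nsq M g - 4 * nsq M (\<lambda>x. (f x + g x) / 2)"
proof -
  have int: "integrable M (\<lambda>x. (cmod ((f x + g x) / 2))\<^sup>2)"
    using l2_integrable[OF l2_scale[OF l2_add[OF assms], of "1/2"]] by simp
  have "(cmod (a - b))\<^sup>2 = 2 * (cmod a)\<^sup>2 + 2 * (cmod b)\<^sup>2 - 4 * (cmod ((a + b) / 2))\<^sup>2" for a b
    unfolding cmod_power2 by (simp add: power2_eq_square field_simps)
  then have "nsq M (\<lambda>x. f x - g x)
      = (\<integral>x. 2 * (cmod (f x))\<^sup>2 + 2 * (cmod (g x))\<^sup>2 - 4 * (cmod ((f x + g x) / 2))\<^sup>2 \<partial>M)"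
    unfolding nsq_def by simp
  also have "\<dots> = 2 * nsq M f + 2 * nsq M g - 4 * nsq M (\<lambda>x. (f x + g x) / 2)"
    unfolding nsq_def using assms[THEN l2_integrable] int by (simp del: norm_divide_numeral)
  finally show ?thesis .
qed

lemma nsq_expand:
  assumes "f \<in> l2 M" "g \<in> l2 M"
  shows "nsq M (\<lambda>x. f x - g x) = nsq M f + nsq M g - 2 * Re (ip M f g)"
proof -
  have "(cmod (a - b))\<^sup>2 = (cmod a)\<^sup>2 + (cmod b)\<^sup>2 - 2 * Re (a * cnj b)" for a b
    unfolding cmod_power2 by (simp add: power2_eq_square algebra_simps)
  then have "nsq M (\<lambda>x. f x - g x)
      = (\<integral>x. (cmod (f x))\<^sup>2 + (cmod (g x))\<^sup>2 - 2 * Re (f x * cnj (g x)) \<partial>M)"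
    unfolding nsq_def by simp
  also have "\<dots> = nsq M f + nsq M g - 2 * Re (ip M f g)"
    unfolding nsq_def ip_def using assms[THEN l2_integrable] integrable_ip[OF assms]
    by (simp add: integrable_Re integral_Re del: times_complex.sel)
  finally show ?thesis .
qed

lemma ip_zero_left:
  assumes "f \<in> l2 M" "g \<in> l2 M" "nsq M f = 0"
  shows "ip M f g = 0"
proof -
  have "AE x in M. f x * cnj (g x) = 0"
    using assms(3) nsq_eq_0_iff[OF assms(1)] by auto
  then show ?thesis
    unfolding ip_def by (rule integral_eq_zero_AE)
qed

lemma ip_zero_right:
  assumes "f \<in> l2 M" "g \<in> l2 M" "nsq M g = 0"
  shows "ip M f g = 0"
  using ip_zero_left[OF assms(2,1,3)] ip_commute[of M f g] by simp

text \<open>The squared norm of \<open>b f - z g\<close> with \<open>b = nsq M g\<close> and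
  \<open>z = ip M f g\<close> equals \<open>b * (b * nsq M f - |z|^2)\<close>; dividing by
  \<open>b\<close> is what separates the case of a null \<open>g\<close>.\<close>

lemma ip_Cauchy_Schwarz:
  assumes "f \<in> l2 M" "g \<in> l2 M"
  shows "(cmod (ip M f g))\<^sup>2 \<le> nsq M f * nsq M g"
proof (cases "nsq M g = 0")
  case True
  then show ?thesis using ip_zero_right[OF assms] by simp
next
  case False
  then have pos: "nsq M g > 0" using nsq_nonneg[of M g] by linarith
  define z where "z = ip M f g"
  define b where "b = nsq M g"
  have "0 \<le> nsq M (\<lambda>x. complex_of_real b * f x - z * g x)" by simp
  also have "\<dots> = b\<^sup>2 * nsq M f + (cmod z)\<^sup>2 * b - 2 * Re (b * (cnj z * z))"
  proof -
    have "ip M (\<lambda>x. complex_of_real b * f x) (\<lambda>x. z * g x) = b * (cnj z * ip M f g)"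
      by (simp add: ip_scale ip_commute[of M _ "\<lambda>x. z * g x"] ip_commute[of M g f])
    then show ?thesis
      by (subst nsq_expand) (use assms in \<open>auto intro: l2_scale simp: nsq_scale z_def b_def\<close>)
  qed
  also have "\<dots> = b * (b * nsq M f - (cmod z)\<^sup>2)"
    unfolding cmod_power2 by (simp add: power2_eq_square algebra_simps)
  finally have "0 \<le> b * nsq M f - (cmod z)\<^sup>2"
    using pos by (simp add: b_def zero_le_mult_iff)
  then show ?thesis by (simp add: z_def b_def mult.commute)
qed

lemma ip_tendsto:
  assumes "\<And>n. f n \<in> l2 M" "g \<in> l2 M" "h \<in> l2 M" "(\<lambda>n. nsq M (\<lambda>x. f n x - g x)) \<longlonglongrightarrow> 0"
  shows "(\<lambda>n. ip M (f n) h) \<longlonglongrightarrow> ip M g h"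
proof -
  have "(\<lambda>n. sqrt (nsq M (\<lambda>x. f n x - g x) * nsq M h)) \<longlonglongrightarrow> sqrt (0 * nsq M h)"
    by (intro tendsto_real_sqrt tendsto_mult assms tendsto_const)
  then have *: "(\<lambda>n. sqrt (nsq M (\<lambda>x. f n x - g x) * nsq M h)) \<longlonglongrightarrow> 0" by simp
  have "(\<lambda>n. ip M (f n) h - ip M g h) \<longlonglongrightarrow> 0"
  proof (rule Lim_null_comparison[OF _ *], rule always_eventually, rule allI)
    fix n
    have "ip M (f n) h - ip M g h = ip M (\<lambda>x. f n x - g x) h"
      using assms by (simp add: ip_diff)
    then show "norm (ip M (f n) h - ip M g h) \<le> sqrt (nsq M (\<lambda>x. f n x - g x) * nsq M h)"
      using ip_Cauchy_Schwarz[OF l2_diff[OF assms(1)[of n] assms(2)] assms(3)]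
      by (simp add: real_le_rsqrt)
  qed
  then show ?thesis by (simp add: LIM_zero_iff)
qed

text \<open>Along a subsequence with \<open>\<parallel>s\<^sub>k\<^sub>+\<^sub>1 - s\<^sub>k\<parallel>\<^sup>2 < 4\<^sup>-\<^sup>k\<close>, the integral of
  \<open>\<Sum>k. 2\<^sup>k \<bar>s\<^sub>k\<^sub>+\<^sub>1 - s\<^sub>k\<bar>\<^sup>2\<close> is finite, which forces pointwise convergence almost everywhere.\<close>

lemma l2_AE_convergent_fast:
  assumes s: "\<And>k. s k \<in> l2 M" and fast: "\<And>k. nsq M (\<lambda>x. s (Suc k) x - s k x) \<le> (1/4) ^ k"
  shows "AE x in M. convergent (\<lambda>k. s k x)"
proof -
  define d where "d k x = 2 ^ k * (cmod (s (Suc k) x - s k x))\<^sup>2" for k x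
  have ms[measurable]: "s k \<in> borel_measurable M" for k using s by (rule l2_measurable)
  have int: "integrable M (d k)" for k
    unfolding d_def using l2_integrable[OF l2_diff[OF s s]] by auto
  have le: "(\<integral>\<^sup>+x. ennreal (d k x) \<partial>M) \<le> ennreal ((1/2) ^ k)" for k
  proof -
    have "(\<integral>\<^sup>+x. ennreal (d k x) \<partial>M) = ennreal (\<integral>x. d k x \<partial>M)"
      using int by (rule nn_integral_eq_integral) (simp add: d_def)
    also have "(\<integral>x. d k x \<partial>M) = 2 ^ k * nsq M (\<lambda>x. s (Suc k) x - s k x)"
      unfolding d_def nsq_def by simp
    also have "\<dots> \<le> 2 ^ k * (1/4) ^ k"
      using fast by (intro mult_left_mono) auto
    also have "\<dots> = (1/2) ^ k" by (simp add: power_mult_distrib[symmetric])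
    finally show ?thesis by (simp add: ennreal_leI)
  qed
  have "(\<integral>\<^sup>+x. (\<Sum>k. ennreal (d k x)) \<partial>M) = (\<Sum>k. \<integral>\<^sup>+x. ennreal (d k x) \<partial>M)"
    by (rule nn_integral_suminf) (simp add: d_def)
  also have "\<dots> \<le> (\<Sum>k. ennreal ((1/2) ^ k))"
    by (intro suminf_le le) auto
  also have "\<dots> < \<infinity>"
    by (subst suminf_ennreal2) (auto simp: summable_geometric)
  finally have "(\<integral>\<^sup>+x. (\<Sum>k. ennreal (d k x)) \<partial>M) \<noteq> \<infinity>" by simp
  then have "AE x in M. (\<Sum>k. ennreal (d k x)) \<noteq> \<infinity>"
    by (intro nn_integral_noteq_infinite) (auto simp: d_def)
  then show ?thesis
  proof (eventually_elim)
    case (elim x)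
    then have sm: "summable (\<lambda>k. d k x)"
      by (intro summable_suminf_not_top) (auto simp: d_def)
    define C where "C = (\<Sum>k. d k x)"
    have dC: "d k x \<le> C" for k
      unfolding C_def using sum_le_suminf[OF sm, of "{k}"] by (simp add: d_def)
    have C0: "C \<ge> 0" using dC[of 0] by (simp add: d_def) (meson order_trans zero_le_power2)
    \<comment> \<open>Each weighted term is at most the sum \<open>C\<close>, so the increments
      decay geometrically with ratio \<open>1 / sqrt 2\<close>.\<close>
    have b: "norm (s (Suc k) x - s k x) \<le> sqrt C * (1 / sqrt 2) ^ k" for k
    proof -
      have "(cmod (s (Suc k) x - s k x))\<^sup>2 \<le> C * (1/2) ^ k"
        using dC[of k] by (simp add: d_def power_one_over field_simps)
      then have "cmod (s (Suc k) x - s k x) \<le> sqrt (C * (1/2) ^ k)"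
        by (rule real_le_rsqrt)
      also have "\<dots> = sqrt C * (1 / sqrt 2) ^ k"
        by (simp add: real_sqrt_mult real_sqrt_power real_sqrt_divide)
      finally show ?thesis .
    qed
    have "summable (\<lambda>k. s (Suc k) x - s k x)"
      by (rule summable_comparison_test'[OF summable_mult[OF summable_geometric] b]) simp
    then have "convergent (\<lambda>n. \<Sum>k<n. s (Suc k) x - s k x)"
      by (simp add: summable_iff_convergent)
    then have "convergent (\<lambda>n. s n x - s 0 x)"
      using sum_lessThan_telescope[of "\<lambda>k. s k x"] by simp
    then have "convergent (\<lambda>n. (s n x - s 0 x) + s 0 x)"
      by (rule convergent_add) (rule convergent_const)
    then show ?case by simp
  qed
qed

text \<open>The limit is built pointwise along a fast subsequence; Fatou's lemma then bounds the
  distance of every late term to it.\<close>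

theorem l2_complete:
  assumes s: "\<And>n. s n \<in> l2 M"
    and Cauchy: "\<And>e. e > 0 \<Longrightarrow> \<exists>N. \<forall>m\<ge>N. \<forall>n\<ge>N. nsq M (\<lambda>x. s m x - s n x) < e"
  obtains l where "l \<in> l2 M" "(\<lambda>n. nsq M (\<lambda>x. s n x - l x)) \<longlonglongrightarrow> 0"
proof -
  obtain N where N: "nsq M (\<lambda>x. s m x - s n x) < (1/4) ^ k" if "m \<ge> N k" "n \<ge> N k" for m n k
    using Cauchy[of "(1/4) ^ k" for k] by (metis zero_less_divide_1_iff zero_less_numeral zero_less_power)
  \<comment> \<open>The maximum makes consecutive differences along \<open>r\<close> fast in the
    sense of \<open>l2_AE_convergent_fast\<close>, and the summand \<open>k\<close> makes
    \<open>r\<close> cofinal.\<close>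
  define r where "r k = Max (N ` {..k}) + k" for k
  have rN: "r k \<ge> N j" if "j \<le> k" for j k
    unfolding r_def using that by (intro trans_le_add1 Max_ge) auto
  have rk: "r k \<ge> k" for k by (simp add: r_def)
  have ms[measurable]: "s k \<in> borel_measurable M" for k using s by (rule l2_measurable)
  have conv: "AE x in M. convergent (\<lambda>k. s (r k) x)"
    by (rule l2_AE_convergent_fast) (auto intro!: s less_imp_le N rN)
  define l where "l x = (if convergent (\<lambda>k. s (r k) x) then lim (\<lambda>k. s (r k) x) else 0)" for x
  have lm[measurable]: "l \<in> borel_measurable M" 
  proof -
    have "Measurable.pred M (\<lambda>x. convergent (\<lambda>k. s (r k) x))"
      unfolding Cauchy_convergent_iff[symmetric] pred_def by (rule sets_Collect_Cauchy) auto
    then show ?thesis unfolding l_def by measurable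
  qed
  have lim: "AE x in M. (\<lambda>k. s (r k) x) \<longlonglongrightarrow> l x"
    using conv by eventually_elim (simp add: l_def convergent_LIMSEQ_iff)
  have fatou: "(\<integral>\<^sup>+x. ennreal ((cmod (s n x - l x))\<^sup>2) \<partial>M) \<le> ennreal e"
    if e: "e > 0" and n: "\<And>m. m \<ge> n \<Longrightarrow> nsq M (\<lambda>x. s n x - s m x) \<le> e" for n e
  proof -
    have "(\<integral>\<^sup>+x. ennreal ((cmod (s n x - l x))\<^sup>2) \<partial>M)
        = (\<integral>\<^sup>+x. liminf (\<lambda>k. ennreal ((cmod (s n x - s (r k) x))\<^sup>2)) \<partial>M)"
    proof (rule nn_integral_cong_AE, use lim in eventually_elim)
      case (elim x)
      then have "(\<lambda>k. ennreal ((cmod (s n x - s (r k) x))\<^sup>2)) \<longlonglongrightarrow> ennreal ((cmod (s n x - l x))\<^sup>2)"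
        by (intro tendsto_intros)
      then show ?case by (rule lim_imp_Liminf[OF sequentially_bot, symmetric])
    qed
    also have "\<dots> \<le> liminf (\<lambda>k. \<integral>\<^sup>+x. ennreal ((cmod (s n x - s (r k) x))\<^sup>2) \<partial>M)"
      by (rule nn_integral_liminf) measurable
    also have "\<dots> \<le> liminf (\<lambda>k. ennreal e)"
    proof (rule Liminf_mono, rule eventually_mono[OF eventually_ge_at_top[of n]])
      fix k assume "k \<ge> n"
      then have "nsq M (\<lambda>x. s n x - s (r k) x) \<le> e" using rk[of k] by (intro n) linarith
      then show "(\<integral>\<^sup>+x. ennreal ((cmod (s n x - s (r k) x))\<^sup>2) \<partial>M) \<le> ennreal e"
        using nn_integral_eq_integral[OF l2_integrable[OF l2_diff[OF s[of n] s[of "r k"]]]]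
        by (simp add: nsq_def ennreal_leI)
    qed
    also have "\<dots> = ennreal e" by (simp add: Liminf_const)
    finally show ?thesis .
  qed
  have mem: "(\<lambda>x. s n x - l x) \<in> l2 M \<and> nsq M (\<lambda>x. s n x - l x) \<le> e"
    if "e > 0" and n: "\<And>m. m \<ge> n \<Longrightarrow> nsq M (\<lambda>x. s n x - s m x) \<le> e" for n e
  proof -
    have "(\<integral>\<^sup>+x. ennreal ((cmod (s n x - l x))\<^sup>2) \<partial>M) \<le> ennreal e"
      using that by (intro fatou) auto
    moreover have "integrable M (\<lambda>x. (cmod (s n x - l x))\<^sup>2)"
      by (rule integrableI_bounded) (use calculation in \<open>auto simp: less_top[symmetric] top_unique\<close>)
    ultimately show ?thesis
      using nn_integral_eq_integral[of M "\<lambda>x. (cmod (s n x - l x))\<^sup>2"] \<open>e > 0\<close>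
      by (simp add: l2_def nsq_def)
  qed
  show thesis
  proof (rule that)
    have n0: "nsq M (\<lambda>x. s (N 0) x - s m x) \<le> 1" if "m \<ge> N 0" for m
      using N[of 0 "N 0" m] that by simp
    have "(\<lambda>x. s (N 0) x - l x) \<in> l2 M"
      using mem[of 1 "N 0"] n0 by auto
    from l2_diff[OF s[of "N 0"] this] show "l \<in> l2 M" by simp
    show "(\<lambda>n. nsq M (\<lambda>x. s n x - l x)) \<longlonglongrightarrow> 0"
    proof (rule LIMSEQ_I)
      fix e :: real assume "e > 0"
      then obtain K where K: "\<forall>m\<ge>K. \<forall>n\<ge>K. nsq M (\<lambda>x. s m x - s n x) < e/2"
        using Cauchy[of "e/2"] by auto
      have "norm (nsq M (\<lambda>x. s n x - l x) - 0) < e" if n: "n \<ge> K" for n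
      proof -
        have "nsq M (\<lambda>x. s n x - s m x) \<le> e/2" if "m \<ge> n" for m
          using K n that by (meson less_imp_le order_trans)
        then have "nsq M (\<lambda>x. s n x - l x) \<le> e/2" using mem[of "e/2" n] \<open>e > 0\<close> by auto
        then show ?thesis using \<open>e > 0\<close> by simp
      qed
      then show "\<exists>no. \<forall>n\<ge>no. norm (nsq M (\<lambda>x. s n x - l x) - 0) < e" by blast
    qed
  qed
qed

lemma ip_cong: "(\<And>x. x \<in> space M \<Longrightarrow> f x = f' x) \<Longrightarrow> (\<And>x. x \<in> space M \<Longrightarrow> g x = g' x) \<Longrightarrow> ip M f g = ip M f' g'"
  unfolding ip_def by (auto intro: Bochner_Integration.integral_cong)

lemma nsq_cong: "(\<And>x. x \<in> space M \<Longrightarrow> f x = g x) \<Longrightarrow> nsq M f = nsq M g"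
  unfolding nsq_def by (auto intro: Bochner_Integration.integral_cong)

lemma nsq_tendsto:
  assumes "\<And>n. f n \<in> l2 M" "g \<in> l2 M" "(\<lambda>n. nsq M (\<lambda>x. f n x - g x)) \<longlonglongrightarrow> 0"
  shows "(\<lambda>n. nsq M (f n)) \<longlonglongrightarrow> nsq M g"
proof -
  have "nsq M (f n) = nsq M (\<lambda>x. f n x - g x) - nsq M g + 2 * Re (ip M (f n) g)" for n
    using nsq_expand[OF assms(1)[of n] assms(2)] by simp
  moreover have "(\<lambda>n. nsq M (\<lambda>x. f n x - g x) - nsq M g + 2 * Re (ip M (f n) g))
      \<longlonglongrightarrow> 0 - nsq M g + 2 * Re (ip M g g)"
    by (intro tendsto_intros assms ip_tendsto)
  ultimately show ?thesis by (simp add: ip_self)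
qed

lemma ip_diff_right:
  assumes "f \<in> l2 M" "g \<in> l2 M" "h \<in> l2 M"
  shows "ip M h (\<lambda>x. f x - g x) = ip M h f - ip M h g"
  using ip_diff[OF assms] ip_commute[of M h] by (metis complex_cnj_diff)

lemma ip_eqI:
  assumes "f \<in> l2 M" "f' \<in> l2 M" "g \<in> l2 M" "g' \<in> l2 M"
    and "nsq M (\<lambda>x. f x - f' x) = 0" "nsq M (\<lambda>x. g x - g' x) = 0"
  shows "ip M f g = ip M f' g'"
proof -
  have "ip M f g - ip M f' g = 0"
    using ip_zero_left[OF l2_diff[OF assms(1,2)] assms(3)] assms by (simp add: ip_diff)
  moreover have "ip M f' g - ip M f' g' = 0"
    using ip_zero_right[OF assms(2) l2_diff[OF assms(3,4)]] assms by (simp add: ip_diff_right)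
  ultimately show ?thesis by simp
qed

section \<open>Measure preserving flows and their invariant functions\<close>

text \<open>The measure may be infinite, in contrast to \<open>mp_action\<close>: the flows of
  interest are skew products with an infinite group. Values outside the space are left open, so
  functions are compared on the space only.\<close>

locale mp_flow = group G for G (structure) +
  fixes \<Omega> :: "'w measure" and T
  assumes T_meas: "g \<in> carrier G \<Longrightarrow> T g \<in> \<Omega> \<rightarrow>\<^sub>M \<Omega>"
    and T_distr: "g \<in> carrier G \<Longrightarrow> distr \<Omega> \<Omega> (T g) = \<Omega>"
    and T_mult: "\<lbrakk>g \<in> carrier G; h \<in> carrier G; x \<in> space \<Omega>\<rbrakk> \<Longrightarrow> T (g \<otimes> h) x = T g (T h x)"
    and T_one: "x \<in> space \<Omega> \<Longrightarrow> T \<one> x = x"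
begin

lemma T_space: "g \<in> carrier G \<Longrightarrow> x \<in> space \<Omega> \<Longrightarrow> T g x \<in> space \<Omega>"
  using T_meas by (auto dest: measurable_space)

lemma integral_T:
  fixes f :: "'w \<Rightarrow> 'c :: {banach, second_countable_topology}"
  assumes "g \<in> carrier G" "f \<in> borel_measurable \<Omega>"
  shows "(\<integral>x. f (T g x) \<partial>\<Omega>) = (\<integral>x. f x \<partial>\<Omega>)"
  using integral_distr[OF T_meas[OF assms(1)] assms(2)] T_distr[OF assms(1)] by simp

lemma l2_T:
  assumes "g \<in> carrier G" "f \<in> l2 \<Omega>"
  shows "(\<lambda>x. f (T g x)) \<in> l2 \<Omega>"
proof -
  note [measurable] = T_meas[OF assms(1)] l2_measurable[OF assms(2)]
  have "integrable \<Omega> (\<lambda>x. (cmod (f (T g x)))\<^sup>2)"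
    using integrable_distr[OF T_meas[OF assms(1)], of "\<lambda>x. (cmod (f x))\<^sup>2"]
      l2_integrable[OF assms(2)] T_distr[OF assms(1)] by simp
  then show ?thesis by (simp add: l2_def)
qed

lemma ip_T:
  assumes "g \<in> carrier G" "f \<in> l2 \<Omega>" "f' \<in> l2 \<Omega>"
  shows "ip \<Omega> (\<lambda>x. f (T g x)) (\<lambda>x. f' (T g x)) = ip \<Omega> f f'"
  unfolding ip_def using integral_T[OF assms(1), of "\<lambda>x. f x * cnj (f' x)"] assms(2,3)[THEN l2_measurable]
  by simp

lemma nsq_T:
  assumes "g \<in> carrier G" "f \<in> l2 \<Omega>"
  shows "nsq \<Omega> (\<lambda>x. f (T g x)) = nsq \<Omega> f"
  unfolding nsq_def using integral_T[OF assms(1), of "\<lambda>x. (cmod (f x))\<^sup>2"] assms(2)[THEN l2_measurable]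
  by simp

lemma nsq_T_diff:
  assumes "g \<in> carrier G" "f \<in> l2 \<Omega>" "f' \<in> l2 \<Omega>"
  shows "nsq \<Omega> (\<lambda>x. f (T g x) - f' (T g x)) = nsq \<Omega> (\<lambda>x. f x - f' x)"
  using nsq_T[OF assms(1) l2_diff[OF assms(2,3)]] by simp

lemma T_inv:
  assumes "g \<in> carrier G" "x \<in> space \<Omega>"
  shows "T g (T (inv g) x) = x" "T (inv g) (T g x) = x"
  using T_mult[of g "inv g" x] T_mult[of "inv g" g x] assms by (auto simp: T_one)

lemma ip_T_adjoint:
  assumes "g \<in> carrier G" "f \<in> l2 \<Omega>" "f' \<in> l2 \<Omega>"
  shows "ip \<Omega> (\<lambda>x. f (T g x)) f' = ip \<Omega> f (\<lambda>x. f' (T (inv g) x))"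
proof -
  have "ip \<Omega> f (\<lambda>x. f' (T (inv g) x)) = ip \<Omega> (\<lambda>x. f (T g x)) (\<lambda>x. f' (T (inv g) (T g x)))"
    using ip_T[OF assms(1,2) l2_T[OF _ assms(3), of "inv g"]] assms(1) by simp
  also have "\<dots> = ip \<Omega> (\<lambda>x. f (T g x)) f'"
    using assms by (intro ip_cong) (auto simp: T_inv)
  finally show ?thesis by simp
qed

text \<open>Invariance in the sense of L^2: the exceptional null set may depend on
  \<open>h\<close>.\<close>

definition invariant_fun :: "'a set \<Rightarrow> ('w \<Rightarrow> complex) \<Rightarrow> bool" where
  "invariant_fun H f \<longleftrightarrow> (\<forall>h\<in>H. nsq \<Omega> (\<lambda>x. f (T h x) - f x) = 0)"

text \<open>Moving \<open>h\<close> past \<open>g\<close> replaces it by the conjugate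
  \<open>g \<otimes> h \<otimes> inv g\<close>, which lies in \<open>H\<close> again by normality,
  and \<open>T g\<close> preserves the norm.\<close>

lemma invariant_fun_diff_T:
  assumes H: "H \<lhd> G" and f: "f \<in> l2 \<Omega>" "invariant_fun H f" and g: "g \<in> carrier G"
  shows "invariant_fun H (\<lambda>x. f (T g x))"
  unfolding invariant_fun_def
proof
  fix h assume h: "h \<in> H"
  interpret normal H G by (rule H)
  have hG: "h \<in> carrier G" using h by (rule mem_carrier)
  have "nsq \<Omega> (\<lambda>x. f (T g (T h x)) - f (T g x)) = nsq \<Omega> (\<lambda>x. f (T (g \<otimes> h \<otimes> inv g) (T g x)) - f (T g x))"
  proof (rule nsq_cong)
    fix x assume x: "x \<in> space \<Omega>"
    have "T (g \<otimes> h \<otimes> inv g) (T g x) = T (g \<otimes> h) x"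
      using g hG x by (simp add: T_mult T_space T_inv)
    then show "f (T g (T h x)) - f (T g x) = f (T (g \<otimes> h \<otimes> inv g) (T g x)) - f (T g x)"
      using g hG x by (simp add: T_mult)
  qed
  also have "\<dots> = nsq \<Omega> (\<lambda>x. f (T (g \<otimes> h \<otimes> inv g) x) - f x)"
    using nsq_T[OF g l2_diff[OF l2_T[OF _ f(1)] f(1)], of "g \<otimes> h \<otimes> inv g"] g hG by simp
  also have "\<dots> = 0"
    using f(2) inv_op_closed2[OF g h] by (auto simp: invariant_fun_def)
  finally show "nsq \<Omega> (\<lambda>x. f (T g (T h x)) - f (T g x)) = 0" .
qed

text \<open>Midpoints are the convex combinations that the parallelogram law handles. Induction over
  this hull carries bounds from the orbit of a function to a minimizing sequence.\<close>

inductive_set midpoint_hull :: "('w \<Rightarrow> complex) set \<Rightarrow> ('w \<Rightarrow> complex) set" for S where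
  base: "f \<in> S \<Longrightarrow> f \<in> midpoint_hull S"
| mid: "\<lbrakk>f \<in> midpoint_hull S; g \<in> midpoint_hull S\<rbrakk> \<Longrightarrow> (\<lambda>x. (f x + g x) / 2) \<in> midpoint_hull S"

text \<open>An element of minimal norm of the closed convex hull of the orbit of \<open>\<xi>\<close> is invariant, and
  it is the orthogonal projection of \<open>\<xi>\<close> to the invariant functions.\<close>

lemma invariant_projection:
  assumes H: "subgroup H G" and \<xi>: "\<xi> \<in> l2 \<Omega>"
  obtains \<eta> where "\<eta> \<in> l2 \<Omega>" "invariant_fun H \<eta>"
    "\<And>\<zeta>. \<zeta> \<in> l2 \<Omega> \<Longrightarrow> invariant_fun H \<zeta> \<Longrightarrow> ip \<Omega> \<eta> \<zeta> = ip \<Omega> \<xi> \<zeta>"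
    "\<And>r. (\<And>h. h \<in> H \<Longrightarrow> nsq \<Omega> (\<lambda>x. \<xi> (T h x) - \<xi> x) \<le> r) \<Longrightarrow> nsq \<Omega> (\<lambda>x. \<eta> x - \<xi> x) \<le> r"
proof -
  interpret H: subgroup H G by (rule H)
  define S where "S = {f \<in> l2 \<Omega>. \<exists>h\<in>H. \<forall>x\<in>space \<Omega>. f x = \<xi> (T h x)}"
  define C where "C = midpoint_hull S"
  have C_l2: "f \<in> l2 \<Omega>" if "f \<in> C" for f
    using that unfolding C_def
  proof induction
    case (mid f g)
    then show ?case using l2_scale[OF l2_add, of f \<Omega> g "1/2"] by simp
  qed (simp add: S_def)
  have C_mid: "(\<lambda>x. (f x + g x) / 2) \<in> C" if "f \<in> C" "g \<in> C" for f g
    using that unfolding C_def by (rule midpoint_hull.mid)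
  have C_T: "(\<lambda>x. f (T h x)) \<in> C" if "f \<in> C" "h \<in> H" for f h
    using that(1) unfolding C_def
  proof induction
    case (base f)
    then obtain k where k: "k \<in> H" "\<forall>x\<in>space \<Omega>. f x = \<xi> (T k x)" by (auto simp: S_def)
    then have "\<forall>x\<in>space \<Omega>. f (T h x) = \<xi> (T (k \<otimes> h) x)"
      using that(2) by (simp add: T_mult T_space)
    then show ?case
      using base k that(2) l2_T[of h f] by (intro midpoint_hull.base) (auto simp: S_def)
  next
    case (mid f g)
    then show ?case by (intro midpoint_hull.mid)
  qed
  have \<xi>C: "\<xi> \<in> C"
    unfolding C_def S_def using \<xi> by (intro midpoint_hull.base) (auto intro!: bexI[of _ \<one>] simp: T_one)
  define d where "d = Inf (nsq \<Omega> ` C)"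
  have bdd: "bdd_below (nsq \<Omega> ` C)" by (rule bdd_belowI[of _ 0]) auto
  have d_le: "d \<le> nsq \<Omega> f" if "f \<in> C" for f
    unfolding d_def using that bdd by (auto intro: cInf_lower)
  have "\<exists>f\<in>C. nsq \<Omega> f < d + 1 / real (Suc n)" for n
    using cInf_lessD[of "nsq \<Omega> ` C" "d + 1 / real (Suc n)"] \<xi>C by (auto simp: d_def)
  then obtain f where fC: "\<And>n. f n \<in> C" and fd: "\<And>n. nsq \<Omega> (f n) < d + 1 / real (Suc n)"
    by metis
  \<comment> \<open>Parallelogram law; the midpoint of \<open>u\<close> and \<open>v\<close> lies in
    \<open>C\<close>, so its squared norm is at least \<open>d\<close>.\<close>
  have close: "nsq \<Omega> (\<lambda>x. u x - v x) \<le> 2 * (nsq \<Omega> u - d) + 2 * (nsq \<Omega> v - d)"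
    if "u \<in> C" "v \<in> C" for u v
    using nsq_parallelogram[OF C_l2 C_l2, OF that] d_le[OF C_mid[OF that]] by simp
  have f_l2: "f n \<in> l2 \<Omega>" for n by (rule C_l2[OF fC])
  obtain \<eta> where \<eta>: "\<eta> \<in> l2 \<Omega>" "(\<lambda>n. nsq \<Omega> (\<lambda>x. f n x - \<eta> x)) \<longlonglongrightarrow> 0"
  proof (rule l2_complete[OF f_l2])
    fix e :: real assume "e > 0"
    then obtain N where N: "1 / real (Suc N) < e / 4"
      using reals_Archimedean[of "e/4"] by (auto simp: inverse_eq_divide)
    have *: "nsq \<Omega> (f n) < d + e / 4" if "n \<ge> N" for n
    proof -
      have "1 / real (Suc n) \<le> 1 / real (Suc N)" using that by (intro divide_left_mono) auto
      then have "1 / real (Suc n) < e / 4" using N by (rule order_le_less_trans)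
      from less_trans[OF fd add_strict_left_mono[OF this]] show ?thesis .
    qed
    have "nsq \<Omega> (\<lambda>x. f m x - f n x) < e" if "m \<ge> N" "n \<ge> N" for m n
    proof -
      have "a < e" if "a \<le> 2 * (b - d) + 2 * (c - d)" "b < d + e / 4" "c < d + e / 4" for a b c :: real
        using that by argo
      from this[OF close[OF fC fC] *[OF that(1)] *[OF that(2)]] show ?thesis .
    qed
    then show "\<exists>N. \<forall>m\<ge>N. \<forall>n\<ge>N. nsq \<Omega> (\<lambda>x. f m x - f n x) < e" by blast
  qed blast
  show thesis
  proof (rule that[OF \<eta>(1)])
    show "invariant_fun H \<eta>"
      unfolding invariant_fun_def
    proof
      fix h assume h: "h \<in> H"
      define a where "a n = nsq \<Omega> (\<lambda>x. f n x - \<eta> x)" for n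
      have hG: "h \<in> carrier G" using h by simp
      have "nsq \<Omega> (\<lambda>x. \<eta> (T h x) - \<eta> x) \<le> 6 * a n + 16 * (1 / real (Suc n))" for n
      proof -
        have "nsq \<Omega> (\<lambda>x. \<eta> (T h x) - \<eta> x)
            \<le> 2 * nsq \<Omega> (\<lambda>x. \<eta> (T h x) - f n (T h x)) + 2 * nsq \<Omega> (\<lambda>x. f n (T h x) - \<eta> x)"
          by (intro nsq_diff_le l2_T hG f_l2 \<eta>)
        also have "nsq \<Omega> (\<lambda>x. \<eta> (T h x) - f n (T h x)) = a n"
          unfolding a_def by (subst nsq_T_diff[OF hG \<eta>(1) f_l2]) (rule nsq_minus_commute)
        also have "nsq \<Omega> (\<lambda>x. f n (T h x) - \<eta> x) \<le> 2 * nsq \<Omega> (\<lambda>x. f n (T h x) - f n x) + 2 * a n"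
          unfolding a_def by (intro nsq_diff_le l2_T hG f_l2 \<eta>)
        \<comment> \<open>The translate of \<open>f n\<close> lies in \<open>C\<close> and has the
          same nearly minimal norm, so \<open>close\<close> applies to the two.\<close>
        also have "nsq \<Omega> (\<lambda>x. f n (T h x) - f n x) \<le> 4 * (1 / real (Suc n))"
          using close[OF C_T[OF fC h] fC, of n n] nsq_T[OF hG f_l2, of n] fd[of n] by simp
        finally show ?thesis by simp
      qed
      moreover have "(\<lambda>n. 6 * a n + 16 * (1 / real (Suc n))) \<longlonglongrightarrow> 6 * 0 + 16 * 0"
        unfolding a_def by (intro tendsto_intros \<eta> LIMSEQ_Suc lim_1_over_n)
      ultimately have "nsq \<Omega> (\<lambda>x. \<eta> (T h x) - \<eta> x) \<le> 6 * 0 + 16 * 0"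
        by (intro LIMSEQ_le_const[of _ "6 * 0 + 16 * 0"]) auto
      then show "nsq \<Omega> (\<lambda>x. \<eta> (T h x) - \<eta> x) = 0"
        using nsq_nonneg[of \<Omega> "\<lambda>x. \<eta> (T h x) - \<eta> x"] by linarith
    qed
  next
    fix \<zeta> assume \<zeta>: "\<zeta> \<in> l2 \<Omega>" "invariant_fun H \<zeta>"
    have "ip \<Omega> u \<zeta> = ip \<Omega> \<xi> \<zeta>" if "u \<in> C" for u
      using that unfolding C_def
    proof induction
      case (base u)
      then obtain h where h: "h \<in> H" "\<forall>x\<in>space \<Omega>. u x = \<xi> (T h x)" and u: "u \<in> l2 \<Omega>"
        by (auto simp: S_def)
      have hG: "h \<in> carrier G" using h by simp
      have "ip \<Omega> u \<zeta> = ip \<Omega> (\<lambda>x. \<xi> (T h x)) \<zeta>" using h by (intro ip_cong) auto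
      also have "\<dots> = ip \<Omega> (\<lambda>x. \<xi> (T h x)) (\<lambda>x. \<zeta> (T h x))"
        using \<zeta> h by (intro ip_eqI l2_T hG \<xi>)
          (auto simp: invariant_fun_def nsq_minus_commute[of _ \<zeta>] nsq_eq_0_iff[OF l2_zero])
      also have "\<dots> = ip \<Omega> \<xi> \<zeta>" by (rule ip_T[OF hG \<xi> \<zeta>(1)])
      finally show ?case .
    next
      case (mid u v)
      have "u \<in> l2 \<Omega>" "v \<in> l2 \<Omega>" using mid C_l2 by (auto simp: C_def)
      then show ?case
        using mid ip_scale[of \<Omega> "1/2" "\<lambda>x. u x + v x" \<zeta>] \<zeta> by (simp add: ip_add)
    qed
    then have "(\<lambda>n. ip \<Omega> (f n) \<zeta>) = (\<lambda>n. ip \<Omega> \<xi> \<zeta>)" using fC by auto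
    then show "ip \<Omega> \<eta> \<zeta> = ip \<Omega> \<xi> \<zeta>"
      using ip_tendsto[OF f_l2 \<eta>(1) \<zeta>(1) \<eta>(2)] by (metis LIMSEQ_const_iff)
  next
    fix r assume r: "\<And>h. h \<in> H \<Longrightarrow> nsq \<Omega> (\<lambda>x. \<xi> (T h x) - \<xi> x) \<le> r"
    have "nsq \<Omega> (\<lambda>x. u x - \<xi> x) \<le> r" if "u \<in> C" for u
      using that unfolding C_def
    proof induction
      case (base u)
      then obtain h where h: "h \<in> H" "\<forall>x\<in>space \<Omega>. u x = \<xi> (T h x)" by (auto simp: S_def)
      then have "nsq \<Omega> (\<lambda>x. u x - \<xi> x) = nsq \<Omega> (\<lambda>x. \<xi> (T h x) - \<xi> x)" by (intro nsq_cong) auto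
      then show ?case using r[OF h(1)] by simp
    next
      case (mid u v)
      then have l2: "(\<lambda>x. u x - \<xi> x) \<in> l2 \<Omega>" "(\<lambda>x. v x - \<xi> x) \<in> l2 \<Omega>"
        using C_l2 \<xi> by (auto simp: C_def intro: l2_diff)
      have "nsq \<Omega> (\<lambda>x. (u x + v x) / 2 - \<xi> x) = nsq \<Omega> (\<lambda>x. ((u x - \<xi> x) + (v x - \<xi> x)) / 2)"
        by (intro nsq_cong) (simp add: field_simps)
      then show ?case
        using nsq_parallelogram[OF l2] mid nsq_nonneg[of \<Omega> "\<lambda>x. u x - \<xi> x - (v x - \<xi> x)"] by linarith
    qed
    then have le: "\<forall>n\<ge>0. nsq \<Omega> (\<lambda>x. f n x - \<xi> x) \<le> r" using fC by auto
    have "(\<lambda>n. nsq \<Omega> (\<lambda>x. f n x - \<xi> x)) \<longlonglongrightarrow> nsq \<Omega> (\<lambda>x. \<eta> x - \<xi> x)"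
      by (rule nsq_tendsto) (use \<eta> f_l2 \<xi> in \<open>auto intro: l2_diff\<close>)
    then show "nsq \<Omega> (\<lambda>x. \<eta> x - \<xi> x) \<le> r"
      using le by (intro LIMSEQ_le_const2) auto
  qed
qed

end

section \<open>Realizing a cyclic-type representation on complex sequences\<close>

lemma group_actionI:
  assumes "group G"
    and ext: "\<And>g. g \<in> carrier G \<Longrightarrow> \<phi> g \<in> extensional E"
    and closed: "\<And>g x. g \<in> carrier G \<Longrightarrow> x \<in> E \<Longrightarrow> \<phi> g x \<in> E"
    and one: "\<And>x. x \<in> E \<Longrightarrow> \<phi> \<one>\<^bsub>G\<^esub> x = x"
    and mult: "\<And>g h x. \<lbrakk>g \<in> carrier G; h \<in> carrier G; x \<in> E\<rbrakk> \<Longrightarrow> \<phi> (g \<otimes>\<^bsub>G\<^esub> h) x = \<phi> g (\<phi> h x)"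
  shows "group_action G E \<phi>"
proof -
  interpret group G by (rule assms(1))
  have bij: "bij_betw (\<phi> g) E E" if g: "g \<in> carrier G" for g
  proof (rule bij_betwI[where g = "\<phi> (inv\<^bsub>G\<^esub> g)"])
    show "\<phi> (inv\<^bsub>G\<^esub> g) (\<phi> g x) = x" if "x \<in> E" for x
      using mult[of "inv\<^bsub>G\<^esub> g" g x] g that by (simp add: one)
    show "\<phi> g (\<phi> (inv\<^bsub>G\<^esub> g) x) = x" if "x \<in> E" for x
      using mult[of g "inv\<^bsub>G\<^esub> g" x] g that by (simp add: one)
  qed (use closed g in auto)
  show ?thesis
    unfolding group_action_def group_hom_def group_hom_axioms_def
  proof (intro conjI homI)
    show "\<phi> g \<in> carrier (BijGroup E)" if "g \<in> carrier G" for g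
      using ext[OF that] bij[OF that] by (simp add: BijGroup_def Bij_def)
    show "\<phi> (g \<otimes>\<^bsub>G\<^esub> h) = \<phi> g \<otimes>\<^bsub>BijGroup E\<^esub> \<phi> h"
      if gh: "g \<in> carrier G" "h \<in> carrier G" for g h
    proof (rule extensionalityI[of _ E])
      show "\<phi> (g \<otimes>\<^bsub>G\<^esub> h) \<in> extensional E" using ext gh by simp
      show "\<phi> g \<otimes>\<^bsub>BijGroup E\<^esub> \<phi> h \<in> extensional E"
        using bij gh ext by (simp add: BijGroup_def Bij_def restrict_def extensional_def compose_def)
      show "\<phi> (g \<otimes>\<^bsub>G\<^esub> h) x = (\<phi> g \<otimes>\<^bsub>BijGroup E\<^esub> \<phi> h) x" if "x \<in> E" for x
        using bij gh ext that by (simp add: BijGroup_def Bij_def mult compose_def)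
    qed
  qed (simp_all add: assms(1) group_BijGroup)
qed

context mp_flow
begin

text \<open>The double orthogonal complement of the family, that is, its closed linear span. In this
  form, stability under limits and under translation is a statement about the vectors orthogonal to
  the family.\<close>

definition perp_perp :: "('a \<Rightarrow> nat \<Rightarrow> 'w \<Rightarrow> complex) \<Rightarrow> ('w \<Rightarrow> complex) set" where
  "perp_perp e = {f \<in> l2 \<Omega>. \<forall>z\<in>l2 \<Omega>. (\<forall>g\<in>carrier G. \<forall>n. ip \<Omega> z (e g n) = 0) \<longrightarrow> ip \<Omega> f z = 0}"

lemma perp_perp_l2: "f \<in> perp_perp e \<Longrightarrow> f \<in> l2 \<Omega>"
  by (simp add: perp_perp_def)

lemma perp_perp_add: "f \<in> perp_perp e \<Longrightarrow> f' \<in> perp_perp e \<Longrightarrow> (\<lambda>x. f x + f' x) \<in> perp_perp e"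
  by (simp add: perp_perp_def l2_add ip_add)

lemma perp_perp_scale: "f \<in> perp_perp e \<Longrightarrow> (\<lambda>x. c * f x) \<in> perp_perp e"
  by (simp add: perp_perp_def l2_scale ip_scale)

lemma perp_perp_diff:
  assumes "f \<in> perp_perp e" "f' \<in> perp_perp e"
  shows "(\<lambda>x. f x - f' x) \<in> perp_perp e"
  using perp_perp_add[OF assms(1) perp_perp_scale[OF assms(2), of "-1"]] by simp

lemma perp_perp_zero: "(\<lambda>x. 0) \<in> perp_perp e"
  by (simp add: perp_perp_def l2_zero ip_zero_left ip_def)

lemma perp_perp_generator:
  assumes "e g n \<in> l2 \<Omega>" "g \<in> carrier G"
  shows "e g n \<in> perp_perp e"
  using assms ip_commute[of \<Omega> "e g n"] by (auto simp: perp_perp_def)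

lemma perp_perp_limit:
  assumes "\<And>n. f n \<in> perp_perp e" "l \<in> l2 \<Omega>" "(\<lambda>n. nsq \<Omega> (\<lambda>x. f n x - l x)) \<longlonglongrightarrow> 0"
  shows "l \<in> perp_perp e"
  unfolding perp_perp_def
proof (intro CollectI conjI ballI impI assms(2))
  fix z assume z: "z \<in> l2 \<Omega>" "\<forall>g\<in>carrier G. \<forall>n. ip \<Omega> z (e g n) = 0"
  then have "(\<lambda>n. ip \<Omega> (f n) z) = (\<lambda>n. 0)" using assms(1) by (auto simp: perp_perp_def)
  then show "ip \<Omega> l z = 0"
    using ip_tendsto[OF perp_perp_l2[OF assms(1)] assms(2) z(1) assms(3)] by (simp add: LIMSEQ_const_iff)
qed

text \<open>A vector orthogonal to the whole family stays so after translation by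
  \<open>inv h\<close>, because \<open>e (g \<otimes> h) n\<close> belongs to the family; then pass
  to the adjoint.\<close>

lemma perp_perp_T:
  assumes f: "f \<in> perp_perp e" and h: "h \<in> carrier G"
    and l2: "\<And>n g. g \<in> carrier G \<Longrightarrow> e g n \<in> l2 \<Omega>"
    and e: "\<And>g n x. g \<in> carrier G \<Longrightarrow> x \<in> space \<Omega> \<Longrightarrow> e (g \<otimes> h) n x = e g n (T h x)"
  shows "(\<lambda>x. f (T h x)) \<in> perp_perp e"
  unfolding perp_perp_def
proof (intro CollectI conjI ballI impI)
  show "(\<lambda>x. f (T h x)) \<in> l2 \<Omega>" using f h by (intro l2_T perp_perp_l2)
  fix z assume z: "z \<in> l2 \<Omega>" "\<forall>g\<in>carrier G. \<forall>n. ip \<Omega> z (e g n) = 0"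
  have "ip \<Omega> (\<lambda>x. z (T (inv h) x)) (e g n) = 0" if g: "g \<in> carrier G" for g n
  proof -
    have "ip \<Omega> (\<lambda>x. z (T (inv h) x)) (e g n) = ip \<Omega> z (\<lambda>x. e g n (T h x))"
      using ip_T_adjoint[of "inv h" z "e g n"] h z(1) l2[OF g] by simp
    also have "\<dots> = ip \<Omega> z (e (g \<otimes> h) n)" using g e by (intro ip_cong) auto
    finally show ?thesis using z(2) g h by simp
  qed
  moreover have "(\<lambda>x. z (T (inv h) x)) \<in> l2 \<Omega>" using z(1) h by (intro l2_T) auto
  ultimately have "ip \<Omega> f (\<lambda>x. z (T (inv h) x)) = 0" using f by (auto simp: perp_perp_def)
  then show "ip \<Omega> (\<lambda>x. f (T h x)) z = 0"
    using ip_T_adjoint[OF h perp_perp_l2[OF f] z(1)] by simp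
qed

end

text \<open>The closed span of the translates \<open>e g n\<close> is realised on complex sequences by
  \<open>f \<mapsto> \<langle>f, e g n\<rangle>\<close>, the pairs \<open>(g, n)\<close> being enumerated; the group then acts
  by translation of the index.\<close>

locale cyclic_rep = mp_flow G \<Omega> T
  for G :: "('a, 'c) monoid_scheme" (structure) and \<Omega> :: "'b measure" and T +
  fixes \<zeta> :: "nat \<Rightarrow> 'b \<Rightarrow> complex"
  assumes countable_G: "countable (carrier G)"
    and \<zeta>: "\<zeta> n \<in> l2 \<Omega>"
begin

definition e where "e g n = (\<lambda>x. \<zeta> n (T g x))"

abbreviation "K \<equiv> perp_perp e"

definition code :: "'a \<Rightarrow> nat \<Rightarrow> nat" where
  "code g n = to_nat_on (carrier G \<times> (UNIV :: nat set)) (g, n)"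

definition ix_group :: "nat \<Rightarrow> 'a" where
  "ix_group k = fst (from_nat_into (carrier G \<times> (UNIV :: nat set)) k)"

definition ix_nat :: "nat \<Rightarrow> nat" where
  "ix_nat k = snd (from_nat_into (carrier G \<times> (UNIV :: nat set)) k)"

lemma ix_group_code [simp]: "g \<in> carrier G \<Longrightarrow> ix_group (code g n) = g"
  and ix_nat_code [simp]: "g \<in> carrier G \<Longrightarrow> ix_nat (code g n) = n"
  using countable_G by (simp_all add: ix_group_def ix_nat_def code_def)

lemma ix_group_closed [simp]: "ix_group k \<in> carrier G"
  using from_nat_into[of "carrier G \<times> (UNIV :: nat set)" k] by (auto simp: ix_group_def mem_Times_iff)

definition encode :: "('b \<Rightarrow> complex) \<Rightarrow> nat \<Rightarrow> complex" where
  "encode f = (\<lambda>k. ip \<Omega> f (e (ix_group k) (ix_nat k)))"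

text \<open>The preimage is determined only up to a function of norm 0 (\<open>encode_inj\<close>),
  so the inner product does not depend on the choice (\<open>ip_decode\<close>).\<close>

definition decode :: "(nat \<Rightarrow> complex) \<Rightarrow> 'b \<Rightarrow> complex" where
  "decode u = (SOME f. f \<in> K \<and> encode f = u)"

definition space_H :: "(nat \<Rightarrow> complex) hilbert" where
  "space_H = \<lparr>carrier = encode ` K, mult = (\<lambda>u v. undefined), one = undefined, zero = (\<lambda>k. 0),
     add = (\<lambda>u v k. u k + v k), smult = (\<lambda>c u k. c * u k),
     hinner = (\<lambda>u v. ip \<Omega> (decode u) (decode v))\<rparr>"

definition rep :: "'a \<Rightarrow> (nat \<Rightarrow> complex) \<Rightarrow> nat \<Rightarrow> complex" where
  "rep h = (\<lambda>u\<in>encode ` K. \<lambda>k. u (code (ix_group k \<otimes> h) (ix_nat k)))"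

lemma space_H_simps [simp]:
  "carrier space_H = encode ` K" "\<zero>\<^bsub>space_H\<^esub> = (\<lambda>k. 0)"
  "u \<oplus>\<^bsub>space_H\<^esub> v = (\<lambda>k. u k + v k)" "c \<odot>\<^bsub>space_H\<^esub> u = (\<lambda>k. c * u k)"
  "hinner space_H u v = ip \<Omega> (decode u) (decode v)"
  by (simp_all add: space_H_def)

lemma e_l2: "g \<in> carrier G \<Longrightarrow> e g n \<in> l2 \<Omega>"
  unfolding e_def by (intro l2_T \<zeta>)

lemma e_T: "g \<in> carrier G \<Longrightarrow> h \<in> carrier G \<Longrightarrow> x \<in> space \<Omega> \<Longrightarrow> e (g \<otimes> h) n x = e g n (T h x)"
  by (simp add: e_def T_mult)

lemma K_T: "f \<in> K \<Longrightarrow> h \<in> carrier G \<Longrightarrow> (\<lambda>x. f (T h x)) \<in> K"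
  by (rule perp_perp_T) (auto simp: e_l2 e_T)

lemma encode_add: "f \<in> l2 \<Omega> \<Longrightarrow> f' \<in> l2 \<Omega> \<Longrightarrow> encode (\<lambda>x. f x + f' x) = (\<lambda>k. encode f k + encode f' k)"
  by (simp add: encode_def ip_add e_l2)

lemma encode_diff: "f \<in> l2 \<Omega> \<Longrightarrow> f' \<in> l2 \<Omega> \<Longrightarrow> encode (\<lambda>x. f x - f' x) = (\<lambda>k. encode f k - encode f' k)"
  by (simp add: encode_def ip_diff e_l2)

lemma encode_scale: "encode (\<lambda>x. c * f x) = (\<lambda>k. c * encode f k)"
  by (simp add: encode_def ip_scale)

text \<open>The adjoint of translation by \<open>inv h\<close> is translation by \<open>h\<close>,
  which sends the generator at \<open>g\<close> to the one at \<open>g \<otimes> h\<close>. Hence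
  the index shift in \<open>rep\<close>.\<close>

lemma encode_T:
  assumes "f \<in> l2 \<Omega>" "h \<in> carrier G"
  shows "encode (\<lambda>x. f (T (inv h) x)) = (\<lambda>k. encode f (code (ix_group k \<otimes> h) (ix_nat k)))"
proof
  fix k
  have "encode (\<lambda>x. f (T (inv h) x)) k = ip \<Omega> f (\<lambda>x. e (ix_group k) (ix_nat k) (T h x))"
    unfolding encode_def using ip_T_adjoint[of "inv h" f] assms e_l2 by simp
  also have "\<dots> = ip \<Omega> f (e (ix_group k \<otimes> h) (ix_nat k))"
    using assms by (intro ip_cong) (auto simp: e_T)
  finally show "encode (\<lambda>x. f (T (inv h) x)) k = encode f (code (ix_group k \<otimes> h) (ix_nat k))"
    using assms by (simp add: encode_def)
qed

text \<open>Such an \<open>f\<close> is itself one of the test vectors in the definition of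
  \<open>perp_perp\<close>, hence orthogonal to itself.\<close>

lemma encode_zero_imp_null:
  assumes f: "f \<in> K" and "encode f = (\<lambda>k. 0)"
  shows "nsq \<Omega> f = 0"
proof -
  have "ip \<Omega> f (e g n) = 0" if "g \<in> carrier G" for g n
    using fun_cong[OF assms(2), of "code g n"] that by (simp add: encode_def)
  then have "ip \<Omega> f f = 0" using f by (auto simp: perp_perp_def)
  then show ?thesis by (simp add: ip_self)
qed

lemma encode_inj:
  assumes "f \<in> K" "f' \<in> K" "encode f = encode f'"
  shows "nsq \<Omega> (\<lambda>x. f x - f' x) = 0"
  using assms by (intro encode_zero_imp_null perp_perp_diff) (simp_all add: encode_diff perp_perp_l2)

lemma decode:
  assumes "u \<in> encode ` K"
  shows "decode u \<in> K" "encode (decode u) = u"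
  using someI_ex[of "\<lambda>f. f \<in> K \<and> encode f = u"] assms by (auto simp: decode_def)

lemma decode_encode: "f \<in> K \<Longrightarrow> nsq \<Omega> (\<lambda>x. decode (encode f) x - f x) = 0"
  using decode[of "encode f"] by (intro encode_inj) auto

lemma ip_decode:
  assumes "f \<in> K" "f' \<in> K"
  shows "ip \<Omega> (decode (encode f)) (decode (encode f')) = ip \<Omega> f f'"
  using assms decode[of "encode f"] decode[of "encode f'"]
  by (intro ip_eqI decode_encode) (auto intro: perp_perp_l2)

lemma H_add: "u \<in> encode ` K \<Longrightarrow> v \<in> encode ` K \<Longrightarrow> (\<lambda>k. u k + v k) \<in> encode ` K"
  by (auto simp: encode_add[symmetric] perp_perp_l2 intro!: imageI perp_perp_add)

lemma H_scale: "u \<in> encode ` K \<Longrightarrow> (\<lambda>k. c * u k) \<in> encode ` K"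
  by (auto simp: encode_scale[symmetric] intro!: imageI perp_perp_scale)

lemma H_zero: "(\<lambda>k. 0) \<in> encode ` K"
  using H_scale[of _ 0] perp_perp_zero by fastforce

lemma abelian_group_H: "abelian_group space_H"
proof (rule abelian_groupI)
  fix u assume "u \<in> carrier space_H"
  then have "(\<lambda>k. (-1) * u k) \<in> carrier space_H" using H_scale[of u "-1"] by simp
  then show "\<exists>v\<in>carrier space_H. v \<oplus>\<^bsub>space_H\<^esub> u = \<zero>\<^bsub>space_H\<^esub>"
    by (rule bexI[rotated]) simp
qed (auto simp: H_add H_zero algebra_simps)

lemma H_minus:
  assumes "u \<in> carrier space_H" "v \<in> carrier space_H"
  shows "u \<ominus>\<^bsub>space_H\<^esub> v = (\<lambda>k. u k - v k)"
proof -
  interpret abelian_group space_H by (rule abelian_group_H)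
  have "\<ominus>\<^bsub>space_H\<^esub> v = (\<lambda>k. (-1) * v k)"
    by (rule minus_equality) (use assms H_scale[of v "-1"] in auto)
  then show ?thesis by (simp add: a_minus_def)
qed

lemma hnorm_H:
  assumes "f \<in> K"
  shows "hnorm space_H (encode f) = sqrt (nsq \<Omega> f)"
  using ip_decode[OF assms assms] by (simp add: hnorm_def ip_self)

lemma hilbert_space_H: "hilbert_space space_H"
proof -
  have mod: "module (ring_of_type_algebra :: complex ring) space_H"
    by (rule moduleI)
      (use abelian_group_H in \<open>auto simp: H_scale ring_of_type_algebra_def algebra_simps cring_from_type_algebra[unfolded ring_of_type_algebra_def]\<close>)
  have ax: "hilbert_space_axioms space_H"
  proof
    fix u v w :: "nat \<Rightarrow> complex" and c
    assume uv: "u \<in> carrier space_H" "v \<in> carrier space_H"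
    then obtain f f' where f: "f \<in> K" "f' \<in> K" and [simp]: "u = encode f" "v = encode f'" by auto
    show "hinner space_H (c \<odot>\<^bsub>space_H\<^esub> u) v = c * hinner space_H u v"
      using f by (simp add: encode_scale[symmetric] ip_decode perp_perp_scale ip_scale del: encode_def)
    show "hinner space_H v u = cnj (hinner space_H u v)"
      unfolding space_H_simps by (rule ip_commute)
    assume "w \<in> carrier space_H"
    then obtain f'' where f'': "f'' \<in> K" and [simp]: "w = encode f''" by auto
    show "hinner space_H (u \<oplus>\<^bsub>space_H\<^esub> v) w = hinner space_H u w + hinner space_H v w"
      using f f'' by (simp add: encode_add[symmetric] ip_decode perp_perp_add perp_perp_l2 ip_add)
  next
    fix u assume "u \<in> carrier space_H" "u \<noteq> \<zero>\<^bsub>space_H\<^esub>"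
    then obtain f where f: "f \<in> K" and u: "u = encode f" "encode f \<noteq> (\<lambda>k. 0)" by auto
    have "nsq \<Omega> f \<noteq> 0"
    proof
      assume "nsq \<Omega> f = 0"
      then have "encode f = (\<lambda>k. 0)"
        unfolding encode_def by (intro ext ip_zero_left[OF perp_perp_l2[OF f] e_l2]) auto
      then show False using u by simp
    qed
    then show "0 < Re (hinner space_H u u)"
      using ip_decode[OF f f] nsq_nonneg[of \<Omega> f] by (simp add: u ip_self less_le)
  next
    fix s :: "nat \<Rightarrow> nat \<Rightarrow> complex"
    assume s: "range s \<subseteq> carrier space_H"
      and C: "\<forall>e>0. \<exists>N. \<forall>m\<ge>N. \<forall>n\<ge>N. hnorm space_H (s m \<ominus>\<^bsub>space_H\<^esub> s n) < e"
    define f where "f n = decode (s n)" for n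
    have sn: "s n \<in> encode ` K" for n using s by (simp add: subset_eq)
    have f: "f n \<in> K" and sf: "s n = encode (f n)" for n
      using decode[OF sn] by (simp_all add: f_def)
    have f_l2: "f n \<in> l2 \<Omega>" for n by (rule perp_perp_l2[OF f])
    have hn: "hnorm space_H (encode g \<ominus>\<^bsub>space_H\<^esub> encode g') = sqrt (nsq \<Omega> (\<lambda>x. g x - g' x))"
      if "g \<in> K" "g' \<in> K" for g g'
      using hnorm_H[OF perp_perp_diff[OF that]] that
      by (simp add: H_minus encode_diff perp_perp_l2)
    obtain l where l: "l \<in> l2 \<Omega>" "(\<lambda>n. nsq \<Omega> (\<lambda>x. f n x - l x)) \<longlonglongrightarrow> 0"
    proof (rule l2_complete[OF f_l2])
      fix d :: real assume d: "d > 0"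
      then obtain N where "\<forall>m\<ge>N. \<forall>n\<ge>N. hnorm space_H (s m \<ominus>\<^bsub>space_H\<^esub> s n) < sqrt d"
        using C by (meson real_sqrt_gt_zero)
      then show "\<exists>N. \<forall>m\<ge>N. \<forall>n\<ge>N. nsq \<Omega> (\<lambda>x. f m x - f n x) < d"
        unfolding sf hn[OF f f] real_sqrt_less_iff by blast
    qed blast
    have "l \<in> K" by (rule perp_perp_limit[OF f l])
    moreover have "(\<lambda>n. hnorm space_H (s n \<ominus>\<^bsub>space_H\<^esub> encode l)) \<longlonglongrightarrow> 0"
      unfolding sf hn[OF f \<open>l \<in> K\<close>] using tendsto_real_sqrt[OF l(2)] by simp
    ultimately show "\<exists>l\<in>carrier space_H. (\<lambda>n. hnorm space_H (s n \<ominus>\<^bsub>space_H\<^esub> l)) \<longlonglongrightarrow> 0"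
      by auto
  qed
  show ?thesis by (intro hilbert_space.intro mod ax)
qed

lemma rep_encode:
  assumes "f \<in> K" "h \<in> carrier G"
  shows "rep h (encode f) = encode (\<lambda>x. f (T (inv h) x))"
  using assms by (simp add: rep_def encode_T perp_perp_l2)

lemma unitary_rep_H: "unitary_rep G space_H rep"
  unfolding unitary_rep_def
proof (intro conjI ballI allI hilbert_space_H)
  show "group_action G (carrier space_H) rep"
  proof (rule group_actionI)
    show "group G" by (rule is_group)
    show "rep g \<in> extensional (carrier space_H)" for g by (simp add: rep_def)
    fix u assume "u \<in> carrier space_H"
    then obtain f where f: "f \<in> K" and u: "u = encode f" by auto
    show "rep g u \<in> carrier space_H" if "g \<in> carrier G" for g
      using f that by (auto simp: u rep_encode intro!: imageI K_T)
    have "encode (\<lambda>x. f (T \<one> x)) = encode f"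
      unfolding encode_def by (intro ext ip_cong) (auto simp: T_one)
    then show "rep \<one> u = u" using f by (simp add: u rep_encode)
    show "rep (g \<otimes> h) u = rep g (rep h u)" if "g \<in> carrier G" "h \<in> carrier G" for g h
    proof -
      have "rep g (rep h u) = encode (\<lambda>x. f (T (inv h) (T (inv g) x)))"
        using f that by (simp add: u rep_encode K_T)
      also have "\<dots> = encode (\<lambda>x. f (T (inv (g \<otimes> h)) x))"
        unfolding encode_def using that
        by (intro ext ip_cong) (auto simp: inv_mult_group T_mult)
      finally show ?thesis using f that by (simp add: u rep_encode)
    qed
  qed
next
  fix g u v assume g: "g \<in> carrier G" and uv: "u \<in> carrier space_H" "v \<in> carrier space_H"
  then obtain f f' where f: "f \<in> K" "f' \<in> K" and [simp]: "u = encode f" "v = encode f'" by auto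
  have T: "(\<lambda>x. f (T (inv g) x)) \<in> K" "(\<lambda>x. f' (T (inv g) x)) \<in> K"
    using f g by (auto intro: K_T)
  show "rep g (u \<oplus>\<^bsub>space_H\<^esub> v) = rep g u \<oplus>\<^bsub>space_H\<^esub> rep g v"
    using f g T perp_perp_add[OF f] by (simp add: encode_add[symmetric] perp_perp_l2 rep_encode)
  show "rep g (c \<odot>\<^bsub>space_H\<^esub> u) = c \<odot>\<^bsub>space_H\<^esub> rep g u" for c
    using f g T perp_perp_scale[OF f(1), of c] by (simp add: encode_scale[symmetric] rep_encode)
  show "hinner space_H (rep g u) (rep g v) = hinner space_H u v"
    using f g T ip_T[of "inv g" f f'] by (simp add: rep_encode ip_decode perp_perp_l2)
qed

end

section \<open>Near-invariant functions from relative property (T)\<close>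

context mp_flow
begin

lemma invariant_fun_diff:
  assumes "f \<in> l2 \<Omega>" "f' \<in> l2 \<Omega>" "invariant_fun H f" "invariant_fun H f'" "H \<subseteq> carrier G"
  shows "invariant_fun H (\<lambda>x. f x - f' x)"
  unfolding invariant_fun_def
proof
  fix h assume h: "h \<in> H"
  have hG: "h \<in> carrier G" using h assms(5) by auto
  have "nsq \<Omega> (\<lambda>x. f (T h x) - f' (T h x) - (f x - f' x))
      = nsq \<Omega> (\<lambda>x. (f (T h x) - f x) + (f' x - f' (T h x)))"
    by (intro nsq_cong) simp
  also have "\<dots> \<le> 2 * nsq \<Omega> (\<lambda>x. f (T h x) - f x) + 2 * nsq \<Omega> (\<lambda>x. (f' x - f' (T h x)))"
    by (intro nsq_add_le l2_diff l2_T hG assms)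
  also have "\<dots> = 0"
    using assms(3,4) h nsq_minus_commute[of \<Omega> f' "\<lambda>x. f' (T h x)"] unfolding invariant_fun_def by simp
  finally show "nsq \<Omega> (\<lambda>x. f (T h x) - f' (T h x) - (f x - f' x)) = 0"
    using nsq_nonneg[of \<Omega> "\<lambda>x. f (T h x) - f' (T h x) - (f x - f' x)"] by linarith
qed

text \<open>If the projections of the \<open>\<xi> n\<close> to the invariant functions stayed away from the \<open>\<xi> n\<close>,
  the differences would span a representation that has almost invariant vectors but no non-zero
  \<open>G0\<close>-invariant one.\<close>

theorem relative_property_T_near_invariant:
  assumes relT: "relative_property_T G G0" and normal: "G0 \<lhd> G" and cnt: "countable (carrier G)"
    and \<xi>: "\<And>n. \<xi> n \<in> l2 \<Omega>"
    and almost: "\<And>g. g \<in> carrier G \<Longrightarrow> (\<lambda>n. nsq \<Omega> (\<lambda>x. \<xi> n (T g x) - \<xi> n x)) \<longlonglongrightarrow> 0"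
    and d: "d > 0"
  shows "\<exists>n\<ge>m. \<exists>\<eta>\<in>l2 \<Omega>. invariant_fun G0 \<eta> \<and> nsq \<Omega> (\<lambda>x. \<eta> x - \<xi> n x) < d"
proof (rule ccontr)
  assume far: "\<not> ?thesis"
  have G0: "subgroup G0 G" using normal by (rule normal_imp_subgroup)
  have G0_sub: "G0 \<subseteq> carrier G" by (rule subgroup.subset[OF G0])
  have "\<exists>\<eta>. \<eta> \<in> l2 \<Omega> \<and> invariant_fun G0 \<eta> \<and>
      (\<forall>\<theta>. \<theta> \<in> l2 \<Omega> \<longrightarrow> invariant_fun G0 \<theta> \<longrightarrow> ip \<Omega> \<eta> \<theta> = ip \<Omega> (\<xi> (n + m)) \<theta>)" for n
    using invariant_projection[OF G0 \<xi>[of "n + m"]] by metis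
  then obtain \<eta> where \<eta>: "\<And>n. \<eta> n \<in> l2 \<Omega>" "\<And>n. invariant_fun G0 (\<eta> n)"
    and proj: "\<And>n \<theta>. \<theta> \<in> l2 \<Omega> \<Longrightarrow> invariant_fun G0 \<theta> \<Longrightarrow> ip \<Omega> (\<eta> n) \<theta> = ip \<Omega> (\<xi> (n + m)) \<theta>"
    by metis
  define \<zeta> where "\<zeta> n = (\<lambda>x. \<xi> (n + m) x - \<eta> n x)" for n
  have \<zeta>: "\<zeta> n \<in> l2 \<Omega>" for n unfolding \<zeta>_def by (intro l2_diff \<xi> \<eta>)
  have big: "nsq \<Omega> (\<zeta> n) \<ge> d" for n
  proof -
    have "\<not> nsq \<Omega> (\<lambda>x. \<eta> n x - \<xi> (n + m) x) < d" using far \<eta>[of n] le_add2[of m n] by blast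
    then show ?thesis
      unfolding \<zeta>_def by (subst nsq_minus_commute) simp
  qed
  have orth: "ip \<Omega> (\<zeta> n) \<theta> = 0" if "\<theta> \<in> l2 \<Omega>" "invariant_fun G0 \<theta>" for n \<theta>
    unfolding \<zeta>_def using that \<eta> \<xi> by (simp add: ip_diff proj)
  have inv_T: "invariant_fun G0 (\<lambda>x. \<theta> (T g x))" if "\<theta> \<in> l2 \<Omega>" "invariant_fun G0 \<theta>" "g \<in> carrier G" for \<theta> g
    using invariant_fun_diff_T[OF normal that] .
  have orth_T: "ip \<Omega> (\<lambda>x. \<zeta> n (T g x)) \<theta> = 0"
    if "\<theta> \<in> l2 \<Omega>" "invariant_fun G0 \<theta>" "g \<in> carrier G" for n \<theta> g
  proof -
    have "inv g \<in> carrier G" using that(3) by simp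
    from orth[OF l2_T[OF this that(1)] inv_T[OF that(1,2) this]] show ?thesis
      using ip_T_adjoint[OF that(3) \<zeta> that(1)] by simp
  qed
  have \<zeta>_le: "nsq \<Omega> (\<lambda>x. \<zeta> n (T g x) - \<zeta> n x) \<le> nsq \<Omega> (\<lambda>x. \<xi> (n + m) (T g x) - \<xi> (n + m) x)"
    if g: "g \<in> carrier G" for n g
  proof -
    \<comment> \<open>The displacement of \<open>\<xi>\<close> is \<open>A - B\<close>. The part
      \<open>A\<close> is orthogonal to all invariant functions and \<open>B\<close> is invariant,
      so Pythagoras bounds \<open>A\<close> by the displacement.\<close>
    define A where "A = (\<lambda>x. \<zeta> n (T g x) - \<zeta> n x)"
    define B where "B = (\<lambda>x. \<eta> n x - \<eta> n (T g x))"
    have l2: "A \<in> l2 \<Omega>" "B \<in> l2 \<Omega>"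
      unfolding A_def B_def by (intro l2_diff l2_T g \<zeta> \<eta>)+
    have "invariant_fun G0 B"
      unfolding B_def by (intro invariant_fun_diff inv_T l2_T g \<eta> G0_sub)
    then have "ip \<Omega> A B = 0"
      unfolding A_def using l2 g \<zeta> by (simp add: ip_diff l2_T orth orth_T)
    then have "nsq \<Omega> A \<le> nsq \<Omega> (\<lambda>x. A x - B x)"
      using nsq_expand[OF l2] nsq_nonneg[of \<Omega> B] by simp
    also have "\<dots> = nsq \<Omega> (\<lambda>x. \<xi> (n + m) (T g x) - \<xi> (n + m) x)"
      by (intro nsq_cong) (simp add: A_def B_def \<zeta>_def)
    finally show ?thesis unfolding A_def .
  qed
  have \<zeta>_lim: "(\<lambda>n. nsq \<Omega> (\<lambda>x. \<zeta> n (T g x) - \<zeta> n x)) \<longlonglongrightarrow> 0" if g: "g \<in> carrier G" for g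
    by (rule real_tendsto_sandwich[OF _ _ tendsto_const LIMSEQ_ignore_initial_segment[OF almost[OF g], of m]])
      (auto intro!: always_eventually \<zeta>_le g)
  interpret R: cyclic_rep G \<Omega> T \<zeta>
    by unfold_locales (use cnt \<zeta> in auto)
  have \<zeta>K: "\<zeta> n \<in> R.K" for n
  proof -
    have "R.e \<one> n \<in> R.K" by (rule perp_perp_generator) (auto intro: R.e_l2)
    \<comment> \<open>\<open>R.e \<one> n\<close> agrees with \<open>\<zeta> n\<close> on the space,
      not as a function, so membership is obtained as the limit of a constant sequence.\<close>
    moreover have "nsq \<Omega> (\<lambda>x. R.e \<one> n x - \<zeta> n x) = 0"
      using nsq_cong[of \<Omega> "\<lambda>x. R.e \<one> n x - \<zeta> n x" "\<lambda>x. 0"] by (simp add: R.e_def T_one nsq_def)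
    ultimately show ?thesis
      by (intro perp_perp_limit[of "\<lambda>_. R.e \<one> n" _ "\<zeta> n"] \<zeta>) auto
  qed
  have "weakly_contains G R.space_H R.rep complex_line trivial_rep"
    unfolding weakly_contains_def
  proof (intro ballI allI impI)
    fix v :: complex and F and \<epsilon> :: real
    assume F: "finite F \<and> F \<subseteq> carrier G \<and> \<epsilon> > 0"
    define b where "b = (cmod v)\<^sup>2"
    \<comment> \<open>Cauchy-Schwarz will give an error of at most
      \<open>b / q * sqrt (r * q)\<close>; since \<open>q \<ge> d\<close>, this choice makes it at
      most \<open>\<epsilon> * (b / (b + 1))\<close>. The summand 1 covers
      \<open>b = 0\<close>.\<close>
    define r where "r = d * (\<epsilon> / (b + 1))\<^sup>2"
    have b: "b \<ge> 0" by (simp add: b_def)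
    have r: "r > 0" using F d b by (simp add: r_def)
    have "\<forall>\<^sub>F n in sequentially. \<forall>g\<in>F. nsq \<Omega> (\<lambda>x. \<zeta> n (T (inv g) x) - \<zeta> n x) < r"
      using F r by (intro eventually_ball_finite ballI order_tendstoD(2)[OF \<zeta>_lim]) auto
    from eventually_happens'[OF sequentially_bot this]
    obtain n where n: "\<And>g. g \<in> F \<Longrightarrow> nsq \<Omega> (\<lambda>x. \<zeta> n (T (inv g) x) - \<zeta> n x) < r"
      by blast
    define q where "q = nsq \<Omega> (\<zeta> n)"
    have q: "q \<ge> d" "q > 0" using big[of n] d by (auto simp: q_def)
    \<comment> \<open>Rescales \<open>\<zeta> n\<close> to the norm of \<open>v\<close>, so that
      both coefficients agree at the identity.\<close>
    define c where "c = complex_of_real (cmod v / sqrt q)"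
    define w where "w = R.encode (\<lambda>x. c * \<zeta> n x)"
    have wK: "(\<lambda>x. c * \<zeta> n x) \<in> R.K" by (intro perp_perp_scale \<zeta>K)
    have cc: "c * cnj c = complex_of_real (b / q)"
      using q by (simp add: c_def b_def power2_eq_square flip: of_real_mult)
    have "cmod (hinner complex_line (trivial_rep g v) v - hinner R.space_H (R.rep g w) w) < \<epsilon>"
      if g: "g \<in> F" for g
    proof -
      have gG: "g \<in> carrier G" using g F by auto
      define u where "u = (\<lambda>x. \<zeta> n (T (inv g) x))"
      have u: "u \<in> l2 \<Omega>" unfolding u_def using gG by (intro l2_T \<zeta>) auto
      have "hinner R.space_H (R.rep g w) w = ip \<Omega> (\<lambda>x. c * u x) (\<lambda>x. c * \<zeta> n x)"
        unfolding w_def u_def using gG wK R.K_T[OF wK, of "inv g"]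
        by (simp add: R.rep_encode R.ip_decode)
      also have "\<dots> = c * cnj c * ip \<Omega> u (\<zeta> n)"
        by (simp add: ip_scale ip_commute[of \<Omega> u "\<lambda>x. c * \<zeta> n x"] ip_commute[of \<Omega> u "\<zeta> n"])
      finally have 1: "hinner R.space_H (R.rep g w) w = complex_of_real (b / q) * ip \<Omega> u (\<zeta> n)"
        by (simp only: cc)
      have 2: "hinner complex_line (trivial_rep g v) v = complex_of_real (b / q) * ip \<Omega> (\<zeta> n) (\<zeta> n)"
        using q by (simp add: complex_line_def trivial_rep_def b_def ip_self flip: q_def complex_norm_square)
      have "cmod (ip \<Omega> (\<lambda>x. u x - \<zeta> n x) (\<zeta> n)) \<le> sqrt (r * q)"
      proof (rule real_le_rsqrt)
        have "nsq \<Omega> (\<lambda>x. u x - \<zeta> n x) * q \<le> r * q"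
          using n[OF g] q by (intro mult_right_mono) (auto simp: u_def)
        then show "(cmod (ip \<Omega> (\<lambda>x. u x - \<zeta> n x) (\<zeta> n)))\<^sup>2 \<le> r * q"
          using ip_Cauchy_Schwarz[OF l2_diff[OF u \<zeta>[of n]] \<zeta>[of n]] by (simp add: q_def)
      qed
      also have "\<dots> \<le> sqrt ((\<epsilon> / (b + 1) * q)\<^sup>2)"
      proof (intro real_sqrt_le_mono)
        have "d * q * (\<epsilon> / (b + 1))\<^sup>2 \<le> q * q * (\<epsilon> / (b + 1))\<^sup>2"
          using q by (intro mult_right_mono) auto
        then show "r * q \<le> (\<epsilon> / (b + 1) * q)\<^sup>2"
          unfolding r_def power_mult_distrib power2_eq_square[of q] by (simp only: mult_ac)
      qed
      also have "\<dots> = \<epsilon> / (b + 1) * q" using F b q by simp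
      finally have 3: "cmod (ip \<Omega> (\<lambda>x. u x - \<zeta> n x) (\<zeta> n)) \<le> \<epsilon> / (b + 1) * q" .
      have "hinner complex_line (trivial_rep g v) v - hinner R.space_H (R.rep g w) w
          = - (complex_of_real (b / q) * ip \<Omega> (\<lambda>x. u x - \<zeta> n x) (\<zeta> n))"
        unfolding 1 2 using u \<zeta> by (simp add: ip_diff algebra_simps)
      then have "cmod (hinner complex_line (trivial_rep g v) v - hinner R.space_H (R.rep g w) w)
          = b / q * cmod (ip \<Omega> (\<lambda>x. u x - \<zeta> n x) (\<zeta> n))"
        using b q by (simp add: norm_mult norm_divide)
      also have "\<dots> \<le> b / q * (\<epsilon> / (b + 1) * q)"
        using b q by (intro mult_left_mono 3) auto
      also have "\<dots> = \<epsilon> * (b / (b + 1))" using q by simp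
      also have "\<dots> < \<epsilon>" using F b by (simp add: field_simps)
      finally show ?thesis .
    qed
    moreover have "set [w] \<subseteq> carrier R.space_H" using wK by (simp add: w_def)
    ultimately show "\<exists>ws. set ws \<subseteq> carrier R.space_H \<and> (\<forall>g\<in>F. cmod (hinner complex_line (trivial_rep g v) v -
        (\<Sum>w\<leftarrow>ws. hinner R.space_H (R.rep g w) w)) < \<epsilon>)"
      by (intro exI[of _ "[w]"]) (simp del: R.space_H_simps)
  qed
  from relT[unfolded relative_property_T_def, rule_format, OF conjI[OF R.unitary_rep_H this]]
  obtain v where v: "v \<in> carrier R.space_H" "v \<noteq> \<zero>\<^bsub>R.space_H\<^esub>" "\<And>g. g \<in> G0 \<Longrightarrow> R.rep g v = v"
    by metis
  from v(1) obtain f where f: "f \<in> R.K" and vf: "v = R.encode f" by auto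
  have f_l2: "f \<in> l2 \<Omega>" by (rule perp_perp_l2[OF f])
  have inv: "invariant_fun G0 f"
    unfolding invariant_fun_def
  proof
    fix h assume h: "h \<in> G0"
    then have hG: "h \<in> carrier G" and h': "inv h \<in> G0" using G0_sub subgroup.m_inv_closed[OF G0] by auto
    have "R.encode (\<lambda>x. f (T h x)) = R.encode f"
      using v(3)[OF h'] hG f by (simp add: vf R.rep_encode)
    then show "nsq \<Omega> (\<lambda>x. f (T h x) - f x) = 0"
      by (intro R.encode_inj R.K_T f hG)
  qed
  \<comment> \<open>The function \<open>f\<close> is invariant, so every translate of every
    \<open>\<zeta> n\<close> is orthogonal to it, and these inner products are all the coordinates
    of \<open>v\<close>.\<close>
  have "R.encode f = (\<lambda>k. 0)"
    unfolding R.encode_def R.e_def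
    using orth_T[OF f_l2 inv] ip_commute[of \<Omega> f] by (auto intro!: ext)
  then show False using v(2) vf by simp
qed

end

section \<open>Images of sets under a flow\<close>

context mp_flow
begin

lemma T_image_eq:
  assumes "g \<in> carrier G" "A \<subseteq> space \<Omega>"
  shows "T g ` A = T (inv g) -` A \<inter> space \<Omega>"
proof (intro equalityI subsetI)
  fix y assume y: "y \<in> T (inv g) -` A \<inter> space \<Omega>"
  then have "y = T g (T (inv g) y)" using assms by (simp add: T_inv)
  then show "y \<in> T g ` A" using y by blast
qed (use assms in \<open>auto simp: T_inv T_space\<close>)

lemma T_image_sets: "g \<in> carrier G \<Longrightarrow> A \<in> sets \<Omega> \<Longrightarrow> T g ` A \<in> sets \<Omega>"
  using measurable_sets[OF T_meas, of "inv g" A] by (simp add: T_image_eq sets.sets_into_space)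

lemma emeasure_T_vimage:
  assumes "g \<in> carrier G" "A \<in> sets \<Omega>"
  shows "emeasure \<Omega> (T g -` A \<inter> space \<Omega>) = emeasure \<Omega> A"
  using emeasure_distr[OF T_meas assms(2)] T_distr assms(1) by simp

lemma emeasure_T_image:
  assumes "g \<in> carrier G" "A \<in> sets \<Omega>"
  shows "emeasure \<Omega> (T g ` A) = emeasure \<Omega> A"
  using emeasure_T_vimage[of "inv g" A] assms by (simp add: T_image_eq sets.sets_into_space)

lemma T_bij: "g \<in> carrier G \<Longrightarrow> inj_on (T g) (space \<Omega>)"
  by (rule inj_on_inverseI[of _ "T (inv g)"]) (simp add: T_inv)

lemma T_image_mult:
  assumes "g \<in> carrier G" "h \<in> carrier G" "A \<subseteq> space \<Omega>"
  shows "T g ` T h ` A = T (g \<otimes> h) ` A"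
  unfolding image_image by (rule image_cong[OF refl]) (use assms in \<open>auto simp: T_mult\<close>)

lemma flow_subgroup: "subgroup H G \<Longrightarrow> mp_flow (G\<lparr>carrier := H\<rparr>) \<Omega> T"
  using T_meas T_distr T_mult T_one
  by (auto simp: mp_flow_def mp_flow_axioms_def subgroup_imp_group subgroup.mem_carrier)

end

lemma mp_action_flow:
  assumes "mp_action G M a"
  shows "mp_flow G M a"
proof -
  interpret group_action G "space M" a using assms by (simp add: mp_action_def)
  have "group G" using group_hom by (simp add: group_hom_def)
  moreover have "a \<one>\<^bsub>G\<^esub> x = x" if "x \<in> space M" for x
    using id_eq_one that by (metis restrict_apply')
  ultimately show ?thesis
    using assms by (auto simp: mp_flow_def mp_flow_axioms_def mp_action_def measure_preserving_def composition_rule)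
qed

section \<open>Skew products with a countable set\<close>

lemma skew_product_measurable:
  assumes L: "countable L" and \<tau>: "\<tau> \<in> N \<rightarrow>\<^sub>M N"
    and closed: "\<And>x l. x \<in> space N \<Longrightarrow> l \<in> L \<Longrightarrow> \<sigma> x l \<in> L"
    and meas: "\<And>l k. l \<in> L \<Longrightarrow> k \<in> L \<Longrightarrow> {x \<in> space N. \<sigma> x l = k} \<in> sets N"
  shows "(\<lambda>(x, l). (\<tau> x, \<sigma> x l)) \<in> N \<Otimes>\<^sub>M count_space L \<rightarrow>\<^sub>M N \<Otimes>\<^sub>M count_space L"
proof -
  have 1: "(\<lambda>x. \<sigma> (fst x) l) \<in> N \<Otimes>\<^sub>M count_space L \<rightarrow>\<^sub>M count_space L" if l: "l \<in> L" for l
  proof (subst measurable_count_space_eq_countable[OF L], intro conjI ballI)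
    fix k assume k: "k \<in> L"
    have "(\<lambda>x. \<sigma> (fst x) l) -` {k} \<inter> space (N \<Otimes>\<^sub>M count_space L) = {x \<in> space N. \<sigma> x l = k} \<times> L"
      by (auto simp: space_pair_measure)
    also have "\<dots> \<in> sets (N \<Otimes>\<^sub>M count_space L)" using meas[OF l k] by auto
    finally show "(\<lambda>x. \<sigma> (fst x) l) -` {k} \<inter> space (N \<Otimes>\<^sub>M count_space L) \<in> sets (N \<Otimes>\<^sub>M count_space L)" .
  qed (use closed l in \<open>auto simp: space_pair_measure\<close>)
  have "(\<lambda>x. \<sigma> (fst x) (snd x)) \<in> N \<Otimes>\<^sub>M count_space L \<rightarrow>\<^sub>M count_space L"
    by (rule measurable_compose_countable'[OF 1 _ L]) auto
  then show ?thesis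
    using \<tau> by (auto simp: split_beta' intro!: measurable_Pair)
qed

text \<open>Integrate over the fibres first: each \<open>\<sigma> x\<close> permutes the counting
  measure, which reduces the claim to invariance of the base under \<open>\<tau>\<close>.\<close>

lemma skew_product_distr:
  assumes sf: "sigma_finite_measure N" and L: "countable L"
    and \<tau>: "\<tau> \<in> N \<rightarrow>\<^sub>M N" "distr N N \<tau> = N"
    and bij: "\<And>x. x \<in> space N \<Longrightarrow> bij_betw (\<sigma> x) L L"
    and meas: "\<And>l k. l \<in> L \<Longrightarrow> k \<in> L \<Longrightarrow> {x \<in> space N. \<sigma> x l = k} \<in> sets N"
  shows "distr (N \<Otimes>\<^sub>M count_space L) (N \<Otimes>\<^sub>M count_space L) (\<lambda>(x, l). (\<tau> x, \<sigma> x l)) = N \<Otimes>\<^sub>M count_space L"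
    (is "distr ?P ?P ?F = ?P")
proof (rule measure_eqI)
  interpret N: sigma_finite_measure N by (rule sf)
  interpret C: sigma_finite_measure "count_space L" by (rule sigma_finite_measure_count_space_countable[OF L])
  have F: "?F \<in> ?P \<rightarrow>\<^sub>M ?P"
    using bij meas \<tau> L by (intro skew_product_measurable) (auto simp: bij_betw_def)
  fix A assume "A \<in> sets (distr ?P ?P ?F)"
  then have A: "A \<in> sets ?P" by simp
  define h where "h x = (\<integral>\<^sup>+l. indicator A (x, l) \<partial>count_space L)" for x
  have h: "h \<in> borel_measurable N" unfolding h_def using A by measurable
  have "emeasure (distr ?P ?P ?F) A = emeasure ?P (?F -` A \<inter> space ?P)"
    by (rule emeasure_distr[OF F A])
  also have "\<dots> = (\<integral>\<^sup>+x. \<integral>\<^sup>+l. indicator (?F -` A \<inter> space ?P) (x, l) \<partial>count_space L \<partial>N)"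
    by (rule C.emeasure_pair_measure) (rule measurable_sets[OF F A])
  also have "\<dots> = (\<integral>\<^sup>+x. h (\<tau> x) \<partial>N)"
  proof (rule nn_integral_cong)
    fix x assume x: "x \<in> space N"
    have "(\<integral>\<^sup>+l. indicator (?F -` A \<inter> space ?P) (x, l) \<partial>count_space L)
        = (\<integral>\<^sup>+l. indicator A (\<tau> x, \<sigma> x l) \<partial>count_space L)"
      using x by (intro nn_integral_cong) (auto simp: indicator_def space_pair_measure)
    also have "\<dots> = h (\<tau> x)"
      unfolding h_def by (rule nn_integral_bij_count_space[OF bij[OF x]])
    finally show "(\<integral>\<^sup>+l. indicator (?F -` A \<inter> space ?P) (x, l) \<partial>count_space L) = h (\<tau> x)" .
  qed
  also have "\<dots> = (\<integral>\<^sup>+x. h x \<partial>N)"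
    using nn_integral_distr[OF \<tau>(1), of h] h \<tau>(2) by simp
  also have "\<dots> = emeasure ?P A"
    unfolding h_def by (rule C.emeasure_pair_measure[symmetric, OF A])
  finally show "emeasure (distr ?P ?P ?F) A = emeasure ?P A" .
qed simp

section \<open>Profinite actions\<close>

locale profinite = group \<Gamma>
  for \<Gamma> :: "'g monoid" (structure) and \<Gamma>0 :: "'g set"
    and Xs :: "nat \<Rightarrow> 'x measure" and \<alpha>n :: "nat \<Rightarrow> 'g \<Rightarrow> 'x \<Rightarrow> 'x"
    and q :: "nat \<Rightarrow> 'x \<Rightarrow> 'x"
    and M :: "(nat \<Rightarrow> 'x) measure" and \<alpha> :: "'g \<Rightarrow> (nat \<Rightarrow> 'x) \<Rightarrow> nat \<Rightarrow> 'x" +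
  assumes countable_\<Gamma>: "countable (carrier \<Gamma>)"
    and normal: "\<Gamma>0 \<lhd> \<Gamma>"
    and action: "mp_action \<Gamma> M \<alpha>"
    and ergodic0: "ergodic_action (\<Gamma>\<lparr>carrier := \<Gamma>0\<rparr>) M \<alpha>"
    and limit: "is_inverse_limit \<Gamma> Xs \<alpha>n q M \<alpha>"
begin

sublocale A: mp_flow \<Gamma> M \<alpha>
  by (rule mp_action_flow[OF action])

sublocale M: prob_space M
  using action by (simp add: mp_action_def)

abbreviation "card_X n \<equiv> card (space (Xs n))"

definition "cell n a = {x \<in> space M. x n = a}"

lemma \<Gamma>0_subgroup: "subgroup \<Gamma>0 \<Gamma>"
  using normal by (rule normal_imp_subgroup)

lemma \<Gamma>0_carrier: "h \<in> \<Gamma>0 \<Longrightarrow> h \<in> carrier \<Gamma>"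
  using \<Gamma>0_subgroup by (rule subgroup.mem_carrier)

lemma finite_X: "n \<ge> 1 \<Longrightarrow> finite (space (Xs n))"
  and sets_X: "n \<ge> 1 \<Longrightarrow> sets (Xs n) = Pow (space (Xs n))"
  and pos_X: "n \<ge> 1 \<Longrightarrow> a \<in> space (Xs n) \<Longrightarrow> emeasure (Xs n) {a} > 0"
  and action_X: "n \<ge> 1 \<Longrightarrow> mp_action \<Gamma> (Xs n) (\<alpha>n n)"
  using limit by (auto simp: is_inverse_limit_def finite_prob_space_def)

lemma coordinate: "n \<ge> 1 \<Longrightarrow> (\<lambda>x. x n) \<in> M \<rightarrow>\<^sub>M Xs n" "n \<ge> 1 \<Longrightarrow> distr M (Xs n) (\<lambda>x. x n) = Xs n"
  using limit by (auto simp: is_inverse_limit_def measure_preserving_def)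

lemma coordinate_space: "n \<ge> 1 \<Longrightarrow> x \<in> space M \<Longrightarrow> x n \<in> space (Xs n)"
  using coordinate(1) by (auto dest: measurable_space)

lemma sets_M: "sets M = sets (restrict_space (PiM {1..} Xs) (inverse_limit_set Xs q))"
  using limit by (simp add: is_inverse_limit_def)

lemma space_M: "space M = inverse_limit_set Xs q"
  using sets_eq_imp_space_eq[OF sets_M]
  by (auto simp: space_restrict_space space_PiM inverse_limit_set_def)

lemma act_coordinate: "\<lbrakk>n \<ge> 1; g \<in> carrier \<Gamma>; x \<in> space M\<rbrakk> \<Longrightarrow> \<alpha> g x n = \<alpha>n n g (x n)"
  using limit by (simp add: is_inverse_limit_def)

lemma refine:
  assumes "x \<in> space M" "y \<in> space M" "x n = y n" "1 \<le> m" "m \<le> n"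
  shows "x m = y m"
  using assms(5,4,3)
proof (induction rule: inc_induct)
  case (step k)
  then have "x (Suc k) = y (Suc k)" by simp
  then show ?case
    using assms(1,2) step.prems by (metis (mono_tags, lifting) inverse_limit_set_def mem_Collect_eq space_M)
qed

text \<open>The index 0 lies outside the product, where all members of the limit are
  \<open>undefined\<close>.\<close>

lemma M_eqI:
  assumes "x \<in> space M" "y \<in> space M" "\<And>n. n \<ge> 1 \<Longrightarrow> x n = y n"
  shows "x = y"
proof
  fix n show "x n = y n"
    using assms by (cases "n \<ge> 1") (auto simp: space_M inverse_limit_set_def PiE_def extensional_def)
qed

lemma cell_sets [measurable]: "n \<ge> 1 \<Longrightarrow> cell n a \<in> sets M"
proof -
  assume n: "n \<ge> 1"
  have "cell n a = (\<lambda>x. x n) -` ({a} \<inter> space (Xs n)) \<inter> space M"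
    using coordinate_space[OF n] by (auto simp: cell_def)
  also have "\<dots> \<in> sets M"
    by (rule measurable_sets[OF coordinate(1)[OF n]]) (use sets_X[OF n] in auto)
  finally show ?thesis .
qed

lemma cell_subset: "cell n a \<subseteq> space M"
  by (auto simp: cell_def)

lemma measure_cell_pos:
  assumes "n \<ge> 1" "a \<in> space (Xs n)"
  shows "M.prob (cell n a) > 0"
proof -
  have "emeasure M (cell n a) = emeasure (distr M (Xs n) (\<lambda>x. x n)) {a}"
    by (subst emeasure_distr[OF coordinate(1)[OF assms(1)]])
      (use assms sets_X in \<open>auto simp: cell_def intro!: arg_cong[where f = "emeasure M"]\<close>)
  then have "emeasure M (cell n a) > 0" using pos_X assms coordinate(2) by simp
  then show ?thesis by (simp add: M.emeasure_eq_measure)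
qed

lemma Xn_flow: "n \<ge> 1 \<Longrightarrow> mp_flow \<Gamma> (Xs n) (\<alpha>n n)"
  by (intro mp_action_flow action_X)

lemma act_cell:
  assumes "n \<ge> 1" "g \<in> carrier \<Gamma>" "a \<in> space (Xs n)"
  shows "\<alpha> g ` cell n a = cell n (\<alpha>n n g a)"
proof -
  interpret X: mp_flow \<Gamma> "Xs n" "\<alpha>n n" by (rule Xn_flow[OF assms(1)])
  show ?thesis
  proof (intro equalityI subsetI)
    fix y assume "y \<in> cell n (\<alpha>n n g a)"
    then have y: "y \<in> space M" "y n = \<alpha>n n g a" by (auto simp: cell_def)
    have "y = \<alpha> g (\<alpha> (inv g) y)" using y assms by (simp add: A.T_inv)
    moreover have "\<alpha> (inv g) y \<in> cell n a"
      using y assms by (simp add: cell_def A.T_space act_coordinate X.T_inv)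
    ultimately show "y \<in> \<alpha> g ` cell n a" by blast
  qed (use assms in \<open>auto simp: cell_def A.T_space act_coordinate\<close>)
qed

lemma measure_image: "g \<in> carrier \<Gamma> \<Longrightarrow> A \<in> sets M \<Longrightarrow> M.prob (\<alpha> g ` A) = M.prob A"
  using A.emeasure_T_image by (simp add: measure_def)

text \<open>The union of the \<open>\<Gamma>0\<close>-translates of the cell of \<open>a\<close> is
  invariant and not null, so by ergodicity it is conull and meets the cell of
  \<open>b\<close>.\<close>

lemma transitive0:
  assumes n: "n \<ge> 1" and a: "a \<in> space (Xs n)" "b \<in> space (Xs n)"
  obtains h where "h \<in> \<Gamma>0" "\<alpha>n n h a = b"
proof -
  interpret H: subgroup \<Gamma>0 \<Gamma> by (rule \<Gamma>0_subgroup)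
  interpret X: mp_flow \<Gamma> "Xs n" "\<alpha>n n" by (rule Xn_flow[OF n])
  define U where "U = (\<Union>h\<in>\<Gamma>0. \<alpha> h ` cell n a)"
  have cnt: "countable \<Gamma>0" using countable_\<Gamma> H.subset by (rule countable_subset[rotated])
  have U: "U \<in> sets M"
    unfolding U_def using cnt n by (intro sets.countable_UN'' A.T_image_sets cell_sets) (auto dest: \<Gamma>0_carrier)
  have sub: "\<alpha> g ` U \<subseteq> U" if g: "g \<in> \<Gamma>0" for g
  proof -
    have "\<alpha> g ` U = (\<Union>h\<in>\<Gamma>0. \<alpha> (g \<otimes> h) ` cell n a)"
      unfolding U_def image_UN using g by (intro SUP_cong refl A.T_image_mult cell_subset) auto
    then show ?thesis using g by (auto simp: U_def)
  qed
  have inv: "\<alpha> g ` U = U" if g: "g \<in> \<Gamma>0" for g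
  proof
    have "U = \<alpha> g ` \<alpha> (inv g) ` U"
      using g sets.sets_into_space[OF U] by (subst A.T_image_mult) (auto simp: A.T_one image_iff subset_eq)
    then show "U \<subseteq> \<alpha> g ` U" using sub[of "inv g"] g by blast
  qed (rule sub[OF g])
  have "emeasure M U = 0 \<or> emeasure M (space M - U) = 0"
    using ergodic0 U inv by (auto simp: ergodic_action_def)
  moreover have "emeasure M U > 0"
  proof -
    have "cell n a \<subseteq> U"
    proof
      fix x assume x: "x \<in> cell n a"
      then have "\<alpha> \<one> x = x" using cell_subset A.T_one by blast
      then have "x \<in> \<alpha> \<one> ` cell n a" using x by (metis imageI)
      then show "x \<in> U" unfolding U_def using H.one_closed by blast
    qed
    then have "emeasure M (cell n a) \<le> emeasure M U" using U by (rule emeasure_mono)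
    then show ?thesis using measure_cell_pos[OF n a(1)] by (auto simp: M.emeasure_eq_measure)
  qed
  ultimately have null: "emeasure M (space M - U) = 0" by auto
  have "cell n b \<inter> U \<noteq> {}"
  proof
    assume "cell n b \<inter> U = {}"
    then have "cell n b \<subseteq> space M - U" by (auto simp: cell_def)
    then have "emeasure M (cell n b) \<le> emeasure M (space M - U)" using U by (intro emeasure_mono) auto
    then show False using measure_cell_pos[OF n a(2)] null by (simp add: M.emeasure_eq_measure)
  qed
  then obtain h y where "h \<in> \<Gamma>0" "y \<in> cell n b" "y \<in> cell n (\<alpha>n n h a)"
    using act_cell[OF n _ a(1)] \<Gamma>0_carrier by (auto simp: U_def)
  then show thesis using that by (auto simp: cell_def)
qed

lemma X_nonempty: "n \<ge> 1 \<Longrightarrow> space (Xs n) \<noteq> {}"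
  using M.not_empty coordinate_space by fastforce

lemma card_X_pos: "n \<ge> 1 \<Longrightarrow> card_X n > 0"
  using X_nonempty finite_X by (simp add: card_gt_0_iff)

text \<open>By transitivity all cells of level \<open>n\<close> are translates of one another, and
  they partition the space.\<close>

lemma measure_cell:
  assumes n: "n \<ge> 1" and a: "a \<in> space (Xs n)"
  shows "M.prob (cell n a) = 1 / real (card_X n)"
proof -
  have eq: "M.prob (cell n b) = M.prob (cell n a)" if b: "b \<in> space (Xs n)" for b
  proof -
    obtain h where "h \<in> \<Gamma>0" "\<alpha>n n h a = b" using transitive0[OF n a b] .
    then show ?thesis
      using measure_image[of h "cell n a"] act_cell[OF n _ a] \<Gamma>0_carrier n by auto
  qed
  have "1 = M.prob (\<Union>b\<in>space (Xs n). cell n b)"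
  proof -
    have "(\<Union>b\<in>space (Xs n). cell n b) = space M" using coordinate_space[OF n] by (auto simp: cell_def)
    then show ?thesis by (simp add: M.prob_space)
  qed
  also have "\<dots> = (\<Sum>b\<in>space (Xs n). M.prob (cell n b))"
    by (rule M.finite_measure_finite_Union) (use finite_X n cell_sets[OF n] in \<open>auto simp: disjoint_family_on_def, auto simp: cell_def\<close>)
  also have "\<dots> = real (card_X n) * M.prob (cell n a)"
    using eq by simp
  finally show ?thesis using card_X_pos[OF n] by (simp add: field_simps)
qed

text \<open>For subsets of the space this means being a union of cells of level
  \<open>n\<close>.\<close>

definition "saturated n U \<longleftrightarrow> (\<forall>x\<in>space M. \<forall>y\<in>space M. x n = y n \<longrightarrow> (x \<in> U \<longleftrightarrow> y \<in> U))"

lemma saturated_mono: "saturated m U \<Longrightarrow> 1 \<le> m \<Longrightarrow> m \<le> n \<Longrightarrow> saturated n U"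
  unfolding saturated_def using refine by blast

definition "approximable A \<longleftrightarrow> A \<in> sets M \<and>
  (\<forall>e>0. \<exists>n\<ge>1. \<exists>U\<in>sets M. saturated n U \<and> M.prob ((A - U) \<union> (U - A)) < e)"

lemma approximable_finite_Union:
  fixes k :: nat
  assumes "\<And>i. i < k \<Longrightarrow> approximable (A i)" "e > 0"
  shows "\<exists>n\<ge>1. \<exists>U\<in>sets M. saturated n U \<and> M.prob (((\<Union>i<k. A i) - U) \<union> (U - (\<Union>i<k. A i))) < e"
  using assms
proof (induction k arbitrary: e)
  case 0
  then show ?case by (intro exI[of _ 1] conjI bexI[of _ "{}"]) (auto simp: saturated_def)
next
  case (Suc k)
  define B where "B = (\<Union>i<k. A i)"
  have "B \<in> sets M" and Ak: "A k \<in> sets M"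
    using Suc.prems(1) by (auto simp: B_def approximable_def less_Suc_eq intro!: sets.finite_UN)
  note [measurable] = this
  obtain n U where n: "n \<ge> 1" and U[measurable]: "U \<in> sets M" and satU: "saturated n U"
    and lU: "M.prob ((B - U) \<union> (U - B)) < e / 2"
    using Suc.IH[of "e/2"] Suc.prems by (auto simp: B_def)
  obtain m V where m: "m \<ge> 1" and V[measurable]: "V \<in> sets M" and satV: "saturated m V"
    and lV: "M.prob ((A k - V) \<union> (V - A k)) < e / 2"
    using Suc.prems(1)[of k] Suc.prems(2) by (auto simp: approximable_def dest!: spec[of _ "e/2"])
  have "saturated (max m n) (U \<union> V)"
  proof -
    have "saturated (max m n) U" "saturated (max m n) V"
      using saturated_mono[OF satU n] saturated_mono[OF satV m] by simp_all
    then show ?thesis unfolding saturated_def by blast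
  qed
  moreover have "M.prob (((A k \<union> B) - (U \<union> V)) \<union> ((U \<union> V) - (A k \<union> B))) < e"
  proof -
    have "M.prob (((A k \<union> B) - (U \<union> V)) \<union> ((U \<union> V) - (A k \<union> B)))
        \<le> M.prob (((B - U) \<union> (U - B)) \<union> ((A k - V) \<union> (V - A k)))"
      by (intro M.finite_measure_mono) auto
    also have "\<dots> \<le> M.prob ((B - U) \<union> (U - B)) + M.prob ((A k - V) \<union> (V - A k))"
      by (intro measure_Un_le) auto
    finally show ?thesis using lU lV by linarith
  qed
  moreover have "(\<Union>i<Suc k. A i) = A k \<union> B" by (auto simp: B_def less_Suc_eq)
  ultimately show ?case using n U V by (intro exI[of _ "max m n"] conjI bexI[of _ "U \<union> V"]) auto
qed

text \<open>Saturated sets approximating infinitely many \<open>A i\<close> may have no common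
  level. Hence the union is first exhausted up to \<open>e / 2\<close> by a finite one, for which a
  maximal level exists.\<close>

lemma approximable_Union:
  assumes A: "\<And>i::nat. approximable (A i)"
  shows "approximable (\<Union>i. A i)"
  unfolding approximable_def
proof (intro conjI allI impI)
  have [measurable]: "A i \<in> sets M" for i using A by (simp add: approximable_def)
  show "(\<Union>i. A i) \<in> sets M" by auto
  fix e :: real assume e: "e > 0"
  define B where "B k = (\<Union>i<k. A i)" for k
  have [measurable]: "B k \<in> sets M" for k by (auto simp: B_def)
  have "(\<lambda>k. M.prob (B k)) \<longlonglongrightarrow> M.prob (\<Union>k. B k)"
    by (rule M.finite_Lim_measure_incseq) (auto simp: B_def incseq_def intro: less_le_trans)
  moreover have UB: "(\<Union>k. B k) = (\<Union>i. A i)" by (auto simp: B_def)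
  ultimately have "\<forall>\<^sub>F k in sequentially. M.prob (B k) > M.prob (\<Union>i. A i) - e / 2"
    using e by (intro order_tendstoD(1)) auto
  from eventually_happens'[OF sequentially_bot this]
  obtain k where "M.prob (B k) > M.prob (\<Union>i. A i) - e / 2" by blast
  then have k: "M.prob (\<Union>i. A i) - M.prob (B k) < e / 2" by linarith
  have "M.prob ((\<Union>i. A i) - B k) = M.prob (\<Union>i. A i) - M.prob (B k)"
    by (intro M.finite_measure_Diff) (auto simp: B_def)
  with k have k': "M.prob ((\<Union>i. A i) - B k) < e / 2" by simp
  obtain n U where n: "n \<ge> 1" and U[measurable]: "U \<in> sets M" and satU: "saturated n U"
    and lU: "M.prob ((B k - U) \<union> (U - B k)) < e / 2"
    using approximable_finite_Union[of k A "e/2"] A e by (auto simp: B_def)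
  have "M.prob (((\<Union>i. A i) - U) \<union> (U - (\<Union>i. A i))) \<le> M.prob (((\<Union>i. A i) - B k) \<union> ((B k - U) \<union> (U - B k)))"
    by (intro M.finite_measure_mono) (auto simp: B_def)
  also have "\<dots> \<le> M.prob ((\<Union>i. A i) - B k) + M.prob ((B k - U) \<union> (U - B k))"
    by (intro measure_Un_le) auto
  finally have "M.prob (((\<Union>i. A i) - U) \<union> (U - (\<Union>i. A i))) < e" using k' lU by linarith
  then show "\<exists>n\<ge>1. \<exists>U\<in>sets M. saturated n U \<and> M.prob (((\<Union>i. A i) - U) \<union> (U - (\<Union>i. A i))) < e"
    using n U satU by blast
qed

lemma approximable_compl:
  assumes "approximable A"
  shows "approximable (space M - A)"
  unfolding approximable_def
proof (intro conjI allI impI)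
  show "space M - A \<in> sets M" using assms by (auto simp: approximable_def)
  fix e :: real assume "e > 0"
  then obtain n U where n: "n \<ge> 1" "U \<in> sets M" "saturated n U" "M.prob ((A - U) \<union> (U - A)) < e"
    using assms by (auto simp: approximable_def)
  have "A \<subseteq> space M" using assms sets.sets_into_space by (auto simp: approximable_def)
  then have "((space M - A) - (space M - U)) \<union> ((space M - U) - (space M - A)) = (A - U) \<union> (U - A)"
    using sets.sets_into_space[OF n(2)] by auto
  moreover have "saturated n (space M - U)" using n(3) unfolding saturated_def by blast
  moreover have "space M - U \<in> sets M" using n(2) by (rule sets.compl_sets)
  ultimately show "\<exists>n\<ge>1. \<exists>V\<in>sets M. saturated n V \<and> M.prob (((space M - A) - V) \<union> (V - (space M - A))) < e"
    using n(1,4) by metis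
qed

text \<open>The approximable sets form a sigma-algebra for which all coordinates are measurable, and
  the coordinates generate the measurable sets of the limit.\<close>

lemma approximable: "A \<in> sets M \<Longrightarrow> approximable A"
proof -
  define \<A> where "\<A> = {A. approximable A}"
  have sa: "sigma_algebra (space M) \<A>"
    unfolding sigma_algebra_iff2 \<A>_def
  proof (intro conjI ballI allI impI)
    show "{A. approximable A} \<subseteq> Pow (space M)" using sets.sets_into_space by (auto simp: approximable_def)
    have "saturated 1 {}" by (simp add: saturated_def)
    then have "approximable {}" by (auto simp: approximable_def intro!: exI[of _ 1] bexI[of _ "{}"])
    then show "{} \<in> {A. approximable A}" by simp
  next
    fix A :: "nat \<Rightarrow> (nat \<Rightarrow> 'x) set" assume "range A \<subseteq> {A. approximable A}"
    then show "(\<Union>i. A i) \<in> {A. approximable A}" using approximable_Union[of A] by blast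
  qed (auto simp: approximable_compl)
  \<comment> \<open>\<open>N\<close> turns the sigma-algebra into a measure space, so that
    measurability of the identity into the product can be checked on coordinates.\<close>
  define N where "N = measure_of (space M) \<A> (\<lambda>_. 0)"
  have spN: "space N = space M" and seN: "sets N = \<A>"
    unfolding N_def using sa by (auto simp: sigma_algebra.sigma_sets_eq sigma_algebra_iff2)
  have coord: "(\<lambda>x. x n) \<in> N \<rightarrow>\<^sub>M Xs n" if n: "n \<ge> 1" for n
  proof (rule measurableI)
    show "x n \<in> space (Xs n)" if "x \<in> space N" for x
      using that coordinate_space[OF n] by (simp add: spN)
    fix B assume B: "B \<in> sets (Xs n)"
    have "approximable ((\<lambda>x. x n) -` B \<inter> space M)"
      unfolding approximable_def
      using measurable_sets[OF coordinate(1)[OF n] B] n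
      by (auto simp: saturated_def intro!: exI[of _ n] bexI[of _ "(\<lambda>x. x n) -` B \<inter> space M"])
    then show "(\<lambda>x. x n) -` B \<inter> space N \<in> sets N" by (simp add: spN seN \<A>_def)
  qed
  have "(\<lambda>x. x) \<in> N \<rightarrow>\<^sub>M restrict_space (PiM {1..} Xs) (inverse_limit_set Xs q)"
  proof (intro measurable_restrict_space2 measurable_PiM_single')
    show "(\<lambda>x. x) \<in> space N \<rightarrow> inverse_limit_set Xs q" by (simp add: spN space_M)
    show "(\<lambda>x. x) \<in> space N \<rightarrow> (\<Pi>\<^sub>E i\<in>{1..}. space (Xs i))" by (auto simp: spN space_M inverse_limit_set_def)
  qed (use coord in auto)
  moreover assume A: "A \<in> sets M"
  ultimately have "(\<lambda>x. x) -` A \<inter> space N \<in> sets N"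
    by (intro measurable_sets) (auto simp: sets_M)
  moreover have "(\<lambda>x. x) -` A \<inter> space N = A" using sets.sets_into_space[OF A] by (auto simp: spN)
  ultimately show "approximable A" by (simp add: seN \<A>_def)
qed

end

section \<open>Cocycles of profinite actions with values in a countable group\<close>

text \<open>The cocycle identity is required at every point. This makes the skew product below a
  genuine flow rather than an action modulo null sets.\<close>

locale profinite_cocycle = profinite +
  L: group \<Lambda> for \<Lambda> :: "('l, 'k) monoid_scheme" +
  fixes w :: "'a \<Rightarrow> (nat \<Rightarrow> 'b) \<Rightarrow> 'l"
  assumes countable_\<Lambda>: "countable (carrier \<Lambda>)"
    and w_closed: "\<lbrakk>g \<in> carrier \<Gamma>; x \<in> space M\<rbrakk> \<Longrightarrow> w g x \<in> carrier \<Lambda>"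
    and w_mult: "\<lbrakk>g \<in> carrier \<Gamma>; h \<in> carrier \<Gamma>; x \<in> space M\<rbrakk> \<Longrightarrow> w (g \<otimes> h) x = w g (\<alpha> h x) \<otimes>\<^bsub>\<Lambda>\<^esub> w h x"
    and w_sets: "\<lbrakk>g \<in> carrier \<Gamma>; l \<in> carrier \<Lambda>\<rbrakk> \<Longrightarrow> {x \<in> space M. w g x = l} \<in> sets M"
begin

sublocale P: pair_prob_space M M ..

sublocale C: sigma_finite_measure "count_space (carrier \<Lambda>)"
  by (rule sigma_finite_measure_count_space_countable[OF countable_\<Lambda>])

abbreviation "PM \<equiv> M \<Otimes>\<^sub>M M"
abbreviation "\<Omega> \<equiv> PM \<Otimes>\<^sub>M count_space (carrier \<Lambda>)"

lemma w_one: "x \<in> space M \<Longrightarrow> w \<one> x = \<one>\<^bsub>\<Lambda>\<^esub>"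
  using w_mult[of \<one> \<one> x] w_closed[of \<one> x] by (simp add: A.T_one L.l_cancel_one')

lemma w_pair_sets:
  assumes "g \<in> carrier \<Gamma>" "h \<in> carrier \<Gamma>"
  shows "{p \<in> space PM. R (w g (fst p)) (w h (snd p))} \<in> sets PM"
proof -
  have "{p \<in> space PM. R (w g (fst p)) (w h (snd p))}
      = (\<Union>a\<in>carrier \<Lambda>. \<Union>b\<in>{b\<in>carrier \<Lambda>. R a b}. {x \<in> space M. w g x = a} \<times> {x \<in> space M. w h x = b})"
    using assms w_closed by (auto simp: space_pair_measure)
  also have "\<dots> \<in> sets PM"
    using countable_\<Lambda> assms w_sets
    by (intro sets.countable_UN'' pair_measureI) (auto intro: countable_subset)
  finally show ?thesis .
qed

definition pact :: "'a \<Rightarrow> (nat \<Rightarrow> 'b) \<times> (nat \<Rightarrow> 'b) \<Rightarrow> (nat \<Rightarrow> 'b) \<times> (nat \<Rightarrow> 'b)" where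
  "pact g p = (\<alpha> g (fst p), \<alpha> g (snd p))"

definition ptrans :: "'a \<Rightarrow> (nat \<Rightarrow> 'b) \<times> (nat \<Rightarrow> 'b) \<Rightarrow> 'l \<Rightarrow> 'l" where
  "ptrans g p l = w g (fst p) \<otimes>\<^bsub>\<Lambda>\<^esub> l \<otimes>\<^bsub>\<Lambda>\<^esub> inv\<^bsub>\<Lambda>\<^esub> (w g (snd p))"

definition T where
  "T g = (\<lambda>(p, l). (pact g p, ptrans g p l))"

lemma pact_meas: "g \<in> carrier \<Gamma> \<Longrightarrow> pact g \<in> PM \<rightarrow>\<^sub>M PM"
  unfolding pact_def using A.T_meas[of g] by measurable

lemma pact_distr: "g \<in> carrier \<Gamma> \<Longrightarrow> distr PM PM (pact g) = PM"
  using pair_measure_distr[OF A.T_meas A.T_meas, of g g] A.T_distr[of g] M.sigma_finite_measure_axioms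
  by (simp add: pact_def[abs_def] split_beta')

lemma bij_two_sided:
  assumes "a \<in> carrier \<Lambda>" "b \<in> carrier \<Lambda>"
  shows "bij_betw (\<lambda>l. a \<otimes>\<^bsub>\<Lambda>\<^esub> l \<otimes>\<^bsub>\<Lambda>\<^esub> inv\<^bsub>\<Lambda>\<^esub> b) (carrier \<Lambda>) (carrier \<Lambda>)"
proof (rule bij_betwI[where g = "\<lambda>l. inv\<^bsub>\<Lambda>\<^esub> a \<otimes>\<^bsub>\<Lambda>\<^esub> l \<otimes>\<^bsub>\<Lambda>\<^esub> b"])
  fix l assume l: "l \<in> carrier \<Lambda>"
  show "inv\<^bsub>\<Lambda>\<^esub> a \<otimes>\<^bsub>\<Lambda>\<^esub> (a \<otimes>\<^bsub>\<Lambda>\<^esub> l \<otimes>\<^bsub>\<Lambda>\<^esub> inv\<^bsub>\<Lambda>\<^esub> b) \<otimes>\<^bsub>\<Lambda>\<^esub> b = l"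
    using assms l by (simp add: L.m_assoc) (simp add: L.m_assoc[symmetric])
  show "a \<otimes>\<^bsub>\<Lambda>\<^esub> (inv\<^bsub>\<Lambda>\<^esub> a \<otimes>\<^bsub>\<Lambda>\<^esub> l \<otimes>\<^bsub>\<Lambda>\<^esub> b) \<otimes>\<^bsub>\<Lambda>\<^esub> inv\<^bsub>\<Lambda>\<^esub> b = l"
    using assms l by (simp add: L.m_assoc) (simp add: L.m_assoc[symmetric])
qed (use assms in auto)

sublocale F: mp_flow \<Gamma> \<Omega> T
proof
  fix g assume g: "g \<in> carrier \<Gamma>"
  have bij: "bij_betw (ptrans g p) (carrier \<Lambda>) (carrier \<Lambda>)" if "p \<in> space PM" for p
    using bij_two_sided[OF w_closed w_closed, of g "fst p" g "snd p"] that g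
    by (auto simp: ptrans_def[abs_def] space_pair_measure)
  have meas: "{p \<in> space PM. ptrans g p l = k} \<in> sets PM" for l k
    unfolding ptrans_def by (rule w_pair_sets[OF g g])
  show "T g \<in> \<Omega> \<rightarrow>\<^sub>M \<Omega>"
    unfolding T_def using bij meas pact_meas[OF g]
    by (intro skew_product_measurable countable_\<Lambda>) (auto simp: bij_betw_def)
  show "distr \<Omega> \<Omega> (T g) = \<Omega>"
    unfolding T_def
    by (intro skew_product_distr P.sigma_finite_measure_axioms countable_\<Lambda> pact_meas pact_distr bij meas g)
next
  fix g h z assume gh: "g \<in> carrier \<Gamma>" "h \<in> carrier \<Gamma>" and z: "z \<in> space \<Omega>"
  obtain x y l where [simp]: "z = ((x, y), l)" by (metis prod.exhaust)
  have xyl: "x \<in> space M" "y \<in> space M" "l \<in> carrier \<Lambda>" using z by (auto simp: space_pair_measure)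
  have cl: "w h x \<in> carrier \<Lambda>" "w h y \<in> carrier \<Lambda>" "w g (\<alpha> h x) \<in> carrier \<Lambda>" "w g (\<alpha> h y) \<in> carrier \<Lambda>"
    using gh xyl by (auto intro: w_closed A.T_space)
  show "T (g \<otimes> h) z = T g (T h z)"
    using gh xyl cl by (simp add: T_def pact_def ptrans_def A.T_mult w_mult L.inv_mult_group L.m_assoc)
next
  fix z assume z: "z \<in> space \<Omega>"
  then show "T \<one> z = z"
    by (auto simp: T_def pact_def ptrans_def w_one A.T_one space_pair_measure)
qed

definition "diag n = {p \<in> space PM. fst p n = snd p n}"
definition "disagree n g = {p \<in> diag n. w g (fst p) \<noteq> w g (snd p)}"

lemma diag_eq: "n \<ge> 1 \<Longrightarrow> diag n = (\<Union>a\<in>space (Xs n). cell n a \<times> cell n a)"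
  using coordinate_space by (fastforce simp: diag_def cell_def space_pair_measure)

lemma diag_sets: "n \<ge> 1 \<Longrightarrow> diag n \<in> sets PM"
  unfolding diag_eq using finite_X cell_sets by (intro sets.finite_UN pair_measureI) auto

lemma disagree_sets: "n \<ge> 1 \<Longrightarrow> g \<in> carrier \<Gamma> \<Longrightarrow> disagree n g \<in> sets PM"
proof -
  assume n: "n \<ge> 1" and g: "g \<in> carrier \<Gamma>"
  have "disagree n g = diag n \<inter> {p \<in> space PM. w g (fst p) \<noteq> w g (snd p)}"
    by (auto simp: disagree_def diag_def)
  also have "\<dots> \<in> sets PM" by (intro sets.Int diag_sets n w_pair_sets g)
  finally show ?thesis .
qed

lemma prob_Times: "A \<in> sets M \<Longrightarrow> B \<in> sets M \<Longrightarrow> P.prob (A \<times> B) = M.prob A * M.prob B"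
  by (simp add: measure_def M.emeasure_pair_measure_Times enn2real_mult)

lemma prob_slice_Union:
  assumes n: "n \<ge> 1" and E: "E \<in> sets M"
  shows "(\<Sum>a\<in>space (Xs n). M.prob (E \<inter> cell n a)) = M.prob E"
proof -
  have "E = (\<Union>a\<in>space (Xs n). E \<inter> cell n a)"
    using sets.sets_into_space[OF E] coordinate_space[OF n] by (auto simp: cell_def)
  moreover have "M.prob (\<Union>a\<in>space (Xs n). E \<inter> cell n a) = (\<Sum>a\<in>space (Xs n). M.prob (E \<inter> cell n a))"
    by (rule M.finite_measure_finite_Union)
      (use finite_X n E cell_sets[OF n] in \<open>auto simp: disjoint_family_on_def, auto simp: cell_def\<close>)
  ultimately show ?thesis by simp
qed

text \<open>For a fixed first coordinate, the section of \<open>diag n\<close> is one cell, of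
  measure \<open>1 / card_X n\<close>.\<close>

lemma prob_diag_fst:
  assumes n: "n \<ge> 1" and E: "E \<in> sets M"
  shows "P.prob {p \<in> diag n. fst p \<in> E} = M.prob E / card_X n"
proof -
  have "{p \<in> diag n. fst p \<in> E} = (\<Union>a\<in>space (Xs n). (E \<inter> cell n a) \<times> cell n a)"
    by (auto simp: diag_eq[OF n])
  moreover have "P.prob (\<Union>a\<in>space (Xs n). (E \<inter> cell n a) \<times> cell n a)
      = (\<Sum>a\<in>space (Xs n). P.prob ((E \<inter> cell n a) \<times> cell n a))"
    by (rule P.finite_measure_finite_Union)
      (use finite_X n E cell_sets[OF n] in \<open>auto simp: disjoint_family_on_def, auto simp: cell_def\<close>)
  ultimately have "P.prob {p \<in> diag n. fst p \<in> E} = (\<Sum>a\<in>space (Xs n). M.prob (E \<inter> cell n a) / card_X n)"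
    using n E cell_sets[OF n] by (simp add: prob_Times measure_cell)
  then show ?thesis using prob_slice_Union[OF n E] by (simp add: sum_divide_distrib[symmetric])
qed

lemma prob_diag_snd:
  assumes n: "n \<ge> 1" and E: "E \<in> sets M"
  shows "P.prob {p \<in> diag n. snd p \<in> E} = M.prob E / card_X n"
proof -
  have "{p \<in> diag n. snd p \<in> E} = (\<Union>a\<in>space (Xs n). cell n a \<times> (E \<inter> cell n a))"
    by (auto simp: diag_eq[OF n])
  moreover have "P.prob (\<Union>a\<in>space (Xs n). cell n a \<times> (E \<inter> cell n a))
      = (\<Sum>a\<in>space (Xs n). P.prob (cell n a \<times> (E \<inter> cell n a)))"
    by (rule P.finite_measure_finite_Union)
      (use finite_X n E cell_sets[OF n] in \<open>auto simp: disjoint_family_on_def, auto simp: cell_def\<close>)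
  ultimately have "P.prob {p \<in> diag n. snd p \<in> E} = (\<Sum>a\<in>space (Xs n). M.prob (E \<inter> cell n a) / card_X n)"
    using n E cell_sets[OF n] by (simp add: prob_Times measure_cell)
  then show ?thesis using prob_slice_Union[OF n E] by (simp add: sum_divide_distrib[symmetric])
qed

lemma finite_range_approx:
  assumes g: "g \<in> carrier \<Gamma>" and e: "e > 0"
  obtains F where "finite F" "F \<subseteq> carrier \<Lambda>" "M.prob {x \<in> space M. w g x \<notin> F} < e"
proof -
  define F where "F k = from_nat_into (carrier \<Lambda>) ` {..<k::nat}" for k
  have ne: "carrier \<Lambda> \<noteq> {}" using L.one_closed by blast
  have Fsub: "F k \<subseteq> carrier \<Lambda>" for k using from_nat_into[OF ne] by (auto simp: F_def)
  define B where "B k = {x \<in> space M. w g x \<in> F k}" for k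
  have B[measurable]: "B k \<in> sets M" for k
  proof -
    have "(\<Union>l\<in>F k. {x \<in> space M. w g x = l}) \<in> sets M"
      using Fsub[of k] by (intro sets.finite_UN w_sets[OF g]) (auto simp: F_def)
    also have "(\<Union>l\<in>F k. {x \<in> space M. w g x = l}) = B k" by (auto simp: B_def)
    finally show ?thesis .
  qed
  have "(\<lambda>k. M.prob (B k)) \<longlonglongrightarrow> M.prob (\<Union>k. B k)"
    proof (rule M.finite_Lim_measure_incseq)
    show "range B \<subseteq> sets M" using B by blast
  qed (auto simp: B_def F_def incseq_def intro: less_le_trans)
  moreover have "(\<Union>k. B k) = space M"
  proof -
    have "\<exists>k. w g x \<in> F k" if x: "x \<in> space M" for x
    proof -
      obtain i where "from_nat_into (carrier \<Lambda>) i = w g x"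
        using from_nat_into_surj[OF countable_\<Lambda> w_closed[OF g x]] by auto
      then have "w g x \<in> F (Suc i)" unfolding F_def by (metis imageI lessI lessThan_iff)
      then show ?thesis by blast
    qed
    then show ?thesis by (auto simp: B_def)
  qed
  ultimately have "\<forall>\<^sub>F k in sequentially. M.prob (B k) > 1 - e"
    using e by (intro order_tendstoD(1)) (auto simp: M.prob_space)
  from eventually_happens'[OF sequentially_bot this] obtain k where k: "M.prob (B k) > 1 - e" by blast
  have "{x \<in> space M. w g x \<notin> F k} = space M - B k" by (auto simp: B_def)
  then have "M.prob {x \<in> space M. w g x \<notin> F k} < e" using k by (simp add: M.prob_compl)
  then show thesis using that[of "F k"] Fsub by (auto simp: F_def)
qed

text \<open>The factor normalizes \<open>diag n\<close> to total mass 1. Up to small mass,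
  \<open>w g\<close> takes finitely many values \<open>l\<close>, and its level sets
  \<open>A l\<close> are close to saturated sets \<open>U l\<close>. Two points of one cell lie both
  in \<open>U l\<close> or both outside; so if they disagree and the first has the value
  \<open>l\<close>, then it lies in \<open>A l - U l\<close> or the second lies in
  \<open>U l - A l\<close>.\<close>

lemma disagree_small:
  assumes g: "g \<in> carrier \<Gamma>"
  shows "(\<lambda>n. card_X n * P.prob (disagree n g)) \<longlonglongrightarrow> 0"
proof (rule LIMSEQ_I)
  fix r :: real assume r: "r > 0"
  obtain F where F: "finite F" "F \<subseteq> carrier \<Lambda>" and small: "M.prob {x \<in> space M. w g x \<notin> F} < r / 2"
    using finite_range_approx[OF g, of "r/2"] r by auto
  define A where "A l = {x \<in> space M. w g x = l}" for l
  \<comment> \<open>Each value in \<open>F\<close> contributes at most \<open>2 * e\<close>, so all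
    of them together at most \<open>r / 2\<close>; the summand 1 covers an empty
    \<open>F\<close>.\<close>
  define e where "e = r / (4 * (real (card F) + 1))"
  have e: "e > 0" using r by (simp add: e_def)
  have A: "A l \<in> sets M" if "l \<in> F" for l using w_sets[OF g] F that by (auto simp: A_def)
  have "\<exists>n U. n \<ge> 1 \<and> U \<in> sets M \<and> saturated n U \<and> M.prob ((A l - U) \<union> (U - A l)) < e" if "l \<in> F" for l
    using approximable[OF A[OF that]] e unfolding approximable_def by blast
  then obtain k U where k: "\<And>l. l \<in> F \<Longrightarrow> k l \<ge> 1" and U: "\<And>l. l \<in> F \<Longrightarrow> U l \<in> sets M"
    and sat: "\<And>l. l \<in> F \<Longrightarrow> saturated (k l) (U l)"
    and Ue: "\<And>l. l \<in> F \<Longrightarrow> M.prob ((A l - U l) \<union> (U l - A l)) < e"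
    by metis
  \<comment> \<open>Inserting 1 keeps the maximum defined for empty \<open>F\<close> and keeps the
    levels at least 1.\<close>
  define K where "K = Max (insert 1 (k ` F))"
  have bound: "card_X n * P.prob (disagree n g) < r" if nK: "n \<ge> K" for n
  proof -
    have n: "n \<ge> 1" and kn: "\<And>l. l \<in> F \<Longrightarrow> k l \<le> n"
      using nK F(1) by (auto simp: K_def)
    define B where "B = {x \<in> space M. w g x \<notin> F}"
    have B: "B \<in> sets M"
    proof -
      have "B = space M - (\<Union>l\<in>F. A l)" by (auto simp: B_def A_def)
      then show ?thesis using A F by auto
    qed
    define D where "D l = {p \<in> diag n. fst p \<in> A l - U l} \<union> {p \<in> diag n. snd p \<in> U l - A l}" for l
    have s1: "{p \<in> diag n. fst p \<in> E} \<in> sets PM" if "E \<in> sets M" for E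
    proof -
      have "{p \<in> diag n. fst p \<in> E} = diag n \<inter> (E \<times> space M)" by (auto simp: diag_def space_pair_measure)
      then show ?thesis using diag_sets[OF n] that by auto
    qed
    have s2: "{p \<in> diag n. snd p \<in> E} \<in> sets PM" if "E \<in> sets M" for E
    proof -
      have "{p \<in> diag n. snd p \<in> E} = diag n \<inter> (space M \<times> E)" by (auto simp: diag_def space_pair_measure)
      then show ?thesis using diag_sets[OF n] that by auto
    qed
    have D: "D l \<in> sets PM" if "l \<in> F" for l
      unfolding D_def using A U that by (intro sets.Un s1 s2) auto
    have sub: "disagree n g \<subseteq> {p \<in> diag n. fst p \<in> B} \<union> (\<Union>l\<in>F. D l)"
    proof
      fix p assume p: "p \<in> disagree n g"
      obtain x y where [simp]: "p = (x, y)" by (cases p)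
      have xy: "x \<in> space M" "y \<in> space M" "x n = y n" "w g x \<noteq> w g y" and pd: "p \<in> diag n"
        using p by (auto simp: disagree_def diag_def space_pair_measure)
      show "p \<in> {p \<in> diag n. fst p \<in> B} \<union> (\<Union>l\<in>F. D l)"
      proof (cases "w g x \<in> F")
        case True
        let ?l = "w g x"
        have "x \<in> A ?l" "y \<notin> A ?l" using xy by (auto simp: A_def)
        moreover have "x \<in> U ?l \<longleftrightarrow> y \<in> U ?l"
          using saturated_mono[OF sat[OF True] k[OF True] kn[OF True]] xy unfolding saturated_def by blast
        ultimately have "p \<in> D ?l" using pd by (auto simp: D_def)
        then show ?thesis using True by blast
      next
        case False
        then show ?thesis using xy pd by (auto simp: B_def)
      qed
    qed
    have N: "real (card_X n) > 0" using card_X_pos[OF n] by simp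
    have Dl: "card_X n * P.prob (D l) \<le> 2 * e" if l: "l \<in> F" for l
    proof -
      have "P.prob (D l) \<le> P.prob {p \<in> diag n. fst p \<in> A l - U l} + P.prob {p \<in> diag n. snd p \<in> U l - A l}"
        unfolding D_def using A U l by (intro measure_Un_le s1 s2) auto
      also have "\<dots> = (M.prob (A l - U l) + M.prob (U l - A l)) / card_X n"
        unfolding prob_diag_fst[OF n sets.Diff[OF A[OF l] U[OF l]]]
          prob_diag_snd[OF n sets.Diff[OF U[OF l] A[OF l]]] by (simp add: add_divide_distrib)
      finally have "card_X n * P.prob (D l) \<le> M.prob (A l - U l) + M.prob (U l - A l)"
        using N by (simp add: field_simps)
      moreover have "M.prob (A l - U l) \<le> M.prob ((A l - U l) \<union> (U l - A l))"
        "M.prob (U l - A l) \<le> M.prob ((A l - U l) \<union> (U l - A l))"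
        using A U l by (auto intro!: M.finite_measure_mono)
      ultimately show ?thesis using Ue[OF l] by linarith
    qed
    have "P.prob (disagree n g) \<le> P.prob ({p \<in> diag n. fst p \<in> B} \<union> (\<Union>l\<in>F. D l))"
      using sub s1[OF B] D F by (intro P.finite_measure_mono) auto
    also have "\<dots> \<le> P.prob {p \<in> diag n. fst p \<in> B} + P.prob (\<Union>l\<in>F. D l)"
      using s1[OF B] D F by (intro measure_Un_le) auto
    also have "P.prob (\<Union>l\<in>F. D l) \<le> (\<Sum>l\<in>F. P.prob (D l))"
      using D F by (intro P.finite_measure_subadditive_finite) auto
    finally have "P.prob (disagree n g) \<le> M.prob B / card_X n + (\<Sum>l\<in>F. P.prob (D l))"
      by (simp add: prob_diag_fst[OF n B])
    then have "card_X n * P.prob (disagree n g) \<le> card_X n * (M.prob B / card_X n + (\<Sum>l\<in>F. P.prob (D l)))"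
      using N by (intro mult_left_mono) auto
    also have "\<dots> = M.prob B + (\<Sum>l\<in>F. card_X n * P.prob (D l))"
      using N by (simp add: distrib_left sum_distrib_left)
    also have "\<dots> \<le> M.prob B + (\<Sum>l\<in>F. 2 * e)"
      by (intro add_left_mono sum_mono Dl)
    also have "\<dots> < r / 2 + (\<Sum>l\<in>F. 2 * e)" using small by (simp add: B_def)
    also have "\<dots> \<le> r"
    proof -
      have "real (card F) * (2 * e) \<le> (real (card F) + 1) * (2 * e)" using e by simp
      also have "\<dots> = r / 2" unfolding e_def by (simp add: field_simps)
      finally show ?thesis by simp
    qed
    finally show ?thesis .
  qed
  then show "\<exists>no. \<forall>n\<ge>no. norm (card_X n * P.prob (disagree n g) - 0) < r"
    by (intro exI[of _ K]) (auto simp: abs_mult)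
qed

text \<open>Since \<open>diag n\<close> has measure \<open>1 / card_X n\<close>, the factor makes
  these unit vectors.\<close>

definition \<xi> :: "nat \<Rightarrow> ((nat \<Rightarrow> 'b) \<times> (nat \<Rightarrow> 'b)) \<times> 'l \<Rightarrow> complex" where
  "\<xi> n = (\<lambda>z. complex_of_real (sqrt (card_X n)) * indicator (diag n \<times> {\<one>\<^bsub>\<Lambda>\<^esub>}) z)"

lemma slice_sets: "E \<in> sets PM \<Longrightarrow> l \<in> carrier \<Lambda> \<Longrightarrow> E \<times> {l} \<in> sets \<Omega>"
  by (intro pair_measureI) auto

lemma emeasure_slice: "E \<in> sets PM \<Longrightarrow> l \<in> carrier \<Lambda> \<Longrightarrow> emeasure \<Omega> (E \<times> {l}) = emeasure PM E"
  by (subst C.emeasure_pair_measure_Times) auto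

lemma measure_slice: "E \<in> sets PM \<Longrightarrow> l \<in> carrier \<Lambda> \<Longrightarrow> measure \<Omega> (E \<times> {l}) = P.prob E"
  by (simp add: measure_def emeasure_slice)

lemma integrable_slice:
  assumes "E \<in> sets PM" "l \<in> carrier \<Lambda>"
  shows "integrable \<Omega> (indicator (E \<times> {l}) :: _ \<Rightarrow> real)"
  using slice_sets[OF assms] emeasure_slice[OF assms]
  by (intro integrable_real_indicator) (auto simp: less_top[symmetric])

lemma \<xi>_l2: "n \<ge> 1 \<Longrightarrow> \<xi> n \<in> l2 \<Omega>"
proof -
  assume n: "n \<ge> 1"
  note S[measurable] = slice_sets[OF diag_sets[OF n] L.one_closed]
  have "(\<lambda>z. (cmod (complex_of_real (indicator (diag n \<times> {\<one>\<^bsub>\<Lambda>\<^esub>}) z)))\<^sup>2)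
      = (indicator (diag n \<times> {\<one>\<^bsub>\<Lambda>\<^esub>}) :: _ \<Rightarrow> real)"
    by (auto simp: indicator_def)
  then have "(\<lambda>z. complex_of_real (indicator (diag n \<times> {\<one>\<^bsub>\<Lambda>\<^esub>}) z)) \<in> l2 \<Omega>"
    unfolding l2_def using integrable_slice[OF diag_sets[OF n] L.one_closed] by simp
  from l2_scale[OF this, of "complex_of_real (sqrt (card_X n))"] show ?thesis
    by (simp add: \<xi>_def of_real_indicator)
qed

lemma pact_diag_iff:
  assumes "n \<ge> 1" "g \<in> carrier \<Gamma>" "p \<in> space PM"
  shows "pact g p \<in> diag n \<longleftrightarrow> p \<in> diag n"
proof -
  interpret X: mp_flow \<Gamma> "Xs n" "\<alpha>n n" by (rule Xn_flow[OF assms(1)])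
  have "fst p \<in> space M" "snd p \<in> space M" using assms(3) by (auto simp: space_pair_measure)
  then show ?thesis
    using assms X.T_bij[OF assms(2)] coordinate_space[OF assms(1)]
    by (auto simp: diag_def pact_def space_pair_measure A.T_space act_coordinate inj_on_eq_iff)
qed

text \<open>The action sends the fibre coordinate one over \<open>(x, y)\<close> to the quotient of
  \<open>w g x\<close> by \<open>w g y\<close>, which is one again exactly when the two values
  agree.\<close>

lemma \<xi>_product:
  assumes n: "n \<ge> 1" and g: "g \<in> carrier \<Gamma>" and z: "z \<in> space \<Omega>"
  shows "\<xi> n (T g z) * cnj (\<xi> n z)
    = complex_of_real (real (card_X n) * indicator ((diag n - disagree n g) \<times> {\<one>\<^bsub>\<Lambda>\<^esub>}) z)"
proof -
  obtain p l where zz: "z = (p, l)" by (cases z)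
  have p: "p \<in> space PM" using z by (simp add: zz space_pair_measure)
  have cl: "w g (fst p) \<in> carrier \<Lambda>" "w g (snd p) \<in> carrier \<Lambda>"
    using p g by (auto simp: space_pair_measure intro!: w_closed)
  have "w g (fst p) \<otimes>\<^bsub>\<Lambda>\<^esub> inv\<^bsub>\<Lambda>\<^esub> w g (snd p) = \<one>\<^bsub>\<Lambda>\<^esub> \<longleftrightarrow> w g (fst p) = w g (snd p)"
    using cl by (metis L.inv_closed L.inv_equality L.inv_inv L.r_inv)
  moreover have "complex_of_real (sqrt (card_X n)) * complex_of_real (sqrt (card_X n)) = of_nat (card_X n)"
    by (simp flip: of_real_mult)
  ultimately show ?thesis
    using pact_diag_iff[OF n g p] cl
    by (auto simp: zz \<xi>_def T_def ptrans_def disagree_def indicator_def)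
qed

lemma nsq_\<xi>_diff:
  assumes n: "n \<ge> 1" and g: "g \<in> carrier \<Gamma>"
  shows "nsq \<Omega> (\<lambda>z. \<xi> n (T g z) - \<xi> n z) = 2 * (card_X n * P.prob (disagree n g))"
proof -
  have N: "real (card_X n) > 0" using card_X_pos[OF n] by simp
  have d: "P.prob (diag n) = 1 / card_X n"
    using prob_diag_fst[OF n sets.top] by (simp add: diag_def space_pair_measure mem_Times_iff M.prob_space cong: conj_cong)
  have ip: "ip \<Omega> (\<lambda>z. \<xi> n (T h z)) (\<xi> n) = complex_of_real (1 - card_X n * P.prob (disagree n h))"
    if h: "h \<in> carrier \<Gamma>" for h
  proof -
    have E: "diag n - disagree n h \<in> sets PM" using diag_sets[OF n] disagree_sets[OF n h] by auto
    have "ip \<Omega> (\<lambda>z. \<xi> n (T h z)) (\<xi> n)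
        = (\<integral>z. complex_of_real (real (card_X n) * indicator ((diag n - disagree n h) \<times> {\<one>\<^bsub>\<Lambda>\<^esub>}) z) \<partial>\<Omega>)"
      unfolding ip_def by (intro Bochner_Integration.integral_cong refl \<xi>_product n h)
    also have "\<dots> = complex_of_real (card_X n * P.prob (diag n - disagree n h))"
      using slice_sets[OF E L.one_closed]
      by (subst integral_complex_of_real) (simp add: measure_slice[OF E] sets.Int_space_eq2)
    also have "P.prob (diag n - disagree n h) = 1 / card_X n - P.prob (disagree n h)"
      unfolding d[symmetric] using diag_sets[OF n] disagree_sets[OF n h]
      by (intro P.finite_measure_Diff) (auto simp: disagree_def)
    finally show ?thesis using N by (simp add: field_simps)
  qed
  have "ip \<Omega> (\<xi> n) (\<xi> n) = ip \<Omega> (\<lambda>z. \<xi> n (T \<one> z)) (\<xi> n)"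
    by (intro ip_cong) (auto simp: F.T_one)
  also have "\<dots> = 1"
  proof -
    have "disagree n \<one> = {}" by (auto simp: disagree_def diag_def space_pair_measure w_one)
    then show ?thesis using ip[of \<one>] by simp
  qed
  finally have 1: "nsq \<Omega> (\<xi> n) = 1" by (metis Re_complex_of_real ip_self one_complex.sel(1))
  have "nsq \<Omega> (\<lambda>z. \<xi> n (T g z) - \<xi> n z)
      = nsq \<Omega> (\<lambda>z. \<xi> n (T g z)) + nsq \<Omega> (\<xi> n) - 2 * Re (ip \<Omega> (\<lambda>z. \<xi> n (T g z)) (\<xi> n))"
    by (intro nsq_expand F.l2_T g \<xi>_l2 n)
  then show ?thesis using ip[OF g] F.nsq_T[OF g \<xi>_l2[OF n]] 1 by simp
qed

definition "cell_pairs n a = (cell n a \<times> cell n a) \<times> carrier \<Lambda>"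

lemma cell_pairs_sets: "n \<ge> 1 \<Longrightarrow> cell_pairs n a \<in> sets \<Omega>"
  unfolding cell_pairs_def by (intro pair_measureI cell_sets) auto

definition local :: "nat \<Rightarrow> 'b \<Rightarrow> (((nat \<Rightarrow> 'b) \<times> (nat \<Rightarrow> 'b)) \<times> 'l \<Rightarrow> complex)
    \<Rightarrow> ((nat \<Rightarrow> 'b) \<times> (nat \<Rightarrow> 'b)) \<times> 'l \<Rightarrow> complex" where
  "local n a f = (\<lambda>z. indicator (cell_pairs n a) z * f z)"

lemma local_l2:
  assumes "n \<ge> 1" "f \<in> l2 \<Omega>"
  shows "local n a f \<in> l2 \<Omega>"
  by (rule l2_bounded[OF _ assms(2)])
    (use l2_measurable[OF assms(2)] cell_pairs_sets[OF assms(1)] in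
      \<open>auto simp: local_def indicator_def norm_mult intro!: borel_measurable_times borel_measurable_indicator\<close>)

lemma nsq_local_le: "n \<ge> 1 \<Longrightarrow> f \<in> l2 \<Omega> \<Longrightarrow> nsq \<Omega> (local n a f) \<le> nsq \<Omega> f"
  unfolding nsq_def
  by (intro integral_mono l2_integrable local_l2) (auto simp: local_def indicator_def)

text \<open>The sets \<open>cell_pairs n a\<close> are disjoint for different \<open>a\<close>: the
  first coordinate determines the cell.\<close>

lemma sum_nsq_local:
  assumes n: "n \<ge> 1" and f: "f \<in> l2 \<Omega>"
  shows "(\<Sum>a\<in>space (Xs n). nsq \<Omega> (local n a f)) \<le> nsq \<Omega> f"
proof -
  have "(\<Sum>a\<in>space (Xs n). nsq \<Omega> (local n a f)) = (\<integral>z. (\<Sum>a\<in>space (Xs n). (cmod (local n a f z))\<^sup>2) \<partial>\<Omega>)"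
    unfolding nsq_def using local_l2[OF n f]
    by (subst Bochner_Integration.integral_sum) (auto intro: l2_integrable)
  also have "\<dots> \<le> nsq \<Omega> f"
    unfolding nsq_def
  proof (intro integral_mono Bochner_Integration.integrable_sum l2_integrable local_l2 n f)
    fix z assume "z \<in> space \<Omega>"
    obtain x y l where z: "z = ((x, y), l)" by (metis prod.exhaust)
    have "(\<Sum>a\<in>space (Xs n). (cmod (local n a f z))\<^sup>2)
        = (\<Sum>a\<in>space (Xs n). if a = x n then (cmod (local n a f z))\<^sup>2 else 0)"
      by (intro sum.cong) (auto simp: local_def cell_pairs_def cell_def z)
    also have "\<dots> \<le> (cmod (f z))\<^sup>2"
      using finite_X[OF n] by (auto simp: sum.delta local_def indicator_def)
    finally show "(\<Sum>a\<in>space (Xs n). (cmod (local n a f z))\<^sup>2) \<le> (cmod (f z))\<^sup>2" .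
  qed
  finally show ?thesis .
qed

lemma T_cell_pairs_iff:
  assumes n: "n \<ge> 1" and g: "g \<in> carrier \<Gamma>" "\<alpha>n n g a = a" and a: "a \<in> space (Xs n)" and z: "z \<in> space \<Omega>"
  shows "T g z \<in> cell_pairs n a \<longleftrightarrow> z \<in> cell_pairs n a"
proof -
  interpret X: mp_flow \<Gamma> "Xs n" "\<alpha>n n" by (rule Xn_flow[OF n])
  obtain x y l where zz: "z = ((x, y), l)" by (metis prod.exhaust)
  have xyl: "x \<in> space M" "y \<in> space M" "l \<in> carrier \<Lambda>" using z by (auto simp: zz space_pair_measure)
  have *: "\<alpha> g u \<in> cell n a \<longleftrightarrow> u \<in> cell n a" if "u \<in> space M" for u
    using that n g a X.T_bij[OF g(1)] coordinate_space[OF n that]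
    by (simp add: cell_def A.T_space act_coordinate) (metis inj_on_eq_iff)
  show ?thesis
    using *[OF xyl(1)] *[OF xyl(2)] xyl g w_closed
    by (simp add: zz cell_pairs_def T_def pact_def ptrans_def)
qed

text \<open>A group element fixing \<open>a\<close> maps the cut-off set to itself, so cutting off
  commutes with the translation.\<close>

lemma local_T:
  assumes n: "n \<ge> 1" and g: "g \<in> carrier \<Gamma>" "\<alpha>n n g a = a" and a: "a \<in> space (Xs n)" and f: "f \<in> l2 \<Omega>"
  shows "nsq \<Omega> (local n a (\<lambda>z. f (T g z))) = nsq \<Omega> (local n a f)"
proof -
  have "nsq \<Omega> (local n a (\<lambda>z. f (T g z))) = nsq \<Omega> (\<lambda>z. local n a f (T g z))"
    by (intro nsq_cong) (simp add: local_def indicator_def T_cell_pairs_iff[OF n g a])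
  also have "\<dots> = nsq \<Omega> (local n a f)" by (rule F.nsq_T[OF g(1) local_l2[OF n f]])
  finally show ?thesis .
qed

lemma nsq_local_diff_le:
  assumes n: "n \<ge> 1" and f: "f \<in> l2 \<Omega>" "g \<in> l2 \<Omega>" "h \<in> l2 \<Omega>"
  shows "nsq \<Omega> (local n a (\<lambda>z. f z - h z))
    \<le> 2 * nsq \<Omega> (local n a (\<lambda>z. f z - g z)) + 2 * nsq \<Omega> (local n a (\<lambda>z. g z - h z))"
proof -
  have "nsq \<Omega> (local n a (\<lambda>z. f z - h z))
      = nsq \<Omega> (\<lambda>z. local n a (\<lambda>z. f z - g z) z + local n a (\<lambda>z. g z - h z) z)"
    by (intro nsq_cong) (simp add: local_def algebra_simps)
  also have "\<dots> \<le> 2 * nsq \<Omega> (local n a (\<lambda>z. f z - g z)) + 2 * nsq \<Omega> (local n a (\<lambda>z. g z - h z))"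
    by (intro nsq_add_le local_l2 n l2_diff f)
  finally show ?thesis .
qed

text \<open>Over a disagreeing pair, in the slice of fibre coordinate one, the translate of
  \<open>\<xi> n\<close> vanishes while \<open>\<xi> n\<close> has absolute square
  \<open>card_X n\<close>.\<close>

lemma disagree_le_nsq_local:
  assumes n: "n \<ge> 1" and g: "g \<in> carrier \<Gamma>"
  shows "card_X n * P.prob (disagree n g \<inter> (cell n a \<times> cell n a)) \<le> nsq \<Omega> (local n a (\<lambda>z. \<xi> n (T g z) - \<xi> n z))"
proof -
  define E where "E = disagree n g \<inter> (cell n a \<times> cell n a)"
  have E: "E \<in> sets PM" unfolding E_def by (intro sets.Int disagree_sets n g pair_measureI cell_sets)
  have "card_X n * P.prob E = (\<integral>z. real (card_X n) * indicator (E \<times> {\<one>\<^bsub>\<Lambda>\<^esub>}) z \<partial>\<Omega>)"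
    using slice_sets[OF E L.one_closed] by (simp add: measure_slice[OF E] sets.Int_space_eq2)
  also have "\<dots> \<le> nsq \<Omega> (local n a (\<lambda>z. \<xi> n (T g z) - \<xi> n z))"
    unfolding nsq_def
  proof (intro integral_mono l2_integrable local_l2 n l2_diff \<xi>_l2 F.l2_T g integrable_mult_right)
    show "integrable \<Omega> (indicator (E \<times> {\<one>\<^bsub>\<Lambda>\<^esub>}) :: _ \<Rightarrow> real)" by (rule integrable_slice[OF E L.one_closed])
    fix z assume z: "z \<in> space \<Omega>"
    show "real (card_X n) * indicator (E \<times> {\<one>\<^bsub>\<Lambda>\<^esub>}) z \<le> (cmod (local n a (\<lambda>z. \<xi> n (T g z) - \<xi> n z) z))\<^sup>2"
    proof (cases "z \<in> E \<times> {\<one>\<^bsub>\<Lambda>\<^esub>}")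
      case True
      then obtain p where zz: "z = (p, \<one>\<^bsub>\<Lambda>\<^esub>)" and p: "p \<in> E" by auto
      have pd: "p \<in> disagree n g" "z \<in> cell_pairs n a" using p by (auto simp: E_def cell_pairs_def zz)
      have "\<xi> n z = complex_of_real (sqrt (card_X n))"
        using pd by (simp add: \<xi>_def zz disagree_def)
      moreover have "\<xi> n (T g z) = 0"
      proof -
        have "\<xi> n (T g z) * cnj (\<xi> n z) = 0" using \<xi>_product[OF n g z] pd by (simp add: zz)
        then show ?thesis using calculation card_X_pos[OF n] by simp
      qed
      ultimately show ?thesis using True pd by (simp add: local_def)
    qed simp
  qed
  finally show ?thesis by (simp add: E_def)
qed

text \<open>Relative property (T) provides a \<open>\<Gamma>0\<close>-invariant \<open>\<eta>\<close> close to \<open>\<xi> n\<close>; by averaging over the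
  cells there is one on which \<open>\<eta>\<close> and its translates by \<open>S\<close> are all close to \<open>\<xi> n\<close>.\<close>

lemma cocycle_almost_constant:
  assumes relT: "relative_property_T \<Gamma> \<Gamma>0" and S: "finite S" "S \<subseteq> carrier \<Gamma>" and \<kappa>: "\<kappa> > 0"
  obtains n a where "n \<ge> 1" "a \<in> space (Xs n)"
    "\<And>h s. \<lbrakk>h \<in> \<Gamma>0; s \<in> insert \<one> S; \<alpha>n n (h \<otimes> s) a = a\<rbrakk> \<Longrightarrow>
       P.prob (disagree n (h \<otimes> s) \<inter> (cell n a \<times> cell n a)) \<le> \<kappa> / (card_X n)\<^sup>2"
proof -
  define S' where "S' = insert \<one> S"
  have S': "finite S'" "S' \<subseteq> carrier \<Gamma>" "\<one> \<in> S'" using S by (auto simp: S'_def)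
  define k where "k = real (card S')"
  have k: "k > 0" using S' by (auto simp: k_def card_gt_0_iff)
  \<comment> \<open>Each of the \<open>k\<close> translates of \<open>\<eta>\<close> is within
    \<open>4 * d\<close> of \<open>\<xi> n\<close>, hence within \<open>4 * d * k / N\<close> on the
    chosen cell. The chain of three comparisons at the end weighs this by 4 and 2, which gives
    \<open>24 * d * k / N = \<kappa> / N\<close>.\<close>
  define d where "d = \<kappa> / (24 * k)"
  have d: "d > 0" using \<kappa> k by (simp add: d_def)
  \<comment> \<open>Levels start at 1, hence the shift by \<open>Suc\<close>.\<close>
  have lim: "(\<lambda>n. nsq \<Omega> (\<lambda>z. \<xi> (Suc n) (T g z) - \<xi> (Suc n) z)) \<longlonglongrightarrow> 0" if "g \<in> carrier \<Gamma>" for g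
    using tendsto_mult[OF tendsto_const[of 2] LIMSEQ_Suc[OF disagree_small[OF that]]] that
    by (simp add: nsq_\<xi>_diff)
  have "\<forall>\<^sub>F n in sequentially. \<forall>s\<in>S'. nsq \<Omega> (\<lambda>z. \<xi> (Suc n) (T s z) - \<xi> (Suc n) z) < d"
    using S' d by (intro eventually_ball_finite ballI order_tendstoD(2)[OF lim]) auto
  then obtain m where m: "\<And>n s. n \<ge> m \<Longrightarrow> s \<in> S' \<Longrightarrow> nsq \<Omega> (\<lambda>z. \<xi> (Suc n) (T s z) - \<xi> (Suc n) z) < d"
    by (auto simp: eventually_sequentially)
  obtain n' \<eta> where n': "n' \<ge> m" and \<eta>: "\<eta> \<in> l2 \<Omega>" and inv: "F.invariant_fun \<Gamma>0 \<eta>"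
    and near: "nsq \<Omega> (\<lambda>z. \<eta> z - \<xi> (Suc n') z) < d"
    using F.relative_property_T_near_invariant[OF relT normal countable_\<Gamma> \<xi>_l2 lim d, of m] by auto
  define n where "n = Suc n'"
  have n: "n \<ge> 1" by (simp add: n_def)
  define N where "N = real (card_X n)"
  have N: "N > 0" using card_X_pos[OF n] by (simp add: N_def)
  define D where "D s = (\<lambda>z. \<eta> (T s z) - \<xi> n z)" for s
  have D_l2: "D s \<in> l2 \<Omega>" if "s \<in> carrier \<Gamma>" for s
    unfolding D_def by (intro l2_diff F.l2_T that \<eta> \<xi>_l2 n)
  have D_small: "nsq \<Omega> (D s) \<le> 4 * d" if s: "s \<in> S'" for s
  proof -
    have sG: "s \<in> carrier \<Gamma>" using s S' by auto
    have "nsq \<Omega> (D s) \<le> 2 * nsq \<Omega> (\<lambda>z. \<eta> (T s z) - \<xi> n (T s z)) + 2 * nsq \<Omega> (\<lambda>z. \<xi> n (T s z) - \<xi> n z)"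
      unfolding D_def by (intro nsq_diff_le F.l2_T sG \<eta> \<xi>_l2 n)
    also have "nsq \<Omega> (\<lambda>z. \<eta> (T s z) - \<xi> n (T s z)) = nsq \<Omega> (\<lambda>z. \<eta> z - \<xi> n z)"
      by (rule F.nsq_T_diff[OF sG \<eta> \<xi>_l2[OF n]])
    also have "2 * nsq \<Omega> (\<lambda>z. \<eta> z - \<xi> n z) + 2 * nsq \<Omega> (\<lambda>z. \<xi> n (T s z) - \<xi> n z) \<le> 2 * d + 2 * d"
      using near m[OF n' s] by (intro add_mono mult_left_mono) (auto simp: n_def)
    finally show ?thesis by simp
  qed
  define Q where "Q a = (\<Sum>s\<in>S'. nsq \<Omega> (local n a (D s)))" for a
  have "\<exists>a\<in>space (Xs n). Q a \<le> 4 * d * k / N"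
  proof (rule ccontr)
    assume "\<not> ?thesis"
    then have "(\<Sum>a\<in>space (Xs n). 4 * d * k / N) < (\<Sum>a\<in>space (Xs n). Q a)"
      using finite_X[OF n] X_nonempty[OF n] by (intro sum_strict_mono) auto
    also have "\<dots> = (\<Sum>s\<in>S'. \<Sum>a\<in>space (Xs n). nsq \<Omega> (local n a (D s)))"
      unfolding Q_def by (rule sum.swap)
    also have "\<dots> \<le> (\<Sum>s\<in>S'. nsq \<Omega> (D s))"
      using S' by (intro sum_mono sum_nsq_local n D_l2) auto
    also have "\<dots> \<le> (\<Sum>s\<in>S'. 4 * d)" by (intro sum_mono D_small)
    finally show False using N by (simp add: N_def k_def)
  qed
  then obtain a where a: "a \<in> space (Xs n)" and Qa: "Q a \<le> 4 * d * k / N" by blast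
  have Da: "nsq \<Omega> (local n a (D s)) \<le> 4 * d * k / N" if "s \<in> S'" for s
    using member_le_sum[of s S' "\<lambda>s. nsq \<Omega> (local n a (D s))"] that S' Qa by (simp add: Q_def)
  show thesis
  proof (rule that[OF n a])
    fix h s assume h: "h \<in> \<Gamma>0" and s: "s \<in> insert \<one> S" and fix_a: "\<alpha>n n (h \<otimes> s) a = a"
    have sS: "s \<in> S'" using s by (simp add: S'_def)
    have hG: "h \<in> carrier \<Gamma>" and sG: "s \<in> carrier \<Gamma>" using h \<Gamma>0_carrier sS S' by auto
    define g where "g = h \<otimes> s"
    have gG: "g \<in> carrier \<Gamma>" using hG sG by (simp add: g_def)
    note l2s = F.l2_T[OF gG \<xi>_l2[OF n]] F.l2_T[OF gG \<eta>] F.l2_T[OF sG \<eta>] \<xi>_l2[OF n]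
    \<comment> \<open>Compare \<open>\<xi> n\<close> after \<open>T g\<close> with
      \<open>\<eta>\<close> after \<open>T g\<close>, then with \<open>\<eta>\<close> after
      \<open>T s\<close>, then with \<open>\<xi> n\<close>. The first error is that at the identity
      because \<open>g\<close> preserves the cell, the second is 0 by invariance under
      \<open>h\<close>, and the third depends on \<open>s\<close> alone. So the bound is uniform in
      \<open>h\<close>.\<close>
    have e1: "nsq \<Omega> (local n a (\<lambda>z. \<xi> n (T g z) - \<eta> (T g z))) \<le> 4 * d * k / N"
    proof -
      have "nsq \<Omega> (local n a (\<lambda>z. \<xi> n (T g z) - \<eta> (T g z))) = nsq \<Omega> (local n a (\<lambda>z. \<xi> n z - \<eta> z))"
        using local_T[OF n gG _ a l2_diff[OF \<xi>_l2[OF n] \<eta>]] fix_a by (simp add: g_def)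
      also have "\<dots> = nsq \<Omega> (local n a (D \<one>))"
        unfolding nsq_def local_def D_def
        by (intro Bochner_Integration.integral_cong) (auto simp: F.T_one norm_mult norm_minus_commute)
      finally show ?thesis using Da[OF S'(3)] by simp
    qed
    have e2: "nsq \<Omega> (local n a (\<lambda>z. \<eta> (T g z) - \<eta> (T s z))) = 0"
    proof -
      have "nsq \<Omega> (local n a (\<lambda>z. \<eta> (T g z) - \<eta> (T s z))) \<le> nsq \<Omega> (\<lambda>z. \<eta> (T g z) - \<eta> (T s z))"
        by (intro nsq_local_le n l2_diff l2s)
      also have "\<dots> = nsq \<Omega> (\<lambda>z. \<eta> (T h (T s z)) - \<eta> (T s z))"
        by (intro nsq_cong) (simp add: g_def F.T_mult hG sG)
      also have "\<dots> = nsq \<Omega> (\<lambda>z. \<eta> (T h z) - \<eta> z)"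
        by (rule F.nsq_T_diff[OF sG F.l2_T[OF hG \<eta>] \<eta>])
      also have "\<dots> = 0" using inv h by (simp add: F.invariant_fun_def)
      finally show ?thesis by (intro antisym) auto
    qed
    have "N * P.prob (disagree n g \<inter> (cell n a \<times> cell n a)) \<le> nsq \<Omega> (local n a (\<lambda>z. \<xi> n (T g z) - \<xi> n z))"
      unfolding N_def by (rule disagree_le_nsq_local[OF n gG])
    also have "\<dots> \<le> 2 * nsq \<Omega> (local n a (\<lambda>z. \<xi> n (T g z) - \<eta> (T s z))) + 2 * nsq \<Omega> (local n a (D s))"
      unfolding D_def by (intro nsq_local_diff_le n l2s)
    also have "nsq \<Omega> (local n a (\<lambda>z. \<xi> n (T g z) - \<eta> (T s z)))
        \<le> 2 * nsq \<Omega> (local n a (\<lambda>z. \<xi> n (T g z) - \<eta> (T g z))) + 2 * nsq \<Omega> (local n a (\<lambda>z. \<eta> (T g z) - \<eta> (T s z)))"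
      by (intro nsq_local_diff_le n l2s)
    also have "2 * (2 * nsq \<Omega> (local n a (\<lambda>z. \<xi> n (T g z) - \<eta> (T g z))) + 2 * nsq \<Omega> (local n a (\<lambda>z. \<eta> (T g z) - \<eta> (T s z))))
        + 2 * nsq \<Omega> (local n a (D s)) \<le> 2 * (2 * (4 * d * k / N) + 2 * 0) + 2 * (4 * d * k / N)"
      unfolding e2 by (intro add_mono mult_left_mono e1 Da sS) auto
    also have "\<dots> = \<kappa> / N" using k by (simp add: d_def field_simps)
    finally have "P.prob (disagree n g \<inter> (cell n a \<times> cell n a)) \<le> \<kappa> / N\<^sup>2"
      using N by (simp add: field_simps power2_eq_square)
    then show "P.prob (disagree n (h \<otimes> s) \<inter> (cell n a \<times> cell n a)) \<le> \<kappa> / (card_X n)\<^sup>2"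
      by (simp add: g_def N_def)
  qed
qed

end

text \<open>Preimages of the generators serve as \<open>S\<close>: a subgroup that contains
  \<open>N\<close> and a representative of a coset contains the coset. In this form finite
  generation can be tested on products of \<open>N\<close> with another subgroup.\<close>

lemma (in group) finitely_generated_quotient:
  assumes N: "N \<lhd> G" and fg: "finitely_generated_group (G Mod N)"
  obtains S where "finite S" "S \<subseteq> carrier G"
    "\<And>K. \<lbrakk>subgroup K G; N \<subseteq> K; S \<subseteq> K\<rbrakk> \<Longrightarrow> K = carrier G"
proof -
  interpret N: normal N G by (rule N)
  obtain S0 where S0: "finite S0" "S0 \<subseteq> carrier (G Mod N)" and gen: "generate (G Mod N) S0 = carrier (G Mod N)"
    using fg by (auto simp: finitely_generated_group_def)
  have "\<forall>c\<in>S0. \<exists>s\<in>carrier G. c = N #> s" using S0(2) by (auto simp: carrier_FactGroup)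
  then obtain r where r: "\<And>c. c \<in> S0 \<Longrightarrow> r c \<in> carrier G \<and> c = N #> r c" by metis
  show thesis
  proof (rule that[of "r ` S0"])
    fix K assume K: "subgroup K G" "N \<subseteq> K" "r ` S0 \<subseteq> K"
    interpret K: subgroup K G by (rule K(1))
    have S0K: "c \<subseteq> K" if "c \<in> S0" for c
      using r[OF that] that K by (force simp: r_coset_def)
    have *: "c \<subseteq> K" if "c \<in> generate (G Mod N) S0" for c
      using that
    proof induction
      case one
      then show ?case using K(2) by simp
    next
      case (incl c)
      then show ?case by (rule S0K)
    next
      case (inv c)
      then have "inv\<^bsub>G Mod N\<^esub> c = set_inv c" using S0(2) by (intro N.inv_FactGroup) auto
      then show ?case using S0K[OF inv] by (auto simp: SET_INV_def)
    next
      case (eng c d)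
      then show ?case by (auto simp: set_mult_def)
    qed
    have "g \<in> K" if g: "g \<in> carrier G" for g
    proof -
      have "N #> g \<in> generate (G Mod N) S0" using g by (simp add: gen carrier_FactGroup)
      then have "N #> g \<subseteq> K" by (rule *)
      then show ?thesis using rcos_self[OF g N.subgroup_axioms] by blast
    qed
    then show "K = carrier G" using K.subset by blast
  qed (use S0 r in auto)
qed

section \<open>Invariant parts of conull sets\<close>

context mp_flow
begin

text \<open>The points whose whole orbit stays in \<open>A\<close>. For a countable group, an
  invariant \<open>C\<close> and \<open>A\<close> conull in \<open>C\<close>, this is an invariant
  set conull in \<open>C\<close>; on it, properties that hold almost everywhere can be used at every
  point of an orbit.\<close>

definition "core C A = {x \<in> C. \<forall>g\<in>carrier G. T g x \<in> A}"

lemma core_sets: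
  assumes "countable (carrier G)" "C \<in> sets \<Omega>" "A \<in> sets \<Omega>"
  shows "core C A \<in> sets \<Omega>"
proof -
  have "core C A = C \<inter> (\<Inter>g\<in>carrier G. T g -` A \<inter> space \<Omega>)"
    using sets.sets_into_space[OF assms(2)] by (auto simp: core_def)
  also have "\<dots> \<in> sets \<Omega>"
    using assms one_closed measurable_sets[OF T_meas assms(3)]
    by (intro sets.Int sets.countable_INT') blast+
  finally show ?thesis .
qed

lemma core_null:
  assumes "countable (carrier G)" "C \<in> sets \<Omega>" "A \<in> sets \<Omega>" "C - A \<in> null_sets \<Omega>"
    and inv: "\<And>g x. g \<in> carrier G \<Longrightarrow> x \<in> C \<Longrightarrow> T g x \<in> C"
  shows "C - core C A \<in> null_sets \<Omega>"
proof (rule null_sets_subset)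
  have CA: "C - A \<in> sets \<Omega>" using assms by auto
  have "T g -` (C - A) \<inter> space \<Omega> \<in> null_sets \<Omega>" if "g \<in> carrier G" for g
    using emeasure_T_vimage[OF that CA] measurable_sets[OF T_meas[OF that] CA] assms(4)
    by (simp add: null_sets_def)
  then show "(\<Union>g\<in>carrier G. T g -` (C - A) \<inter> space \<Omega>) \<in> null_sets \<Omega>"
    using assms(1) by (intro null_sets_UN') auto
  show "C - core C A \<in> sets \<Omega>" using core_sets[OF assms(1-3)] assms(2) by auto
  show "C - core C A \<subseteq> (\<Union>g\<in>carrier G. T g -` (C - A) \<inter> space \<Omega>)"
    using sets.sets_into_space[OF assms(2)] inv by (auto simp: core_def)
qed

lemma core_invariant:
  assumes "x \<in> core C A" "C \<subseteq> space \<Omega>" "h \<in> carrier G" "\<And>g x. g \<in> carrier G \<Longrightarrow> x \<in> C \<Longrightarrow> T g x \<in> C"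
  shows "T h x \<in> core C A"
proof -
  have "T g (T h x) = T (g \<otimes> h) x" if "g \<in> carrier G" for g
    using that assms by (subst T_mult) (auto simp: core_def)
  then show ?thesis using assms by (auto simp: core_def)
qed

lemma core_subset: "C \<subseteq> space \<Omega> \<Longrightarrow> core C A \<subseteq> A"
  by (auto simp: core_def) (metis T_one one_closed subsetD)

lemma orbit_union_invariant:
  assumes H: "subgroup H G" and E: "E \<subseteq> space \<Omega>" and g: "g \<in> H"
  shows "T g ` (\<Union>h\<in>H. T h ` E) = (\<Union>h\<in>H. T h ` E)"
proof -
  interpret H: subgroup H G by (rule H)
  define U where "U = (\<Union>h\<in>H. T h ` E)"
  have US: "U \<subseteq> space \<Omega>" using E by (auto simp: U_def T_space)
  have sub: "T k ` U \<subseteq> U" if k: "k \<in> H" for k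
  proof -
    have "T k ` U = (\<Union>h\<in>H. T (k \<otimes> h) ` E)"
      unfolding U_def image_UN using k by (intro SUP_cong refl T_image_mult E) auto
    then show ?thesis using k by (auto simp: U_def)
  qed
  have "U \<subseteq> T g ` U"
  proof
    fix x assume x: "x \<in> U"
    then have "T (inv g) x \<in> U" using sub[of "inv g"] g by auto
    moreover have "x = T g (T (inv g) x)" using x US g by (simp add: T_inv subset_eq)
    ultimately show "x \<in> T g ` U" by blast
  qed
  then show ?thesis using sub[OF g] by (simp add: U_def)
qed

end

section \<open>Stabilizers of cells and ergodicity on a cell\<close>

context profinite
begin

definition "stab n a = {g \<in> carrier \<Gamma>. \<alpha>n n g a = a}"

lemma stab_subgroup:
  assumes "n \<ge> 1" "a \<in> space (Xs n)"
  shows "subgroup (stab n a) \<Gamma>"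
proof -
  interpret X: mp_flow \<Gamma> "Xs n" "\<alpha>n n" by (rule Xn_flow[OF assms(1)])
  show ?thesis
  proof (rule subgroupI)
    show "stab n a \<noteq> {}" using X.T_one[OF assms(2)] by (auto simp: stab_def)
    show "inv g \<in> stab n a" if "g \<in> stab n a" for g
      using that X.T_inv(2)[of g a] assms(2) by (auto simp: stab_def)
  qed (use assms in \<open>auto simp: stab_def X.T_mult\<close>)
qed

lemma stab_cell: "\<lbrakk>n \<ge> 1; g \<in> stab n a; x \<in> cell n a\<rbrakk> \<Longrightarrow> \<alpha> g x \<in> cell n a"
  by (auto simp: stab_def cell_def A.T_space act_coordinate)

lemma stab_cellI: "\<lbrakk>n \<ge> 1; g \<in> carrier \<Gamma>; x \<in> cell n a; \<alpha> g x \<in> cell n a\<rbrakk> \<Longrightarrow> g \<in> stab n a"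
  by (auto simp: stab_def cell_def act_coordinate)

text \<open>An element of \<open>\<Gamma>0\<close> that moves a point of the cell into the cell
  stabilizes it. Hence the union of all \<open>\<Gamma>0\<close>-translates of \<open>E\<close>
  meets the cell in \<open>E\<close> alone, and ergodicity applies to that union.\<close>

lemma ergodic_cell:
  assumes n: "n \<ge> 1" and E: "E \<in> sets M" "E \<subseteq> cell n a"
    and inv: "\<And>h x. \<lbrakk>h \<in> \<Gamma>0; h \<in> stab n a; x \<in> E\<rbrakk> \<Longrightarrow> \<alpha> h x \<in> E"
  shows "M.prob E = 0 \<or> M.prob (cell n a - E) = 0"
proof -
  define U where "U = (\<Union>h\<in>\<Gamma>0. \<alpha> h ` E)"
  have cnt: "countable \<Gamma>0" using countable_\<Gamma> subgroup.subset[OF \<Gamma>0_subgroup] by (rule countable_subset[rotated])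
  have U: "U \<in> sets M"
    unfolding U_def using cnt E by (intro sets.countable_UN'' A.T_image_sets) (auto dest: \<Gamma>0_carrier)
  have "\<alpha> g ` U = U" if "g \<in> \<Gamma>0" for g
    unfolding U_def using that sets.sets_into_space[OF E(1)] by (intro A.orbit_union_invariant \<Gamma>0_subgroup)
  then have "emeasure M U = 0 \<or> emeasure M (space M - U) = 0"
    using ergodic0 U by (auto simp: ergodic_action_def)
  then have d: "M.prob U = 0 \<or> M.prob (space M - U) = 0" by (auto simp: measure_def)
  have "E \<subseteq> U"
  proof
    fix x assume x: "x \<in> E"
    then have "x = \<alpha> \<one> x" using sets.sets_into_space[OF E(1)] by (auto simp: A.T_one)
    then have "x \<in> \<alpha> \<one> ` E" using x by blast
    then show "x \<in> U" unfolding U_def using subgroup.one_closed[OF \<Gamma>0_subgroup] by blast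
  qed
  then have 1: "M.prob E \<le> M.prob U" using U by (rule M.finite_measure_mono)
  have "cell n a \<inter> U \<subseteq> E"
    using E(2) inv stab_cellI[OF n] \<Gamma>0_carrier by (auto simp: U_def)
  then have "cell n a - E \<subseteq> space M - U" using cell_subset by auto
  then have "M.prob (cell n a - E) \<le> M.prob (space M - U)" using U by (intro M.finite_measure_mono) auto
  then show ?thesis using d 1 by (metis measure_le_0_iff)
qed

lemma exists_in_cell:
  assumes n: "n \<ge> 1" and a: "a \<in> space (Xs n)" and A: "A \<in> sets M" "M.prob A < 1 / card_X n"
  obtains x where "x \<in> cell n a" "x \<notin> A"
proof -
  have "\<not> cell n a \<subseteq> A"
    using M.finite_measure_mono[OF _ A(1), of "cell n a"] A(2) measure_cell[OF n a] by auto
  then show thesis using that by blast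
qed

end

section \<open>From nearly constant values to a homomorphism\<close>

context profinite_cocycle
begin

lemma w_cell_sets:
  assumes "n \<ge> 1" "g \<in> carrier \<Gamma>" "l \<in> carrier \<Lambda>"
  shows "{x \<in> cell n a. w g x \<noteq> l} \<in> sets M" "{x \<in> cell n a. w g x = l} \<in> sets M"
proof -
  have "{x \<in> cell n a. w g x \<noteq> l} = cell n a - {x \<in> space M. w g x = l}"
    "{x \<in> cell n a. w g x = l} = cell n a \<inter> {x \<in> space M. w g x = l}"
    by (auto simp: cell_def)
  then show "{x \<in> cell n a. w g x \<noteq> l} \<in> sets M" "{x \<in> cell n a. w g x = l} \<in> sets M"
    using cell_sets[OF assms(1)] w_sets[OF assms(2,3)] by auto
qed

lemma disagree_cell:
  "disagree n g \<inter> (cell n a \<times> cell n a) = {p. fst p \<in> cell n a \<and> snd p \<in> cell n a \<and> w g (fst p) \<noteq> w g (snd p)}"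
proof (intro equalityI subsetI)
  fix p assume "p \<in> {p. fst p \<in> cell n a \<and> snd p \<in> cell n a \<and> w g (fst p) \<noteq> w g (snd p)}"
  then show "p \<in> disagree n g \<inter> (cell n a \<times> cell n a)"
    by (simp add: cell_def disagree_def diag_def space_pair_measure mem_Times_iff)
qed (simp add: disagree_def mem_Times_iff)

text \<open>The section of the disagreement set at \<open>x\<close> is the exceptional set for the
  value \<open>l = w g x\<close>. If all of them were larger than
  \<open>2 * \<kappa> / card_X n\<close>, integrating over the cell would exceed the hypothesis by a
  factor 2.\<close>

lemma nearly_constant:
  assumes n: "n \<ge> 1" and a: "a \<in> space (Xs n)" and g: "g \<in> carrier \<Gamma>" and \<kappa>: "\<kappa> > 0"
    and le: "P.prob (disagree n g \<inter> (cell n a \<times> cell n a)) \<le> \<kappa> / (card_X n)\<^sup>2"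
  shows "\<exists>l\<in>carrier \<Lambda>. M.prob {x \<in> cell n a. w g x \<noteq> l} \<le> 2 * \<kappa> / card_X n"
proof (rule ccontr)
  assume "\<not> ?thesis"
  then have big: "M.prob {x \<in> cell n a. w g x \<noteq> l} > 2 * \<kappa> / card_X n" if "l \<in> carrier \<Lambda>" for l
    using that by force
  define N where "N = real (card_X n)"
  have N: "N > 0" using card_X_pos[OF n] by (simp add: N_def)
  define E where "E = disagree n g \<inter> (cell n a \<times> cell n a)"
  have E: "E \<in> sets PM" unfolding E_def by (intro sets.Int disagree_sets n g pair_measureI cell_sets)
  have "ennreal (2 * \<kappa> / N) * emeasure M (cell n a) = (\<integral>\<^sup>+x. ennreal (2 * \<kappa> / N) * indicator (cell n a) x \<partial>M)"
    using cell_sets[OF n] by (simp add: nn_integral_cmult_indicator)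
  also have "\<dots> \<le> (\<integral>\<^sup>+x. emeasure M (Pair x -` E) \<partial>M)"
  proof (rule nn_integral_mono)
    fix x assume x: "x \<in> space M"
    show "ennreal (2 * \<kappa> / N) * indicator (cell n a) x \<le> emeasure M (Pair x -` E)"
    proof (cases "x \<in> cell n a")
      case True
      have "Pair x -` E = {y \<in> cell n a. w g y \<noteq> w g x}"
        using True unfolding E_def disagree_cell by auto
      then show ?thesis
        using big[OF w_closed[OF g x]] True by (simp add: M.emeasure_eq_measure N_def ennreal_leI)
    qed simp
  qed
  also have "\<dots> = emeasure PM E" by (rule M.emeasure_pair_measure_alt[symmetric, OF E])
  also have "\<dots> \<le> ennreal (\<kappa> / N\<^sup>2)" using le by (simp add: E_def P.emeasure_eq_measure N_def ennreal_leI)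
  finally have "ennreal (2 * \<kappa> / N) * ennreal (1 / N) \<le> ennreal (\<kappa> / N\<^sup>2)"
    using measure_cell[OF n a] by (simp add: M.emeasure_eq_measure N_def)
  then have "2 * \<kappa> / N * (1 / N) \<le> \<kappa> / N\<^sup>2"
    using \<kappa> N by (simp flip: ennreal_mult)
  then show False using \<kappa> N by (simp add: field_simps power2_eq_square)
qed

text \<open>A cocycle that is uniformly close to a homomorphism on a cell is cohomologous to it: the
  orbit of the indicator function of \<open>cell n a \<times> {1}\<close> under the skew product action twisted by the
  homomorphism stays close to it, hence there is an invariant function close to it.\<close>

lemma cohomologous_on_cell:
  assumes n: "n \<ge> 1" and a: "a \<in> space (Xs n)" and \<beta>: "\<beta> > 0" "16 * \<beta> < 1 / card_X n"
    and near: "\<And>h. h \<in> \<Gamma>0 \<inter> stab n a \<Longrightarrow> \<exists>l\<in>carrier \<Lambda>. M.prob {x \<in> cell n a. w h x \<noteq> l} \<le> \<beta>"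
  obtains \<delta> \<psi> V where "V \<in> sets M" "V \<subseteq> cell n a" "cell n a - V \<in> null_sets M"
    "\<And>h. h \<in> \<Gamma>0 \<inter> stab n a \<Longrightarrow> \<delta> h \<in> carrier \<Lambda>"
    "\<And>x. x \<in> V \<Longrightarrow> \<psi> x \<in> carrier \<Lambda>"
    "\<And>l. l \<in> carrier \<Lambda> \<Longrightarrow> {x \<in> V. \<psi> x = l} \<in> sets M"
    "M.prob {x \<in> V. \<psi> x \<noteq> \<one>\<^bsub>\<Lambda>\<^esub>} \<le> 8 * \<beta>"
    "\<And>h x. h \<in> \<Gamma>0 \<inter> stab n a \<Longrightarrow> x \<in> V \<Longrightarrow> \<alpha> h x \<in> V"
    "\<And>h x. h \<in> \<Gamma>0 \<inter> stab n a \<Longrightarrow> x \<in> V \<Longrightarrow> w h x \<otimes>\<^bsub>\<Lambda>\<^esub> \<psi> x = \<psi> (\<alpha> h x) \<otimes>\<^bsub>\<Lambda>\<^esub> \<delta> h"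
proof -
  define C where "C = cell n a"
  define c where "c = 1 / real (card_X n)"
  define H where "H = \<Gamma>0 \<inter> stab n a"
  have C[measurable]: "C \<in> sets M" using n by (simp add: C_def)
  have CM: "C \<subseteq> space M" by (simp add: C_def cell_subset)
  have pC: "M.prob C = c" using measure_cell[OF n a] by (simp add: C_def c_def)
  have c: "c > 0" using card_X_pos[OF n] by (simp add: c_def)
  have H: "subgroup H \<Gamma>" unfolding H_def by (intro subgroups_Inter_pair \<Gamma>0_subgroup stab_subgroup n a)
  interpret H: subgroup H \<Gamma> by (rule H)
  have HC: "\<alpha> h x \<in> C" if "h \<in> H" "x \<in> C" for h x
    using that stab_cell[OF n] by (auto simp: H_def C_def)
  have cntH: "countable H" using countable_\<Gamma> H.subset by (rule countable_subset[rotated])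
  obtain \<delta> where \<delta>: "\<And>h. h \<in> H \<Longrightarrow> \<delta> h \<in> carrier \<Lambda>"
    and \<delta>_near: "\<And>h. h \<in> H \<Longrightarrow> M.prob {x \<in> C. w h x \<noteq> \<delta> h} \<le> \<beta>"
    using near unfolding H_def C_def by metis
  have bad: "{x \<in> C. w h x \<noteq> \<delta> h} \<in> sets M" if "h \<in> H" for h
    unfolding C_def by (rule w_cell_sets[OF n]) (use that \<delta> in auto)
  \<comment> \<open>The three exceptional sets, each of measure at most \<open>\<beta>\<close>, do
    not cover the cell. At a remaining point the cocycle identity becomes the identity for
    \<open>\<delta>\<close>.\<close>
  have \<delta>_mult: "\<delta> (h \<otimes> k) = \<delta> h \<otimes>\<^bsub>\<Lambda>\<^esub> \<delta> k" if hk: "h \<in> H" "k \<in> H" for h k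
  proof -
    define B where "B = {x \<in> C. w h x \<noteq> \<delta> h}"
    define B' where "B' = \<alpha> k -` B \<inter> space M"
    have B: "B \<in> sets M" using bad[OF hk(1)] by (simp add: B_def)
    have B'm: "B' \<in> sets M" unfolding B'_def using hk by (intro measurable_sets[OF A.T_meas B]) auto
    have B': "M.prob B' \<le> \<beta>"
      using A.emeasure_T_vimage[OF _ B, of k] hk \<delta>_near[OF hk(1)] by (simp add: B'_def B_def measure_def)
    have hk': "h \<otimes> k \<in> H" using hk by simp
    have "M.prob (B' \<union> ({x \<in> C. w k x \<noteq> \<delta> k} \<union> {x \<in> C. w (h \<otimes> k) x \<noteq> \<delta> (h \<otimes> k)}))
        \<le> M.prob B' + M.prob ({x \<in> C. w k x \<noteq> \<delta> k} \<union> {x \<in> C. w (h \<otimes> k) x \<noteq> \<delta> (h \<otimes> k)})"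
      using bad hk hk' B'm by (intro measure_Un_le sets.Un) auto
    also have "M.prob ({x \<in> C. w k x \<noteq> \<delta> k} \<union> {x \<in> C. w (h \<otimes> k) x \<noteq> \<delta> (h \<otimes> k)})
        \<le> M.prob {x \<in> C. w k x \<noteq> \<delta> k} + M.prob {x \<in> C. w (h \<otimes> k) x \<noteq> \<delta> (h \<otimes> k)}"
      using bad hk hk' by (intro measure_Un_le) auto
    finally have "M.prob (B' \<union> ({x \<in> C. w k x \<noteq> \<delta> k} \<union> {x \<in> C. w (h \<otimes> k) x \<noteq> \<delta> (h \<otimes> k)})) < 1 / card_X n"
      using B' \<delta>_near[OF hk(2)] \<delta>_near[OF hk'] \<beta> by linarith
    then obtain x where x: "x \<in> C" "x \<notin> B'" "w k x = \<delta> k" "w (h \<otimes> k) x = \<delta> (h \<otimes> k)"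
      using exists_in_cell[OF n a, of "B' \<union> ({x \<in> C. w k x \<noteq> \<delta> k} \<union> {x \<in> C. w (h \<otimes> k) x \<noteq> \<delta> (h \<otimes> k)})"]
        bad hk hk' B'm unfolding C_def by auto
    have "w h (\<alpha> k x) = \<delta> h" using x(1,2) HC[OF hk(2) x(1)] CM by (auto simp: B'_def B_def)
    then show ?thesis using w_mult[of h k x] x hk CM by auto
  qed
  have \<delta>_one: "\<delta> \<one> = \<one>\<^bsub>\<Lambda>\<^esub>"
    using \<delta>_mult[of \<one> \<one>] \<delta>[of \<one>] by (simp add: L.l_cancel_one')
  define \<Omega>2 where "\<Omega>2 = M \<Otimes>\<^sub>M count_space (carrier \<Lambda>)"
  \<comment> \<open>Multiplying by the inverse of \<open>\<delta> h\<close> on the right makes the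
    slice over \<open>C\<close> of fibre coordinate one almost invariant;
    \<open>\<delta>_mult\<close> makes this an action.\<close>
  define \<sigma> where "\<sigma> h x l = w h x \<otimes>\<^bsub>\<Lambda>\<^esub> l \<otimes>\<^bsub>\<Lambda>\<^esub> inv\<^bsub>\<Lambda>\<^esub> (\<delta> h)" for h x l
  define S where "S h = (\<lambda>(x, l). (\<alpha> h x, \<sigma> h x l))" for h
  let ?HG = "\<Gamma>\<lparr>carrier := H\<rparr>"
  have \<sigma>_bij: "bij_betw (\<sigma> h x) (carrier \<Lambda>) (carrier \<Lambda>)" if "h \<in> H" "x \<in> space M" for h x
    unfolding \<sigma>_def[abs_def] using that \<delta> by (intro bij_two_sided w_closed) auto
  have \<sigma>_sets: "{x \<in> space M. \<sigma> h x l = k} \<in> sets M" if "h \<in> H" "l \<in> carrier \<Lambda>" "k \<in> carrier \<Lambda>" for h l k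
  proof -
    have "{x \<in> space M. \<sigma> h x l = k} = (\<Union>m\<in>{m \<in> carrier \<Lambda>. m \<otimes>\<^bsub>\<Lambda>\<^esub> l \<otimes>\<^bsub>\<Lambda>\<^esub> inv\<^bsub>\<Lambda>\<^esub> (\<delta> h) = k}. {x \<in> space M. w h x = m})"
      using w_closed that by (auto simp: \<sigma>_def)
    also have "\<dots> \<in> sets M"
      using countable_\<Lambda> that by (intro sets.countable_UN'' w_sets) (auto intro: countable_subset)
    finally show ?thesis .
  qed
  interpret S: mp_flow ?HG \<Omega>2 S
  proof (unfold mp_flow_def mp_flow_axioms_def, intro conjI allI impI)
    show "group ?HG" by (rule subgroup_imp_group[OF H])
    fix h assume "h \<in> carrier ?HG"
    then have h: "h \<in> H" "h \<in> carrier \<Gamma>" by auto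
    show "S h \<in> \<Omega>2 \<rightarrow>\<^sub>M \<Omega>2"
      unfolding S_def \<Omega>2_def using \<sigma>_bij h \<sigma>_sets
      by (intro skew_product_measurable countable_\<Lambda> A.T_meas) (auto simp: bij_betw_def)
    show "distr \<Omega>2 \<Omega>2 (S h) = \<Omega>2"
      unfolding S_def \<Omega>2_def using h
      by (intro skew_product_distr M.sigma_finite_measure_axioms countable_\<Lambda> A.T_meas A.T_distr \<sigma>_bij \<sigma>_sets)
  next
    fix h k z assume hk: "h \<in> carrier ?HG" "k \<in> carrier ?HG" and z: "z \<in> space \<Omega>2"
    obtain x l where zz: "z = (x, l)" by (cases z)
    have "x \<in> space M" "l \<in> carrier \<Lambda>" using z by (auto simp: zz \<Omega>2_def space_pair_measure)
    then show "S (h \<otimes>\<^bsub>?HG\<^esub> k) z = S h (S k z)"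
      using hk \<delta> w_closed A.T_space
      by (simp add: zz S_def \<sigma>_def A.T_mult w_mult \<delta>_mult L.inv_mult_group L.m_assoc)
  next
    fix z assume "z \<in> space \<Omega>2"
    then show "S \<one>\<^bsub>?HG\<^esub> z = z"
      by (auto simp: S_def \<sigma>_def w_one A.T_one \<delta>_one \<Omega>2_def space_pair_measure)
  qed
  define \<upsilon> where "\<upsilon> = (\<lambda>z. complex_of_real (indicator (C \<times> {\<one>\<^bsub>\<Lambda>\<^esub>}) z))"
  have slice: "E \<times> {l} \<in> sets \<Omega>2" "emeasure \<Omega>2 (E \<times> {l}) = emeasure M E"
    if "E \<in> sets M" "l \<in> carrier \<Lambda>" for E l
    unfolding \<Omega>2_def using that by (auto simp: C.emeasure_pair_measure_Times intro!: pair_measureI)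
  have int_slice: "integrable \<Omega>2 (indicator (E \<times> {l}) :: _ \<Rightarrow> real)" "(\<integral>z. indicator (E \<times> {l}) z \<partial>\<Omega>2) = M.prob E"
    if "E \<in> sets M" "l \<in> carrier \<Lambda>" for E l
    using slice[OF that]
    by (auto intro!: integrable_real_indicator simp: less_top[symmetric] sets.Int_space_eq2 measure_def)
  have \<upsilon>_sq: "(\<lambda>z. (cmod (\<upsilon> z))\<^sup>2) = indicator (C \<times> {\<one>\<^bsub>\<Lambda>\<^esub>})" by (auto simp: \<upsilon>_def indicator_def)
  have \<upsilon>: "\<upsilon> \<in> l2 \<Omega>2"
  proof -
    have "\<upsilon> \<in> borel_measurable \<Omega>2" unfolding \<upsilon>_def using slice(1)[OF C L.one_closed] by simp
    moreover have "integrable \<Omega>2 (\<lambda>z. (cmod (\<upsilon> z))\<^sup>2)" unfolding \<upsilon>_sq by (rule int_slice(1)[OF C L.one_closed])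
    ultimately show ?thesis by (simp add: l2_def)
  qed
  have nsq_\<upsilon>: "nsq \<Omega>2 \<upsilon> = c"
    unfolding nsq_def \<upsilon>_sq using int_slice[OF C L.one_closed] pC by simp
  \<comment> \<open>The slice and its translate overlap exactly where
    \<open>w h x = \<delta> h\<close>, so the squared distance is twice the measure of the
    exceptional set.\<close>
  have move: "nsq \<Omega>2 (\<lambda>z. \<upsilon> (S h z) - \<upsilon> z) \<le> 2 * \<beta>" if "h \<in> carrier ?HG" for h
  proof -
    have h: "h \<in> H" "h \<in> carrier \<Gamma>" using that by auto
    define E where "E = {x \<in> C. w h x = \<delta> h}"
    have E: "E \<in> sets M" unfolding E_def C_def by (rule w_cell_sets[OF n]) (use h \<delta> in auto)
    have "ip \<Omega>2 (\<lambda>z. \<upsilon> (S h z)) \<upsilon> = (\<integral>z. complex_of_real (indicator (E \<times> {\<one>\<^bsub>\<Lambda>\<^esub>}) z) \<partial>\<Omega>2)"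
      unfolding ip_def
    proof (rule Bochner_Integration.integral_cong[OF refl])
      fix z assume z: "z \<in> space \<Omega>2"
      obtain x l where zz: "z = (x, l)" by (cases z)
      have x: "x \<in> space M" using z by (auto simp: zz \<Omega>2_def space_pair_measure)
      have "w h x \<otimes>\<^bsub>\<Lambda>\<^esub> inv\<^bsub>\<Lambda>\<^esub> \<delta> h = \<one>\<^bsub>\<Lambda>\<^esub> \<longleftrightarrow> w h x = \<delta> h"
        using w_closed[OF h(2) x] \<delta>[OF h(1)] by (metis L.inv_closed L.inv_equality L.inv_inv L.r_inv)
      then show "\<upsilon> (S h z) * cnj (\<upsilon> z) = complex_of_real (indicator (E \<times> {\<one>\<^bsub>\<Lambda>\<^esub>}) z)"
        using HC[OF h(1)] w_closed[OF h(2) x]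
        by (auto simp: zz \<upsilon>_def S_def \<sigma>_def E_def indicator_def)
    qed
    also have "\<dots> = complex_of_real (M.prob E)"
      using int_slice[OF E L.one_closed] by (subst integral_complex_of_real) simp
    finally have ip: "Re (ip \<Omega>2 (\<lambda>z. \<upsilon> (S h z)) \<upsilon>) = M.prob E" by simp
    have "C - E = {x \<in> C. w h x \<noteq> \<delta> h}" by (auto simp: E_def)
    then have "M.prob C - M.prob E \<le> \<beta>"
      using M.finite_measure_Diff[OF C E] \<delta>_near[OF h(1)] by (auto simp: E_def)
    then show ?thesis
      using nsq_expand[OF S.l2_T[OF that \<upsilon>] \<upsilon>] S.nsq_T[OF that \<upsilon>] nsq_\<upsilon> ip pC by simp
  qed
  obtain \<eta> where \<eta>: "\<eta> \<in> l2 \<Omega>2" and inv: "S.invariant_fun H \<eta>" and close: "nsq \<Omega>2 (\<lambda>z. \<eta> z - \<upsilon> z) \<le> 2 * \<beta>"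
  proof (rule S.invariant_projection[OF S.subgroup_self \<upsilon>])
    fix \<eta> assume "\<eta> \<in> l2 \<Omega>2" "S.invariant_fun (carrier ?HG) \<eta>"
      "\<And>r. (\<And>h. h \<in> carrier ?HG \<Longrightarrow> nsq \<Omega>2 (\<lambda>z. \<upsilon> (S h z) - \<upsilon> z) \<le> r) \<Longrightarrow> nsq \<Omega>2 (\<lambda>z. \<eta> z - \<upsilon> z) \<le> r"
    then show thesis using that[of \<eta>] move by simp
  qed
  note [measurable] = l2_measurable[OF \<eta>] l2_measurable[OF \<upsilon>]
  interpret MC: pair_sigma_finite M "count_space (carrier \<Lambda>)" ..
  have AE1: "AE x in M. \<forall>l\<in>carrier \<Lambda>. \<eta> (S h (x, l)) = \<eta> (x, l)" if h: "h \<in> H" for h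
  proof -
    have "AE z in \<Omega>2. \<eta> (S h z) - \<eta> z = 0"
      using inv h nsq_eq_0_iff[OF l2_diff[OF S.l2_T[OF _ \<eta>] \<eta>], of h] by (auto simp: S.invariant_fun_def)
    then have "AE x in M. AE l in count_space (carrier \<Lambda>). \<eta> (S h (x, l)) - \<eta> (x, l) = 0"
      unfolding \<Omega>2_def by (rule MC.AE_pair)
    then show ?thesis by (simp add: AE_count_space)
  qed
  have "AE x in M. \<forall>h\<in>H. \<forall>l\<in>carrier \<Lambda>. \<eta> (S h (x, l)) = \<eta> (x, l)"
    using AE1 cntH by (simp add: AE_ball_countable)
  then obtain Z where Z: "{x \<in> space M. \<not> (\<forall>h\<in>H. \<forall>l\<in>carrier \<Lambda>. \<eta> (S h (x, l)) = \<eta> (x, l))} \<subseteq> Z"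
    "Z \<in> null_sets M"
    by (rule AE_E) (auto simp: null_sets_def)
  have Z_inv: "\<eta> (S h (x, l)) = \<eta> (x, l)" if "x \<in> space M - Z" "h \<in> H" "l \<in> carrier \<Lambda>" for x h l
    using Z(1) that by blast
  note Z = Z(2)
  interpret AH: mp_flow ?HG M \<alpha> by (rule A.flow_subgroup[OF H])
  \<comment> \<open>Discarding the null set \<open>Z\<close> along whole orbits makes
    \<open>\<eta>\<close> invariant at every point over \<open>G\<close>.\<close>
  define G where "G = AH.core C (space M - Z)"
  have cntH': "countable (carrier ?HG)" using cntH by simp
  have Zs: "space M - Z \<in> sets M" using Z by auto
  have G[measurable]: "G \<in> sets M" unfolding G_def by (rule AH.core_sets[OF cntH' C Zs])
  have "C - (space M - Z) \<in> null_sets M"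
  proof (rule null_sets_subset[OF Z])
    show "C - (space M - Z) \<in> sets M" using C Z by auto
  qed (use CM in auto)
  then have CG: "C - G \<in> null_sets M"
    unfolding G_def using HC by (intro AH.core_null cntH' C Zs) auto
  have G_inv: "\<alpha> h x \<in> G" if "h \<in> H" "x \<in> G" for h x
    using AH.core_invariant[OF that(2)[unfolded G_def] CM, of h] that HC by (simp add: G_def)
  have GC: "G \<subseteq> C" by (auto simp: G_def AH.core_def)
  have GZ: "G \<subseteq> space M - Z" unfolding G_def by (rule AH.core_subset[OF CM])
  \<comment> \<open>Where \<open>\<eta>\<close> is within 1/2 of the indicator on a fibre, one is
    the only coordinate in \<open>R x\<close>. Invariance of \<open>\<eta>\<close> carries
    \<open>R x\<close> bijectively to \<open>R (\<alpha> h x)\<close>, so the unique coordinate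
    \<open>\<psi> x\<close> is moved by \<open>\<sigma>\<close>; this is the asserted cohomology
    relation.\<close>
  define R where "R x = {l \<in> carrier \<Lambda>. cmod (\<eta> (x, l) - 1) < 1 / 2}" for x
  define V where "V = {x \<in> G. \<exists>!l. l \<in> R x}"
  define \<psi> where "\<psi> x = (THE l. l \<in> R x)" for x
  have \<psi>R: "\<psi> x \<in> R x" and \<psi>_eq: "\<And>l. l \<in> R x \<Longrightarrow> \<psi> x = l" if "x \<in> V" for x
    using that theI'[of "\<lambda>l. l \<in> R x"] by (auto simp: V_def \<psi>_def)
  have \<psi>_closed: "\<psi> x \<in> carrier \<Lambda>" if "x \<in> V" for x using \<psi>R[OF that] by (simp add: R_def)
  have R_sets: "{x \<in> space M. l \<in> R x} \<in> sets M" if "l \<in> carrier \<Lambda>" for l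
  proof -
    have "(\<lambda>x. (x, l)) \<in> M \<rightarrow>\<^sub>M \<Omega>2"
      unfolding \<Omega>2_def using that by (intro measurable_Pair2') simp
    then have "(\<lambda>x. \<eta> (x, l)) \<in> borel_measurable M"
      by (rule measurable_compose[OF _ l2_measurable[OF \<eta>]])
    then show ?thesis using that unfolding R_def by simp
  qed
  have VG: "V \<subseteq> G" by (auto simp: V_def)
  have V_slice: "{x \<in> V. \<psi> x = l} \<in> sets M" if l: "l \<in> carrier \<Lambda>" for l
  proof -
    have "{x \<in> V. \<psi> x = l} = G \<inter> ({x \<in> space M. l \<in> R x} - (\<Union>m\<in>carrier \<Lambda> - {l}. {x \<in> space M. m \<in> R x}))"
    proof (intro equalityI subsetI)
      fix x assume "x \<in> {x \<in> V. \<psi> x = l}"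
      then have x: "x \<in> V" "\<psi> x = l" by auto
      then have "l \<in> R x" "\<And>m. m \<in> R x \<Longrightarrow> m = l" using \<psi>R \<psi>_eq by blast+
      then show "x \<in> G \<inter> ({x \<in> space M. l \<in> R x} - (\<Union>m\<in>carrier \<Lambda> - {l}. {x \<in> space M. m \<in> R x}))"
        using x(1) VG GC CM by blast
    next
      fix x assume x: "x \<in> G \<inter> ({x \<in> space M. l \<in> R x} - (\<Union>m\<in>carrier \<Lambda> - {l}. {x \<in> space M. m \<in> R x}))"
      then have "l \<in> R x" by blast
      moreover have "m = l" if "m \<in> R x" for m
      proof (rule ccontr)
        assume "m \<noteq> l"
        moreover have "m \<in> carrier \<Lambda>" using that by (simp add: R_def)
        ultimately show False using that x GC CM by blast
      qed
      ultimately have "x \<in> V" using x unfolding V_def by blast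
      then show "x \<in> {x \<in> V. \<psi> x = l}" using \<psi>_eq \<open>l \<in> R x\<close> by blast
    qed
    also have "\<dots> \<in> sets M"
      using countable_\<Lambda> l R_sets by (intro sets.Int G sets.Diff sets.countable_UN'') auto
    finally show ?thesis .
  qed
  have VU: "V = (\<Union>l\<in>carrier \<Lambda>. {x \<in> V. \<psi> x = l})" using \<psi>_closed by auto
  have V[measurable]: "V \<in> sets M"
    by (subst VU) (intro sets.countable_UN'' countable_\<Lambda> V_slice)
  have R_shift: "l \<in> R x \<longleftrightarrow> \<sigma> h x l \<in> R (\<alpha> h x)" if "h \<in> H" "x \<in> G" "l \<in> carrier \<Lambda>" for h x l
  proof -
    have "\<eta> (\<alpha> h x, \<sigma> h x l) = \<eta> (x, l)" using Z_inv[of x h l] that GZ by (auto simp: S_def)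
    moreover have "\<sigma> h x l \<in> carrier \<Lambda>"
      using \<sigma>_bij[of h x] that GC CM by (auto simp: bij_betw_def)
    ultimately show ?thesis using that by (simp add: R_def)
  qed
  have V_inv: "\<alpha> h x \<in> V" and \<psi>_h: "\<psi> (\<alpha> h x) = \<sigma> h x (\<psi> x)" if h: "h \<in> H" and x: "x \<in> V" for h x
  proof -
    have xG: "x \<in> G" and xM: "x \<in> space M" using x VG GC CM by auto
    have u: "\<sigma> h x (\<psi> x) \<in> R (\<alpha> h x)"
      using R_shift[OF h xG \<psi>_closed[OF x]] \<psi>R[OF x] by simp
    moreover have "m = \<sigma> h x (\<psi> x)" if "m \<in> R (\<alpha> h x)" for m
    proof -
      have "m \<in> carrier \<Lambda>" using that by (simp add: R_def)
      then obtain l where l: "l \<in> carrier \<Lambda>" "m = \<sigma> h x l"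
        using \<sigma>_bij[OF h xM] unfolding bij_betw_def by (metis imageE)
      then have "l \<in> R x" using that R_shift[OF h xG l(1)] by simp
      then show ?thesis using \<psi>_eq[OF x] l by simp
    qed
    ultimately show "\<alpha> h x \<in> V" using G_inv[OF h xG] unfolding V_def by blast
    then show "\<psi> (\<alpha> h x) = \<sigma> h x (\<psi> x)" using \<psi>_eq u by blast
  qed
  define W where "W = {x \<in> V. \<psi> x = \<one>\<^bsub>\<Lambda>\<^esub>}"
  have W[measurable]: "W \<in> sets M" unfolding W_def by (rule V_slice) simp
  \<comment> \<open>Chebyshev: off \<open>W\<close> some fibre coordinate contributes at least 1/4
    to a total of at most \<open>2 * \<beta>\<close>, so \<open>G - W\<close> has measure at most
    \<open>8 * \<beta>\<close>.\<close>
  have "ennreal (1 / 4) * emeasure M (G - W) = (\<integral>\<^sup>+x. ennreal (1 / 4) * indicator (G - W) x \<partial>M)"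
    by (rule nn_integral_cmult_indicator[symmetric]) auto
  also have "\<dots> \<le> (\<integral>\<^sup>+x. \<integral>\<^sup>+l. ennreal ((cmod (\<eta> (x, l) - \<upsilon> (x, l)))\<^sup>2) \<partial>count_space (carrier \<Lambda>) \<partial>M)"
  proof (rule nn_integral_mono)
    fix x assume "x \<in> space M"
    show "ennreal (1 / 4) * indicator (G - W) x \<le> (\<integral>\<^sup>+l. ennreal ((cmod (\<eta> (x, l) - \<upsilon> (x, l)))\<^sup>2) \<partial>count_space (carrier \<Lambda>))"
    proof (cases "x \<in> G - W")
      case True
      have "\<exists>l\<in>carrier \<Lambda>. (cmod (\<eta> (x, l) - \<upsilon> (x, l)))\<^sup>2 \<ge> 1 / 4"
      proof (rule ccontr)
        assume "\<not> ?thesis"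
        then have lt: "cmod (\<eta> (x, l) - \<upsilon> (x, l)) < 1 / 2" if "l \<in> carrier \<Lambda>" for l
          using that power_mono[of "1/2" "cmod (\<eta> (x, l) - \<upsilon> (x, l))" 2]
          by (force simp: power_divide)
        have "\<one>\<^bsub>\<Lambda>\<^esub> \<in> R x"
          using lt[of "\<one>\<^bsub>\<Lambda>\<^esub>"] True GC by (auto simp: R_def \<upsilon>_def)
        moreover have "l = \<one>\<^bsub>\<Lambda>\<^esub>" if "l \<in> R x" for l
        proof (rule ccontr)
          assume ne: "l \<noteq> \<one>\<^bsub>\<Lambda>\<^esub>"
          have l: "l \<in> carrier \<Lambda>" "cmod (\<eta> (x, l) - 1) < 1 / 2" using that by (auto simp: R_def)
          then have "cmod (\<eta> (x, l)) < 1 / 2" using lt[OF l(1)] ne by (simp add: \<upsilon>_def)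
          then show False using l(2) norm_triangle_ineq4[of "\<eta> (x, l)" "\<eta> (x, l) - 1"] by simp
        qed
        ultimately have xV: "x \<in> V" using True unfolding V_def by blast
        moreover have "\<psi> x = \<one>\<^bsub>\<Lambda>\<^esub>" using \<psi>_eq[OF xV] \<open>\<one>\<^bsub>\<Lambda>\<^esub> \<in> R x\<close> by blast
        ultimately show False using True by (simp add: W_def)
      qed
      then obtain l where l: "l \<in> carrier \<Lambda>" "(cmod (\<eta> (x, l) - \<upsilon> (x, l)))\<^sup>2 \<ge> 1 / 4" by blast
      have "ennreal (1 / 4) * indicator (G - W) x \<le> ennreal ((cmod (\<eta> (x, l) - \<upsilon> (x, l)))\<^sup>2)"
        using l True by (simp add: ennreal_leI del: ennreal_le_iff)
      also have "\<dots> = (\<integral>\<^sup>+m. ennreal ((cmod (\<eta> (x, l) - \<upsilon> (x, l)))\<^sup>2) * indicator {l} m \<partial>count_space (carrier \<Lambda>))"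
        using l(1) by (subst nn_integral_cmult_indicator) auto
      also have "\<dots> \<le> (\<integral>\<^sup>+m. ennreal ((cmod (\<eta> (x, m) - \<upsilon> (x, m)))\<^sup>2) \<partial>count_space (carrier \<Lambda>))"
        by (intro nn_integral_mono) (auto simp: indicator_def)
      finally show ?thesis .
    qed simp
  qed
  also have "\<dots> = (\<integral>\<^sup>+z. ennreal ((cmod (\<eta> z - \<upsilon> z))\<^sup>2) \<partial>\<Omega>2)"
    unfolding \<Omega>2_def using C.nn_integral_fst[of "\<lambda>z. ennreal ((cmod (\<eta> z - \<upsilon> z))\<^sup>2)" M] l2_measurable[OF l2_diff[OF \<eta> \<upsilon>]]
    unfolding \<Omega>2_def by simp
  also have "\<dots> = ennreal (nsq \<Omega>2 (\<lambda>z. \<eta> z - \<upsilon> z))"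
    unfolding nsq_def by (intro nn_integral_eq_integral l2_integrable l2_diff \<eta> \<upsilon>) auto
  also have "\<dots> \<le> ennreal (2 * \<beta>)" using close by (rule ennreal_leI)
  finally have "ennreal (1 / 4 * M.prob (G - W)) \<le> ennreal (2 * \<beta>)"
    by (subst ennreal_mult) (simp_all add: M.emeasure_eq_measure)
  then have GW: "M.prob (G - W) \<le> 8 * \<beta>" using \<beta> by simp
  have prob_G: "M.prob G = c"
  proof -
    have "M.prob (C - G) = M.prob C - M.prob G" using GC by (intro M.finite_measure_Diff) auto
    moreover have "M.prob (C - G) = 0" using CG by (simp add: null_sets_def measure_def)
    ultimately show ?thesis using pC by simp
  qed
  \<comment> \<open>\<open>V\<close> is invariant, and it contains \<open>W\<close>, which is not
    null because \<open>8 * \<beta>\<close> is less than the measure of the cell; ergodicity makes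
    it conull.\<close>
  have "M.prob V = 0 \<or> M.prob (cell n a - V) = 0"
    using V VG GC V_inv by (intro ergodic_cell[OF n]) (auto simp: C_def H_def)
  moreover have "M.prob V \<noteq> 0"
  proof
    assume 0: "M.prob V = 0"
    have "M.prob G \<le> M.prob ((G - W) \<union> V)" using G W V by (intro M.finite_measure_mono) (auto simp: W_def)
    also have "\<dots> \<le> M.prob (G - W) + M.prob V" by (intro measure_Un_le) auto
    finally show False using 0 GW prob_G \<beta> by (simp add: c_def)
  qed
  ultimately have "M.prob (cell n a - V) = 0" by blast
  then have CV: "cell n a - V \<in> null_sets M"
    using cell_sets[OF n, of a] by (auto simp: null_sets_def M.emeasure_eq_measure)
  show thesis
  proof (rule that[of V \<delta> \<psi>])
    have "{x \<in> V. \<psi> x \<noteq> \<one>\<^bsub>\<Lambda>\<^esub>} \<subseteq> G - W" using VG by (auto simp: W_def)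
    then have "M.prob {x \<in> V. \<psi> x \<noteq> \<one>\<^bsub>\<Lambda>\<^esub>} \<le> M.prob (G - W)" by (intro M.finite_measure_mono) auto
    then show "M.prob {x \<in> V. \<psi> x \<noteq> \<one>\<^bsub>\<Lambda>\<^esub>} \<le> 8 * \<beta>" using GW by linarith
    fix h x assume h: "h \<in> \<Gamma>0 \<inter> stab n a" and x: "x \<in> V"
    have hH: "h \<in> H" using h by (simp add: H_def)
    have "w h x \<in> carrier \<Lambda>" using hH x VG GC CM by (intro w_closed) auto
    then show "w h x \<otimes>\<^bsub>\<Lambda>\<^esub> \<psi> x = \<psi> (\<alpha> h x) \<otimes>\<^bsub>\<Lambda>\<^esub> \<delta> h"
      using \<psi>_h[OF hH x] \<delta>[OF hH] \<psi>_closed[OF x] by (simp add: \<sigma>_def L.m_assoc)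
  qed (use V VG GC CV \<delta> \<psi>_closed V_slice V_inv in \<open>auto simp: C_def H_def\<close>)
qed

end

context mp_flow
begin

lemma AE_T:
  assumes "g \<in> carrier G" "AE x in \<Omega>. P x"
  shows "AE x in \<Omega>. P (T g x)"
proof (rule AE_distrD[OF T_meas[OF assms(1)]])
  show "AE x in distr \<Omega> \<Omega> (T g). P x" unfolding T_distr[OF assms(1)] by (rule assms(2))
qed

end

context profinite_cocycle
begin

lemma left_cancel:
  "\<lbrakk>p \<otimes>\<^bsub>\<Lambda>\<^esub> a = p \<otimes>\<^bsub>\<Lambda>\<^esub> b; p \<in> carrier \<Lambda>; a \<in> carrier \<Lambda>; b \<in> carrier \<Lambda>\<rbrakk> \<Longrightarrow> a = b"
  by (metis L.Units_eq L.Units_l_cancel)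

text \<open>On the stabilizer in \<open>\<Gamma>0\<close> this is
  \<open>cohomologous_on_cell\<close>. For a further stabilizing element \<open>g\<close>, normality
  relates the corrected cocycle \<open>u g\<close> at \<open>x\<close> and at
  \<open>\<alpha> k x\<close> through values of \<open>\<delta>0\<close>, so that near constancy of
  \<open>u g\<close> becomes constancy. The elements with constant \<open>u\<close> form a subgroup,
  which turns out to be the whole stabilizer.\<close>

theorem cocycle_superrigidity:
  assumes relT: "relative_property_T \<Gamma> \<Gamma>0" and fg: "finitely_generated_group (\<Gamma> Mod \<Gamma>0)"
  obtains n a \<delta> \<psi> U where "n \<ge> 1" "a \<in> space (Xs n)"
    "U \<in> sets M" "U \<subseteq> cell n a" "cell n a - U \<in> null_sets M"
    "\<And>g. g \<in> stab n a \<Longrightarrow> \<delta> g \<in> carrier \<Lambda>"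
    "\<And>g h. \<lbrakk>g \<in> stab n a; h \<in> stab n a\<rbrakk> \<Longrightarrow> \<delta> (g \<otimes> h) = \<delta> g \<otimes>\<^bsub>\<Lambda>\<^esub> \<delta> h"
    "\<And>x. x \<in> U \<Longrightarrow> \<psi> x \<in> carrier \<Lambda>"
    "\<And>l. l \<in> carrier \<Lambda> \<Longrightarrow> {x \<in> U. \<psi> x = l} \<in> sets M"
    "\<And>g x. g \<in> stab n a \<Longrightarrow> x \<in> U \<Longrightarrow> \<alpha> g x \<in> U"
    "\<And>g x. g \<in> stab n a \<Longrightarrow> x \<in> U \<Longrightarrow> w g x \<otimes>\<^bsub>\<Lambda>\<^esub> \<psi> x = \<psi> (\<alpha> g x) \<otimes>\<^bsub>\<Lambda>\<^esub> \<delta> g"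
proof -
  obtain S where S: "finite S" "S \<subseteq> carrier \<Gamma>"
    and S_gen: "\<And>K. \<lbrakk>subgroup K \<Gamma>; \<Gamma>0 \<subseteq> K; S \<subseteq> K\<rbrakk> \<Longrightarrow> K = carrier \<Gamma>"
    using finitely_generated_quotient[OF normal fg] by blast
  \<comment> \<open>By \<open>nearly_constant\<close> this yields exceptional sets of measure at
    most one hundredth of the cell, which is \<open>\<beta>\<close>.\<close>
  have pos: "(0::real) < 1 / 200" by simp
  obtain n a where n: "n \<ge> 1" and a: "a \<in> space (Xs n)"
    and dis: "\<And>h s. \<lbrakk>h \<in> \<Gamma>0; s \<in> insert \<one> S; \<alpha>n n (h \<otimes> s) a = a\<rbrakk> \<Longrightarrow>
       P.prob (disagree n (h \<otimes> s) \<inter> (cell n a \<times> cell n a)) \<le> (1 / 200) / (card_X n)\<^sup>2"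
  proof (rule cocycle_almost_constant[OF relT S pos])
    fix n a assume *: "1 \<le> n" "a \<in> space (Xs n)"
      "\<And>h s. \<lbrakk>h \<in> \<Gamma>0; s \<in> insert \<one> S; \<alpha>n n (h \<otimes> s) a = a\<rbrakk> \<Longrightarrow>
       P.prob (disagree n (h \<otimes> s) \<inter> (cell n a \<times> cell n a)) \<le> (1 / 200) / (card_X n)\<^sup>2"
    show thesis by (rule that[OF *])
  qed
  define C where "C = cell n a"
  define c where "c = 1 / real (card_X n)"
  define \<beta> where "\<beta> = c / 100"
  define St where "St = stab n a"
  define H where "H = \<Gamma>0 \<inter> stab n a"
  have c: "c > 0" using card_X_pos[OF n] by (simp add: c_def)
  have St: "subgroup St \<Gamma>" unfolding St_def by (rule stab_subgroup[OF n a])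
  interpret St: subgroup St \<Gamma> by (rule St)
  have HSt: "H \<subseteq> St" by (auto simp: H_def St_def)
  have near: "\<exists>l\<in>carrier \<Lambda>. M.prob {x \<in> C. w (h \<otimes> s) x \<noteq> l} \<le> \<beta>"
    if "h \<in> \<Gamma>0" "s \<in> insert \<one> S" "h \<otimes> s \<in> St" for h s
  proof -
    have hs: "\<alpha>n n (h \<otimes> s) a = a" "h \<otimes> s \<in> carrier \<Gamma>" using that(3) unfolding St_def stab_def by auto
    have "2 * (1 / 200) / real (card_X n) = \<beta>" by (simp add: \<beta>_def c_def)
    then show ?thesis
      using nearly_constant[OF n a hs(2) pos dis[OF that(1,2) hs(1)]] unfolding C_def by simp
  qed
  have nearH: "\<exists>l\<in>carrier \<Lambda>. M.prob {x \<in> cell n a. w h x \<noteq> l} \<le> \<beta>" if "h \<in> \<Gamma>0 \<inter> stab n a" for h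
    using near[of h \<one>] that \<Gamma>0_carrier by (auto simp: C_def St_def)
  have \<beta>: "\<beta> > 0" "16 * \<beta> < 1 / card_X n" using c unfolding c_def[symmetric] by (auto simp: \<beta>_def)
  obtain \<delta>0 \<psi> V where V[measurable]: "V \<in> sets M" and VC: "V \<subseteq> C" and CV: "C - V \<in> null_sets M"
    and \<delta>0: "\<And>h. h \<in> H \<Longrightarrow> \<delta>0 h \<in> carrier \<Lambda>"
    and \<psi>: "\<And>x. x \<in> V \<Longrightarrow> \<psi> x \<in> carrier \<Lambda>"
    and \<psi>_sets: "\<And>l. l \<in> carrier \<Lambda> \<Longrightarrow> {x \<in> V. \<psi> x = l} \<in> sets M"
    and \<psi>_near: "M.prob {x \<in> V. \<psi> x \<noteq> \<one>\<^bsub>\<Lambda>\<^esub>} \<le> 8 * \<beta>"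
    and VH: "\<And>h x. h \<in> H \<Longrightarrow> x \<in> V \<Longrightarrow> \<alpha> h x \<in> V"
    and coh: "\<And>h x. h \<in> H \<Longrightarrow> x \<in> V \<Longrightarrow> w h x \<otimes>\<^bsub>\<Lambda>\<^esub> \<psi> x = \<psi> (\<alpha> h x) \<otimes>\<^bsub>\<Lambda>\<^esub> \<delta>0 h"
  proof (rule cohomologous_on_cell[OF n a \<beta> nearH, folded C_def H_def])
    fix \<delta>0 \<psi> V assume *: "V \<in> sets M" "V \<subseteq> C" "C - V \<in> null_sets M"
      "\<And>h. h \<in> H \<Longrightarrow> \<delta>0 h \<in> carrier \<Lambda>" "\<And>x. x \<in> V \<Longrightarrow> \<psi> x \<in> carrier \<Lambda>"
      "\<And>l. l \<in> carrier \<Lambda> \<Longrightarrow> {x \<in> V. \<psi> x = l} \<in> sets M"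
      "M.prob {x \<in> V. \<psi> x \<noteq> \<one>\<^bsub>\<Lambda>\<^esub>} \<le> 8 * \<beta>"
      "\<And>h x. h \<in> H \<Longrightarrow> x \<in> V \<Longrightarrow> \<alpha> h x \<in> V"
      "\<And>h x. h \<in> H \<Longrightarrow> x \<in> V \<Longrightarrow> w h x \<otimes>\<^bsub>\<Lambda>\<^esub> \<psi> x = \<psi> (\<alpha> h x) \<otimes>\<^bsub>\<Lambda>\<^esub> \<delta>0 h"
    show thesis by (rule that[OF *])
  qed
  have C[measurable]: "C \<in> sets M" using n by (simp add: C_def)
  have CM: "C \<subseteq> space M" by (simp add: C_def cell_subset)
  have pC: "M.prob C = c" using measure_cell[OF n a] by (simp add: C_def c_def)
  have StC: "\<alpha> g x \<in> C" if "g \<in> St" "x \<in> C" for g x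
    using that stab_cell[OF n] by (auto simp: St_def C_def)
  let ?SG = "\<Gamma>\<lparr>carrier := St\<rparr>"
  interpret AS: mp_flow ?SG M \<alpha> by (rule A.flow_subgroup[OF St])
  have "countable St" using countable_\<Gamma> St.subset by (rule countable_subset[rotated])
  then have cntSt: "countable (carrier ?SG)" by simp
  \<comment> \<open>\<open>V\<close> is invariant under \<open>H\<close> only; this is its part
    invariant under the whole stabilizer.\<close>
  define V2 where "V2 = AS.core C V"
  have V2[measurable]: "V2 \<in> sets M" unfolding V2_def by (rule AS.core_sets[OF cntSt C V])
  have CV2: "C - V2 \<in> null_sets M"
    unfolding V2_def using StC by (intro AS.core_null cntSt C V CV) auto
  have V2V: "V2 \<subseteq> V" unfolding V2_def by (rule AS.core_subset[OF CM])
  have V2C: "V2 \<subseteq> C" and V2M: "V2 \<subseteq> space M" using V2V VC CM by auto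
  have V2_inv: "\<alpha> g x \<in> V2" if "g \<in> St" "x \<in> V2" for g x
    using AS.core_invariant[OF that(2)[unfolded V2_def] CM, of g] that StC by (simp add: V2_def)
  \<comment> \<open>The cocycle \<open>w\<close> corrected by the coboundary of
    \<open>\<psi>\<close>. It equals \<open>\<delta>0\<close> on \<open>H\<close>.\<close>
  define u where "u g x = inv\<^bsub>\<Lambda>\<^esub> \<psi> (\<alpha> g x) \<otimes>\<^bsub>\<Lambda>\<^esub> w g x \<otimes>\<^bsub>\<Lambda>\<^esub> \<psi> x" for g x
  have cl: "\<psi> x \<in> carrier \<Lambda>" "\<psi> (\<alpha> g x) \<in> carrier \<Lambda>" "w g x \<in> carrier \<Lambda>" "u g x \<in> carrier \<Lambda>"
    if "g \<in> St" "x \<in> V2" for g x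
  proof -
    show "\<psi> x \<in> carrier \<Lambda>" using that V2V \<psi> by blast
    moreover show "\<psi> (\<alpha> g x) \<in> carrier \<Lambda>" using that V2V \<psi> V2_inv by blast
    moreover show "w g x \<in> carrier \<Lambda>" using that V2M by (intro w_closed) auto
    ultimately show "u g x \<in> carrier \<Lambda>" by (simp add: u_def)
  qed
  have u_w: "w g x \<otimes>\<^bsub>\<Lambda>\<^esub> \<psi> x = \<psi> (\<alpha> g x) \<otimes>\<^bsub>\<Lambda>\<^esub> u g x" if "g \<in> St" "x \<in> V2" for g x
    using cl[OF that] by (simp add: u_def L.m_assoc) (simp add: L.m_assoc[symmetric])
  have u_mult: "u (g \<otimes> k) x = u g (\<alpha> k x) \<otimes>\<^bsub>\<Lambda>\<^esub> u k x" if g: "g \<in> St" and k: "k \<in> St" and x: "x \<in> V2" for g k x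
  proof -
    note kx = V2_inv[OF k x]
    have gk: "\<alpha> (g \<otimes> k) x = \<alpha> g (\<alpha> k x)" "w (g \<otimes> k) x = w g (\<alpha> k x) \<otimes>\<^bsub>\<Lambda>\<^esub> w k x"
      using g k x V2M by (auto intro!: A.T_mult w_mult)
    have "\<psi> (\<alpha> (g \<otimes> k) x) \<otimes>\<^bsub>\<Lambda>\<^esub> u (g \<otimes> k) x = w g (\<alpha> k x) \<otimes>\<^bsub>\<Lambda>\<^esub> (w k x \<otimes>\<^bsub>\<Lambda>\<^esub> \<psi> x)"
      using u_w[of "g \<otimes> k" x] g k x gk cl[OF g kx] cl[OF k x] by (simp add: L.m_assoc)
    also have "\<dots> = (w g (\<alpha> k x) \<otimes>\<^bsub>\<Lambda>\<^esub> \<psi> (\<alpha> k x)) \<otimes>\<^bsub>\<Lambda>\<^esub> u k x"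
      using cl[OF g kx] cl[OF k x] by (simp add: u_w[OF k x] L.m_assoc)
    also have "\<dots> = \<psi> (\<alpha> (g \<otimes> k) x) \<otimes>\<^bsub>\<Lambda>\<^esub> (u g (\<alpha> k x) \<otimes>\<^bsub>\<Lambda>\<^esub> u k x)"
      using cl[OF g kx] cl[OF k x] by (simp add: u_w[OF g kx] gk L.m_assoc)
    finally show ?thesis
    proof (rule left_cancel)
      show "\<psi> (\<alpha> (g \<otimes> k) x) \<in> carrier \<Lambda>" "u (g \<otimes> k) x \<in> carrier \<Lambda>"
        using cl(2,4)[of "g \<otimes> k" x] g k x by auto
      show "u g (\<alpha> k x) \<otimes>\<^bsub>\<Lambda>\<^esub> u k x \<in> carrier \<Lambda>"
        by (intro L.m_closed cl(4) g k x kx)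
    qed
  qed
  have u_H: "u h x = \<delta>0 h" if h: "h \<in> H" and x: "x \<in> V2" for h x
  proof -
    have hS: "h \<in> St" and xV: "x \<in> V" using h x HSt V2V by auto
    have "\<psi> (\<alpha> h x) \<otimes>\<^bsub>\<Lambda>\<^esub> u h x = \<psi> (\<alpha> h x) \<otimes>\<^bsub>\<Lambda>\<^esub> \<delta>0 h"
      using u_w[OF hS x] coh[OF h xV] by simp
    then show ?thesis by (rule left_cancel) (intro cl(2,4)[OF hS x] \<delta>0[OF h])+
  qed
  have u_sets: "{x \<in> V2. u g x = l} \<in> sets M" if g: "g \<in> St" and l: "l \<in> carrier \<Lambda>" for g l
  proof -
    let ?I = "{(p, q, r). p \<in> carrier \<Lambda> \<and> q \<in> carrier \<Lambda> \<and> r \<in> carrier \<Lambda> \<and> inv\<^bsub>\<Lambda>\<^esub> p \<otimes>\<^bsub>\<Lambda>\<^esub> q \<otimes>\<^bsub>\<Lambda>\<^esub> r = l}"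
    let ?B = "\<lambda>(p, q, r). V2 \<inter> ((\<alpha> g -` {x \<in> V. \<psi> x = p} \<inter> space M) \<inter> {x \<in> space M. w g x = q} \<inter> {x \<in> V. \<psi> x = r})"
    have "?I \<subseteq> carrier \<Lambda> \<times> carrier \<Lambda> \<times> carrier \<Lambda>" by auto
    then have I: "countable ?I" by (rule countable_subset) (intro countable_SIGMA countable_\<Lambda>)
    have "{x \<in> V2. u g x = l} = (\<Union>i\<in>?I. ?B i)"
    proof (intro equalityI subsetI)
      fix x assume "x \<in> {x \<in> V2. u g x = l}"
      then have x: "x \<in> V2" "u g x = l" by auto
      then have "(\<psi> (\<alpha> g x), w g x, \<psi> x) \<in> ?I" using cl[OF g x(1)] by (simp add: u_def)
      moreover have "x \<in> ?B (\<psi> (\<alpha> g x), w g x, \<psi> x)"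
        using x V2V V2M V2_inv[OF g x(1)] by auto
      ultimately show "x \<in> (\<Union>i\<in>?I. ?B i)" by blast
    qed (auto simp: u_def)
    also have "\<dots> \<in> sets M"
    proof (rule sets.countable_UN''[OF I])
      fix i assume "i \<in> ?I"
      then obtain p q r where i: "i = (p, q, r)" "p \<in> carrier \<Lambda>" "q \<in> carrier \<Lambda>" "r \<in> carrier \<Lambda>" by auto
      have gG: "g \<in> carrier \<Gamma>" using g by simp
      show "?B i \<in> sets M"
        unfolding i(1) prod.case
        by (intro sets.Int V2 measurable_sets[OF A.T_meas[OF gG]] \<psi>_sets w_sets gG i)
    qed
    finally show ?thesis .
  qed
  define G' where "G' = {g \<in> St. \<exists>l\<in>carrier \<Lambda>. AE x in M. x \<in> V2 \<longrightarrow> u g x = l}"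
  have V2_one: "u \<one> x = \<one>\<^bsub>\<Lambda>\<^esub>" if "x \<in> V2" for x
  proof -
    have "x \<in> space M" "\<psi> x \<in> carrier \<Lambda>" using that V2M V2V \<psi> by auto
    then show ?thesis by (simp add: u_def A.T_one w_one)
  qed
  have G': "subgroup G' \<Gamma>"
  proof (rule subgroupI)
    show "G' \<subseteq> carrier \<Gamma>" using St.subset by (auto simp: G'_def)
    have "\<one> \<in> G'" using V2_one by (auto simp: G'_def intro!: bexI[of _ "\<one>\<^bsub>\<Lambda>\<^esub>"])
    then show "G' \<noteq> {}" by blast
    fix g assume g: "g \<in> G'"
    then obtain l where gS: "g \<in> St" and l: "l \<in> carrier \<Lambda>" "AE x in M. x \<in> V2 \<longrightarrow> u g x = l" by (auto simp: G'_def)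
    have gG: "g \<in> carrier \<Gamma>" "inv g \<in> carrier \<Gamma>" "inv g \<in> St" using gS by auto
    have "AE x in M. x \<in> V2 \<longrightarrow> u (inv g) x = inv\<^bsub>\<Lambda>\<^esub> l"
      using A.AE_T[OF gG(2) l(2)]
    proof eventually_elim
      case (elim x)
      show ?case
      proof
        assume x: "x \<in> V2"
        have "\<one>\<^bsub>\<Lambda>\<^esub> = l \<otimes>\<^bsub>\<Lambda>\<^esub> u (inv g) x"
          using u_mult[OF gS gG(3) x] elim V2_inv[OF gG(3) x] V2_one[OF x] gG by simp
        then show "u (inv g) x = inv\<^bsub>\<Lambda>\<^esub> l"
          using cl(4)[OF gG(3) x] l(1) by (metis L.inv_comm L.inv_equality)
      qed
    qed
    then show "inv g \<in> G'" using gG(3) l(1) by (auto simp: G'_def)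
    fix k assume "k \<in> G'"
    then obtain m where kS: "k \<in> St" and m: "m \<in> carrier \<Lambda>" "AE x in M. x \<in> V2 \<longrightarrow> u k x = m" by (auto simp: G'_def)
    have kG: "k \<in> carrier \<Gamma>" using kS by auto
    have "AE x in M. x \<in> V2 \<longrightarrow> u (g \<otimes> k) x = l \<otimes>\<^bsub>\<Lambda>\<^esub> m"
      using A.AE_T[OF kG l(2)] m(2)
      by eventually_elim (use u_mult[OF gS kS] V2_inv[OF kS] in auto)
    then show "g \<otimes> k \<in> G'" using gS kS l(1) m(1) by (auto simp: G'_def)
  qed
  have mem_G': "h \<otimes> s \<in> G'" if h: "h \<in> \<Gamma>0" and s: "s \<in> insert \<one> S" and hs: "h \<otimes> s \<in> St" for h s
  proof -
    define g where "g = h \<otimes> s"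
    have gS: "g \<in> St" and gG: "g \<in> carrier \<Gamma>" using hs by (auto simp: g_def)
    obtain l where l: "l \<in> carrier \<Lambda>" and l_near: "M.prob {x \<in> C. w g x \<noteq> l} \<le> \<beta>"
      using near[OF h s hs] by (auto simp: g_def)
    define B1 where "B1 = {x \<in> C. w g x \<noteq> l}"
    define B2 where "B2 = {x \<in> V. \<psi> x \<noteq> \<one>\<^bsub>\<Lambda>\<^esub>}"
    define B3 where "B3 = \<alpha> g -` B2 \<inter> space M"
    define E where "E = {x \<in> V2. u g x = l}"
    have B1: "B1 \<in> sets M" unfolding B1_def C_def by (rule w_cell_sets[OF n gG l])
    have B2: "B2 \<in> sets M"
    proof -
      have "B2 = V - {x \<in> V. \<psi> x = \<one>\<^bsub>\<Lambda>\<^esub>}" by (auto simp: B2_def)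
      then show ?thesis using \<psi>_sets[OF L.one_closed] V by auto
    qed
    have B3: "B3 \<in> sets M" unfolding B3_def by (rule measurable_sets[OF A.T_meas[OF gG] B2])
    have pB3: "M.prob B3 = M.prob B2"
      using A.emeasure_T_vimage[OF gG B2] by (simp add: B3_def measure_def)
    have E: "E \<in> sets M" unfolding E_def by (rule u_sets[OF gS l])
    have EC: "E \<subseteq> C" using V2C by (auto simp: E_def)
    have "C - E \<subseteq> (C - V2) \<union> (B1 \<union> (B2 \<union> B3))"
    proof
      fix x assume x: "x \<in> C - E"
      show "x \<in> (C - V2) \<union> (B1 \<union> (B2 \<union> B3))"
      proof (rule ccontr)
        assume no: "x \<notin> (C - V2) \<union> (B1 \<union> (B2 \<union> B3))"
        then have xV2: "x \<in> V2" and "w g x = l" using x by (auto simp: B1_def)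
        moreover have "\<psi> x = \<one>\<^bsub>\<Lambda>\<^esub>" using no xV2 V2V by (auto simp: B2_def)
        moreover have "\<psi> (\<alpha> g x) = \<one>\<^bsub>\<Lambda>\<^esub>"
          using no xV2 V2_inv[OF gS xV2] V2V V2M by (auto simp: B3_def B2_def)
        ultimately have "u g x = l" using l by (simp add: u_def)
        then show False using x xV2 by (simp add: E_def)
      qed
    qed
    then have "M.prob (C - E) \<le> M.prob ((C - V2) \<union> (B1 \<union> (B2 \<union> B3)))"
      using B1 B2 B3 by (intro M.finite_measure_mono) auto
    also have "\<dots> \<le> M.prob (C - V2) + M.prob (B1 \<union> (B2 \<union> B3))"
      using B1 B2 B3 by (intro measure_Un_le) auto
    also have "M.prob (B1 \<union> (B2 \<union> B3)) \<le> M.prob B1 + M.prob (B2 \<union> B3)"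
      using B1 B2 B3 by (intro measure_Un_le) auto
    also have "M.prob (B2 \<union> B3) \<le> M.prob B2 + M.prob B3"
      using B2 B3 by (intro measure_Un_le) auto
    also have "M.prob (C - V2) = 0" using CV2 by (simp add: null_sets_def measure_def)
    \<comment> \<open>One \<open>\<beta>\<close> for \<open>w g\<close>, and
      \<open>8 * \<beta>\<close> each for \<open>\<psi>\<close> at \<open>x\<close> and at its image
      under \<open>g\<close>.\<close>
    finally have pE: "M.prob (C - E) \<le> 17 * \<beta>"
      using l_near \<psi>_near pB3 by (simp add: B1_def B2_def)
    \<comment> \<open>By \<open>shift\<close>, \<open>u g\<close> at \<open>\<alpha> k x\<close> is
      determined by \<open>u g\<close> at \<open>x\<close> and the constants
      \<open>\<delta>0 k\<close>, \<open>\<delta>0 k'\<close>. Two sets of measure at most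
      \<open>17 * \<beta>\<close> do not cover the cell, so some \<open>y\<close> has
      \<open>y\<close> and \<open>\<alpha> k y\<close> in \<open>E\<close>; evaluating there shows
      that the constants send the value \<open>l\<close> to \<open>l\<close>.\<close>
    have E_inv: "\<alpha> k x \<in> E" if k: "k \<in> \<Gamma>0" "k \<in> stab n a" and x: "x \<in> E" for k x
    proof -
      have kH: "k \<in> H" and kS: "k \<in> St" and kG: "k \<in> carrier \<Gamma>" using k \<Gamma>0_carrier by (auto simp: H_def St_def)
      define k' where "k' = g \<otimes> k \<otimes> inv g"
      have k'H: "k' \<in> H"
      proof -
        have "k' \<in> \<Gamma>0" unfolding k'_def by (rule normal.inv_op_closed2[OF normal gG k(1)])
        moreover have "k' \<in> St" unfolding k'_def using gS kS by simp
        ultimately show ?thesis by (simp add: H_def St_def)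
      qed
      have gk: "g \<otimes> k = k' \<otimes> g" using gG kG by (simp add: k'_def m_assoc)
      have shift: "u g (\<alpha> k y) \<otimes>\<^bsub>\<Lambda>\<^esub> \<delta>0 k = \<delta>0 k' \<otimes>\<^bsub>\<Lambda>\<^esub> u g y" if y: "y \<in> V2" for y
      proof -
        have k'S: "k' \<in> St" using k'H HSt by auto
        have "u g (\<alpha> k y) \<otimes>\<^bsub>\<Lambda>\<^esub> \<delta>0 k = u (g \<otimes> k) y"
          using u_mult[OF gS kS y] u_H[OF kH y] by simp
        also have "\<dots> = \<delta>0 k' \<otimes>\<^bsub>\<Lambda>\<^esub> u g y"
          unfolding gk using u_mult[OF k'S gS y] u_H[OF k'H V2_inv[OF gS y]] by simp
        finally show ?thesis .
      qed
      define D where "D = \<alpha> k -` (C - E) \<inter> space M"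
      have D: "D \<in> sets M" unfolding D_def using C E by (intro measurable_sets[OF A.T_meas[OF kG]]) auto
      have "M.prob D = M.prob (C - E)"
        using A.emeasure_T_vimage[OF kG, of "C - E"] C E by (simp add: D_def measure_def)
      then have "M.prob ((C - E) \<union> D) \<le> 34 * \<beta>"
        using measure_Un_le[of "C - E" M D] C E D pE by auto
      also have "\<dots> < 1 / card_X n" using c unfolding c_def[symmetric] by (simp add: \<beta>_def)
      finally obtain y where y: "y \<in> cell n a" "y \<notin> (C - E) \<union> D"
        using exists_in_cell[OF n a, of "(C - E) \<union> D"] C E D by auto
      then have yE: "y \<in> E" and kyE: "\<alpha> k y \<in> E"
        using StC[OF kS, of y] CM by (auto simp: C_def D_def)
      have "l \<otimes>\<^bsub>\<Lambda>\<^esub> \<delta>0 k = \<delta>0 k' \<otimes>\<^bsub>\<Lambda>\<^esub> l" using shift[of y] yE kyE by (simp add: E_def)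
      moreover have "u g (\<alpha> k x) \<otimes>\<^bsub>\<Lambda>\<^esub> \<delta>0 k = \<delta>0 k' \<otimes>\<^bsub>\<Lambda>\<^esub> l" using shift[of x] x by (simp add: E_def)
      ultimately have "u g (\<alpha> k x) \<otimes>\<^bsub>\<Lambda>\<^esub> \<delta>0 k = l \<otimes>\<^bsub>\<Lambda>\<^esub> \<delta>0 k" by simp
      moreover have kx: "\<alpha> k x \<in> V2" using V2_inv[OF kS] x by (auto simp: E_def)
      ultimately have "u g (\<alpha> k x) = l"
        using \<delta>0[OF kH] l cl(4)[OF gS kx] by (simp add: L.r_cancel)
      then show ?thesis using kx by (simp add: E_def)
    qed
    have "M.prob E = 0 \<or> M.prob (C - E) = 0"
      unfolding C_def using E EC E_inv by (intro ergodic_cell[OF n]) (auto simp: C_def)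
    moreover have "M.prob E \<noteq> 0"
    proof
      assume "M.prob E = 0"
      then have "M.prob (C - E) = c" using M.finite_measure_Diff[OF C E EC] pC by simp
      then show False using pE c by (simp add: \<beta>_def)
    qed
    ultimately have "C - E \<in> null_sets M" using C E by (auto simp: null_sets_def M.emeasure_eq_measure)
    then have "AE x in M. x \<notin> C - E" by (rule AE_not_in)
    then have "AE x in M. x \<in> V2 \<longrightarrow> u g x = l"
      by eventually_elim (use V2C in \<open>auto simp: E_def\<close>)
    then show ?thesis using gS l by (auto simp: G'_def g_def)
  qed
  \<comment> \<open>By transitivity some \<open>h\<close> in \<open>\<Gamma>0\<close> brings
    \<open>s\<close> into the stabilizer as \<open>h \<otimes> s\<close>, which lies in
    \<open>G'\<close>; hence the product contains every representative in \<open>S\<close>.\<close>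
  have K: "\<Gamma>0 <#> G' = carrier \<Gamma>"
  proof (rule S_gen)
    show "subgroup (\<Gamma>0 <#> G') \<Gamma>" by (rule mult_norm_subgroup[OF normal G'])
    show "\<Gamma>0 \<subseteq> \<Gamma>0 <#> G'"
      using subgroup.one_closed[OF G'] \<Gamma>0_carrier unfolding set_mult_def by force
    show "S \<subseteq> \<Gamma>0 <#> G'"
    proof
      fix s assume s: "s \<in> S"
      then have sG: "s \<in> carrier \<Gamma>" using S by auto
      interpret X: mp_flow \<Gamma> "Xs n" "\<alpha>n n" by (rule Xn_flow[OF n])
      obtain h where h: "h \<in> \<Gamma>0" "\<alpha>n n h (\<alpha>n n s a) = a"
        using transitive0[OF n X.T_space[OF sG a] a] .
      have hG: "h \<in> carrier \<Gamma>" using h \<Gamma>0_carrier by auto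
      have "h \<otimes> s \<in> St" unfolding St_def stab_def using h(2) hG sG a by (simp add: X.T_mult)
      then have "h \<otimes> s \<in> G'" using mem_G'[OF h(1), of s] s by auto
      moreover have "inv h \<in> \<Gamma>0" using h(1) by (rule subgroup.m_inv_closed[OF \<Gamma>0_subgroup])
      moreover have "s = inv h \<otimes> (h \<otimes> s)" using hG sG by (simp add: m_assoc[symmetric])
      ultimately show "s \<in> \<Gamma>0 <#> G'" unfolding set_mult_def by blast
    qed
  qed
  \<comment> \<open>Write \<open>g = h \<otimes> g'\<close> with \<open>g'\<close> in
    \<open>G'\<close>. Both \<open>g\<close> and \<open>g'\<close> stabilize the cell, hence so does
    \<open>h\<close>, and then \<open>mem_G'\<close> applies to \<open>h\<close> as well.\<close>
  have "g \<in> G'" if g: "g \<in> St" for g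
  proof -
    have "g \<in> \<Gamma>0 <#> G'" using g K by auto
    then obtain h g' where h: "h \<in> \<Gamma>0" and g': "g' \<in> G'" and eq: "g = h \<otimes> g'" by (auto simp: set_mult_def)
    have hG: "h \<in> carrier \<Gamma>" and g'S: "g' \<in> St" and g'G: "g' \<in> carrier \<Gamma>"
      using h g' \<Gamma>0_carrier by (auto simp: G'_def)
    have "h = g \<otimes> inv g'" using eq hG g'G by (simp add: m_assoc)
    then have "h \<in> St" using g g'S by simp
    then have "h \<in> G'" using mem_G'[OF h, of \<one>] hG by simp
    then show ?thesis unfolding eq using g' by (intro subgroup.m_closed[OF G'])
  qed
  then obtain \<delta> where \<delta>: "\<And>g. g \<in> St \<Longrightarrow> \<delta> g \<in> carrier \<Lambda>"
    and AE_\<delta>: "\<And>g. g \<in> St \<Longrightarrow> AE x in M. x \<in> V2 \<longrightarrow> u g x = \<delta> g"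
    unfolding G'_def by simp metis
  have "AE x in M. \<forall>g\<in>St. x \<in> V2 \<longrightarrow> u g x = \<delta> g"
    using AE_\<delta> cntSt by (subst AE_ball_countable) auto
  then obtain Z where Z1: "{x \<in> space M. \<not> (\<forall>g\<in>St. x \<in> V2 \<longrightarrow> u g x = \<delta> g)} \<subseteq> Z" and Z: "Z \<in> null_sets M"
    by (rule AE_E) (auto simp: null_sets_def)
  have Zs: "space M - Z \<in> sets M" using Z by auto
  define U where "U = AS.core V2 (space M - Z)"
  have U: "U \<in> sets M" unfolding U_def by (rule AS.core_sets[OF cntSt V2 Zs])
  have "V2 - (space M - Z) \<in> null_sets M"
    by (rule null_sets_subset[OF Z]) (use V2 V2M Z in auto)
  then have V2U: "V2 - U \<in> null_sets M"
    unfolding U_def using V2_inv by (intro AS.core_null cntSt V2 Zs) auto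
  have UV2: "U \<subseteq> V2" by (auto simp: U_def AS.core_def)
  have UZ: "U \<subseteq> space M - Z" unfolding U_def by (rule AS.core_subset[OF V2M])
  have U_inv: "\<alpha> g x \<in> U" if "g \<in> St" "x \<in> U" for g x
    using AS.core_invariant[OF that(2)[unfolded U_def] V2M, of g] that V2_inv by (simp add: U_def)
  have u_\<delta>: "u g x = \<delta> g" if "g \<in> St" "x \<in> U" for g x
    using that Z1 UZ UV2 by blast
  have CU: "C - U \<in> null_sets M"
  proof (rule null_sets_subset[OF null_sets.Un[OF CV2 V2U]])
    show "C - U \<in> sets M" using U by auto
  qed auto
  \<comment> \<open>A single point of \<open>U\<close> suffices to read off multiplicativity of
    \<open>\<delta>\<close> from that of \<open>u\<close>.\<close>
  have "U \<noteq> {}"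
  proof
    assume "U = {}"
    then have "C \<in> null_sets M" using CU by simp
    then show False using pC c by (simp add: null_sets_def measure_def)
  qed
  then obtain x0 where x0: "x0 \<in> U" by blast
  show thesis
  proof (rule that[of n a U \<delta> \<psi>])
    show "n \<ge> 1" "a \<in> space (Xs n)" "U \<in> sets M" using n a U by auto
    show "U \<subseteq> cell n a" "cell n a - U \<in> null_sets M" using UV2 V2C CU by (auto simp: C_def)
    show "\<delta> g \<in> carrier \<Lambda>" if "g \<in> stab n a" for g using that \<delta> by (simp add: St_def)
    show "\<delta> (g \<otimes> h) = \<delta> g \<otimes>\<^bsub>\<Lambda>\<^esub> \<delta> h" if "g \<in> stab n a" "h \<in> stab n a" for g h
    proof -
      have gh: "g \<in> St" "h \<in> St" "g \<otimes> h \<in> St" using that by (auto simp: St_def[symmetric])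
      show ?thesis
        using u_mult[OF gh(1,2), of x0] x0 UV2 u_\<delta>[OF gh(3) x0] u_\<delta>[OF gh(2) x0] u_\<delta>[OF gh(1) U_inv[OF gh(2) x0]]
        by auto
    qed
    show "\<psi> x \<in> carrier \<Lambda>" if "x \<in> U" for x using that \<psi> UV2 V2V by blast
    show "{x \<in> U. \<psi> x = l} \<in> sets M" if "l \<in> carrier \<Lambda>" for l
    proof -
      have "{x \<in> U. \<psi> x = l} = U \<inter> {x \<in> V. \<psi> x = l}" using UV2 V2V by auto
      then show ?thesis using U \<psi>_sets[OF that] by auto
    qed
    fix g x assume g: "g \<in> stab n a" and x: "x \<in> U"
    have gS: "g \<in> St" using g by (simp add: St_def)
    show "\<alpha> g x \<in> U" by (rule U_inv[OF gS x])
    show "w g x \<otimes>\<^bsub>\<Lambda>\<^esub> \<psi> x = \<psi> (\<alpha> g x) \<otimes>\<^bsub>\<Lambda>\<^esub> \<delta> g"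
      using u_w[OF gS, of x] u_\<delta>[OF gS x] x UV2 by auto
  qed
qed

end

section \<open>Isomorphisms modulo null sets\<close>

lemma iso_mod_null_image:
  assumes iso: "iso_mod_null M N A B f" and S: "S \<in> sets M" "S \<subseteq> A"
  shows "f ` S \<in> sets N" "emeasure N (f ` S) = emeasure M S"
proof -
  have A: "A \<in> sets M" and B: "B \<in> sets N" and bij: "bij_betw f A B"
    and f: "f \<in> restrict_space M A \<rightarrow>\<^sub>M restrict_space N B"
    and fd: "distr (restrict_space M A) (restrict_space N B) f = restrict_space N B"
    and g: "inv_into A f \<in> restrict_space N B \<rightarrow>\<^sub>M restrict_space M A"
    using iso by (auto simp: iso_mod_null_def measure_preserving_def)
  have AM: "A \<inter> space M = A" "B \<inter> space N = B" using A B by (auto dest: sets.sets_into_space)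
  have eq: "inv_into A f -` S \<inter> B = f ` S"
    using S bij by (auto simp: bij_betw_def image_iff inv_into_f_f f_inv_into_f inv_into_into subset_eq intro!: bexI[of _ "inv_into A f _"])
  have SA: "S \<in> sets (restrict_space M A)" using S A AM by (auto simp: sets_restrict_space_iff)
  have "inv_into A f -` S \<inter> space (restrict_space N B) \<in> sets (restrict_space N B)"
    by (rule measurable_sets[OF g SA])
  then have fS: "f ` S \<in> sets (restrict_space N B)" using eq AM by (simp add: space_restrict_space)
  then show "f ` S \<in> sets N" using B AM by (simp add: sets_restrict_space_iff)
  have "f -` f ` S \<inter> A = S" using S bij by (auto simp: bij_betw_def inj_on_def)
  then have "emeasure (distr (restrict_space M A) (restrict_space N B) f) (f ` S) = emeasure (restrict_space M A) S"
    by (subst emeasure_distr[OF f fS]) (simp add: space_restrict_space AM)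
  then show "emeasure N (f ` S) = emeasure M S"
    using S A B AM fS unfolding fd by (simp add: emeasure_restrict_space sets_restrict_space_iff)
qed

lemma iso_mod_null_vimage:
  assumes iso: "iso_mod_null M N A B f" and E: "E \<in> sets N"
  shows "{x \<in> A. f x \<in> E} \<in> sets M" "emeasure M {x \<in> A. f x \<in> E} = emeasure N (E \<inter> B)"
proof -
  have A: "A \<in> sets M" and B: "B \<in> sets N" and bij: "bij_betw f A B"
    and f: "f \<in> restrict_space M A \<rightarrow>\<^sub>M restrict_space N B"
    using iso by (auto simp: iso_mod_null_def measure_preserving_def)
  have AM: "A \<inter> space M = A" "B \<inter> space N = B" using A B by (auto dest: sets.sets_into_space)
  have "E \<inter> B \<in> sets (restrict_space N B)" using E B AM by (simp add: sets_restrict_space_iff)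
  from measurable_sets[OF f this] have "f -` (E \<inter> B) \<inter> A \<in> sets M"
    using A AM by (simp add: space_restrict_space sets_restrict_space_iff)
  moreover have eq: "f -` (E \<inter> B) \<inter> A = {x \<in> A. f x \<in> E}" using bij by (auto simp: bij_betw_def)
  ultimately show S: "{x \<in> A. f x \<in> E} \<in> sets M" by simp
  have "f ` {x \<in> A. f x \<in> E} = E \<inter> B" using bij by (auto simp: bij_betw_def)
  then show "emeasure M {x \<in> A. f x \<in> E} = emeasure N (E \<inter> B)"
    using iso_mod_null_image(2)[OF iso S] by simp
qed

text \<open>Remove countably many null sets containing the fixed points of the nontrivial elements,
  then pass to the invariant core.\<close>

lemma (in mp_flow) free_conull_set:
  assumes cnt: "countable (carrier G)" and free: "free_action G \<Omega> T"
    and D: "D \<in> sets \<Omega>" "space \<Omega> - D \<in> null_sets \<Omega>"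
  shows "\<exists>F. F \<in> sets \<Omega> \<and> F \<subseteq> D \<and> space \<Omega> - F \<in> null_sets \<Omega> \<and>
    (\<forall>g\<in>carrier G. \<forall>x\<in>F. T g x \<in> F \<and> (T g x = x \<longrightarrow> g = \<one>))"
proof -
  have "\<exists>N\<in>null_sets \<Omega>. {x \<in> space \<Omega>. T g x = x} \<subseteq> N" if "g \<in> carrier G" "g \<noteq> \<one>" for g
  proof -
    have "AE x in \<Omega>. T g x \<noteq> x" using free that by (simp add: free_action_def)
    then show ?thesis by (rule AE_E) (auto simp: null_sets_def)
  qed
  then obtain N where N: "\<And>g. g \<in> carrier G \<Longrightarrow> g \<noteq> \<one> \<Longrightarrow> N g \<in> null_sets \<Omega>"
    and N_sub: "\<And>g. g \<in> carrier G \<Longrightarrow> g \<noteq> \<one> \<Longrightarrow> {x \<in> space \<Omega>. T g x = x} \<subseteq> N g"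
    by metis
  define NN where "NN = (\<Union>g\<in>carrier G - {\<one>}. N g)"
  have NN: "NN \<in> null_sets \<Omega>" unfolding NN_def using cnt N by (intro null_sets_UN') auto
  define A where "A = D - NN"
  have A: "A \<in> sets \<Omega>" using D NN by (auto simp: A_def)
  have spA: "space \<Omega> - A \<in> null_sets \<Omega>"
  proof (rule null_sets_subset[OF null_sets.Un[OF D(2) NN]])
    show "space \<Omega> - A \<in> sets \<Omega>" using A by auto
  qed (auto simp: A_def)
  define F where "F = core (space \<Omega>) A"
  have FA: "F \<subseteq> A" unfolding F_def by (rule core_subset) simp
  have FS: "F \<subseteq> space \<Omega>" by (auto simp: F_def core_def)
  show ?thesis
  proof (intro exI[of _ F] conjI ballI impI)
    show "F \<in> sets \<Omega>" unfolding F_def by (intro core_sets cnt A) auto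
    show "F \<subseteq> D" using FA by (auto simp: A_def)
    show "space \<Omega> - F \<in> null_sets \<Omega>" unfolding F_def by (intro core_null cnt A spA T_space) auto
    fix g x assume g: "g \<in> carrier G" and x: "x \<in> F"
    show "T g x \<in> F" using core_invariant[OF x[unfolded F_def] _ g] T_space by (simp add: F_def)
    assume fixed: "T g x = x"
    show "g = \<one>"
    proof (rule ccontr)
      assume "g \<noteq> \<one>"
      then have "x \<in> N g" using N_sub[OF g] fixed x FS by auto
      then have "x \<in> NN" using g \<open>g \<noteq> \<one>\<close> by (auto simp: NN_def)
      then show False using x FA by (auto simp: A_def)
    qed
  qed
qed

section \<open>Amplifications induced by free actions\<close>

lemma
  assumes "Y \<in> sets N"
  shows sets_normalized_restriction: "S \<in> sets (normalized_restriction N t Y) \<longleftrightarrow> S \<subseteq> Y \<and> S \<in> sets N"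
    and space_normalized_restriction: "space (normalized_restriction N t Y) = Y"
    and emeasure_normalized_restriction:
      "S \<subseteq> Y \<Longrightarrow> emeasure (normalized_restriction N t Y) S = ennreal (1 / t) * emeasure N S"
proof -
  have Y: "Y \<inter> space N = Y" using sets.sets_into_space[OF assms] by auto
  show "S \<in> sets (normalized_restriction N t Y) \<longleftrightarrow> S \<subseteq> Y \<and> S \<in> sets N"
    using assms Y by (simp add: normalized_restriction_def sets_restrict_space_iff)
  show "space (normalized_restriction N t Y) = Y"
    using Y by (simp add: normalized_restriction_def space_restrict_space space_scale_measure)
  show "S \<subseteq> Y \<Longrightarrow> emeasure (normalized_restriction N t Y) S = ennreal (1 / t) * emeasure N S"
    using assms Y by (simp add: normalized_restriction_def emeasure_restrict_space)
qed

lemma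
  assumes "S \<in> sets M"
  shows sets_stabilized_times: "S \<times> I \<in> sets (stabilized_measure M)"
    and emeasure_stabilized_times:
      "finite I \<Longrightarrow> emeasure (stabilized_measure M) (S \<times> I) = emeasure M S * ennreal (card I)"
proof -
  interpret C: sigma_finite_measure "count_space (UNIV :: nat set)"
    by (rule sigma_finite_measure_count_space_countable) simp
  show "S \<times> I \<in> sets (stabilized_measure M)" unfolding stabilized_measure_def using assms by auto
  show "emeasure (stabilized_measure M) (S \<times> I) = emeasure M S * ennreal (card I)" if "finite I"
    unfolding stabilized_measure_def using that
    by (subst C.emeasure_pair_measure_Times) (use assms in \<open>auto simp: emeasure_count_space ennreal_of_nat_eq_real_of_nat\<close>)
qed

locale induced_amplification = profinite +
  L: group \<Lambda> for \<Lambda> :: "nat monoid" +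
  fixes Z :: "'z measure" and b :: "nat \<Rightarrow> 'z \<Rightarrow> 'z" and t :: real
    and Y A :: "((nat \<Rightarrow> 'b) \<times> nat) set" and B and f
  assumes free_\<Gamma>: "free_action \<Gamma> M \<alpha>"
    and t: "t > 0"
    and Y: "Y \<in> sets (stabilized_measure M)" "emeasure (stabilized_measure M) Y = ennreal t"
    and std: "standard_prob_space Z"
    and action_\<Lambda>: "mp_action \<Lambda> Z b" and free_\<Lambda>: "free_action \<Lambda> Z b" and ergodic_\<Lambda>: "ergodic_action \<Lambda> Z b"
    and iso: "iso_mod_null (normalized_restriction (stabilized_measure M) t Y) Z A B f"
    and rel: "\<forall>x\<in>A. \<forall>y\<in>A. (x, y) \<in> stabilization (orbit_equiv_rel \<Gamma> M \<alpha>) \<inter> Y \<times> Y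
      \<longleftrightarrow> (f x, f y) \<in> orbit_equiv_rel \<Lambda> Z b"
begin

sublocale b: mp_flow \<Lambda> Z b
  by (rule mp_action_flow[OF action_\<Lambda>])

sublocale Z: prob_space Z
  using action_\<Lambda> by (simp add: mp_action_def)

abbreviation "SM \<equiv> stabilized_measure M"
abbreviation "NR \<equiv> normalized_restriction SM t Y"

lemma space_SM: "space SM = space M \<times> UNIV"
  by (simp add: stabilized_measure_def space_pair_measure)

lemma sets_NR: "S \<in> sets NR \<longleftrightarrow> S \<subseteq> Y \<and> S \<in> sets SM"
  by (rule sets_normalized_restriction[OF Y(1)])

lemma space_NR: "space NR = Y"
  by (rule space_normalized_restriction[OF Y(1)])

lemma emeasure_NR: "S \<subseteq> Y \<Longrightarrow> emeasure NR S = ennreal (1 / t) * emeasure SM S"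
  by (rule emeasure_normalized_restriction[OF Y(1)])

lemma A_sets: "A \<in> sets SM" and A_Y: "A \<subseteq> Y"
  using iso sets_NR by (auto simp: iso_mod_null_def)

lemma f_image:
  assumes "S \<in> sets SM" "S \<subseteq> A"
  shows "f ` S \<in> sets Z" "emeasure Z (f ` S) = ennreal (1 / t) * emeasure SM S"
  using iso_mod_null_image[OF iso, of S] assms A_Y sets_NR[of S] emeasure_NR[of S] by auto

lemma f_vimage: "E \<in> sets Z \<Longrightarrow> {p \<in> A. f p \<in> E} \<in> sets SM"
  using iso_mod_null_vimage(1)[OF iso] sets_NR by auto

lemma f_inj: "inj_on f A" and f_space: "p \<in> A \<Longrightarrow> f p \<in> space Z"
  using iso sets.sets_into_space[of B Z] by (auto simp: iso_mod_null_def bij_betw_def)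

lemma f_null:
  assumes "E \<in> null_sets Z"
  shows "{p \<in> A. f p \<in> E} \<in> null_sets SM"
proof -
  have E: "E \<in> sets Z" using assms by auto
  let ?S = "{p \<in> A. f p \<in> E}"
  have S: "?S \<in> sets SM" by (rule f_vimage[OF E])
  have "ennreal (1 / t) * emeasure SM ?S = emeasure Z (f ` ?S)"
    by (rule f_image(2)[symmetric, OF S]) auto
  also have "\<dots> \<le> emeasure Z E" using E by (intro emeasure_mono) auto
  also have "\<dots> = 0" using assms by auto
  finally have "emeasure SM ?S = 0" using t by auto
  then show ?thesis using S by auto
qed

lemma Y_diff_A: "Y - A \<in> null_sets SM"
proof -
  have S: "Y - A \<in> sets SM" using Y A_sets by auto
  have "emeasure NR (Y - A) = 0" using iso by (auto simp: iso_mod_null_def space_NR)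
  then have "emeasure SM (Y - A) = 0" using emeasure_NR[of "Y - A"] t by auto
  then show ?thesis using S by auto
qed

text \<open>Besides invariance and freeness at every point, the set carries an injection into the
  reals with measurable preimages. It makes sets on which two maps into \<open>Z\<close> agree
  measurable, as \<open>\<theta>_eq_sets\<close> requires.\<close>

definition "good_Z = (SOME F. F \<in> sets Z \<and> space Z - F \<in> null_sets Z \<and>
  (\<forall>l\<in>carrier \<Lambda>. \<forall>z\<in>F. b l z \<in> F \<and> (b l z = z \<longrightarrow> l = \<one>\<^bsub>\<Lambda>\<^esub>)) \<and>
  (\<exists>j :: 'z \<Rightarrow> real. inj_on j F \<and> (\<forall>T\<in>sets borel. {z \<in> F. j z \<in> T} \<in> sets Z)))"

lemma good_Z_exists: "good_Z \<in> sets Z \<and> space Z - good_Z \<in> null_sets Z \<and>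
  (\<forall>l\<in>carrier \<Lambda>. \<forall>z\<in>good_Z. b l z \<in> good_Z \<and> (b l z = z \<longrightarrow> l = \<one>\<^bsub>\<Lambda>\<^esub>)) \<and>
  (\<exists>j :: 'z \<Rightarrow> real. inj_on j good_Z \<and> (\<forall>T\<in>sets borel. {z \<in> good_Z. j z \<in> T} \<in> sets Z))"
proof -
  obtain D B' j where j: "iso_mod_null Z (restrict_space lborel {0..1::real}) D B' j"
    using std by (auto simp: standard_prob_space_def)
  have D: "D \<in> sets Z" "space Z - D \<in> null_sets Z" and inj: "inj_on j D"
    using j by (auto simp: iso_mod_null_def bij_betw_def)
  have "countable (carrier \<Lambda>)" by simp
  from b.free_conull_set[OF this free_\<Lambda> D]
  obtain F where F: "F \<in> sets Z" "F \<subseteq> D" "space Z - F \<in> null_sets Z"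
    and F_free: "\<forall>l\<in>carrier \<Lambda>. \<forall>z\<in>F. b l z \<in> F \<and> (b l z = z \<longrightarrow> l = \<one>\<^bsub>\<Lambda>\<^esub>)" by blast
  have "{z \<in> F. j z \<in> T} \<in> sets Z" if T: "T \<in> sets borel" for T
  proof -
    have "D = space (restrict_space Z D)" using sets.sets_into_space[OF D(1)] by (auto simp: space_restrict_space)
    have "j ` D \<subseteq> {0..1}"
      using j by (auto simp: iso_mod_null_def bij_betw_def sets_restrict_space_iff dest: sets.sets_into_space)
    then have "{z \<in> F. j z \<in> T} = F \<inter> {z \<in> D. j z \<in> T \<inter> {0..1}}"
      using F(2) unfolding image_subset_iff by blast
    also have "{z \<in> D. j z \<in> T \<inter> {0..1}} \<in> sets Z"
      by (rule iso_mod_null_vimage(1)[OF j]) (use T in \<open>auto simp: sets_restrict_space_iff\<close>)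
    then have "F \<inter> {z \<in> D. j z \<in> T \<inter> {0..1}} \<in> sets Z" using F(1) by auto
    finally show ?thesis .
  qed
  moreover have "inj_on j F" using inj F(2) by (rule inj_on_subset)
  ultimately have "\<exists>F. F \<in> sets Z \<and> space Z - F \<in> null_sets Z \<and>
    (\<forall>l\<in>carrier \<Lambda>. \<forall>z\<in>F. b l z \<in> F \<and> (b l z = z \<longrightarrow> l = \<one>\<^bsub>\<Lambda>\<^esub>)) \<and>
    (\<exists>j :: 'z \<Rightarrow> real. inj_on j F \<and> (\<forall>T\<in>sets borel. {z \<in> F. j z \<in> T} \<in> sets Z))"
    using F(1,3) F_free by blast
  then show ?thesis unfolding good_Z_def by (rule someI_ex)
qed

lemma good_Z: "good_Z \<in> sets Z" "space Z - good_Z \<in> null_sets Z"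
  and good_Z_inv: "l \<in> carrier \<Lambda> \<Longrightarrow> z \<in> good_Z \<Longrightarrow> b l z \<in> good_Z"
  and good_Z_free: "l \<in> carrier \<Lambda> \<Longrightarrow> z \<in> good_Z \<Longrightarrow> b l z = z \<Longrightarrow> l = \<one>\<^bsub>\<Lambda>\<^esub>"
  using good_Z_exists by auto

lemma good_Z_space: "z \<in> good_Z \<Longrightarrow> z \<in> space Z"
  using good_Z(1) by (auto dest: sets.sets_into_space)

lemma good_Z_free_eq:
  assumes "l \<in> carrier \<Lambda>" "m \<in> carrier \<Lambda>" "z \<in> good_Z" "b l z = b m z"
  shows "l = m"
proof -
  have z: "z \<in> space Z" by (rule good_Z_space[OF assms(3)])
  have "b (inv\<^bsub>\<Lambda>\<^esub> m \<otimes>\<^bsub>\<Lambda>\<^esub> l) z = b (inv\<^bsub>\<Lambda>\<^esub> m) (b m z)"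
    using assms z by (simp add: b.T_mult)
  also have "\<dots> = z" using assms z by (simp add: b.T_inv)
  finally have "inv\<^bsub>\<Lambda>\<^esub> m \<otimes>\<^bsub>\<Lambda>\<^esub> l = \<one>\<^bsub>\<Lambda>\<^esub>" using assms by (intro good_Z_free[OF _ assms(3)]) auto
  then show ?thesis using assms by (metis L.inv_comm L.inv_equality L.inv_inv L.inv_closed)
qed

definition "free_X = (SOME F. F \<in> sets M \<and> space M - F \<in> null_sets M \<and>
  (\<forall>g\<in>carrier \<Gamma>. \<forall>x\<in>F. \<alpha> g x \<in> F \<and> (\<alpha> g x = x \<longrightarrow> g = \<one>)))"

lemma free_X_exists: "free_X \<in> sets M \<and> space M - free_X \<in> null_sets M \<and>
  (\<forall>g\<in>carrier \<Gamma>. \<forall>x\<in>free_X. \<alpha> g x \<in> free_X \<and> (\<alpha> g x = x \<longrightarrow> g = \<one>))"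
proof -
  have "space M - space M \<in> null_sets M" by simp
  from A.free_conull_set[OF countable_\<Gamma> free_\<Gamma> sets.top this]
  have "\<exists>F. F \<in> sets M \<and> space M - F \<in> null_sets M \<and>
    (\<forall>g\<in>carrier \<Gamma>. \<forall>x\<in>F. \<alpha> g x \<in> F \<and> (\<alpha> g x = x \<longrightarrow> g = \<one>))" by blast
  then show ?thesis unfolding free_X_def by (rule someI_ex)
qed

lemma free_X: "free_X \<in> sets M" "space M - free_X \<in> null_sets M"
  and free_X_inv: "g \<in> carrier \<Gamma> \<Longrightarrow> x \<in> free_X \<Longrightarrow> \<alpha> g x \<in> free_X"
  and free_X_free: "g \<in> carrier \<Gamma> \<Longrightarrow> x \<in> free_X \<Longrightarrow> \<alpha> g x = x \<Longrightarrow> g = \<one>"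
  using free_X_exists by auto

lemma free_X_space: "x \<in> free_X \<Longrightarrow> x \<in> space M"
  using free_X(1) by (auto dest: sets.sets_into_space)

definition "A' = {p \<in> A. f p \<in> good_Z}"

lemma A'_sets: "A' \<in> sets SM"
  unfolding A'_def by (rule f_vimage[OF good_Z(1)])

lemma slice_A':
  shows "{x \<in> space M. (x, i) \<in> A'} \<in> sets M"
proof -
  have "(\<lambda>x. (x, i)) \<in> M \<rightarrow>\<^sub>M SM" unfolding stabilized_measure_def by (rule measurable_Pair2') simp
  from measurable_sets[OF this A'_sets] show ?thesis by (simp add: vimage_def Int_def conj_commute)
qed

lemma emeasure_slice_SM:
  assumes "S \<in> sets M"
  shows "S \<times> {i} \<in> sets SM" "emeasure SM (S \<times> {i}) = emeasure M S"
  using sets_stabilized_times[OF assms] emeasure_stabilized_times[OF assms, of "{i}"] by auto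

lemma A'_positive: "\<exists>i. emeasure M {x \<in> space M. (x, i) \<in> A'} > 0"
proof (rule ccontr)
  assume "\<not> ?thesis"
  then have z: "emeasure M {x \<in> space M. (x, i) \<in> A'} = 0" for i by (simp add: not_gr_zero)
  have "{x \<in> space M. (x, i) \<in> A'} \<times> {i} \<in> null_sets SM" for i
    using emeasure_slice_SM[OF slice_A'] z by auto
  then have "(\<Union>i. {x \<in> space M. (x, i) \<in> A'} \<times> {i}) \<in> null_sets SM" by auto
  moreover have "(\<Union>i. {x \<in> space M. (x, i) \<in> A'} \<times> {i}) = A'"
    using sets.sets_into_space[OF A'_sets] by (auto simp: space_SM)
  ultimately have 1: "A' \<in> null_sets SM" by simp
  have 2: "{p \<in> A. f p \<in> space Z - good_Z} \<in> null_sets SM" by (rule f_null[OF good_Z(2)])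
  have "Y \<subseteq> A' \<union> {p \<in> A. f p \<in> space Z - good_Z} \<union> (Y - A)"
    using f_space by (auto simp: A'_def)
  then have "Y \<in> null_sets SM"
    by (rule null_sets_subset[OF null_sets.Un[OF null_sets.Un[OF 1 2] Y_diff_A] Y(1)])
  then show False using Y(2) t by auto
qed

text \<open>\<open>\<theta>\<close> first moves a point along its orbit into the domain of \<open>f\<close>; the cocycle \<open>w\<close> below compares
  the two actions along \<open>\<theta>\<close>.\<close>

definition "pair k = from_nat_into (carrier \<Gamma> \<times> (UNIV :: nat set)) k"
definition "move k x = (\<alpha> (fst (pair k)) x, snd (pair k))"
definition "hit k = {x \<in> free_X. move k x \<in> A'}"
definition "X' = (\<Union>k. hit k)"
definition "pick x = (LEAST k. x \<in> hit k)"
definition "\<theta> x = f (move (pick x) x)"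

lemma pair_closed: "fst (pair k) \<in> carrier \<Gamma>"
  using from_nat_into[of "carrier \<Gamma> \<times> (UNIV :: nat set)" k] by (auto simp: pair_def mem_Times_iff)

lemma pair_surj:
  assumes "g \<in> carrier \<Gamma>"
  obtains k where "pair k = (g, i)"
  using from_nat_into_surj[of "carrier \<Gamma> \<times> (UNIV :: nat set)" "(g, i)"] countable_\<Gamma> assms
  by (auto simp: pair_def)

lemma move_meas: "move k \<in> M \<rightarrow>\<^sub>M SM"
  unfolding move_def stabilized_measure_def using A.T_meas[OF pair_closed] by measurable

lemma hit_sets: "hit k \<in> sets M"
proof -
  have "hit k = free_X \<inter> (move k -` A' \<inter> space M)" using free_X_space by (auto simp: hit_def)
  then show ?thesis using free_X(1) measurable_sets[OF move_meas A'_sets] by auto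
qed

lemma X'_sets: "X' \<in> sets M"
  unfolding X'_def using hit_sets by auto

lemma X'_free: "X' \<subseteq> free_X"
  by (auto simp: X'_def hit_def)

lemma X'_space: "x \<in> X' \<Longrightarrow> x \<in> space M"
  using X'_free free_X_space by blast

lemma X'_iff: "x \<in> X' \<longleftrightarrow> x \<in> free_X \<and> (\<exists>g\<in>carrier \<Gamma>. \<exists>i. (\<alpha> g x, i) \<in> A')"
proof
  assume "x \<in> X'"
  then show "x \<in> free_X \<and> (\<exists>g\<in>carrier \<Gamma>. \<exists>i. (\<alpha> g x, i) \<in> A')"
    using pair_closed by (auto simp: X'_def hit_def move_def)
next
  assume "x \<in> free_X \<and> (\<exists>g\<in>carrier \<Gamma>. \<exists>i. (\<alpha> g x, i) \<in> A')"
  then obtain g i where x: "x \<in> free_X" "g \<in> carrier \<Gamma>" "(\<alpha> g x, i) \<in> A'" by auto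
  obtain k where "pair k = (g, i)" using pair_surj[OF x(2)] .
  then have "x \<in> hit k" using x by (simp add: hit_def move_def)
  then show "x \<in> X'" by (auto simp: X'_def)
qed

lemma X'_inv:
  assumes h: "h \<in> carrier \<Gamma>" and x: "x \<in> X'"
  shows "\<alpha> h x \<in> X'"
proof -
  obtain g i where g: "g \<in> carrier \<Gamma>" "(\<alpha> g x, i) \<in> A'" using x by (auto simp: X'_iff)
  have "\<alpha> (g \<otimes> inv h) (\<alpha> h x) = \<alpha> g x"
    using g h X'_space[OF x] by (simp add: A.T_mult A.T_space A.T_inv)
  then have "(\<alpha> (g \<otimes> inv h) (\<alpha> h x), i) \<in> A'" using g by simp
  then show ?thesis
    using g h free_X_inv[OF h] X'_free x unfolding X'_iff by (metis inv_closed m_closed subsetD)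
qed

text \<open>The set is invariant, and up to a null set it contains a slice of \<open>A'\<close> of
  positive measure, so ergodicity of \<open>\<Gamma>0\<close> applies.\<close>

lemma X'_conull: "space M - X' \<in> null_sets M"
proof -
  have "\<alpha> g ` X' = X'" if g: "g \<in> \<Gamma>0" for g
  proof (intro equalityI subsetI)
    fix x assume x: "x \<in> X'"
    have gG: "g \<in> carrier \<Gamma>" using g \<Gamma>0_carrier by auto
    have "x = \<alpha> g (\<alpha> (inv g) x)" using X'_space[OF x] gG by (simp add: A.T_inv)
    then show "x \<in> \<alpha> g ` X'" using X'_inv[of "inv g" x] x gG by auto
  qed (use g \<Gamma>0_carrier X'_inv in auto)
  then have "emeasure M X' = 0 \<or> emeasure M (space M - X') = 0"
    using ergodic0 X'_sets by (auto simp: ergodic_action_def)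
  moreover have "emeasure M X' \<noteq> 0"
  proof
    assume 0: "emeasure M X' = 0"
    obtain i where i: "emeasure M {x \<in> space M. (x, i) \<in> A'} > 0" using A'_positive by blast
    have "{x \<in> space M. (x, i) \<in> A'} \<subseteq> X' \<union> (space M - free_X)"
    proof
      fix x assume x: "x \<in> {x \<in> space M. (x, i) \<in> A'}"
      have "x \<in> X'" if "x \<in> free_X"
        unfolding X'_iff using x that by (auto intro!: bexI[of _ \<one>] simp: A.T_one)
      then show "x \<in> X' \<union> (space M - free_X)" using x by auto
    qed
    moreover have "X' \<in> null_sets M" using 0 X'_sets by auto
    ultimately have "{x \<in> space M. (x, i) \<in> A'} \<in> null_sets M"
      using free_X(2) slice_A' by (meson null_sets.Un null_sets_subset)
    then show False using i by auto
  qed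
  ultimately show ?thesis using X'_sets by auto
qed

lemma pick: "x \<in> X' \<Longrightarrow> x \<in> hit (pick x)"
  unfolding pick_def X'_def by (auto intro: LeastI)

lemma move_A: "x \<in> X' \<Longrightarrow> move (pick x) x \<in> A"
  and \<theta>_good: "x \<in> X' \<Longrightarrow> \<theta> x \<in> good_Z"
  using pick[of x] by (auto simp: hit_def A'_def \<theta>_def)

lemma pick_sets: "{x \<in> X'. pick x = k} \<in> sets M"
proof -
  have "{x \<in> X'. pick x = k} = hit k - (\<Union>j<k. hit j)"
  proof (intro equalityI subsetI)
    fix x assume "x \<in> {x \<in> X'. pick x = k}"
    then have x: "x \<in> X'" "pick x = k" by auto
    have "x \<notin> hit j" if "j < k" for j
      using not_less_Least[of j "\<lambda>k. x \<in> hit k"] that x(2) unfolding pick_def by blast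
    then show "x \<in> hit k - (\<Union>j<k. hit j)" using pick[OF x(1)] x(2) by blast
  next
    fix x assume x: "x \<in> hit k - (\<Union>j<k. hit j)"
    then have "pick x = k" unfolding pick_def by (intro Least_equality) (auto intro: leI)
    moreover have "x \<in> X'" using x unfolding X'_def by blast
    ultimately show "x \<in> {x \<in> X'. pick x = k}" by blast
  qed
  then show ?thesis using hit_sets by auto
qed

lemma \<theta>_sets: "E \<in> sets Z \<Longrightarrow> {x \<in> X'. \<theta> x \<in> E} \<in> sets M"
proof -
  assume E: "E \<in> sets Z"
  have "{x \<in> X'. \<theta> x \<in> E} = (\<Union>k. {x \<in> X'. pick x = k} \<inter> (move k -` {p \<in> A. f p \<in> E} \<inter> space M))"
    using move_A X'_space by (auto simp: \<theta>_def)
  also have "\<dots> \<in> sets M"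
    using pick_sets measurable_sets[OF move_meas f_vimage[OF E]] by auto
  finally show ?thesis .
qed

text \<open>\<open>move\<close> changes a point only within its orbit and up to the copy index, so
  the hypothesis \<open>rel\<close> on points of \<open>A\<close> carries over to all of
  \<open>X'\<close>.\<close>

lemma orbit_\<theta>:
  assumes x: "x \<in> X'" and y: "y \<in> X'"
  shows "(\<exists>l\<in>carrier \<Lambda>. \<theta> y = b l (\<theta> x)) \<longleftrightarrow> (\<exists>g\<in>carrier \<Gamma>. y = \<alpha> g x)"
proof -
  define p where "p = fst (pair (pick x))"
  define r where "r = fst (pair (pick y))"
  have pr: "p \<in> carrier \<Gamma>" "r \<in> carrier \<Gamma>" by (simp_all add: p_def r_def pair_closed)
  have xy: "x \<in> space M" "y \<in> space M" using x y X'_space by auto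
  have "(\<exists>l\<in>carrier \<Lambda>. \<theta> y = b l (\<theta> x)) \<longleftrightarrow> (\<theta> x, \<theta> y) \<in> orbit_equiv_rel \<Lambda> Z b"
    using good_Z_space[OF \<theta>_good[OF x]] by (auto simp: orbit_equiv_rel_def)
  also have "\<dots> \<longleftrightarrow> (move (pick x) x, move (pick y) y) \<in> stabilization (orbit_equiv_rel \<Gamma> M \<alpha>) \<inter> Y \<times> Y"
    using rel move_A[OF x] move_A[OF y] by (simp add: \<theta>_def)
  also have "\<dots> \<longleftrightarrow> (\<exists>g\<in>carrier \<Gamma>. \<alpha> r y = \<alpha> g (\<alpha> p x))"
    using move_A[OF x] move_A[OF y] A_Y pr xy
    by (auto simp: stabilization_def orbit_equiv_rel_def move_def p_def r_def A.T_space)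
  also have "\<dots> \<longleftrightarrow> (\<exists>g\<in>carrier \<Gamma>. y = \<alpha> g x)"
  proof
    assume "\<exists>g\<in>carrier \<Gamma>. \<alpha> r y = \<alpha> g (\<alpha> p x)"
    then obtain g where g: "g \<in> carrier \<Gamma>" "\<alpha> r y = \<alpha> g (\<alpha> p x)" by blast
    have "y = \<alpha> (inv r) (\<alpha> r y)" using pr xy by (simp add: A.T_inv)
    also have "\<dots> = \<alpha> (inv r \<otimes> (g \<otimes> p)) x" using g pr xy by (simp add: A.T_mult A.T_space)
    finally show "\<exists>g\<in>carrier \<Gamma>. y = \<alpha> g x" using g pr by (intro bexI[of _ "inv r \<otimes> (g \<otimes> p)"]) auto
  next
    assume "\<exists>g\<in>carrier \<Gamma>. y = \<alpha> g x"
    then obtain g where g: "g \<in> carrier \<Gamma>" "y = \<alpha> g x" by blast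
    have "\<alpha> (r \<otimes> (g \<otimes> inv p)) (\<alpha> p x) = \<alpha> r y" using g pr xy by (simp add: A.T_mult A.T_space A.T_inv)
    then show "\<exists>g\<in>carrier \<Gamma>. \<alpha> r y = \<alpha> g (\<alpha> p x)" using g pr by (intro bexI[of _ "r \<otimes> (g \<otimes> inv p)"]) auto
  qed
  finally show ?thesis .
qed

text \<open>Off the invariant set \<open>X'\<close> the default value one keeps the cocycle identity
  valid at every point.\<close>

definition "w g x = (if x \<in> X' then (THE l. l \<in> carrier \<Lambda> \<and> \<theta> (\<alpha> g x) = b l (\<theta> x)) else \<one>\<^bsub>\<Lambda>\<^esub>)"

lemma w_eqI: "\<lbrakk>x \<in> X'; l \<in> carrier \<Lambda>; \<theta> (\<alpha> g x) = b l (\<theta> x)\<rbrakk> \<Longrightarrow> w g x = l"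
  unfolding w_def using good_Z_free_eq[OF _ _ \<theta>_good] by (auto intro!: the_equality)

lemma w:
  assumes "g \<in> carrier \<Gamma>" "x \<in> X'"
  shows "w g x \<in> carrier \<Lambda>" "\<theta> (\<alpha> g x) = b (w g x) (\<theta> x)"
proof -
  obtain l where l: "l \<in> carrier \<Lambda>" "\<theta> (\<alpha> g x) = b l (\<theta> x)"
    using orbit_\<theta>[OF assms(2) X'_inv[OF assms]] assms(1) by blast
  then have "w g x = l" by (intro w_eqI assms)
  then show "w g x \<in> carrier \<Lambda>" "\<theta> (\<alpha> g x) = b (w g x) (\<theta> x)" using l by auto
qed

lemma \<theta>_eq_sets:
  assumes g: "g \<in> carrier \<Gamma>" and l: "l \<in> carrier \<Lambda>"
  shows "{x \<in> X'. \<theta> (\<alpha> g x) = b l (\<theta> x)} \<in> sets M"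
proof -
  obtain j :: "'z \<Rightarrow> real" where inj: "inj_on j good_Z" and j: "\<And>T. T \<in> sets borel \<Longrightarrow> {z \<in> good_Z. j z \<in> T} \<in> sets Z"
    using good_Z_exists by blast
  define u where "u x = (if x \<in> X' then j (\<theta> (\<alpha> g x)) else 0)" for x
  define v where "v x = (if x \<in> X' then j (b l (\<theta> x)) else 0)" for x
  have meas: "(\<lambda>x. if x \<in> X' then j (h x) else 0) \<in> borel_measurable M"
    if h: "\<And>E. E \<in> sets Z \<Longrightarrow> {x \<in> X'. h x \<in> E} \<in> sets M" "\<And>x. x \<in> X' \<Longrightarrow> h x \<in> good_Z" for h
  proof (rule measurableI)
    fix T :: "real set" assume T: "T \<in> sets borel"
    have "(\<lambda>x. if x \<in> X' then j (h x) else 0) -` T \<inter> space M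
        = {x \<in> X'. h x \<in> {z \<in> good_Z. j z \<in> T}} \<union> (if 0 \<in> T then space M - X' else {})"
      using h(2) X'_space by (auto split: if_splits)
    then show "(\<lambda>x. if x \<in> X' then j (h x) else 0) -` T \<inter> space M \<in> sets M"
      using h(1)[OF j[OF T]] X'_sets by auto
  qed simp
  have [measurable]: "u \<in> borel_measurable M"
    unfolding u_def
  proof (rule meas)
    fix E assume "E \<in> sets Z"
    from measurable_sets[OF A.T_meas[OF g] \<theta>_sets[OF this]]
    have "X' \<inter> (\<alpha> g -` {x \<in> X'. \<theta> x \<in> E} \<inter> space M) \<in> sets M" using X'_sets by auto
    also have "X' \<inter> (\<alpha> g -` {x \<in> X'. \<theta> x \<in> E} \<inter> space M) = {x \<in> X'. \<theta> (\<alpha> g x) \<in> E}"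
      using X'_space X'_inv[OF g] by auto
    finally show "{x \<in> X'. \<theta> (\<alpha> g x) \<in> E} \<in> sets M" .
  qed (use X'_inv[OF g] \<theta>_good in auto)
  have [measurable]: "v \<in> borel_measurable M"
    unfolding v_def
  proof (rule meas)
    fix E assume "E \<in> sets Z"
    from \<theta>_sets[OF measurable_sets[OF b.T_meas[OF l] this]]
    show "{x \<in> X'. b l (\<theta> x) \<in> E} \<in> sets M"
      using \<theta>_good good_Z_space by (auto elim!: back_subst[of "\<lambda>S. S \<in> sets M"])
  qed (use good_Z_inv[OF l] \<theta>_good in auto)
  have "{x \<in> space M. u x = v x} \<inter> X' \<in> sets M" using X'_sets by measurable
  also have "{x \<in> space M. u x = v x} \<inter> X' = {x \<in> X'. \<theta> (\<alpha> g x) = b l (\<theta> x)}"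
    using inj_onD[OF inj] \<theta>_good X'_inv[OF g] good_Z_inv[OF l] X'_space by (auto simp: u_def v_def)
  finally show ?thesis .
qed

lemma cocycle: "profinite_cocycle \<Gamma> \<Gamma>0 Xs \<alpha>n q M \<alpha> \<Lambda> w"
proof (unfold_locales)
  show "countable (carrier \<Lambda>)" by simp
  fix g x assume g: "g \<in> carrier \<Gamma>" and x: "x \<in> space M"
  show "w g x \<in> carrier \<Lambda>" using w(1)[OF g] by (cases "x \<in> X'") (auto simp: w_def)
  fix h assume h: "h \<in> carrier \<Gamma>"
  show "w (g \<otimes> h) x = w g (\<alpha> h x) \<otimes>\<^bsub>\<Lambda>\<^esub> w h x"
  proof (cases "x \<in> X'")
    case True
    note hx = X'_inv[OF h True]
    have "\<theta> (\<alpha> (g \<otimes> h) x) = b (w g (\<alpha> h x)) (b (w h x) (\<theta> x))"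
      using g h x w(2)[OF g hx] w(2)[OF h True] by (simp add: A.T_mult)
    also have "\<dots> = b (w g (\<alpha> h x) \<otimes>\<^bsub>\<Lambda>\<^esub> w h x) (\<theta> x)"
      using w(1)[OF g hx] w(1)[OF h True] good_Z_space[OF \<theta>_good[OF True]] by (simp add: b.T_mult)
    finally show ?thesis using w(1)[OF g hx] w(1)[OF h True] by (intro w_eqI True) auto
  next
    case False
    have "\<alpha> h x \<notin> X'"
    proof
      assume "\<alpha> h x \<in> X'"
      from X'_inv[OF inv_closed[OF h] this] have "\<alpha> (inv h) (\<alpha> h x) \<in> X'" .
      then show False using False A.T_inv(2)[OF h x] by simp
    qed
    then show ?thesis using False by (simp add: w_def)
  qed
next
  fix g l assume g: "g \<in> carrier \<Gamma>" and l: "l \<in> carrier \<Lambda>"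
  have "{x \<in> space M. w g x = l}
      = {x \<in> X'. \<theta> (\<alpha> g x) = b l (\<theta> x)} \<union> (if l = \<one>\<^bsub>\<Lambda>\<^esub> then space M - X' else {})"
  proof -
    have "w g x = l \<longleftrightarrow> \<theta> (\<alpha> g x) = b l (\<theta> x)" if "x \<in> X'" for x
      using w(2)[OF g that] w_eqI[OF that l] by metis
    moreover have "w g x = \<one>\<^bsub>\<Lambda>\<^esub>" if "x \<notin> X'" for x using that by (simp add: w_def)
    ultimately show ?thesis using X'_space by (cases "l = \<one>\<^bsub>\<Lambda>\<^esub>") auto
  qed
  then show "{x \<in> space M. w g x = l} \<in> sets M" using \<theta>_eq_sets[OF g l] X'_sets by auto
qed

end

section \<open>The equivariant map on a cell\<close>

locale equivariant_cell = induced_amplification +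
  fixes n :: nat and a :: 'b and \<delta> :: "'a \<Rightarrow> nat" and \<psi> :: "(nat \<Rightarrow> 'b) \<Rightarrow> nat" and U :: "(nat \<Rightarrow> 'b) set"
  assumes n: "n \<ge> 1" and a: "a \<in> space (Xs n)"
    and U: "U \<in> sets M" "U \<subseteq> cell n a" "cell n a - U \<in> null_sets M"
    and \<delta>_closed: "g \<in> stab n a \<Longrightarrow> \<delta> g \<in> carrier \<Lambda>"
    and \<delta>_mult: "\<lbrakk>g \<in> stab n a; h \<in> stab n a\<rbrakk> \<Longrightarrow> \<delta> (g \<otimes> h) = \<delta> g \<otimes>\<^bsub>\<Lambda>\<^esub> \<delta> h"
    and \<psi>_closed: "x \<in> U \<Longrightarrow> \<psi> x \<in> carrier \<Lambda>"
    and \<psi>_sets: "l \<in> carrier \<Lambda> \<Longrightarrow> {x \<in> U. \<psi> x = l} \<in> sets M"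
    and U_inv: "\<lbrakk>g \<in> stab n a; x \<in> U\<rbrakk> \<Longrightarrow> \<alpha> g x \<in> U"
    and coh: "\<lbrakk>g \<in> stab n a; x \<in> U\<rbrakk> \<Longrightarrow> w g x \<otimes>\<^bsub>\<Lambda>\<^esub> \<psi> x = \<psi> (\<alpha> g x) \<otimes>\<^bsub>\<Lambda>\<^esub> \<delta> g"
begin

sublocale St: subgroup "stab n a" \<Gamma>
  by (rule stab_subgroup[OF n a])

definition "V = U \<inter> X'"

lemma V_sets: "V \<in> sets M"
  using U(1) X'_sets by (auto simp: V_def)

lemma V_U: "x \<in> V \<Longrightarrow> x \<in> U" and V_X': "x \<in> V \<Longrightarrow> x \<in> X'"
  and V_cell: "x \<in> V \<Longrightarrow> x \<in> cell n a" and V_space: "x \<in> V \<Longrightarrow> x \<in> space M"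
  using U(2) X'_space by (auto simp: V_def)

lemma V_inv: "g \<in> stab n a \<Longrightarrow> x \<in> V \<Longrightarrow> \<alpha> g x \<in> V"
  using U_inv X'_inv St.mem_carrier by (simp add: V_def)

lemma V_conull: "cell n a - V \<in> null_sets M"
proof (rule null_sets_subset[OF null_sets.Un[OF U(3) X'_conull]])
  show "cell n a - V \<in> sets M" using V_sets cell_sets[OF n] by auto
  show "cell n a - V \<subseteq> (cell n a - U) \<union> (space M - X')" using cell_subset by (auto simp: V_def)
qed

definition "\<tau> x = b (inv\<^bsub>\<Lambda>\<^esub> (\<psi> x)) (\<theta> x)"

lemma \<tau>_good: "x \<in> V \<Longrightarrow> \<tau> x \<in> good_Z"
  unfolding \<tau>_def using \<psi>_closed V_U \<theta>_good V_X' by (intro good_Z_inv) auto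

lemma \<theta>_\<tau>: "x \<in> V \<Longrightarrow> \<theta> x = b (\<psi> x) (\<tau> x)"
  unfolding \<tau>_def using \<psi>_closed V_U \<theta>_good V_X' good_Z_space by (simp add: b.T_inv)

lemma \<tau>_equivariant:
  assumes g: "g \<in> stab n a" and x: "x \<in> V"
  shows "\<tau> (\<alpha> g x) = b (\<delta> g) (\<tau> x)"
proof -
  have gG: "g \<in> carrier \<Gamma>" using g by (rule St.mem_carrier)
  note gx = V_inv[OF g x]
  have cl: "\<psi> x \<in> carrier \<Lambda>" "\<psi> (\<alpha> g x) \<in> carrier \<Lambda>" "\<delta> g \<in> carrier \<Lambda>" "w g x \<in> carrier \<Lambda>"
    using \<psi>_closed[OF V_U[OF x]] \<psi>_closed[OF V_U[OF gx]] \<delta>_closed[OF g] w(1)[OF gG V_X'[OF x]] .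
  have z: "\<tau> x \<in> space Z" using \<tau>_good[OF x] by (rule good_Z_space)
  have "\<tau> (\<alpha> g x) = b (inv\<^bsub>\<Lambda>\<^esub> (\<psi> (\<alpha> g x))) (b (w g x) (b (\<psi> x) (\<tau> x)))"
    unfolding \<tau>_def[of "\<alpha> g x"] w(2)[OF gG V_X'[OF x]] \<theta>_\<tau>[OF x] ..
  also have "\<dots> = b (inv\<^bsub>\<Lambda>\<^esub> (\<psi> (\<alpha> g x)) \<otimes>\<^bsub>\<Lambda>\<^esub> (w g x \<otimes>\<^bsub>\<Lambda>\<^esub> \<psi> x)) (\<tau> x)"
    using cl z by (simp add: b.T_mult b.T_space)
  also have "inv\<^bsub>\<Lambda>\<^esub> (\<psi> (\<alpha> g x)) \<otimes>\<^bsub>\<Lambda>\<^esub> (w g x \<otimes>\<^bsub>\<Lambda>\<^esub> \<psi> x) = \<delta> g"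
    unfolding coh[OF g V_U[OF x]] using cl by (simp add: L.m_assoc[symmetric])
  finally show ?thesis .
qed

text \<open>The images of \<open>x\<close> and \<open>y\<close> under \<open>\<theta>\<close> lie in
  one orbit, hence so do \<open>x\<close> and \<open>y\<close>. The connecting element stabilizes
  the cell that contains both, and freeness on \<open>good_Z\<close> identifies its value under
  \<open>\<delta>\<close>.\<close>

lemma \<tau>_orbit:
  assumes x: "x \<in> V" and y: "y \<in> V" and l: "l \<in> carrier \<Lambda>" and eq: "\<tau> y = b l (\<tau> x)"
  obtains g where "g \<in> stab n a" "y = \<alpha> g x" "\<delta> g = l"
proof -
  have cl: "\<psi> x \<in> carrier \<Lambda>" "\<psi> y \<in> carrier \<Lambda>" using \<psi>_closed V_U x y by auto
  have z: "\<theta> x \<in> space Z" using \<theta>_good[OF V_X'[OF x]] by (rule good_Z_space)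
  have "\<theta> y = b (\<psi> y) (b l (b (inv\<^bsub>\<Lambda>\<^esub> (\<psi> x)) (\<theta> x)))"
    unfolding \<theta>_\<tau>[OF y] eq by (simp add: \<tau>_def)
  also have "\<dots> = b (\<psi> y \<otimes>\<^bsub>\<Lambda>\<^esub> (l \<otimes>\<^bsub>\<Lambda>\<^esub> inv\<^bsub>\<Lambda>\<^esub> (\<psi> x))) (\<theta> x)"
    using cl l z by (simp add: b.T_mult b.T_space)
  finally obtain g where g: "g \<in> carrier \<Gamma>" "y = \<alpha> g x"
    using orbit_\<theta>[OF V_X'[OF x] V_X'[OF y]] cl l by blast
  have gS: "g \<in> stab n a" using V_cell[OF x] V_cell[OF y] g by (intro stab_cellI[OF n]) auto
  have "b (\<delta> g) (\<tau> x) = b l (\<tau> x)" using \<tau>_equivariant[OF gS x] eq g by simp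
  then have "\<delta> g = l" using good_Z_free_eq[OF \<delta>_closed[OF gS] l \<tau>_good[OF x]] by simp
  then show thesis using that gS g by blast
qed

text \<open>The pair of choices made at \<open>x\<close>. Where it is constant,
  \<open>\<tau>\<close> is \<open>f\<close> composed with fixed group elements on both sides, hence
  injective and scaling measure by \<open>1 / t\<close>; there are countably many such
  pieces.\<close>

definition "code x = prod_encode (pick x, \<psi> x)"
definition "piece m = {x \<in> V. code x = m}"

lemma piece_sets: "piece m \<in> sets M"
proof (cases "snd (prod_decode m) \<in> carrier \<Lambda>")
  case True
  have "piece m = {x \<in> X'. pick x = fst (prod_decode m)} \<inter> {x \<in> U. \<psi> x = snd (prod_decode m)}"
    by (auto simp: piece_def code_def V_def)
  then show ?thesis using pick_sets \<psi>_sets[OF True] by auto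
next
  case False
  then have "piece m = {}" using \<psi>_closed V_U by (auto simp: piece_def code_def)
  then show ?thesis by simp
qed

lemma piece_code: "x \<in> piece m \<Longrightarrow> pick x = fst (prod_decode m)" "x \<in> piece m \<Longrightarrow> \<psi> x = snd (prod_decode m)"
  by (auto simp: piece_def code_def)

lemma piece_label: "x \<in> piece m \<Longrightarrow> snd (prod_decode m) \<in> carrier \<Lambda>"
proof -
  assume x: "x \<in> piece m"
  then have "\<psi> x \<in> carrier \<Lambda>" using \<psi>_closed V_U by (simp add: piece_def)
  then show ?thesis unfolding piece_code(2)[OF x] .
qed

lemma \<tau>_piece:
  assumes "x \<in> piece m"
  shows "\<tau> x = b (inv\<^bsub>\<Lambda>\<^esub> (snd (prod_decode m))) (f (move (fst (prod_decode m)) x))"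
    "move (fst (prod_decode m)) x \<in> A"
  using move_A[of x] piece_code[OF assms] assms V_X' by (auto simp: \<tau>_def \<theta>_def piece_def)

lemma \<tau>_piece_inj: "inj_on \<tau> (piece m)"
proof (rule inj_onI)
  fix x y assume x: "x \<in> piece m" and y: "y \<in> piece m" and eq: "\<tau> x = \<tau> y"
  let ?l = "snd (prod_decode m)" and ?k = "fst (prod_decode m)"
  have l: "inv\<^bsub>\<Lambda>\<^esub> ?l \<in> carrier \<Lambda>" using piece_label[OF x] by simp
  have "f (move ?k x) = f (move ?k y)"
    using eq \<tau>_piece[OF x] \<tau>_piece[OF y] inj_onD[OF b.T_bij[OF l]] f_space by simp
  then have "move ?k x = move ?k y" using inj_onD[OF f_inj] \<tau>_piece(2)[OF x] \<tau>_piece(2)[OF y] by blast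
  then show "x = y"
    using inj_onD[OF A.T_bij[OF pair_closed[of ?k]]] x y V_space by (auto simp: move_def piece_def)
qed

lemma \<tau>_piece_measure:
  assumes S: "S \<in> sets M" "S \<subseteq> piece m"
  shows "\<tau> ` S \<in> sets Z" "emeasure Z (\<tau> ` S) = ennreal (1 / t) * emeasure M S"
proof -
  have "\<tau> ` S \<in> sets Z \<and> emeasure Z (\<tau> ` S) = ennreal (1 / t) * emeasure M S"
  proof (cases "S = {}")
    case False
    then obtain x where x: "x \<in> S" by blast
    let ?l = "snd (prod_decode m)" and ?k = "fst (prod_decode m)"
    let ?p = "fst (pair ?k)" and ?i = "snd (pair ?k)"
    have l: "inv\<^bsub>\<Lambda>\<^esub> ?l \<in> carrier \<Lambda>" using piece_label[of x m] x S by auto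
    have S1: "\<alpha> ?p ` S \<in> sets M" "emeasure M (\<alpha> ?p ` S) = emeasure M S"
      using A.T_image_sets[OF pair_closed S(1)] A.emeasure_T_image[OF pair_closed S(1)] by auto
    have mv: "move ?k ` S = (\<alpha> ?p ` S) \<times> {?i}" by (auto simp: move_def)
    have S2: "move ?k ` S \<in> sets SM" "emeasure SM (move ?k ` S) = emeasure M S"
      unfolding mv emeasure_slice_SM(2)[OF S1(1)] by (rule emeasure_slice_SM(1)[OF S1(1)], rule S1(2))
    have S2': "move ?k ` S \<subseteq> A" using \<tau>_piece(2) S(2) by blast
    note S3 = f_image[OF S2(1) S2']
    have "\<tau> ` S = b (inv\<^bsub>\<Lambda>\<^esub> ?l) ` f ` move ?k ` S"
      unfolding image_image using \<tau>_piece(1) S(2) by (intro image_cong refl) auto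
    then show ?thesis using b.T_image_sets[OF l S3(1)] b.emeasure_T_image[OF l S3(1)] S3(2) S2(2) by simp
  qed simp
  then show "\<tau> ` S \<in> sets Z" "emeasure Z (\<tau> ` S) = ennreal (1 / t) * emeasure M S" by auto
qed

text \<open>Injectivity on \<open>S\<close> keeps the images of the pieces disjoint, so the scaling
  on each piece adds up.\<close>

lemma \<tau>_measure:
  assumes S: "S \<in> sets M" "S \<subseteq> V" and inj: "inj_on \<tau> S"
  shows "\<tau> ` S \<in> sets Z" "emeasure Z (\<tau> ` S) = ennreal (1 / t) * emeasure M S"
proof -
  have P: "S \<inter> piece m \<in> sets M" for m using S piece_sets by auto
  have SU: "S = (\<Union>m. S \<inter> piece m)" using S(2) by (auto simp: piece_def)
  have \<tau>S: "\<tau> ` S = (\<Union>m. \<tau> ` (S \<inter> piece m))" by (subst SU) (simp only: image_UN)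
  have Q: "\<tau> ` (S \<inter> piece m) \<in> sets Z" "emeasure Z (\<tau> ` (S \<inter> piece m)) = ennreal (1 / t) * emeasure M (S \<inter> piece m)" for m
    using \<tau>_piece_measure[OF P] by auto
  show "\<tau> ` S \<in> sets Z" unfolding \<tau>S using Q by auto
  have disj: "disjoint_family (\<lambda>m. \<tau> ` (S \<inter> piece m))"
    unfolding disjoint_family_on_def
  proof (intro ballI impI)
    fix m k :: nat assume "m \<noteq> k"
    then have "S \<inter> piece m \<inter> (S \<inter> piece k) = {}" by (auto simp: piece_def)
    then show "\<tau> ` (S \<inter> piece m) \<inter> \<tau> ` (S \<inter> piece k) = {}"
      using inj_on_image_Int[OF inj, of "S \<inter> piece m" "S \<inter> piece k"] by simp
  qed
  have "emeasure Z (\<tau> ` S) = (\<Sum>m. emeasure Z (\<tau> ` (S \<inter> piece m)))"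
    unfolding \<tau>S using Q disj by (intro suminf_emeasure[symmetric]) auto
  also have "\<dots> = ennreal (1 / t) * (\<Sum>m. emeasure M (S \<inter> piece m))"
    unfolding Q by (rule ennreal_suminf_cmult)
  also have "(\<Sum>m. emeasure M (S \<inter> piece m)) = emeasure M (\<Union>m. S \<inter> piece m)"
    using P by (intro suminf_emeasure) (auto simp: disjoint_family_on_def piece_def)
  finally show "emeasure Z (\<tau> ` S) = ennreal (1 / t) * emeasure M S" using SU by simp
qed

definition "ker = {g \<in> stab n a. \<delta> g = \<one>\<^bsub>\<Lambda>\<^esub>}"

lemma \<delta>_one: "\<delta> \<one> = \<one>\<^bsub>\<Lambda>\<^esub>"
  using \<delta>_mult[of \<one> \<one>] \<delta>_closed[of \<one>] by (simp add: L.l_cancel_one')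

lemma ker_mult: "g \<in> ker \<Longrightarrow> h \<in> ker \<Longrightarrow> g \<otimes> h \<in> ker"
  by (simp add: ker_def \<delta>_mult)

lemma ker_inv: "g \<in> ker \<Longrightarrow> inv g \<in> ker"
  using \<delta>_mult[of g "inv g"] \<delta>_closed[of "inv g"] by (simp add: ker_def \<delta>_one)

lemma ker_carrier: "g \<in> ker \<Longrightarrow> g \<in> carrier \<Gamma>"
  by (auto simp: ker_def)

lemma \<tau>_ker: "g \<in> ker \<Longrightarrow> x \<in> V \<Longrightarrow> \<tau> (\<alpha> g x) = \<tau> x"
  using \<tau>_equivariant[of g x] good_Z_space[OF \<tau>_good[of x]] by (simp add: ker_def b.T_one)

lemma ker_V: "g \<in> ker \<Longrightarrow> x \<in> V \<Longrightarrow> \<alpha> g x \<in> V"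
  by (intro V_inv) (auto simp: ker_def)

text \<open>The points of least code in their \<open>ker\<close>-orbit form a fundamental domain, because \<open>\<tau>\<close> is
  constant on these orbits and injective on every piece.\<close>

lemma finite_ker: "finite ker"
proof (rule ccontr)
  assume inf: "infinite ker"
  define F where "F = {x \<in> V. \<forall>g\<in>ker. code x \<le> code (\<alpha> g x)}"
  have cnt: "countable ker" using countable_\<Gamma> by (rule countable_subset[rotated]) (auto dest: ker_carrier)
  have one: "\<one> \<in> ker" by (simp add: ker_def \<delta>_one)
  have F_sets: "F \<in> sets M"
  proof -
    have 1: "{x \<in> V. code x \<le> code (\<alpha> g x)} \<in> sets M" if g: "g \<in> ker" for g
    proof -
      have "{x \<in> V. code x \<le> code (\<alpha> g x)}
          = (\<Union>m. \<Union>k\<in>{m..}. piece m \<inter> (\<alpha> g -` piece k \<inter> space M))"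
        using ker_V[OF g] V_space by (auto simp: piece_def)
      also have "\<dots> \<in> sets M"
        by (intro sets.countable_UN'' sets.Int piece_sets measurable_sets[OF A.T_meas[OF ker_carrier[OF g]] piece_sets]) auto
      finally show ?thesis .
    qed
    have "F = (\<Inter>g\<in>ker. {x \<in> V. code x \<le> code (\<alpha> g x)})" using one by (auto simp: F_def)
    also have "\<dots> \<in> sets M" using 1 one cnt by (intro sets.countable_INT') auto
    finally show ?thesis .
  qed
  have F_V: "x \<in> F \<Longrightarrow> x \<in> V" for x by (simp add: F_def)
  have disj: "disjoint_family_on (\<lambda>g. \<alpha> g ` F) ker"
    unfolding disjoint_family_on_def
  proof (intro ballI impI)
    fix g h assume g: "g \<in> ker" and h: "h \<in> ker" and "g \<noteq> h"
    have gh: "g \<in> carrier \<Gamma>" "h \<in> carrier \<Gamma>" using g h ker_carrier by auto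
    show "\<alpha> g ` F \<inter> \<alpha> h ` F = {}"
    proof (rule ccontr)
      assume "\<alpha> g ` F \<inter> \<alpha> h ` F \<noteq> {}"
      then obtain x y where x: "x \<in> F" and y: "y \<in> F" and eq: "\<alpha> g x = \<alpha> h y" by blast
      have xs: "x \<in> space M" "y \<in> space M" using x y F_V V_space by auto
      have "\<alpha> (inv h \<otimes> g) x = \<alpha> (inv h) (\<alpha> h y)" using gh xs eq by (simp add: A.T_mult)
      then have yx: "y = \<alpha> (inv h \<otimes> g) x" using gh xs by (simp add: A.T_inv)
      have "\<alpha> (inv g \<otimes> h) y = \<alpha> (inv g) (\<alpha> g x)" using gh xs eq by (simp add: A.T_mult)
      then have xy: "x = \<alpha> (inv g \<otimes> h) y" using gh xs by (simp add: A.T_inv)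
      have k: "inv h \<otimes> g \<in> ker" "inv g \<otimes> h \<in> ker" using g h by (auto intro: ker_mult ker_inv)
      have "code x \<le> code y" using x k(1) yx by (auto simp: F_def)
      moreover have "code y \<le> code x" using y k(2) xy by (auto simp: F_def)
      ultimately have "code x = code y" by simp
      then have "x \<in> piece (code x)" "y \<in> piece (code x)" using x y F_V by (auto simp: piece_def)
      moreover have "\<tau> x = \<tau> y" using \<tau>_ker[OF k(1) F_V[OF x]] yx by simp
      ultimately have "x = y" using inj_onD[OF \<tau>_piece_inj] by blast
      then have "inv h \<otimes> g = \<one>"
        using yx x F_V V_X' X'_free k(1) ker_carrier by (intro free_X_free[of _ x]) auto
      then show False using gh \<open>g \<noteq> h\<close> by (metis inv_equality inv_inv inv_closed inv_comm)
    qed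
  qed
  have V_eq: "V = (\<Union>g\<in>ker. \<alpha> g ` F)"
  proof (intro equalityI subsetI)
    fix x assume x: "x \<in> V"
    define m where "m = (LEAST m. \<exists>g\<in>ker. code (\<alpha> g x) = m)"
    have "\<exists>m. \<exists>g\<in>ker. code (\<alpha> g x) = m" using one by blast
    then have "\<exists>g\<in>ker. code (\<alpha> g x) = m" unfolding m_def by (rule LeastI_ex)
    then obtain g where g: "g \<in> ker" "code (\<alpha> g x) = m" by blast
    have gG: "g \<in> carrier \<Gamma>" using g ker_carrier by auto
    have "m \<le> code (\<alpha> h (\<alpha> g x))" if h: "h \<in> ker" for h
    proof -
      have "\<alpha> h (\<alpha> g x) = \<alpha> (h \<otimes> g) x" using h gG V_space[OF x] ker_carrier by (simp add: A.T_mult)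
      then show ?thesis unfolding m_def using ker_mult[OF h g(1)] by (intro Least_le) auto
    qed
    then have "\<alpha> g x \<in> F" using g ker_V[OF g(1) x] by (auto simp: F_def)
    moreover have "x = \<alpha> (inv g) (\<alpha> g x)" using gG V_space[OF x] by (simp add: A.T_inv)
    ultimately show "x \<in> (\<Union>g\<in>ker. \<alpha> g ` F)" using ker_inv[OF g(1)] by blast
  qed (use ker_V F_V in auto)
  \<comment> \<open>\<open>V\<close> is the disjoint union of the translates of \<open>F\<close>
    under \<open>ker\<close>, all of the same measure. Infinitely many of them in a finite measure
    force \<open>F\<close>, and with it \<open>V\<close>, to be null, but \<open>V\<close> is conull
    in a cell.\<close>
  have "emeasure M V = (\<integral>\<^sup>+g. emeasure M (\<alpha> g ` F) \<partial>count_space ker)"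
    unfolding V_eq using cnt disj A.T_image_sets[OF ker_carrier F_sets]
    by (intro emeasure_UN_countable) auto
  also have "\<dots> = (\<integral>\<^sup>+g. emeasure M F \<partial>count_space ker)"
    by (intro nn_integral_cong) (simp add: A.emeasure_T_image[OF ker_carrier F_sets])
  also have "\<dots> = emeasure M F * \<infinity>" using inf by simp
  finally have "emeasure M V = emeasure M F * \<infinity>" .
  moreover have "emeasure M V \<noteq> \<infinity>" by simp
  ultimately have "emeasure M V = 0" by (cases "emeasure M F = 0") (auto simp: ennreal_mult_top)
  moreover have "emeasure M (cell n a) \<le> emeasure M V + emeasure M (cell n a - V)"
    using emeasure_subadditive[OF V_sets, of "cell n a - V"] V_sets cell_sets[OF n, of a] V_cell
    by (metis Un_Diff_cancel Un_absorb1 sets.Diff subsetI)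
  ultimately have "emeasure M (cell n a) = 0" using V_conull by auto
  then show False using measure_cell_pos[OF n a] by (simp add: measure_def)
qed

theorem amplification_value: "\<exists>m k. m \<ge> 1 \<and> k \<ge> 1 \<and> t = real m / real (card_X k)"
proof -
  have "V \<noteq> {}"
  proof
    assume "V = {}"
    then have "emeasure M (cell n a) = 0" using V_conull by auto
    then show False using measure_cell_pos[OF n a] by (simp add: measure_def)
  qed
  then obtain x0 where x0: "x0 \<in> V" by blast
  have x0s: "x0 \<in> space M" by (rule V_space[OF x0])
  \<comment> \<open>A nontrivial element of \<open>ker\<close> moves \<open>x0\<close>, and some
    coordinate detects it. As \<open>ker\<close> is finite, one level \<open>N\<close> detects all
    of them, so that \<open>ker\<close> meets the stabilizer of the smaller cell trivially.\<close>
  have "\<exists>k\<ge>1. \<alpha> g x0 k \<noteq> x0 k" if g: "g \<in> ker" "g \<noteq> \<one>" for g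
  proof (rule ccontr)
    assume "\<not> ?thesis"
    then have "\<alpha> g x0 = x0" using x0s ker_carrier[OF g(1)] by (intro M_eqI) (auto intro: A.T_space)
    then show False using free_X_free[OF ker_carrier[OF g(1)], of x0] g(2) x0 V_X' X'_free by auto
  qed
  then obtain lev where lev: "\<And>g. g \<in> ker \<Longrightarrow> g \<noteq> \<one> \<Longrightarrow> lev g \<ge> 1 \<and> \<alpha> g x0 (lev g) \<noteq> x0 (lev g)" by metis
  \<comment> \<open>Inserting \<open>n\<close> makes the new cell a part of the old one.\<close>
  define N where "N = Max (insert n (lev ` ker))"
  have N: "n \<le> N" "\<And>g. g \<in> ker \<Longrightarrow> lev g \<le> N" using finite_ker by (auto simp: N_def)
  have N1: "N \<ge> 1" using N(1) n by simp
  define a' where "a' = x0 N"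
  have a': "a' \<in> space (Xs N)" unfolding a'_def by (rule coordinate_space[OF N1 x0s])
  have x0c: "x0 \<in> cell N a'" using x0s by (simp add: cell_def a'_def)
  have x0n: "x0 n = a" using V_cell[OF x0] by (simp add: cell_def)
  have cell_sub: "cell N a' \<subseteq> cell n a"
    using refine[OF _ x0s _ n N(1)] x0n by (auto simp: cell_def a'_def)
  have stab_carrier: "g \<in> carrier \<Gamma>" if "g \<in> stab N a'" for g
    using that by (rule subgroup.mem_carrier[OF stab_subgroup[OF N1 a']])
  have stab_sub: "g \<in> stab n a" if "g \<in> stab N a'" for g
    using stab_cell[OF N1 that x0c] cell_sub x0c by (intro stab_cellI[OF n stab_carrier[OF that], of x0]) auto
  have ker_triv: "g = \<one>" if "g \<in> ker" "g \<in> stab N a'" for g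
  proof (rule ccontr)
    assume ne: "g \<noteq> \<one>"
    have "\<alpha> g x0 N = x0 N" using stab_cell[OF N1 that(2) x0c] by (simp add: cell_def a'_def)
    then have "\<alpha> g x0 (lev g) = x0 (lev g)"
      using refine[OF A.T_space[OF ker_carrier[OF that(1)] x0s] x0s] lev[OF that(1) ne] N(2)[OF that(1)] by blast
    then show False using lev[OF that(1) ne] by simp
  qed
  define V' where "V' = V \<inter> cell N a'"
  have V'_sets: "V' \<in> sets M" using V_sets cell_sets[OF N1] by (auto simp: V'_def)
  have V'_V: "V' \<subseteq> V" by (auto simp: V'_def)
  have V'_inv: "\<alpha> g x \<in> V'" if "g \<in> stab N a'" "x \<in> V'" for g x
    using that V_inv[OF stab_sub] stab_cell[OF N1] by (auto simp: V'_def)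
  have orbit': "\<exists>g\<in>stab N a'. y = \<alpha> g x \<and> \<delta> g = l"
    if o: "x \<in> V'" "y \<in> V'" "l \<in> carrier \<Lambda>" "\<tau> y = b l (\<tau> x)" for x y l
  proof -
    have xy: "x \<in> V" "y \<in> V" using o by (auto simp: V'_def)
    obtain g where g: "g \<in> stab n a" "y = \<alpha> g x" "\<delta> g = l" using \<tau>_orbit[OF xy o(3,4)] .
    then have "g \<in> stab N a'" using o(1,2) by (intro stab_cellI[OF N1, of g x]) (auto simp: V'_def)
    then show ?thesis using g by blast
  qed
  have inj: "inj_on \<tau> V'"
  proof (rule inj_onI)
    fix x y assume x: "x \<in> V'" and y: "y \<in> V'" and "\<tau> x = \<tau> y"
    then have "\<tau> y = b \<one>\<^bsub>\<Lambda>\<^esub> (\<tau> x)" using good_Z_space[OF \<tau>_good, of x] V'_V by (auto simp: b.T_one)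
    then obtain g where g: "g \<in> stab N a'" "y = \<alpha> g x" "\<delta> g = \<one>\<^bsub>\<Lambda>\<^esub>" using orbit'[OF x y] by auto
    then have "g = \<one>" using stab_sub by (intro ker_triv) (auto simp: ker_def)
    then show "x = y" using g x V'_V V_space by (auto simp: A.T_one)
  qed
  define c where "c = 1 / real (card_X N)"
  have c: "c > 0" using card_X_pos[OF N1] by (simp add: c_def)
  have "cell N a' - V' \<in> null_sets M"
    by (rule null_sets_subset[OF V_conull]) (use V'_sets cell_sets[OF N1] cell_sub in \<open>auto simp: V'_def\<close>)
  then have "M.prob (cell N a' - V') = 0" by (simp add: null_sets_def measure_def)
  moreover have "M.prob (cell N a' - V') = M.prob (cell N a') - M.prob V'"
    using V'_sets cell_sets[OF N1] by (intro M.finite_measure_Diff) (auto simp: V'_def)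
  ultimately have prob_V': "M.prob V' = c" using measure_cell[OF N1 a'] by (simp add: c_def)
  define D where "D = \<tau> ` V'"
  have D: "D \<in> sets Z" and "emeasure Z D = ennreal (1 / t) * emeasure M V'"
    unfolding D_def using \<tau>_measure[OF V'_sets V'_V inj] by auto
  then have eD: "emeasure Z D = ennreal (c / t)"
    using t c by (simp add: M.emeasure_eq_measure prob_V' ennreal_mult[symmetric])
  have D_good: "z \<in> D \<Longrightarrow> z \<in> good_Z" for z using \<tau>_good V'_V by (auto simp: D_def)
  have D_space: "D \<subseteq> space Z" using D by (rule sets.sets_into_space)
  \<comment> \<open>If the translates meet, \<open>inv k \<otimes> l\<close>, formed in
    \<open>\<Lambda>\<close>, is \<open>\<delta> g\<close> for some \<open>g\<close> in the
    stabilizer of the smaller cell. Equivariance then turns invariance of \<open>V'\<close> under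
    \<open>g\<close> into invariance of \<open>D\<close> under \<open>\<delta> g\<close>.\<close>
  have same: "b l ` D = b k ` D" if l: "l \<in> carrier \<Lambda>" and k: "k \<in> carrier \<Lambda>" and ne: "b l ` D \<inter> b k ` D \<noteq> {}" for l k
  proof -
    obtain x y where x: "x \<in> V'" and y: "y \<in> V'" and eq: "b l (\<tau> x) = b k (\<tau> y)" using ne by (auto simp: D_def)
    have z: "\<tau> x \<in> space Z" "\<tau> y \<in> space Z" using x y D_space by (auto simp: D_def)
    have "b (inv\<^bsub>\<Lambda>\<^esub> k \<otimes>\<^bsub>\<Lambda>\<^esub> l) (\<tau> x) = b (inv\<^bsub>\<Lambda>\<^esub> k) (b k (\<tau> y))" using l k z eq by (simp add: b.T_mult)
    also have "\<dots> = \<tau> y" using k z by (simp add: b.T_inv)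
    finally obtain g where g: "g \<in> stab N a'" "\<delta> g = inv\<^bsub>\<Lambda>\<^esub> k \<otimes>\<^bsub>\<Lambda>\<^esub> l"
      using orbit'[OF x y, of "inv\<^bsub>\<Lambda>\<^esub> k \<otimes>\<^bsub>\<Lambda>\<^esub> l"] l k by auto
    have "b (\<delta> g) ` D = \<tau> ` \<alpha> g ` V'"
      unfolding D_def image_image using V'_V stab_sub[OF g(1)]
      by (intro image_cong refl) (auto simp: \<tau>_equivariant)
    also have "\<alpha> g ` V' = V'"
    proof (intro equalityI subsetI)
      fix x assume x: "x \<in> V'"
      have gG: "g \<in> carrier \<Gamma>" using g(1) by (rule stab_carrier)
      have "inv g \<in> stab N a'" using g(1) by (rule subgroup.m_inv_closed[OF stab_subgroup[OF N1 a']])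
      then have "\<alpha> (inv g) x \<in> V'" using x by (rule V'_inv)
      moreover have "x = \<alpha> g (\<alpha> (inv g) x)" using gG x V'_V V_space by (auto simp: A.T_inv)
      ultimately show "x \<in> \<alpha> g ` V'" by blast
    qed (use V'_inv[OF g(1)] in auto)
    finally have gD: "b (\<delta> g) ` D = D" by (simp add: D_def)
    have "l = k \<otimes>\<^bsub>\<Lambda>\<^esub> \<delta> g" using l k g(2) by (simp add: L.m_assoc[symmetric])
    then have "b l ` D = b k ` b (\<delta> g) ` D"
      using k l g(2) by (simp add: b.T_image_mult D_space)
    then show ?thesis by (simp add: gD)
  qed
  \<comment> \<open>The family is indexed by the sets themselves because different group elements
    can give the same translate; its cardinality is the numerator \<open>m\<close>.\<close>
  define \<D> where "\<D> = (\<lambda>l. b l ` D) ` carrier \<Lambda>"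
  have \<D>_sets: "E \<in> sets Z" and \<D>_measure: "emeasure Z E = ennreal (c / t)" if "E \<in> \<D>" for E
    using that b.T_image_sets[OF _ D] b.emeasure_T_image[OF _ D] eD by (auto simp: \<D>_def)
  have cnt: "countable \<D>" unfolding \<D>_def by (intro countable_image countableI_type)
  have disj: "disjoint_family_on (\<lambda>E. E) \<D>"
    using same by (auto simp: disjoint_family_on_def \<D>_def)
  define W where "W = (\<Union>l\<in>carrier \<Lambda>. b l ` D)"
  have WU: "W = (\<Union>E\<in>\<D>. E)" by (auto simp: W_def \<D>_def)
  have W: "W \<in> sets Z" unfolding WU using cnt \<D>_sets by (intro sets.countable_UN'') auto
  have "b l ` W = W" if "l \<in> carrier \<Lambda>" for l
    unfolding W_def using that by (rule b.orbit_union_invariant[OF L.subgroup_self D_space])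
  then have "emeasure Z W = 0 \<or> emeasure Z (space Z - W) = 0"
    using ergodic_\<Lambda> W by (auto simp: ergodic_action_def)
  moreover have "emeasure Z W \<noteq> 0"
  proof
    assume 0: "emeasure Z W = 0"
    have "b \<one>\<^bsub>\<Lambda>\<^esub> ` D \<subseteq> W" unfolding W_def by blast
    then have "emeasure Z (b \<one>\<^bsub>\<Lambda>\<^esub> ` D) \<le> emeasure Z W" using W by (rule emeasure_mono)
    then have "ennreal (c / t) \<le> 0" using 0 b.emeasure_T_image[OF L.one_closed D] eD by simp
    then show False using c t by (simp add: ennreal_eq_0_iff divide_le_0_iff)
  qed
  ultimately have "emeasure Z (space Z - W) = 0" by blast
  then have "emeasure Z W = 1"
    using emeasure_compl[OF W] W Z.emeasure_space_1 Z.prob_compl[OF W] by (simp add: Z.emeasure_eq_measure)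
  moreover have "emeasure Z W = (\<integral>\<^sup>+E. emeasure Z E \<partial>count_space \<D>)"
    unfolding WU using cnt disj \<D>_sets by (intro emeasure_UN_countable) auto
  moreover have "\<dots> = (\<integral>\<^sup>+E. ennreal (c / t) \<partial>count_space \<D>)"
    by (intro nn_integral_cong) (simp add: \<D>_measure)
  ultimately have total: "ennreal (c / t) * emeasure (count_space \<D>) \<D> = 1"
    by simp
  have fin: "finite \<D>"
  proof (rule ccontr)
    assume "infinite \<D>"
    then have "ennreal (c / t) * \<infinity> = 1" using total by simp
    then show False using c t by (auto simp: ennreal_mult_top)
  qed
  have "ennreal (c / t * real (card \<D>)) = 1"
    using total fin c t by (subst ennreal_mult) (auto simp: ennreal_of_nat_eq_real_of_nat)
  then have 1: "c / t * real (card \<D>) = 1" unfolding ennreal_eq_1 .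
  then have "t = real (card \<D>) * c" using t by (simp add: field_simps)
  then have "t = real (card \<D>) / real (card_X N)" by (simp add: c_def)
  moreover have "card \<D> \<ge> 1" using 1 by (cases "card \<D> = 0") auto
  ultimately show ?thesis using N1 by blast
qed

end

lemma (in induced_amplification) amplification_value:
  assumes relT: "relative_property_T \<Gamma> \<Gamma>0" and fg: "finitely_generated_group (\<Gamma> Mod \<Gamma>0)"
  shows "\<exists>m k. m \<ge> 1 \<and> k \<ge> 1 \<and> t = real m / real (card_X k)"
proof -
  interpret W: profinite_cocycle \<Gamma> \<Gamma>0 Xs \<alpha>n q M \<alpha> \<Lambda> w by (rule cocycle)
  show ?thesis
  proof (rule W.cocycle_superrigidity[OF relT fg])
    fix n a \<delta> \<psi> U
    assume "n \<ge> 1" "a \<in> space (Xs n)" "U \<in> sets M" "U \<subseteq> cell n a" "cell n a - U \<in> null_sets M"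
      "\<And>g. g \<in> stab n a \<Longrightarrow> \<delta> g \<in> carrier \<Lambda>"
      "\<And>g h. \<lbrakk>g \<in> stab n a; h \<in> stab n a\<rbrakk> \<Longrightarrow> \<delta> (g \<otimes> h) = \<delta> g \<otimes>\<^bsub>\<Lambda>\<^esub> \<delta> h"
      "\<And>x. x \<in> U \<Longrightarrow> \<psi> x \<in> carrier \<Lambda>"
      "\<And>l. l \<in> carrier \<Lambda> \<Longrightarrow> {x \<in> U. \<psi> x = l} \<in> sets M"
      "\<And>g x. g \<in> stab n a \<Longrightarrow> x \<in> U \<Longrightarrow> \<alpha> g x \<in> U"
      "\<And>g x. g \<in> stab n a \<Longrightarrow> x \<in> U \<Longrightarrow> w g x \<otimes>\<^bsub>\<Lambda>\<^esub> \<psi> x = \<psi> (\<alpha> g x) \<otimes>\<^bsub>\<Lambda>\<^esub> \<delta> g"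
    then interpret E: equivariant_cell \<Gamma> \<Gamma>0 Xs \<alpha>n q M \<alpha> \<Lambda> Z b t Y A B f n a \<delta> \<psi> U
      by unfold_locales
    show ?thesis by (rule E.amplification_value)
  qed
qed

section \<open>Transport to the unit interval\<close>

lemma iso_mod_nullI:
  assumes A: "A \<in> sets M" "space M - A \<in> null_sets M" and B: "B \<in> sets N" "space N - B \<in> null_sets N"
    and bij: "bij_betw f A B"
    and vim: "\<And>E. E \<in> sets N \<Longrightarrow> E \<subseteq> B \<Longrightarrow> {x \<in> A. f x \<in> E} \<in> sets M \<and> emeasure M {x \<in> A. f x \<in> E} = emeasure N E"
    and img: "\<And>S. S \<in> sets M \<Longrightarrow> S \<subseteq> A \<Longrightarrow> f ` S \<in> sets N"
  shows "iso_mod_null M N A B f"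
proof -
  have AM: "A \<inter> space M = A" "B \<inter> space N = B" using A(1) B(1) by (auto dest: sets.sets_into_space)
  let ?A = "restrict_space M A" and ?B = "restrict_space N B"
  have sp: "space ?A = A" "space ?B = B" by (simp_all add: space_restrict_space AM)
  have sA: "S \<in> sets ?A \<longleftrightarrow> S \<subseteq> A \<and> S \<in> sets M" for S using A(1) by (simp add: sets_restrict_space_iff AM)
  have sB: "S \<in> sets ?B \<longleftrightarrow> S \<subseteq> B \<and> S \<in> sets N" for S using B(1) by (simp add: sets_restrict_space_iff AM)
  have eA: "emeasure ?A S = emeasure M S" if "S \<subseteq> A" for S
    using A(1) that by (simp add: emeasure_restrict_space AM)
  have eB: "emeasure ?B S = emeasure N S" if "S \<subseteq> B" for S
    using B(1) that by (simp add: emeasure_restrict_space AM)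
  have fB: "f x \<in> B" if "x \<in> A" for x using bij that by (auto simp: bij_betw_def)
  have vim_eq: "f -` E \<inter> A = {x \<in> A. f x \<in> E}" for E by auto
  have f: "f \<in> ?A \<rightarrow>\<^sub>M ?B"
    by (rule measurableI) (auto simp: sp sA sB fB vim_eq vim)
  have "distr ?A ?B f = ?B"
  proof (rule measure_eqI)
    fix E assume "E \<in> sets (distr ?A ?B f)"
    then have E: "E \<in> sets ?B" by simp
    then have E': "E \<subseteq> B" "E \<in> sets N" by (auto simp: sB)
    show "emeasure (distr ?A ?B f) E = emeasure ?B E"
      using vim[OF E'(2,1)] E' by (simp add: emeasure_distr[OF f E] sp vim_eq eA eB)
  qed simp
  moreover
  let ?g = "inv_into A f"
  have g_vim: "?g -` S \<inter> B = f ` S" if "S \<subseteq> A" for S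
    using that bij by (auto simp: bij_betw_def image_iff inv_into_f_f f_inv_into_f inv_into_into subset_eq intro!: bexI[of _ "?g _"])
  have gA: "?g y \<in> A" if "y \<in> B" for y using bij that by (auto simp: bij_betw_def inv_into_into)
  have img_B: "f ` S \<subseteq> B" if "S \<subseteq> A" for S using that fB by auto
  have g: "?g \<in> ?B \<rightarrow>\<^sub>M ?A"
    by (rule measurableI) (auto simp: sp sA sB gA g_vim img fB)
  have "distr ?B ?A ?g = ?A"
  proof (rule measure_eqI)
    fix S assume "S \<in> sets (distr ?B ?A ?g)"
    then have S: "S \<in> sets ?A" by simp
    then have S': "S \<subseteq> A" "S \<in> sets M" by (auto simp: sA)
    have "{x \<in> A. f x \<in> f ` S} = S" using S' bij by (auto simp: bij_betw_def inj_on_def)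
    then show "emeasure (distr ?B ?A ?g) S = emeasure ?A S"
      using vim[OF img[OF S'(2,1)] img_B[OF S'(1)]] S'
      by (simp add: emeasure_distr[OF g S] sp g_vim eA eB img_B)
  qed simp
  ultimately show ?thesis
    unfolding iso_mod_null_def measure_preserving_def using A B bij f g by auto
qed

abbreviation "unit_interval \<equiv> restrict_space lborel {0..1::real}"

lemma prob_space_unit_interval: "prob_space unit_interval"
  by (rule prob_spaceI) (simp add: emeasure_restrict_space space_restrict_space)

lemma standard_unit_interval: "standard_prob_space unit_interval"
  unfolding standard_prob_space_def
proof (intro exI)
  show "iso_mod_null unit_interval unit_interval (space unit_interval) (space unit_interval) (\<lambda>x. x)"
  proof (rule iso_mod_nullI)
    fix E assume "E \<in> sets unit_interval"
    then have "{x \<in> space unit_interval. x \<in> E} = E" using sets.sets_into_space by blast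
    then show "{x \<in> space unit_interval. x \<in> E} \<in> sets unit_interval \<and>
      emeasure unit_interval {x \<in> space unit_interval. x \<in> E} = emeasure unit_interval E"
      using \<open>E \<in> sets unit_interval\<close> by simp
  qed (auto simp: bij_betw_def sets_restrict_space_iff space_restrict_space)
qed

text \<open>The distribution function of the image measure is continuous, and the quantile function is a
  measurable right inverse of it.\<close>

lemma standard_prob_space_atomless:
  fixes j :: "'a \<Rightarrow> real"
  assumes N: "prob_space N" and A: "A \<in> sets N" "space N - A \<in> null_sets N" and inj: "inj_on j A"
    and meas: "\<And>T. T \<in> sets borel \<Longrightarrow> {x \<in> A. j x \<in> T} \<in> sets N"
    and img: "\<And>S. S \<in> sets N \<Longrightarrow> S \<subseteq> A \<Longrightarrow> j ` S \<in> sets borel"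
    and atomless: "\<And>x. x \<in> A \<Longrightarrow> emeasure N {x} = 0"
  shows "\<exists>A B f. iso_mod_null N unit_interval A B f"
proof -
  interpret N: prob_space N by (rule N)
  \<comment> \<open>Extends \<open>j\<close> by 0 off \<open>A\<close>; as the complement of
    \<open>A\<close> is null, this does not affect the image measure \<open>\<rho>\<close>.\<close>
  define k where "k x = (if x \<in> A then j x else 0)" for x
  have AN: "A \<subseteq> space N" using A(1) by (rule sets.sets_into_space)
  have k_vim: "k -` T \<inter> space N = {x \<in> A. j x \<in> T} \<union> (if 0 \<in> T then space N - A else {})" for T
    using AN by (auto simp: k_def split: if_splits)
  have k[measurable]: "k \<in> borel_measurable N"
  proof (rule measurableI)
    fix T :: "real set" assume "T \<in> sets borel"
    then show "k -` T \<inter> space N \<in> sets N" unfolding k_vim using meas A by auto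
  qed simp
  define \<rho> where "\<rho> = distr N borel k"
  have \<rho>_eq: "emeasure \<rho> T = emeasure N {x \<in> A. j x \<in> T}" if T: "T \<in> sets borel" for T
  proof -
    have "emeasure \<rho> T = emeasure N ({x \<in> A. j x \<in> T} \<union> (if 0 \<in> T then space N - A else {}))"
      unfolding \<rho>_def using T by (simp add: emeasure_distr k_vim)
    also have "\<dots> = emeasure N {x \<in> A. j x \<in> T}"
      using A(2) meas[OF T] by (auto intro!: emeasure_Un_null_set)
    finally show ?thesis .
  qed
  interpret \<rho>: prob_space \<rho> unfolding \<rho>_def by (rule N.prob_space_distr) simp
  interpret \<rho>: cdf_distribution \<rho>
    by (intro cdf_distribution.intro real_distribution.intro \<rho>.prob_space_axioms real_distribution_axioms.intro)
      (simp_all add: \<rho>_def)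
  define F where "F = cdf \<rho>"
  define I where "I \<omega> = Inf {x. \<omega> \<le> F x}" for \<omega>
  have singleton: "emeasure \<rho> {r} = 0" for r
  proof (cases "\<exists>x\<in>A. j x = r")
    case True
    then obtain x where "x \<in> A" "j x = r" by blast
    then have "{x \<in> A. j x \<in> {r}} = {x}" using inj by (auto simp: inj_on_def)
    then show ?thesis using atomless \<open>x \<in> A\<close> by (simp add: \<rho>_eq)
  next
    case False
    then have "{x \<in> A. j x \<in> {r}} = {}" by auto
    then show ?thesis using \<rho>_eq[of "{r}"] by (simp only: borel_singleton emeasure_empty sets.empty_sets)
  qed
  have cont: "isCont F r" for r
    unfolding F_def using singleton[of r] by (simp add: \<rho>.isCont_cdf measure_def)
  have pseudo: "\<omega> \<le> F x \<longleftrightarrow> I \<omega> \<le> x" if "0 < \<omega>" "\<omega> < 1" for \<omega> x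
    using \<rho>.pseudoinverse[OF that] unfolding I_def F_def .
  \<comment> \<open>The quantile property gives one inequality. For the other,
    \<open>F x < \<omega>\<close> for all \<open>x\<close> to the left of \<open>I \<omega>\<close>,
    and \<open>F\<close> is continuous because there are no atoms.\<close>
  have FI: "F (I \<omega>) = \<omega>" if w: "0 < \<omega>" "\<omega> < 1" for \<omega>
  proof (rule antisym)
    show "\<omega> \<le> F (I \<omega>)" using pseudo[OF w] by simp
    have "(F \<longlongrightarrow> F (I \<omega>)) (at_left (I \<omega>))"
      using cont[of "I \<omega>"] unfolding continuous_within by (rule filterlim_mono) (simp_all add: at_le)
    moreover have "\<forall>\<^sub>F x in at_left (I \<omega>). F x \<le> \<omega>"
      unfolding eventually_at_left_field
    proof (intro exI[of _ "I \<omega> - 1"] conjI allI impI)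
      fix x assume "x < I \<omega>"
      then show "F x \<le> \<omega>" using pseudo[OF w, of x] by linarith
    qed simp
    ultimately show "F (I \<omega>) \<le> \<omega>" by (rule tendsto_upperbound) simp
  qed
  have F_meas[measurable]: "F \<in> borel_measurable borel"
    unfolding F_def by (rule \<rho>.measurable_C)
  have I_meas: "I \<in> borel_measurable (restrict_space borel {0<..<1})"
    using \<rho>.measurable_CI by (simp add: I_def[abs_def] F_def)
  have \<rho>_I: "emeasure \<rho> T = emeasure lborel {\<omega> \<in> {0<..<1}. I \<omega> \<in> T}" and I_sets: "{\<omega> \<in> {0<..<1}. I \<omega> \<in> T} \<in> sets borel"
    if T: "T \<in> sets borel" for T
  proof -
    have m: "I \<in> restrict_space lborel {0<..<1} \<rightarrow>\<^sub>M borel"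
      using I_meas by (simp cong: measurable_cong_sets)
    have v: "I -` T \<inter> space (restrict_space lborel {0<..<1}) = {\<omega> \<in> {0<..<1}. I \<omega> \<in> T}"
      by (auto simp: space_restrict_space)
    have "{\<omega> \<in> {0<..<1}. I \<omega> \<in> T} \<in> sets (restrict_space lborel {0<..<1})"
      using measurable_sets[OF m T] unfolding v .
    then show "{\<omega> \<in> {0<..<1}. I \<omega> \<in> T} \<in> sets borel" by (simp add: sets_restrict_space_iff)
    have "\<rho> = distr (restrict_space lborel {0<..<1}) borel I"
      using \<rho>.distr_I_eq_M by (simp add: I_def[abs_def] F_def)
    then have "emeasure \<rho> T = emeasure (restrict_space lborel {0<..<1}) {\<omega> \<in> {0<..<1}. I \<omega> \<in> T}"
      using emeasure_distr[OF m T] unfolding v by simp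
    then show "emeasure \<rho> T = emeasure lborel {\<omega> \<in> {0<..<1}. I \<omega> \<in> T}"
      by (subst (asm) emeasure_restrict_space) auto
  qed
  define I0 where "I0 \<omega> = (if \<omega> \<in> {0<..<1} then I \<omega> else 0)" for \<omega>
  have [measurable]: "I0 \<in> borel_measurable borel"
    unfolding I0_def using I_meas
    by (intro measurable_restrict_space_iff[THEN iffD1]) auto
  \<comment> \<open>On \<open>T\<close> the function \<open>F\<close> is inverted by the quantile
    function, and \<open>T\<close> has full measure because it contains every quantile. Restricting
    the points to \<open>j x \<in> T\<close> and the parameters to quantiles in the image of
    \<open>j\<close> makes \<open>F\<close> after \<open>j\<close> a bijection.\<close>
  define T where "T = {r. F r \<in> {0<..<1} \<and> I0 (F r) = r}"
  have T: "T \<in> sets borel" unfolding T_def by measurable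
  have IT: "I \<omega> \<in> T" if "\<omega> \<in> {0<..<1}" for \<omega> using FI that by (simp add: T_def I0_def)
  define J where "J = j ` A"
  have J: "J \<in> sets borel" unfolding J_def using A by (intro img) auto
  define A' where "A' = {x \<in> A. j x \<in> T}"
  define B' where "B' = {\<omega> \<in> {0<..<1}. I \<omega> \<in> J}"
  have A': "A' \<in> sets N" unfolding A'_def by (rule meas[OF T])
  have B': "B' \<in> sets borel" unfolding B'_def by (rule I_sets[OF J])
  have B'01: "B' \<subseteq> {0..1}" by (auto simp: B'_def)
  have "emeasure N A' = emeasure lborel {\<omega> \<in> {0<..<1}. I \<omega> \<in> T}"
    unfolding A'_def by (simp only: \<rho>_eq[OF T, symmetric] \<rho>_I[OF T])
  also have "{\<omega> \<in> {0<..<1}. I \<omega> \<in> T} = {0<..<1}" using IT by auto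
  finally have "emeasure N A' = 1" by simp
  then have A'_null: "space N - A' \<in> null_sets N"
    using N.prob_compl[OF A'] A' by (auto simp: null_sets_def N.emeasure_eq_measure)
  have "{x \<in> A. j x \<in> J} = A" by (auto simp: J_def)
  then have "emeasure lborel B' = emeasure N A" unfolding B'_def by (simp only: \<rho>_I[OF J, symmetric] \<rho>_eq[OF J])
  also have "\<dots> = 1"
    using A N.prob_compl[OF A(1)] by (auto simp: null_sets_def N.emeasure_eq_measure)
  finally have eB': "emeasure lborel B' = 1" .
  have sU: "S \<in> sets unit_interval \<longleftrightarrow> S \<subseteq> {0..1} \<and> S \<in> sets borel" for S by (simp add: sets_restrict_space_iff)
  have eU: "emeasure unit_interval S = emeasure lborel S" if "S \<subseteq> {0..1}" for S
    using that by (simp add: emeasure_restrict_space)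
  interpret U: prob_space unit_interval by (rule prob_space_unit_interval)
  have B'U: "B' \<in> sets unit_interval" using B' B'01 by (simp add: sU)
  then have B'_null: "space unit_interval - B' \<in> null_sets unit_interval"
    using U.prob_compl[OF B'U] sets.compl_sets[OF B'U] eB' eU[OF B'01] by (auto simp: null_sets_def U.emeasure_eq_measure)
  have fA': "F (j x) \<in> B'" "I (F (j x)) = j x" if "x \<in> A'" for x
  proof -
    show 1: "I (F (j x)) = j x" using that by (auto simp: A'_def T_def I0_def split: if_splits)
    show "F (j x) \<in> B'" using that 1 by (auto simp: B'_def A'_def T_def J_def)
  qed
  have surj: "\<exists>x\<in>A'. F (j x) = \<omega> \<and> j x = I \<omega>" if \<omega>: "\<omega> \<in> B'" for \<omega>
  proof -
    obtain x where "x \<in> A" "I \<omega> = j x" using \<omega> by (auto simp: B'_def J_def)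
    then show ?thesis using IT[of \<omega>] FI[of \<omega>] \<omega> by (intro bexI[of _ x]) (auto simp: A'_def B'_def)
  qed
  have f_inj: "inj_on (\<lambda>x. F (j x)) A'"
  proof (rule inj_onI)
    fix x y assume "x \<in> A'" "y \<in> A'" "F (j x) = F (j y)"
    then have "j x = j y" using fA'(2) by metis
    then show "x = y" using inj \<open>x \<in> A'\<close> \<open>y \<in> A'\<close> by (auto simp: A'_def inj_on_def)
  qed
  have "iso_mod_null N unit_interval A' B' (\<lambda>x. F (j x))"
  proof (rule iso_mod_nullI[OF A' A'_null \<open>B' \<in> sets unit_interval\<close> B'_null])
    show "bij_betw (\<lambda>x. F (j x)) A' B'"
      unfolding bij_betw_def
    proof (intro conjI f_inj equalityI subsetI)
      fix \<omega> assume "\<omega> \<in> B'"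
      then show "\<omega> \<in> (\<lambda>x. F (j x)) ` A'" using surj by blast
    qed (use fA'(1) in auto)
  next
    fix E assume E: "E \<in> sets unit_interval" "E \<subseteq> B'"
    then have Eb: "E \<in> sets borel" by (simp add: sU)
    define T' where "T' = T \<inter> F -` E"
    have T': "T' \<in> sets borel" unfolding T'_def using T measurable_sets[OF F_meas Eb] by auto
    have eq: "{x \<in> A'. F (j x) \<in> E} = {x \<in> A. j x \<in> T'}" by (auto simp: A'_def T'_def)
    have "{\<omega> \<in> {0<..<1}. I \<omega> \<in> T'} = E"
      using E(2) IT FI by (auto simp: T'_def B'_def subset_eq)
    then show "{x \<in> A'. F (j x) \<in> E} \<in> sets N \<and> emeasure N {x \<in> A'. F (j x) \<in> E} = emeasure unit_interval E"
      unfolding eq using meas[OF T'] \<rho>_eq[OF T'] \<rho>_I[OF T'] eU[of E] E(2) B'01 by auto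
  next
    fix S assume S: "S \<in> sets N" "S \<subseteq> A'"
    then have SA: "S \<subseteq> A" by (auto simp: A'_def)
    have "(\<lambda>x. F (j x)) ` S = {\<omega> \<in> {0<..<1}. I \<omega> \<in> j ` S}"
    proof (intro equalityI subsetI)
      fix \<omega> assume \<omega>: "\<omega> \<in> {\<omega> \<in> {0<..<1}. I \<omega> \<in> j ` S}"
      then obtain x where "x \<in> S" "I \<omega> = j x" by auto
      then show "\<omega> \<in> (\<lambda>x. F (j x)) ` S" using FI[of \<omega>] \<omega> by (auto intro!: image_eqI[of _ _ x])
    next
      fix \<omega> assume "\<omega> \<in> (\<lambda>x. F (j x)) ` S"
      then obtain x where x: "x \<in> S" "\<omega> = F (j x)" by auto
      then show "\<omega> \<in> {\<omega> \<in> {0<..<1}. I \<omega> \<in> j ` S}" using fA'[of x] S(2) by (auto simp: B'_def)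
    qed
    then show "(\<lambda>x. F (j x)) ` S \<in> sets unit_interval"
      using I_sets[OF img[OF S(1) SA]] by (auto simp: sU)
  qed
  then show ?thesis by blast
qed

text \<open>The action \<open>a\<close> of \<open>G\<close> is copied to the unit interval along \<open>f\<close> on an invariant conull set
  and made trivial on the remaining null set.\<close>

lemma transport_action:
  fixes G :: "('g, 'r) monoid_scheme" and N :: "'a measure"
  assumes cnt: "countable (carrier G)" and act: "mp_action G N a"
    and free: "free_action G N a" and erg: "ergodic_action G N a"
    and iso: "iso_mod_null N unit_interval A B f"
  shows "\<exists>(\<Lambda> :: nat monoid) b. group \<Lambda> \<and> mp_action \<Lambda> unit_interval b \<and>
    free_action \<Lambda> unit_interval b \<and> ergodic_action \<Lambda> unit_interval b \<and>
    isomorphic_relations N (orbit_equiv_rel G N a) unit_interval (orbit_equiv_rel \<Lambda> unit_interval b)"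
proof -
  interpret F: mp_flow G N a by (rule mp_action_flow[OF act])
  interpret N: prob_space N using act by (simp add: mp_action_def)
  interpret U: prob_space unit_interval by (rule prob_space_unit_interval)
  have A: "A \<in> sets N" "space N - A \<in> null_sets N" using iso by (auto simp: iso_mod_null_def)
  obtain E where E: "E \<in> sets N" "E \<subseteq> A" "space N - E \<in> null_sets N"
    and EE: "\<forall>g\<in>carrier G. \<forall>x\<in>E. a g x \<in> E \<and> (a g x = x \<longrightarrow> g = \<one>\<^bsub>G\<^esub>)"
    using F.free_conull_set[OF cnt free A] by blast
  have E_inv: "a g x \<in> E" if "g \<in> carrier G" "x \<in> E" for g x using EE that by blast
  have E_free: "g = \<one>\<^bsub>G\<^esub>" if "g \<in> carrier G" "x \<in> E" "a g x = x" for g x using EE that by blast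
  have EN: "x \<in> E \<Longrightarrow> x \<in> space N" for x using sets.sets_into_space[OF E(1)] by auto
  define D where "D = f ` E"
  have D: "D \<in> sets unit_interval" and eD: "emeasure unit_interval D = emeasure N E"
    unfolding D_def using iso_mod_null_image[OF iso E(1,2)] by auto
  have DU: "D \<subseteq> space unit_interval" using D by (rule sets.sets_into_space)
  have "emeasure N E = 1"
    using E N.prob_compl[OF E(1)] by (auto simp: null_sets_def N.emeasure_eq_measure)
  then have D_null: "space unit_interval - D \<in> null_sets unit_interval"
    using U.prob_compl[OF D] sets.compl_sets[OF D] D eD by (auto simp: null_sets_def U.emeasure_eq_measure)
  have inj: "inj_on f E" using iso E(2) by (auto simp: iso_mod_null_def bij_betw_def intro: inj_on_subset)
  define f' where "f' = the_inv_into E f"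
  have f'f: "f' (f x) = x" if "x \<in> E" for x unfolding f'_def using inj that by (rule the_inv_into_f_f)
  have f'D: "f' z \<in> E" "f (f' z) = z" if "z \<in> D" for z
    using that f'f by (auto simp: D_def)
  have f_img: "f ` S \<in> sets unit_interval" "emeasure unit_interval (f ` S) = emeasure N S"
    if "S \<in> sets N" "S \<subseteq> E" for S
    using iso_mod_null_image[OF iso that(1)] that(2) E(2) by auto
  have f_vim: "{x \<in> E. f x \<in> S} \<in> sets N" if "S \<in> sets unit_interval" for S
  proof -
    have "{x \<in> E. f x \<in> S} = E \<inter> {x \<in> A. f x \<in> S}" using E(2) by auto
    then show ?thesis using E(1) iso_mod_null_vimage(1)[OF iso that] by auto
  qed
  have f_vim_measure: "emeasure N {x \<in> E. f x \<in> S} = emeasure unit_interval S"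
    if S: "S \<in> sets unit_interval" for S
  proof -
    have "emeasure N {x \<in> E. f x \<in> S} = emeasure unit_interval (f ` {x \<in> E. f x \<in> S})"
      by (rule f_img(2)[symmetric, OF f_vim[OF S]]) auto
    also have "f ` {x \<in> E. f x \<in> S} = S \<inter> D" by (auto simp: D_def)
    also have "emeasure unit_interval (S \<inter> D) = emeasure unit_interval ((S \<inter> D) \<union> (S \<inter> (space unit_interval - D)))"
      using S D D_null by (intro emeasure_Un_null_set[symmetric] null_set_Int1) auto
    also have "(S \<inter> D) \<union> (S \<inter> (space unit_interval - D)) = S" using sets.sets_into_space[OF S] by auto
    finally show ?thesis .
  qed
  let ?e = "to_nat_on (carrier G)" and ?d = "from_nat_into (carrier G)"
  define \<Lambda> :: "nat monoid" where
    "\<Lambda> = \<lparr>carrier = ?e ` carrier G, mult = (\<lambda>l k. ?e (?d l \<otimes>\<^bsub>G\<^esub> ?d k)), one = ?e \<one>\<^bsub>G\<^esub>\<rparr>"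
  have \<Lambda>_simps: "carrier \<Lambda> = ?e ` carrier G" "\<one>\<^bsub>\<Lambda>\<^esub> = ?e \<one>\<^bsub>G\<^esub>" "l \<otimes>\<^bsub>\<Lambda>\<^esub> k = ?e (?d l \<otimes>\<^bsub>G\<^esub> ?d k)" for l k
    by (simp_all add: \<Lambda>_def)
  have de: "?d (?e g) = g" if "g \<in> carrier G" for g using cnt that by simp
  have \<Lambda>: "group \<Lambda>"
  proof (rule groupI)
    fix l assume "l \<in> carrier \<Lambda>"
    then obtain g where g: "g \<in> carrier G" "l = ?e g" by (auto simp: \<Lambda>_simps)
    show "\<exists>k\<in>carrier \<Lambda>. k \<otimes>\<^bsub>\<Lambda>\<^esub> l = \<one>\<^bsub>\<Lambda>\<^esub>"
      using g by (intro bexI[of _ "?e (inv\<^bsub>G\<^esub> g)"]) (auto simp: \<Lambda>_simps de)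
  qed (auto simp: \<Lambda>_simps de F.m_assoc)
  define b where "b l = (\<lambda>z\<in>space unit_interval. if z \<in> D then f (a (?d l) (f' z)) else z)" for l
  have b_D: "b (?e g) (f x) = f (a g x)" if "g \<in> carrier G" "x \<in> E" for g x
    using that DU by (auto simp: b_def de f'f D_def)
  have b_out: "b l z = z" if "z \<in> space unit_interval" "z \<notin> D" for l z
    using that by (simp add: b_def)
  have D_cases: "\<exists>x\<in>E. z = f x" if "z \<in> D" for z using that by (auto simp: D_def)
  have b_closed: "b l z \<in> space unit_interval" and b_D_iff: "b l z \<in> D \<longleftrightarrow> z \<in> D"
    if l: "l \<in> carrier \<Lambda>" and zU: "z \<in> space unit_interval" for l z
  proof -
    obtain g where g: "g \<in> carrier G" "l = ?e g" using l by (auto simp: \<Lambda>_simps)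
    have *: "b l z \<in> D" if z: "z \<in> D"
    proof -
      obtain x where x: "x \<in> E" "z = f x" using D_cases[OF z] by blast
      then show ?thesis using b_D[OF g(1) x(1)] E_inv[OF g(1) x(1)] g by (auto simp: D_def)
    qed
    show "b l z \<in> D \<longleftrightarrow> z \<in> D" using * b_out[OF zU, of l] by (cases "z \<in> D") auto
    show "b l z \<in> space unit_interval" using * b_out[OF zU, of l] zU DU by (cases "z \<in> D") auto
  qed
  have act_b: "group_action \<Lambda> (space unit_interval) b"
  proof (rule group_actionI[OF \<Lambda>])
    show "b l \<in> extensional (space unit_interval)" for l by (simp add: b_def)
    show "b l z \<in> space unit_interval" if "l \<in> carrier \<Lambda>" "z \<in> space unit_interval" for l z
      by (rule b_closed[OF that])
    fix z assume z: "z \<in> space unit_interval"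
    show "b \<one>\<^bsub>\<Lambda>\<^esub> z = z"
    proof (cases "z \<in> D")
      case True
      then obtain x where x: "x \<in> E" "z = f x" using D_cases by blast
      then show ?thesis using b_D[of "\<one>\<^bsub>G\<^esub>" x] F.T_one[OF EN[OF x(1)]] by (simp add: \<Lambda>_simps)
    qed (simp add: b_out[OF z])
    fix l k assume l: "l \<in> carrier \<Lambda>" and k: "k \<in> carrier \<Lambda>"
    obtain g h where g: "g \<in> carrier G" "l = ?e g" and h: "h \<in> carrier G" "k = ?e h"
      using l k by (auto simp: \<Lambda>_simps)
    show "b (l \<otimes>\<^bsub>\<Lambda>\<^esub> k) z = b l (b k z)"
    proof (cases "z \<in> D")
      case True
      then obtain x where x: "x \<in> E" "z = f x" using D_cases by blast
      have "b (l \<otimes>\<^bsub>\<Lambda>\<^esub> k) z = f (a (g \<otimes>\<^bsub>G\<^esub> h) x)"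
        using b_D[of "g \<otimes>\<^bsub>G\<^esub> h" x] g h x by (simp add: \<Lambda>_simps de)
      also have "\<dots> = b l (b k z)"
        using b_D[OF h(1) x(1)] b_D[OF g(1) E_inv[OF h(1) x(1)]] g h x EN[OF x(1)] by (simp add: F.T_mult)
      finally show ?thesis .
    qed (simp add: b_out[OF z])
  qed
  have b_vim: "{z \<in> space unit_interval. b (?e g) z \<in> S}
      = f ` {x \<in> E. a g x \<in> {x \<in> E. f x \<in> S}} \<union> (S \<inter> (space unit_interval - D))"
    if g: "g \<in> carrier G" and S: "S \<in> sets unit_interval" for g S
  proof (intro equalityI subsetI)
    fix z assume z: "z \<in> {z \<in> space unit_interval. b (?e g) z \<in> S}"
    show "z \<in> f ` {x \<in> E. a g x \<in> {x \<in> E. f x \<in> S}} \<union> (S \<inter> (space unit_interval - D))"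
    proof (cases "z \<in> D")
      case True
      then obtain x where x: "x \<in> E" "z = f x" using D_cases by blast
      then show ?thesis using z b_D[OF g x(1)] E_inv[OF g x(1)] by auto
    qed (use z b_out in auto)
  next
    fix z assume z: "z \<in> f ` {x \<in> E. a g x \<in> {x \<in> E. f x \<in> S}} \<union> (S \<inter> (space unit_interval - D))"
    then show "z \<in> {z \<in> space unit_interval. b (?e g) z \<in> S}"
    proof
      assume "z \<in> f ` {x \<in> E. a g x \<in> {x \<in> E. f x \<in> S}}"
      then obtain x where x: "x \<in> E" "f (a g x) \<in> S" "z = f x" by auto
      then show ?thesis using b_D[OF g x(1)] DU by (auto simp: D_def)
    qed (use b_out in auto)
  qed
  have b_mp: "b l \<in> measure_preserving unit_interval unit_interval" if l: "l \<in> carrier \<Lambda>" for l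
  proof -
    obtain g where g: "g \<in> carrier G" "l = ?e g" using l by (auto simp: \<Lambda>_simps)
    have S1: "{x \<in> E. a g x \<in> {x \<in> E. f x \<in> S}} \<in> sets N"
      "emeasure N {x \<in> E. a g x \<in> {x \<in> E. f x \<in> S}} = emeasure unit_interval S" if S: "S \<in> sets unit_interval" for S
    proof -
      have eq: "{x \<in> E. a g x \<in> {x \<in> E. f x \<in> S}} = a g -` {x \<in> E. f x \<in> S} \<inter> space N"
      proof -
        have "x \<in> E" if "x \<in> space N" "a g x \<in> E" for x
          using E_inv[of "inv\<^bsub>G\<^esub> g" "a g x"] that g(1) by (simp add: F.T_inv)
        then show ?thesis using EN by auto
      qed
      show "{x \<in> E. a g x \<in> {x \<in> E. f x \<in> S}} \<in> sets N"
        unfolding eq by (rule measurable_sets[OF F.T_meas[OF g(1)] f_vim[OF S]])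
      show "emeasure N {x \<in> E. a g x \<in> {x \<in> E. f x \<in> S}} = emeasure unit_interval S"
        unfolding eq F.emeasure_T_vimage[OF g(1) f_vim[OF S]] by (rule f_vim_measure[OF S])
    qed
    have vim: "b l -` S \<inter> space unit_interval = {z \<in> space unit_interval. b (?e g) z \<in> S}" for S
      using g(2) by auto
    have m: "b l \<in> unit_interval \<rightarrow>\<^sub>M unit_interval"
    proof (rule measurableI)
      fix S assume S: "S \<in> sets unit_interval"
      show "b l -` S \<inter> space unit_interval \<in> sets unit_interval"
        unfolding vim b_vim[OF g(1) S] 
        by (intro sets.Un sets.Int S sets.compl_sets D f_img(1)[OF S1(1)[OF S]]) auto
    qed (rule b_closed[OF l])
    have "distr unit_interval unit_interval (b l) = unit_interval"
    proof (rule measure_eqI)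
      fix S assume "S \<in> sets (distr unit_interval unit_interval (b l))"
      then have S: "S \<in> sets unit_interval" by simp
      have nl: "S \<inter> (space unit_interval - D) \<in> null_sets unit_interval"
        using S D_null by (intro null_set_Int1) auto
      have fi: "f ` {x \<in> E. a g x \<in> {x \<in> E. f x \<in> S}} \<in> sets unit_interval"
        by (rule f_img(1)[OF S1(1)[OF S]]) auto
      have "emeasure (distr unit_interval unit_interval (b l)) S
          = emeasure unit_interval (f ` {x \<in> E. a g x \<in> {x \<in> E. f x \<in> S}} \<union> (S \<inter> (space unit_interval - D)))"
        unfolding emeasure_distr[OF m S] vim b_vim[OF g(1) S] ..
      also have "\<dots> = emeasure unit_interval (f ` {x \<in> E. a g x \<in> {x \<in> E. f x \<in> S}})"
        by (rule emeasure_Un_null_set[OF fi nl])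
      also have "\<dots> = emeasure N {x \<in> E. a g x \<in> {x \<in> E. f x \<in> S}}"
        by (rule f_img(2)[OF S1(1)[OF S]]) auto
      also have "\<dots> = emeasure unit_interval S" by (rule S1(2)[OF S])
      finally show "emeasure (distr unit_interval unit_interval (b l)) S = emeasure unit_interval S" .
    qed simp
    then show ?thesis using m by (simp add: measure_preserving_def)
  qed
  have "mp_action \<Lambda> unit_interval b"
    unfolding mp_action_def using act_b b_mp U.prob_space_axioms by blast
  moreover have "free_action \<Lambda> unit_interval b"
    unfolding free_action_def
  proof (intro ballI impI)
    fix l assume l: "l \<in> carrier \<Lambda>" "l \<noteq> \<one>\<^bsub>\<Lambda>\<^esub>"
    obtain g where g: "g \<in> carrier G" "l = ?e g" using l(1) by (auto simp: \<Lambda>_simps)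
    have g1: "g \<noteq> \<one>\<^bsub>G\<^esub>" using l(2) g(2) by (auto simp: \<Lambda>_simps)
    have "b l z \<noteq> z" if z: "z \<in> D" for z
    proof
      assume eq: "b l z = z"
      obtain x where x: "x \<in> E" "z = f x" using D_cases[OF z] by blast
      have "f (a g x) = f x" using b_D[OF g(1) x(1)] eq g(2) x(2) by simp
      then have "a g x = x" using inj_onD[OF inj _ E_inv[OF g(1) x(1)] x(1)] by blast
      then show False using E_free[OF g(1) x(1)] g1 by blast
    qed
    then show "AE z in unit_interval. b l z \<noteq> z"
      by (intro AE_I'[OF D_null]) auto
  qed
  moreover have "ergodic_action \<Lambda> unit_interval b"
    unfolding ergodic_action_def
  proof (intro ballI impI)
    fix S assume S: "S \<in> sets unit_interval" and inv: "\<forall>l\<in>carrier \<Lambda>. b l ` S = S"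
    define S' where "S' = {x \<in> E. f x \<in> S}"
    have S': "S' \<in> sets N" "emeasure N S' = emeasure unit_interval S"
      unfolding S'_def using f_vim[OF S] f_vim_measure[OF S] by auto
    have sub: "a g x \<in> S'" if g: "g \<in> carrier G" and x: "x \<in> S'" for g x
    proof -
      have xE: "x \<in> E" and fx: "f x \<in> S" using x by (auto simp: S'_def)
      have "b (?e g) (f x) \<in> S" using inv g fx by (auto simp: \<Lambda>_simps)
      then show ?thesis using b_D[OF g xE] E_inv[OF g xE] by (simp add: S'_def)
    qed
    have "a g ` S' = S'" if g: "g \<in> carrier G" for g
    proof (intro equalityI subsetI)
      fix x assume x: "x \<in> S'"
      have "x = a g (a (inv\<^bsub>G\<^esub> g) x)" using g x EN by (simp add: S'_def F.T_inv)
      then show "x \<in> a g ` S'" using sub[of "inv\<^bsub>G\<^esub> g" x] g x by blast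
    qed (use sub[OF g] in auto)
    then have "emeasure N S' = 0 \<or> emeasure N (space N - S') = 0"
      using erg S'(1) by (auto simp: ergodic_action_def)
    moreover have "emeasure unit_interval (space unit_interval - S) = emeasure N (space N - S')"
      using U.prob_compl[OF S] N.prob_compl[OF S'(1)] S'(2) by (simp add: U.emeasure_eq_measure N.emeasure_eq_measure)
    ultimately show "emeasure unit_interval S = 0 \<or> emeasure unit_interval (space unit_interval - S) = 0"
      using S'(2) by simp
  qed
  moreover have "isomorphic_relations N (orbit_equiv_rel G N a) unit_interval (orbit_equiv_rel \<Lambda> unit_interval b)"
    unfolding isomorphic_relations_def
  proof (intro exI conjI ballI)
    show "iso_mod_null N unit_interval E D f"
    proof (rule iso_mod_nullI[OF E(1,3) D D_null])
      show "bij_betw f E D" using inj by (simp add: bij_betw_def D_def)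
    qed (auto simp: f_vim f_vim_measure f_img)
    fix x y assume x: "x \<in> E" and y: "y \<in> E"
    have "(x, y) \<in> orbit_equiv_rel G N a \<longleftrightarrow> (\<exists>g\<in>carrier G. y = a g x)"
      using EN[OF x] by (auto simp: orbit_equiv_rel_def)
    also have "\<dots> \<longleftrightarrow> (\<exists>g\<in>carrier G. f y = b (?e g) (f x))"
    proof (intro bex_cong refl)
      fix g assume g: "g \<in> carrier G"
      show "y = a g x \<longleftrightarrow> f y = b (?e g) (f x)"
        unfolding b_D[OF g x] using inj_on_eq_iff[OF inj y E_inv[OF g x]] by simp
    qed
    also have "\<dots> \<longleftrightarrow> (f x, f y) \<in> orbit_equiv_rel \<Lambda> unit_interval b"
    proof -
      have "f x \<in> space unit_interval" using DU x by (auto simp: D_def)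
      then show ?thesis unfolding orbit_equiv_rel_def \<Lambda>_simps by blast
    qed
    finally show "(x, y) \<in> orbit_equiv_rel G N a \<longleftrightarrow> (f x, f y) \<in> orbit_equiv_rel \<Lambda> unit_interval b" .
  qed
  ultimately show ?thesis using \<Lambda> by blast
qed

section \<open>Amplifications of rational type\<close>

text \<open>The rotation of the first \<open>m\<close> naturals, continued by the identity to a
  bijection of all naturals. In this way \<open>skew_product_distr\<close> applies to the whole
  stabilized measure before restriction to \<open>Y\<close>.\<close>

definition "rotate_below m k i = (if i < m then nat ((int i + k) mod int m) else i)"

lemma rotate_below_less: "m \<ge> 1 \<Longrightarrow> rotate_below m k i < m \<longleftrightarrow> i < m"
  by (auto simp: rotate_below_def nat_less_iff)

lemma int_rotate_below: "i < m \<Longrightarrow> int (rotate_below m k i) = (int i + k) mod int m"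
  by (simp add: rotate_below_def)

lemma rotate_below_rotate_below:
  assumes "m \<ge> 1"
  shows "rotate_below m k (rotate_below m l i) = rotate_below m (k + l) i"
proof (cases "i < m")
  case True
  then have "rotate_below m l i < m" using rotate_below_less assms by blast
  then have "int (rotate_below m k (rotate_below m l i)) = int (rotate_below m (k + l) i)"
    using True by (simp add: int_rotate_below mod_simps ac_simps)
  then show ?thesis by simp
qed (simp add: rotate_below_def)

lemma rotate_below_mod: "rotate_below m (k mod int m) i = rotate_below m k i"
  by (simp add: rotate_below_def mod_simps)

lemma rotate_below_0: "rotate_below m 0 i = i"
  by (simp add: rotate_below_def)

lemma bij_rotate_below:
  assumes "m \<ge> 1"
  shows "bij_betw (rotate_below m k) UNIV UNIV"
  by (rule bij_betwI[where g = "rotate_below m (- k)"])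
    (simp_all add: rotate_below_rotate_below[OF assms] rotate_below_0)

lemma rotate_below_transitive:
  assumes "i < m" "j < m"
  obtains k where "k \<in> {0..<int m}" "rotate_below m k i = j"
proof (rule that)
  show "(int j - int i) mod int m \<in> {0..<int m}" using assms by simp
  have "int (rotate_below m ((int j - int i) mod int m) i) = int j"
    using assms by (simp add: int_rotate_below mod_simps)
  then show "rotate_below m ((int j - int i) mod int m) i = j" by simp
qed

lemma rotate_below_free:
  assumes "i < m" "k \<in> {0..<int m}" "rotate_below m k i = i"
  shows "k = 0"
proof -
  have "(int i + k) mod int m = int i mod int m"
    using int_rotate_below[OF assms(1), of k] assms by simp
  then have "int m dvd k" by (simp add: mod_eq_dvd_iff)
  then show ?thesis using assms(2) zdvd_not_zless[of k "int m"] by fastforce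
qed

lemma measure_preserving_normalized_restriction:
  assumes Y: "Y \<in> sets N" and F: "F \<in> N \<rightarrow>\<^sub>M N" "distr N N F = N"
    and inv: "\<And>p. p \<in> space N \<Longrightarrow> F p \<in> Y \<longleftrightarrow> p \<in> Y"
  shows "restrict F Y \<in> measure_preserving (normalized_restriction N t Y) (normalized_restriction N t Y)"
proof -
  let ?N = "normalized_restriction N t Y"
  note sp = space_normalized_restriction[OF Y, of t] and se = sets_normalized_restriction[OF Y, of _ t]
    and em = emeasure_normalized_restriction[OF Y, of _ t]
  have YN: "Y \<subseteq> space N" using Y by (rule sets.sets_into_space)
  have vim: "restrict F Y -` S \<inter> space ?N = F -` S \<inter> space N" if "S \<subseteq> Y" for S
    using that inv YN unfolding sp by auto
  have FY: "F -` S \<inter> space N \<subseteq> Y" if "S \<subseteq> Y" for S using that inv by auto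
  have m: "restrict F Y \<in> ?N \<rightarrow>\<^sub>M ?N"
  proof (rule measurableI)
    fix S assume "S \<in> sets ?N"
    then have S: "S \<subseteq> Y" "S \<in> sets N" by (auto simp: se)
    show "restrict F Y -` S \<inter> space ?N \<in> sets ?N"
      unfolding vim[OF S(1)] se using FY[OF S(1)] measurable_sets[OF F(1) S(2)] by blast
  qed (use inv YN in \<open>auto simp: sp\<close>)
  have "distr ?N ?N (restrict F Y) = ?N"
  proof (rule measure_eqI)
    fix S assume "S \<in> sets (distr ?N ?N (restrict F Y))"
    then have S': "S \<in> sets ?N" by simp
    then have S: "S \<subseteq> Y" "S \<in> sets N" by (auto simp: se)
    have "emeasure (distr ?N ?N (restrict F Y)) S = ennreal (1 / t) * emeasure N (F -` S \<inter> space N)"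
      unfolding emeasure_distr[OF m S'] vim[OF S(1)] by (rule em[OF FY[OF S(1)]])
    also have "emeasure N (F -` S \<inter> space N) = emeasure N S"
      using emeasure_distr[OF F(1) S(2)] F(2) by simp
    finally show "emeasure (distr ?N ?N (restrict F Y)) S = emeasure ?N S"
      unfolding em[OF S(1)] .
  qed simp
  then show ?thesis using m by (simp add: measure_preserving_def)
qed

text \<open>The amplification of type \<open>m / card_X n\<close> is carried by \<open>m\<close> copies of a cell of the \<open>n\<close>-th
  partition, on which the stabilizer of the cell acts diagonally and the cyclic group of order
  \<open>m\<close> permutes the copies.\<close>

locale rational_amplification = profinite +
  fixes n m :: nat and a
  assumes free_\<Gamma>: "free_action \<Gamma> M \<alpha>" and std: "standard_prob_space M"
    and n: "n \<ge> 1" and m: "m \<ge> 1" and a: "a \<in> space (Xs n)"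
begin

abbreviation "SM \<equiv> stabilized_measure M"

definition "C = cell n a"
definition "t = real m / real (card_X n)"
definition "Y = C \<times> {..<m}"
definition "N = normalized_restriction SM t Y"
definition "G = (\<Gamma>\<lparr>carrier := stab n a\<rparr>) \<times>\<times> integer_mod_group m"
definition "act = (\<lambda>(g, k). \<lambda>(x, i)\<in>Y. (\<alpha> g x, rotate_below m k i))"

lemma t: "t > 0"
  using m card_X_pos[OF n] by (simp add: t_def)

lemma C_sets: "C \<in> sets M" and C_space: "x \<in> C \<Longrightarrow> x \<in> space M"
  using cell_sets[OF n] cell_subset by (auto simp: C_def)

lemma emeasure_C: "emeasure M C = ennreal (1 / real (card_X n))"
  by (simp add: C_def M.emeasure_eq_measure measure_cell[OF n a])

lemma carrier_G: "carrier G = stab n a \<times> {0..<int m}"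
  using m by (simp add: G_def carrier_integer_mod_group)

lemma stab_carrier: "g \<in> stab n a \<Longrightarrow> g \<in> carrier \<Gamma>"
  by (simp add: stab_def)

lemma stab_group: "group (\<Gamma>\<lparr>carrier := stab n a\<rparr>)"
  by (rule subgroup.subgroup_is_group[OF stab_subgroup[OF n a] is_group])

lemma group_G: "group G"
  unfolding G_def by (rule DirProd_group[OF stab_group group_integer_mod_group])

lemma act_eq: "x \<in> C \<Longrightarrow> i < m \<Longrightarrow> act (g, k) (x, i) = (\<alpha> g x, rotate_below m k i)"
  by (simp add: act_def Y_def)

lemma Y_sets: "Y \<in> sets SM"
  unfolding Y_def by (rule sets_stabilized_times[OF C_sets])

lemma emeasure_Y: "emeasure SM Y = ennreal t"
  unfolding Y_def
  by (subst emeasure_stabilized_times[OF C_sets]) (simp_all add: emeasure_C t_def ennreal_mult'[symmetric])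

lemma sets_N: "S \<in> sets N \<longleftrightarrow> S \<subseteq> Y \<and> S \<in> sets SM"
  and space_N: "space N = Y"
  and emeasure_N: "S \<subseteq> Y \<Longrightarrow> emeasure N S = ennreal (1 / t) * emeasure SM S"
  unfolding N_def using sets_normalized_restriction[OF Y_sets]
    space_normalized_restriction[OF Y_sets] emeasure_normalized_restriction[OF Y_sets] by auto

lemma null_N:
  assumes "S \<in> sets M" "S \<subseteq> C" "emeasure M S = 0"
  shows "S \<times> {..<m} \<in> null_sets N"
proof -
  have "S \<times> {..<m} \<subseteq> Y" using assms by (auto simp: Y_def)
  then show ?thesis
    using sets_stabilized_times[OF assms(1)] assms(3)
    by (auto simp: null_sets_def sets_N emeasure_N emeasure_stabilized_times[OF assms(1)])
qed

lemma prob_space_N: "prob_space N"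
proof (rule prob_spaceI)
  show "emeasure N (space N) = 1"
    using t by (simp add: space_N emeasure_N emeasure_Y ennreal_mult'[symmetric])
qed

lemma act_C: "g \<in> stab n a \<Longrightarrow> x \<in> C \<Longrightarrow> \<alpha> g x \<in> C"
  unfolding C_def by (rule stab_cell[OF n])

lemma act_Y: "gk \<in> carrier G \<Longrightarrow> p \<in> Y \<Longrightarrow> act gk p \<in> Y"
  using act_C rotate_below_less[OF m] by (auto simp: carrier_G Y_def act_eq)

lemma act_mp:
  assumes "gk \<in> carrier G"
  shows "act gk \<in> measure_preserving N N"
proof -
  obtain g k where gk: "gk = (g, k)" "g \<in> stab n a" using assms by (auto simp: carrier_G)
  have g: "g \<in> carrier \<Gamma>" by (rule stab_carrier[OF gk(2)])
  let ?F = "\<lambda>(x, i). (\<alpha> g x, rotate_below m k i)"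
  have F: "?F \<in> SM \<rightarrow>\<^sub>M SM"
    unfolding stabilized_measure_def
    by (rule skew_product_measurable[OF _ A.T_meas[OF g]]) auto
  have distr: "distr SM SM ?F = SM"
    unfolding stabilized_measure_def
    by (rule skew_product_distr[OF _ _ A.T_meas[OF g] A.T_distr[OF g]])
      (auto intro: bij_rotate_below[OF m] M.sigma_finite_measure_axioms)
  have "?F p \<in> Y \<longleftrightarrow> p \<in> Y" if "p \<in> space SM" for p
  proof -
    obtain x i where p: "p = (x, i)" by (cases p)
    have x: "x \<in> space M" using that p by (simp add: stabilized_measure_def space_pair_measure)
    have "\<alpha> g x \<in> C \<longleftrightarrow> x \<in> C"
    proof
      assume "\<alpha> g x \<in> C"
      then have "\<alpha> (inv g) (\<alpha> g x) \<in> C"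
        by (rule act_C[OF subgroup.m_inv_closed[OF stab_subgroup[OF n a] gk(2)]])
      then show "x \<in> C" using A.T_inv(2)[OF g x] by simp
    qed (rule act_C[OF gk(2)])
    then show ?thesis
      using p rotate_below_less[OF m] by (auto simp: Y_def)
  qed
  then have "restrict ?F Y \<in> measure_preserving N N"
    unfolding N_def by (rule measure_preserving_normalized_restriction[OF Y_sets F distr])
  moreover have "act gk = restrict ?F Y" by (auto simp: act_def gk)
  ultimately show ?thesis by simp
qed

lemma action_G: "mp_action G N act"
proof -
  have "group_action G (space N) act"
    unfolding space_N
  proof (rule group_actionI[OF group_G])
    fix gk show "act gk \<in> extensional Y" by (cases gk) (simp add: act_def)
  next
    fix gk p assume "gk \<in> carrier G" "p \<in> Y" then show "act gk p \<in> Y" by (rule act_Y)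
  next
    fix p assume "p \<in> Y"
    then show "act \<one>\<^bsub>G\<^esub> p = p"
      using C_space by (auto simp: G_def Y_def act_eq rotate_below_0 A.T_one)
  next
    fix gk hl p assume *: "gk \<in> carrier G" "hl \<in> carrier G" "p \<in> Y"
    obtain g k h l where gk: "gk = (g, k)" "g \<in> stab n a" "hl = (h, l)" "h \<in> stab n a"
      using * by (auto simp: carrier_G)
    obtain x i where p: "p = (x, i)" "x \<in> C" "i < m" using *(3) by (auto simp: Y_def)
    have "\<alpha> h x \<in> C" by (rule act_C[OF gk(4) p(2)])
    moreover have "rotate_below m l i < m" using rotate_below_less[OF m] p(3) by simp
    moreover have "gk \<otimes>\<^bsub>G\<^esub> hl = (g \<otimes> h, (k + l) mod int m)" by (simp add: G_def gk)
    ultimately show "act (gk \<otimes>\<^bsub>G\<^esub> hl) p = act gk (act hl p)"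
      using p gk C_space stab_carrier
      by (simp add: act_eq A.T_mult rotate_below_mod rotate_below_rotate_below[OF m])
  qed
  then show ?thesis using prob_space_N act_mp by (simp add: mp_action_def)
qed

lemma free_G: "free_action G N act"
  unfolding free_action_def
proof (intro ballI impI)
  fix gk assume gk: "gk \<in> carrier G" "gk \<noteq> \<one>\<^bsub>G\<^esub>"
  obtain g k where g: "gk = (g, k)" "g \<in> stab n a" "k \<in> {0..<int m}" using gk(1) by (auto simp: carrier_G)
  show "AE p in N. act gk p \<noteq> p"
  proof (cases "k = 0")
    case False
    have "act gk p \<noteq> p" if "p \<in> space N" for p
      using that False rotate_below_free[OF _ g(3)] by (auto simp: space_N Y_def act_eq g(1))
    then show ?thesis by (rule AE_I2)
  next
    case True
    then have "g \<noteq> \<one>" using gk(2) g(1) by (auto simp: G_def)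
    then have "AE x in M. \<alpha> g x \<noteq> x" using free_\<Gamma> stab_carrier[OF g(2)] by (auto simp: free_action_def)
    then obtain W where W: "{x \<in> space M. \<not> \<alpha> g x \<noteq> x} \<subseteq> W" "emeasure M W = 0" "W \<in> sets M"
      by (rule AE_E)
    have "emeasure M (W \<inter> C) = 0"
      using W(2) emeasure_mono[of "W \<inter> C" W M] W(3) by auto
    then have "(W \<inter> C) \<times> {..<m} \<in> null_sets N" using W(3) C_sets by (intro null_N) auto
    moreover have "{p \<in> space N. \<not> act gk p \<noteq> p} \<subseteq> (W \<inter> C) \<times> {..<m}"
      using W(1) C_space by (auto simp: space_N Y_def act_eq g(1))
    ultimately show ?thesis by (rule AE_I')
  qed
qed

text \<open>Rotations force an invariant set to be a product of some \<open>E0\<close> with all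
  \<open>m\<close> indices, and \<open>E0\<close> is invariant under the part of the stabilizer in
  \<open>\<Gamma>0\<close>, to which \<open>ergodic_cell\<close> applies.\<close>

lemma ergodic_G: "ergodic_action G N act"
  unfolding ergodic_action_def
proof (intro ballI impI)
  fix E assume E: "E \<in> sets N" and "\<forall>gk\<in>carrier G. act gk ` E = E"
  then have inv: "act gk p \<in> E" if "gk \<in> carrier G" "p \<in> E" for gk p using that by blast
  have EY: "E \<subseteq> Y" "E \<in> sets SM" using E by (auto simp: sets_N)
  have one: "\<one> \<in> stab n a" by (rule subgroup.one_closed[OF stab_subgroup[OF n a]])
  have move: "(x, j) \<in> E" if xi: "(x, i) \<in> E" and j: "j < m" for x i j
  proof -
    have x: "x \<in> C" "i < m" using EY xi by (auto simp: Y_def)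
    obtain k where k: "k \<in> {0..<int m}" "rotate_below m k i = j" using rotate_below_transitive[OF x(2) j] .
    have "act (\<one>, k) (x, i) \<in> E" using one k xi by (intro inv) (auto simp: carrier_G)
    then show ?thesis using x C_space by (simp add: act_eq k A.T_one)
  qed
  define E0 where "E0 = {x \<in> space M. (x, 0) \<in> E}"
  have E0: "E0 \<in> sets M"
  proof -
    have "(\<lambda>x. (x, 0)) \<in> M \<rightarrow>\<^sub>M SM" unfolding stabilized_measure_def by measurable
    from measurable_sets[OF this EY(2)] show ?thesis by (auto simp: E0_def Int_def conj_commute)
  qed
  have E0C: "E0 \<subseteq> C" using EY by (auto simp: E0_def Y_def)
  have E_eq: "E = E0 \<times> {..<m}"
  proof (intro equalityI subsetI)
    fix p assume p: "p \<in> E"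
    then obtain x i where xi: "p = (x, i)" "x \<in> C" "i < m" using EY(1) by (auto simp: Y_def)
    then show "p \<in> E0 \<times> {..<m}" using move[of x i 0] p m C_space by (auto simp: E0_def)
  qed (use move in \<open>auto simp: E0_def\<close>)
  have "M.prob E0 = 0 \<or> M.prob (cell n a - E0) = 0"
  proof (rule ergodic_cell[OF n E0])
    show "E0 \<subseteq> cell n a" using E0C by (simp add: C_def)
    fix h x assume h: "h \<in> \<Gamma>0" "h \<in> stab n a" and x: "x \<in> E0"
    have "act (h, 0) (x, 0) \<in> E" using h x m by (intro inv) (auto simp: carrier_G E0_def)
    then show "\<alpha> h x \<in> E0"
      using x E0C m A.T_space[OF stab_carrier[OF h(2)]] C_space by (auto simp: E0_def act_eq rotate_below_0)
  qed
  then show "emeasure N E = 0 \<or> emeasure N (space N - E) = 0"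
  proof
    assume "M.prob E0 = 0"
    then have "E \<in> null_sets N" unfolding E_eq using E0 E0C by (intro null_N) (simp_all add: M.emeasure_eq_measure)
    then show ?thesis by auto
  next
    assume "M.prob (cell n a - E0) = 0"
    then have "(C - E0) \<times> {..<m} \<in> null_sets N"
      using E0 C_sets by (intro null_N) (auto simp: M.emeasure_eq_measure C_def)
    moreover have "space N - E = (C - E0) \<times> {..<m}" by (auto simp: space_N Y_def E_eq)
    ultimately show ?thesis by auto
  qed
qed

text \<open>An element that moves a point of the cell into the cell is in its stabilizer, and the
  rotations connect any two copies.\<close>

lemma orbit_relation_G:
  "orbit_equiv_rel G N act = stabilization (orbit_equiv_rel \<Gamma> M \<alpha>) \<inter> Y \<times> Y"
proof (intro equalityI subsetI)
  fix z assume "z \<in> orbit_equiv_rel G N act"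
  then obtain p gk where p: "p \<in> Y" and gk: "gk \<in> carrier G" and z: "z = (p, act gk p)"
    by (auto simp: orbit_equiv_rel_def space_N)
  have "act gk p \<in> Y" by (rule act_Y[OF gk p])
  obtain x i where xi: "p = (x, i)" "x \<in> C" "i < m" using p by (auto simp: Y_def)
  obtain g k where g: "gk = (g, k)" "g \<in> stab n a" using gk by (auto simp: carrier_G)
  have "act gk p = (\<alpha> g x, rotate_below m k i)" using xi g by (simp add: act_eq)
  moreover have "(x, \<alpha> g x) \<in> orbit_equiv_rel \<Gamma> M \<alpha>"
    using C_space[OF xi(2)] stab_carrier[OF g(2)] by (auto simp: orbit_equiv_rel_def)
  ultimately show "z \<in> stabilization (orbit_equiv_rel \<Gamma> M \<alpha>) \<inter> Y \<times> Y"
    using \<open>act gk p \<in> Y\<close> p z xi(1) by (auto simp: stabilization_def)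
next
  fix z assume "z \<in> stabilization (orbit_equiv_rel \<Gamma> M \<alpha>) \<inter> Y \<times> Y"
  then obtain x i g j where z: "z = ((x, i), (\<alpha> g x, j))" and g: "g \<in> carrier \<Gamma>"
    and xi: "x \<in> C" "i < m" and yj: "\<alpha> g x \<in> C" "j < m"
    by (auto simp: stabilization_def orbit_equiv_rel_def Y_def)
  have "g \<in> stab n a" using stab_cellI[OF n g] xi yj by (simp add: C_def)
  moreover obtain k where "k \<in> {0..<int m}" "rotate_below m k i = j"
    using rotate_below_transitive[OF xi(2) yj(2)] .
  ultimately have "(g, k) \<in> carrier G" "z = ((x, i), act (g, k) (x, i))" "(x, i) \<in> Y"
    using z xi by (auto simp: carrier_G act_eq Y_def)
  then show "z \<in> orbit_equiv_rel G N act" unfolding orbit_equiv_rel_def space_N by blast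
qed

lemma standard_N: "\<exists>A B f. iso_mod_null N unit_interval A B f"
proof -
  obtain D B \<phi> where iso: "iso_mod_null M unit_interval D B \<phi>"
    using std by (auto simp: standard_prob_space_def)
  have D: "D \<in> sets M" "space M - D \<in> null_sets M" and inj: "inj_on \<phi> D"
    using iso by (auto simp: iso_mod_null_def bij_betw_def)
  have \<phi>01: "\<phi> x \<in> {0..1}" if "x \<in> D" for x
    using iso that by (auto simp: iso_mod_null_def bij_betw_def sets_restrict_space_iff dest: sets.sets_into_space)
  define A where "A = (D \<inter> C) \<times> {..<m}"
  \<comment> \<open>The copies go to intervals of length 1 at distance 1 from each other, so that
    the index can be recovered from the value.\<close>
  define j where "j = (\<lambda>(x, i). \<phi> x + 2 * real i)"
  have AY: "A \<subseteq> Y" by (auto simp: A_def Y_def)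
  have DC: "D \<inter> C \<in> sets M" using D C_sets by auto
  show ?thesis
  proof (rule standard_prob_space_atomless[OF prob_space_N])
    show A: "A \<in> sets N" unfolding sets_N using AY sets_stabilized_times[OF DC] by (simp add: A_def)
    have "emeasure M (C - D) = 0"
      using D C_space by (intro null_setsD1[OF null_sets_subset[OF D(2)]]) (use C_sets in auto)
    then have "(C - D) \<times> {..<m} \<in> null_sets N" using C_sets D(1) by (intro null_N) auto
    moreover have "space N - A = (C - D) \<times> {..<m}" by (auto simp: space_N Y_def A_def)
    ultimately show "space N - A \<in> null_sets N" by simp
    show "inj_on j A"
    proof (rule inj_onI)
      fix p p' assume "p \<in> A" "p' \<in> A" and eq: "j p = j p'"
      then obtain x i y l where p: "p = (x, i)" "x \<in> D" "p' = (y, l)" "y \<in> D" by (auto simp: A_def)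
      have "\<phi> x + 2 * real i = \<phi> y + 2 * real l" using eq p by (simp add: j_def)
      then have "\<bar>real i - real l\<bar> < 1" using \<phi>01[OF p(2)] \<phi>01[OF p(4)] by auto
      then have "i = l" by linarith
      then show "p = p'" using eq p inj by (auto simp: j_def inj_on_def)
    qed
    fix T :: "real set" assume T: "T \<in> sets borel"
    show "{p \<in> A. j p \<in> T} \<in> sets N"
    proof -
      have S: "{x \<in> D. \<phi> x \<in> (\<lambda>r. r + 2 * real i) -` T \<inter> {0..1}} \<in> sets M" for i
      proof (rule iso_mod_null_vimage(1)[OF iso])
        have "(\<lambda>r. r + 2 * real i) -` T \<inter> space borel \<in> sets borel" by (rule measurable_sets[OF _ T]) simp
        then show "(\<lambda>r. r + 2 * real i) -` T \<inter> {0..1} \<in> sets unit_interval"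
          by (auto simp: sets_restrict_space_iff)
      qed
      have eq: "{p \<in> A. j p \<in> T}
          = (\<Union>i<m. ({x \<in> D. \<phi> x \<in> (\<lambda>r. r + 2 * real i) -` T \<inter> {0..1}} \<inter> C) \<times> {i})"
        using \<phi>01 by (auto simp: A_def j_def)
      have "{p \<in> A. j p \<in> T} \<in> sets SM"
        unfolding eq by (intro sets.finite_UN sets_stabilized_times sets.Int S C_sets) simp
      then show ?thesis unfolding sets_N using AY by auto
    qed
  next
    fix S assume S: "S \<in> sets N" "S \<subseteq> A"
    have slice: "{x \<in> space M. (x, i) \<in> S} \<in> sets M" for i
    proof -
      have "(\<lambda>x. (x, i)) \<in> M \<rightarrow>\<^sub>M SM" unfolding stabilized_measure_def by measurable
      from measurable_sets[OF this, of S] show ?thesis using S(1) by (auto simp: sets_N Int_def conj_commute)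
    qed
    have sub: "{x \<in> space M. (x, i) \<in> S} \<subseteq> D" for i using S(2) by (auto simp: A_def)
    have "(\<lambda>r. r + 2 * real i) ` \<phi> ` {x \<in> space M. (x, i) \<in> S} \<in> sets borel" for i
    proof -
      have "\<phi> ` {x \<in> space M. (x, i) \<in> S} \<in> sets unit_interval"
        by (rule iso_mod_null_image(1)[OF iso slice sub])
      then have "\<phi> ` {x \<in> space M. (x, i) \<in> S} \<in> sets borel" by (simp add: sets_restrict_space_iff)
      then have "(\<lambda>r. r - 2 * real i) -` \<phi> ` {x \<in> space M. (x, i) \<in> S} \<inter> space borel \<in> sets borel"
        by (rule measurable_sets[rotated]) simp
      moreover have "(\<lambda>r. r - c) -` T \<inter> space borel = (\<lambda>r. r + c) ` T" for c :: real and T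
        by (auto simp: image_iff intro!: bexI[of _ "_ - c"])
      ultimately show ?thesis by simp
    qed
    moreover have "j ` S = (\<Union>i<m. (\<lambda>r. r + 2 * real i) ` \<phi> ` {x \<in> space M. (x, i) \<in> S})"
    proof (intro equalityI subsetI)
      fix r assume "r \<in> j ` S"
      then obtain x i where xi: "(x, i) \<in> S" "r = \<phi> x + 2 * real i" by (auto simp: j_def)
      moreover have "x \<in> space M" "i < m" using S(2) xi(1) C_space by (auto simp: A_def)
      ultimately show "r \<in> (\<Union>i<m. (\<lambda>r. r + 2 * real i) ` \<phi> ` {x \<in> space M. (x, i) \<in> S})" by blast
    qed (force simp: j_def)
    ultimately show "j ` S \<in> sets borel" by auto
  next
    fix p assume "p \<in> A"
    then obtain x i where p: "p = (x, i)" "x \<in> D" "x \<in> C" "i < m" by (auto simp: A_def)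
    have U: "{\<phi> x} \<in> sets unit_interval" using \<phi>01[OF p(2)] by (simp add: sets_restrict_space_iff)
    have eq: "{y \<in> D. \<phi> y \<in> {\<phi> x}} = {x}" using p(2) inj by (auto simp: inj_on_def)
    have "emeasure M {x} = emeasure unit_interval ({\<phi> x} \<inter> B)"
      using iso_mod_null_vimage(2)[OF iso U] unfolding eq .
    also have "\<dots> \<le> emeasure unit_interval {\<phi> x}" using U by (intro emeasure_mono) auto
    also have "\<dots> = 0" using \<phi>01[OF p(2)] by (simp add: emeasure_restrict_space)
    finally have 0: "emeasure M {x} = 0" by simp
    have x: "{x} \<in> sets M" using iso_mod_null_vimage(1)[OF iso U] unfolding eq .
    have "{p} = {x} \<times> {i}" by (simp add: p(1))
    then have "emeasure SM {p} = 0" using emeasure_stabilized_times[OF x, of "{i}"] 0 by simp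
    then show "emeasure N {p} = 0" using p by (subst emeasure_N) (auto simp: Y_def)
  qed
qed

lemma amplification_set_member: "t \<in> amplification_set M (orbit_equiv_rel \<Gamma> M \<alpha>)"
proof -
  have "countable (stab n a)" using countable_\<Gamma> by (rule countable_subset[rotated]) (auto simp: stab_def)
  then have cnt: "countable (carrier G)" unfolding carrier_G by (intro countable_SIGMA) auto
  obtain A B f where iso: "iso_mod_null N unit_interval A B f" using standard_N by blast
  obtain \<Lambda> :: "nat monoid" and b where "group \<Lambda> \<and> mp_action \<Lambda> unit_interval b \<and>
    free_action \<Lambda> unit_interval b \<and> ergodic_action \<Lambda> unit_interval b \<and>
    isomorphic_relations N (orbit_equiv_rel G N act) unit_interval (orbit_equiv_rel \<Lambda> unit_interval b)"
    using transport_action[OF cnt action_G free_G ergodic_G iso] by blast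
  then show ?thesis
    unfolding amplification_set_def orbit_relation_G
    using t Y_sets emeasure_Y standard_unit_interval unfolding N_def by blast
qed

end

theorem corollary5p7:
  fixes \<Gamma> :: "'g monoid" and \<Gamma>0 :: "'g set"
    and Xs :: "nat \<Rightarrow> 'x measure" and \<alpha>n :: "nat \<Rightarrow> 'g \<Rightarrow> 'x \<Rightarrow> 'x"
    and q :: "nat \<Rightarrow> 'x \<Rightarrow> 'x"
    and M :: "(nat \<Rightarrow> 'x) measure" and \<alpha> :: "'g \<Rightarrow> (nat \<Rightarrow> 'x) \<Rightarrow> nat \<Rightarrow> 'x"
  assumes "group \<Gamma>" and "countable (carrier \<Gamma>)"
    and "\<Gamma>0 \<lhd> \<Gamma>" and "infinite \<Gamma>0"
    and "relative_property_T \<Gamma> \<Gamma>0"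
    and "finitely_generated_group (\<Gamma> Mod \<Gamma>0)"
    and "standard_prob_space M"
    and "mp_action \<Gamma> M \<alpha>"
    and "free_action \<Gamma> M \<alpha>"
    and "ergodic_action \<Gamma> M \<alpha>"
    and "ergodic_action (\<Gamma>\<lparr>carrier := \<Gamma>0\<rparr>) M \<alpha>"
    and "is_inverse_limit \<Gamma> Xs \<alpha>n q M \<alpha>"
  shows "amplification_set M (orbit_equiv_rel \<Gamma> M \<alpha>)
           = {real m / real (card (space (Xs n))) | m n :: nat. m \<ge> 1 \<and> n \<ge> 1}
       \<and> {real m / real (card (space (Xs n))) | m n :: nat. m \<ge> 1 \<and> n \<ge> 1}
           \<subseteq> {r \<in> \<rat>. r > 0}"
proof -
  interpret group \<Gamma> by fact
  interpret P: profinite \<Gamma> \<Gamma>0 Xs \<alpha>n q M \<alpha>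
    by (intro profinite.intro profinite_axioms.intro is_group assms)
  have "t \<in> {real m / real (card (space (Xs n))) | m n :: nat. m \<ge> 1 \<and> n \<ge> 1}"
    if t: "t \<in> amplification_set M (orbit_equiv_rel \<Gamma> M \<alpha>)" for t
  proof -
    obtain Y and \<Lambda> :: "nat monoid" and Z :: "real measure" and b A B f
      where "t > 0" and "Y \<in> sets (stabilized_measure M)" "emeasure (stabilized_measure M) Y = ennreal t"
        and \<Lambda>: "group \<Lambda>" and "standard_prob_space Z" "mp_action \<Lambda> Z b" "free_action \<Lambda> Z b" "ergodic_action \<Lambda> Z b"
        and "iso_mod_null (normalized_restriction (stabilized_measure M) t Y) Z A B f"
        and "\<forall>x\<in>A. \<forall>y\<in>A. (x, y) \<in> stabilization (orbit_equiv_rel \<Gamma> M \<alpha>) \<inter> Y \<times> Y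
          \<longleftrightarrow> (f x, f y) \<in> orbit_equiv_rel \<Lambda> Z b"
      using t unfolding amplification_set_def isomorphic_relations_def by blast
    interpret L: group \<Lambda> by fact
    interpret I: induced_amplification \<Gamma> \<Gamma>0 Xs \<alpha>n q M \<alpha> \<Lambda> Z b t Y A B f
      by unfold_locales fact+
    show ?thesis using I.amplification_value[OF assms(5,6)] by blast
  qed
  moreover have "real m / real (card (space (Xs n))) \<in> amplification_set M (orbit_equiv_rel \<Gamma> M \<alpha>)"
    if mn: "m \<ge> 1" "n \<ge> 1" for m n
  proof -
    obtain a where "a \<in> space (Xs n)" using P.X_nonempty[OF mn(2)] by blast
    then interpret R: rational_amplification \<Gamma> \<Gamma>0 Xs \<alpha>n q M \<alpha> n m a
      using mn assms(7,9) by unfold_locales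
    show ?thesis using R.amplification_set_member unfolding R.t_def .
  qed
  moreover have "real m / real (card (space (Xs n))) \<in> {r \<in> \<rat>. r > 0}" if "m \<ge> 1" "n \<ge> 1" for m n
    using that P.card_X_pos[of n] by simp
  ultimately show ?thesis by blast
qed

end
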